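(* Let $\Gamma$ be a rectifiable Jordan curve, $X$ a Banach function space over $\Gamma$, and $w:\Gamma\to[0,\infty]$ a weight such that the Cauchy singular integral operator $S$ is bounded on the weighted Banach function space $X_w$ and $X_w$ is reflexive. Let $t\in\Gamma$. If, for some $k\in\mathbb{Z}$ and $\gamma\in\mathbb{C}$, the operator $\varphi_{t,k-\gamma}S\varphi_{t,\gamma-k}I$ is bounded on $X_w$, then $$g_{t,\gamma}(\tau)=(1-t/\tau)^{k-\gamma}\,\tau^k\,(\tau-t)^{\gamma-k},\qquad\tau\in\Gamma\setminus\{t\},$$ is a Wiener-Hopf factorization of the function $g_{t,\gamma}$ in $X_w$ (with $a_-(\tau)=(1-t/\tau)^{k-\gamma}$, $\kappa=k$, $a_+(\tau)=(\tau-t)^{\gamma-k}$).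
   Context: Curve. A rectifiable Jordan curve $\Gamma\subset\mathbb{C}$ (homeomorphic to a circle) carries Lebesgue length measure $|d\tau|$ and the counter-clockwise orientation. $\Gamma$ divides $\mathbb{C}$ into a bounded component $D^+$ and an unbounded component $D^-$, and it is assumed that $0\in D^+$. For $t\in\Gamma$, $R>0$: $\Gamma(t,R)=\{\tau\in\Gamma:|\tau-t|<R\}$. A weight is a measurable $w:\Gamma\to[0,\infty]$ with $0<w<\infty$ a.e. Banach function spaces. Let $\mathcal{M}^+$ be the set of measurable functions $\Gamma\to[0,\infty]$. A map $\rho:\mathcal{M}^+\to[0,\infty]$ is a Banach function norm if for all $f,g,f_n\in\mathcal{M}^+$, $a\ge0$ and measurable $E\subset\Gamma$: (A1) $\rho(f)=0\Leftrightarrow f=0$ a.e., $\rho(af)=a\rho(f)$, $\rho(f+g)\le\rho(f)+\rho(g)$; (A2) $0\le g\le f$ a.e. implies $\rho(g)\le\rho(f)$; (A3) $0\le f_n\uparrow f$ a.e. implies $\rho(f_n)\uparrow\rho(f)$; (A4) $\rho(\chi_E)<\infty$; (A5) $\int_E f\,|d\tau|\le C_E\rho(f)$ with $C_E\in(0,\infty)$ independent of $f$. The Banach function space $X$ consists of all measurable complex $f$ (modulo null sets) with $\|f\|_X:=\rho(|f|)<\infty$. Its associate space $X'$ is the Banach function space generated by $\rho'(g)=\sup\{\int_\Gamma fg\,|d\tau|: f\in\mathcal{M}^+,\rho(f)\le1\}$. For a weight $w$, $X_w=\{f \text{ measurable}: fw\in X\}$ with $\|f\|_{X_w}=\|fw\|_X$;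 similarly $X'_{1/w}=\{g:g/w\in X'\}$. Operators and factorization. $(Sf)(t)=\lim_{R\to0}\frac{1}{\pi i}\int_{\Gamma\setminus\Gamma(t,R)}\frac{f(\tau)}{\tau-t}\,d\tau$, $P_\pm=(I\pm S)/2$. Under the hypotheses $P_\pm$ are bounded projections on both $X_w$ and $X'_{1/w}$; put $(X_w)_+=P_+X_w$, $(X_w)_-=P_-X_w\dot{+}\mathbb{C}$, and define $(X'_{1/w})_\pm$ analogously. A function $a\in L^\infty$ admits a Wiener-Hopf factorization in $X_w$ if $1/a\in L^\infty$ and $a(\tau)=a_-(\tau)\tau^\kappa a_+(\tau)$ a.e. on $\Gamma$ with $\kappa\in\mathbb{Z}$, where (i) $a_-\in(X_w)_-$, $1/a_-\in(X'_{1/w})_-$, $a_+\in(X'_{1/w})_+$, $1/a_+\in(X_w)_+$; (ii) the operator $(1/a_+)Sa_+I$ is bounded on $X_w$. The functions $g_{t,\gamma}$ and $\varphi_{t,\gamma}$. Fix $t\in\Gamma$. Map the interior and the exterior of the unit circle conformally onto $D^+$ and $D^-$, respectively, so that $1\mapsto t$ and the points $0$ and $\infty$ are fixed; let $\Lambda_0$, $\Lambda_\infty$ be the images of $[0,1]$ and $[1,\infty)\cup\{\infty\}$. Let $\arg z$ be a continuous branch of the argument in $\mathbb{C}\setminus(\Lambda_0\cup\Lambda_\infty)$ and set $z^\gamma=|z|^\gamma e^{i\gamma\arg z}$ there. $g_{t,\gamma}$ is the restriction of $z^\gamma$ to $\Gamma\setminus\{t\}$. Further, $\varphi_{t,\gamma}(\tau)=|\tau-t|^{\operatorname{Re}\gamma}e^{-\operatorname{Im}\gamma\arg(\tau-t)}$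 for $\tau\in\Gamma\setminus\{t\}$, with a continuous branch of $\arg(\tau-t)$ on $\Gamma\setminus\{t\}$. Branches: $(1-t/z)^{k-\gamma}$ is the branch analytic in $(\mathbb{C}\cup\{\infty\})\setminus\Lambda_0$ with value $1$ at $\infty$; $(z-t)^{\gamma-k}$ is the branch analytic in $\mathbb{C}\setminus\Lambda_\infty$ chosen (which is possible) so that the displayed identity holds on $\Gamma\setminus\{t\}$. *)

theory Defs
  imports "HOL-Complex_Analysis.Complex_Analysis"
begin

section \<open>Rectifiable Jordan curves\<close>

text \<open>
  A Jordan curve \<open>\<Gamma>\<close> is given by a parametrization \<open>p\<close> on \<open>[0,1]\<close>, with \<open>\<Gamma> = path_image p\<close>,
  \<open>D\<^sup>+ = inside \<Gamma>\<close> and \<open>D\<^sup>- = outside \<Gamma>\<close>. Apart from the orientation, nothing below depends on the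
  choice of \<open>p\<close>.
\<close>

definition inscribed_lengths :: "(real \<Rightarrow> complex) \<Rightarrow> real \<Rightarrow> real \<Rightarrow> real set" where
  "inscribed_lengths p a b =
     {(\<Sum>i<n. dist (p (x i)) (p (x (Suc i)))) |n x.
        (\<forall>i\<le>n. x i \<in> {a..b}) \<and> (\<forall>i<n. x i \<le> x (Suc i))}"

definition rectifiable_Jordan_curve :: "(real \<Rightarrow> complex) \<Rightarrow> bool" where
  "rectifiable_Jordan_curve p \<longleftrightarrow>
     simple_path p \<and> pathfinish p = pathstart p \<and> bdd_above (inscribed_lengths p 0 1)"

definition counterclockwise_about_0 :: "(real \<Rightarrow> complex) \<Rightarrow> bool" where
  "counterclockwise_about_0 p \<longleftrightarrow> 0 \<in> inside (path_image p) \<and> winding_number p 0 = 1"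

definition arc_length :: "(real \<Rightarrow> complex) \<Rightarrow> real \<Rightarrow> real" where
  "arc_length p x = Sup (inscribed_lengths p 0 x)"

text \<open>The reparametrization by arc length, on \<open>[0, arc_length p 1]\<close>.\<close>

definition natural_param :: "(real \<Rightarrow> complex) \<Rightarrow> real \<Rightarrow> complex" where
  "natural_param p s = p (inv_into {0..1} (arc_length p) s)"

definition length_measure :: "(real \<Rightarrow> complex) \<Rightarrow> complex measure" where
  "length_measure p =
     completion (distr (restrict_space lborel {0..arc_length p 1})
                       (restrict_space borel (path_image p)) (natural_param p))"

text \<open>
  The unit tangent, so that \<open>d\<tau> = unit_tangent p \<tau> |d\<tau>|\<close>. It is meaningful for almost every \<open>\<tau>\<close>,
  because \<open>natural_param p\<close> is Lipschitz.
\<close>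

definition unit_tangent :: "(real \<Rightarrow> complex) \<Rightarrow> complex \<Rightarrow> complex" where
  "unit_tangent p \<tau> =
     vector_derivative (natural_param p)
       (at (inv_into {0..<arc_length p 1} (natural_param p) \<tau>))"

section \<open>Banach function spaces\<close>

definition banach_function_norm :: "'a measure \<Rightarrow> (('a \<Rightarrow> ennreal) \<Rightarrow> ennreal) \<Rightarrow> bool" where
  "banach_function_norm M \<rho> \<longleftrightarrow>
     (\<forall>f\<in>borel_measurable M. \<rho> f = 0 \<longleftrightarrow> (AE x in M. f x = 0)) \<and>
     (\<forall>f\<in>borel_measurable M. \<forall>a\<ge>0. \<rho> (\<lambda>x. ennreal a * f x) = ennreal a * \<rho> f) \<and>
     (\<forall>f\<in>borel_measurable M. \<forall>g\<in>borel_measurable M. \<rho> (\<lambda>x. f x + g x) \<le> \<rho> f + \<rho> g) \<and>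
     (\<forall>f\<in>borel_measurable M. \<forall>g\<in>borel_measurable M. (AE x in M. g x \<le> f x) \<longrightarrow> \<rho> g \<le> \<rho> f) \<and>
     (\<forall>F f. (\<forall>n. F n \<in> borel_measurable M) \<longrightarrow> f \<in> borel_measurable M \<longrightarrow>
        (AE x in M. incseq (\<lambda>n. F n x) \<and> (\<lambda>n. F n x) \<longlonglongrightarrow> f x) \<longrightarrow>
        incseq (\<lambda>n. \<rho> (F n)) \<and> (\<lambda>n. \<rho> (F n)) \<longlonglongrightarrow> \<rho> f) \<and>
     (\<forall>E\<in>sets M. \<rho> (indicator E) < \<infinity>) \<and>
     (\<forall>E\<in>sets M. \<exists>C. 0 < C \<and> C < \<infinity> \<and>
        (\<forall>f\<in>borel_measurable M. (\<integral>\<^sup>+x\<in>E. f x \<partial>M) \<le> C * \<rho> f))"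

definition associate_norm ::
    "'a measure \<Rightarrow> (('a \<Rightarrow> ennreal) \<Rightarrow> ennreal) \<Rightarrow> ('a \<Rightarrow> ennreal) \<Rightarrow> ennreal" where
  "associate_norm M \<rho> g = (SUP f\<in>{f \<in> borel_measurable M. \<rho> f \<le> 1}. \<integral>\<^sup>+x. f x * g x \<partial>M)"

definition is_weight :: "'a measure \<Rightarrow> ('a \<Rightarrow> ennreal) \<Rightarrow> bool" where
  "is_weight M w \<longleftrightarrow> w \<in> borel_measurable M \<and> (AE x in M. 0 < w x \<and> w x < \<infinity>)"

definition weighted_norm ::
    "(('a \<Rightarrow> ennreal) \<Rightarrow> ennreal) \<Rightarrow> ('a \<Rightarrow> ennreal) \<Rightarrow> ('a \<Rightarrow> complex) \<Rightarrow> ennreal" where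
  "weighted_norm \<rho> w f = \<rho> (\<lambda>x. ennreal (cmod (f x)) * w x)"

text \<open>
  Here and below functions that agree almost everywhere are not identified, so \<open>weighted_norm\<close> is
  a seminorm on \<open>weighted_space\<close>.
\<close>

definition weighted_space ::
    "'a measure \<Rightarrow> (('a \<Rightarrow> ennreal) \<Rightarrow> ennreal) \<Rightarrow> ('a \<Rightarrow> ennreal) \<Rightarrow> ('a \<Rightarrow> complex) set" where
  "weighted_space M \<rho> w = {f \<in> borel_measurable M. weighted_norm \<rho> w f < \<infinity>}"

definition L_infinity :: "'a measure \<Rightarrow> ('a \<Rightarrow> complex) set" where
  "L_infinity M = {f \<in> borel_measurable M. \<exists>C. AE x in M. cmod (f x) \<le> C}"

subsection \<open>Duality and reflexivity\<close>

text \<open>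
  \<open>V\<close> is a linear space of complex functions with (semi)norm \<open>N\<close>. Functionals on \<open>V\<close> are made
  to vanish off \<open>V\<close>; the dual is then again a linear space of complex functions under the pointwise
  operations, and the construction can be iterated.
\<close>

definition dual_space ::
    "('a \<Rightarrow> complex) set \<Rightarrow> (('a \<Rightarrow> complex) \<Rightarrow> ennreal) \<Rightarrow> (('a \<Rightarrow> complex) \<Rightarrow> complex) set" where
  "dual_space V N = {\<phi>.
     (\<forall>f\<in>V. \<forall>g\<in>V. \<phi> (\<lambda>x. f x + g x) = \<phi> f + \<phi> g) \<and>
     (\<forall>c. \<forall>f\<in>V. \<phi> (\<lambda>x. c * f x) = c * \<phi> f) \<and>
     (\<exists>C. \<forall>f\<in>V. ennreal (cmod (\<phi> f)) \<le> ennreal C * N f) \<and>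
     (\<forall>f. f \<notin> V \<longrightarrow> \<phi> f = 0)}"

definition dual_norm ::
    "('a \<Rightarrow> complex) set \<Rightarrow> (('a \<Rightarrow> complex) \<Rightarrow> ennreal) \<Rightarrow> (('a \<Rightarrow> complex) \<Rightarrow> complex) \<Rightarrow> ennreal" where
  "dual_norm V N \<phi> = (SUP f\<in>{f \<in> V. N f \<le> 1}. ennreal (cmod (\<phi> f)))"

definition reflexive_space :: "('a \<Rightarrow> complex) set \<Rightarrow> (('a \<Rightarrow> complex) \<Rightarrow> ennreal) \<Rightarrow> bool" where
  "reflexive_space V N \<longleftrightarrow>
     (\<forall>\<Phi>\<in>dual_space (dual_space V N) (dual_norm V N).
        \<exists>f\<in>V. \<forall>\<phi>\<in>dual_space V N. \<Phi> \<phi> = \<phi> f)"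

section \<open>The Cauchy singular integral operator\<close>

definition cauchy_integrand ::
    "(real \<Rightarrow> complex) \<Rightarrow> (complex \<Rightarrow> complex) \<Rightarrow> complex \<Rightarrow> complex \<Rightarrow> complex" where
  "cauchy_integrand p f t \<tau> = f \<tau> / (\<tau> - t) * unit_tangent p \<tau>"

definition cauchy_truncated ::
    "(real \<Rightarrow> complex) \<Rightarrow> (complex \<Rightarrow> complex) \<Rightarrow> complex \<Rightarrow> real \<Rightarrow> complex" where
  "cauchy_truncated p f t R = 1 / (of_real pi * \<i>) *
     set_lebesgue_integral (length_measure p)
       (path_image p - {\<tau> \<in> path_image p. cmod (\<tau> - t) < R}) (cauchy_integrand p f t)"

definition cauchy_S :: "(real \<Rightarrow> complex) \<Rightarrow> (complex \<Rightarrow> complex) \<Rightarrow> complex \<Rightarrow> complex" where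
  "cauchy_S p f t = Lim (at_right 0) (cauchy_truncated p f t)"

text \<open>
  \<open>cauchy_S\<close> has an unspecified value where the limit does not exist, and non-integrable functions have
  Bochner integral 0, so existence of \<open>S f\<close> almost everywhere is expressed separately.
\<close>

definition cauchy_S_exists :: "(real \<Rightarrow> complex) \<Rightarrow> (complex \<Rightarrow> complex) \<Rightarrow> bool" where
  "cauchy_S_exists p f \<longleftrightarrow>
     (AE t in length_measure p.
        (\<forall>R>0. set_integrable (length_measure p)
           (path_image p - {\<tau> \<in> path_image p. cmod (\<tau> - t) < R}) (cauchy_integrand p f t)) \<and>
        (\<exists>l. (cauchy_truncated p f t \<longlongrightarrow> l) (at_right 0)))"

text \<open>The operator \<open>u S v I\<close>, with multiplication operators \<open>u\<close> and \<open>v\<close>, is bounded on \<open>X\<^sub>w\<close>.\<close>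

definition mult_S_mult_bounded ::
    "(real \<Rightarrow> complex) \<Rightarrow> ((complex \<Rightarrow> ennreal) \<Rightarrow> ennreal) \<Rightarrow> (complex \<Rightarrow> ennreal) \<Rightarrow>
     (complex \<Rightarrow> complex) \<Rightarrow> (complex \<Rightarrow> complex) \<Rightarrow> bool" where
  "mult_S_mult_bounded p \<rho> w u v \<longleftrightarrow>
     (\<exists>C. \<forall>f\<in>weighted_space (length_measure p) \<rho> w.
        cauchy_S_exists p (\<lambda>\<tau>. v \<tau> * f \<tau>) \<and>
        (\<lambda>t. u t * cauchy_S p (\<lambda>\<tau>. v \<tau> * f \<tau>) t) \<in> weighted_space (length_measure p) \<rho> w \<and>
        weighted_norm \<rho> w (\<lambda>t. u t * cauchy_S p (\<lambda>\<tau>. v \<tau> * f \<tau>) t)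
          \<le> ennreal C * weighted_norm \<rho> w f)"

abbreviation S_bounded ::
    "(real \<Rightarrow> complex) \<Rightarrow> ((complex \<Rightarrow> ennreal) \<Rightarrow> ennreal) \<Rightarrow> (complex \<Rightarrow> ennreal) \<Rightarrow> bool" where
  "S_bounded p \<rho> w \<equiv> mult_S_mult_bounded p \<rho> w (\<lambda>_. 1) (\<lambda>_. 1)"

section \<open>Wiener-Hopf factorization\<close>

definition plus_space :: "(real \<Rightarrow> complex) \<Rightarrow> (complex \<Rightarrow> complex) set \<Rightarrow> (complex \<Rightarrow> complex) set" where
  "plus_space p V = {h \<in> borel_measurable (length_measure p).
     \<exists>f\<in>V. cauchy_S_exists p f \<and>
       (AE \<tau> in length_measure p. h \<tau> = (f \<tau> + cauchy_S p f \<tau>) / 2)}"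

definition minus_space :: "(real \<Rightarrow> complex) \<Rightarrow> (complex \<Rightarrow> complex) set \<Rightarrow> (complex \<Rightarrow> complex) set" where
  "minus_space p V = {h \<in> borel_measurable (length_measure p).
     \<exists>f\<in>V. \<exists>c. cauchy_S_exists p f \<and>
       (AE \<tau> in length_measure p. h \<tau> = (f \<tau> - cauchy_S p f \<tau>) / 2 + c)}"

definition wiener_hopf_factorization ::
    "(real \<Rightarrow> complex) \<Rightarrow> ((complex \<Rightarrow> ennreal) \<Rightarrow> ennreal) \<Rightarrow> (complex \<Rightarrow> ennreal) \<Rightarrow>
     (complex \<Rightarrow> complex) \<Rightarrow> (complex \<Rightarrow> complex) \<Rightarrow> int \<Rightarrow> (complex \<Rightarrow> complex) \<Rightarrow> bool" where
  "wiener_hopf_factorization p \<rho> w a a_minus \<kappa> a_plus \<longleftrightarrow>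
     (let M = length_measure p;
          Xw = weighted_space M \<rho> w;
          X'w = weighted_space M (associate_norm M \<rho>) (\<lambda>\<tau>. 1 / w \<tau>)
      in a \<in> L_infinity M \<and> (\<lambda>\<tau>. 1 / a \<tau>) \<in> L_infinity M \<and>
         (AE \<tau> in M. a \<tau> = a_minus \<tau> * \<tau> powi \<kappa> * a_plus \<tau>) \<and>
         a_minus \<in> minus_space p Xw \<and> (\<lambda>\<tau>. 1 / a_minus \<tau>) \<in> minus_space p X'w \<and>
         a_plus \<in> plus_space p X'w \<and> (\<lambda>\<tau>. 1 / a_plus \<tau>) \<in> plus_space p Xw \<and>
         mult_S_mult_bounded p \<rho> w (\<lambda>\<tau>. 1 / a_plus \<tau>) a_plus)"

section \<open>Conformal maps, cuts and branches\<close>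

text \<open>
  The values on the unit circle are those of the continuous extension of the conformal map, which
  exists by Caratheodory's theorem since the domains are bounded by a Jordan curve.
\<close>

definition interior_conformal_map :: "complex set \<Rightarrow> complex \<Rightarrow> (complex \<Rightarrow> complex) \<Rightarrow> bool" where
  "interior_conformal_map \<Gamma> t \<Phi> \<longleftrightarrow>
     \<Phi> holomorphic_on ball 0 1 \<and> bij_betw \<Phi> (ball 0 1) (inside \<Gamma>) \<and>
     continuous_on (cball 0 1) \<Phi> \<and> \<Phi> 0 = 0 \<and> \<Phi> 1 = t"

definition exterior_conformal_map :: "complex set \<Rightarrow> complex \<Rightarrow> (complex \<Rightarrow> complex) \<Rightarrow> bool" where
  "exterior_conformal_map \<Gamma> t \<Psi> \<longleftrightarrow>
     \<Psi> holomorphic_on {z. 1 < cmod z} \<and> bij_betw \<Psi> {z. 1 < cmod z} (outside \<Gamma>) \<and>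
     continuous_on {z. 1 \<le> cmod z} \<Psi> \<and> filterlim \<Psi> at_infinity at_infinity \<and> \<Psi> 1 = t"

definition interior_cut :: "(complex \<Rightarrow> complex) \<Rightarrow> complex set" where
  "interior_cut \<Phi> = (\<lambda>x. \<Phi> (of_real x)) ` {0..1}"

text \<open>The finite part of the cut \<open>\<Lambda>\<^sub>\<infinity>\<close>, which also contains the point at infinity.\<close>

definition exterior_cut :: "(complex \<Rightarrow> complex) \<Rightarrow> complex set" where
  "exterior_cut \<Psi> = (\<lambda>x. \<Psi> (of_real x)) ` {1..}"

definition arg_branch :: "complex set \<Rightarrow> (complex \<Rightarrow> complex) \<Rightarrow> (complex \<Rightarrow> real) \<Rightarrow> bool" where
  "arg_branch D f \<theta> \<longleftrightarrow>
     continuous_on D \<theta> \<and> (\<forall>z\<in>D. f z = of_real (cmod (f z)) * exp (\<i> * of_real (\<theta> z)))"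

definition g_fun :: "(complex \<Rightarrow> real) \<Rightarrow> complex \<Rightarrow> complex \<Rightarrow> complex" where
  "g_fun \<alpha> \<gamma> \<tau> = of_real (cmod \<tau>) powr \<gamma> * exp (\<i> * \<gamma> * of_real (\<alpha> \<tau>))"

definition phi_fun :: "(complex \<Rightarrow> real) \<Rightarrow> complex \<Rightarrow> complex \<Rightarrow> complex \<Rightarrow> real" where
  "phi_fun \<theta> t \<gamma> \<tau> = cmod (\<tau> - t) powr Re \<gamma> * exp (- Im \<gamma> * \<theta> \<tau>)"

text \<open>\<open>h\<close> is an analytic branch of \<open>f\<^sup>\<delta>\<close> on \<open>D\<close>.\<close>

definition power_branch ::
    "complex set \<Rightarrow> (complex \<Rightarrow> complex) \<Rightarrow> complex \<Rightarrow> (complex \<Rightarrow> complex) \<Rightarrow> bool" where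
  "power_branch D f \<delta> h \<longleftrightarrow>
     (\<exists>L. L holomorphic_on D \<and> (\<forall>z\<in>D. exp (L z) = f z \<and> h z = exp (\<delta> * L z)))"

end

theory Submission
  imports Defs
begin

text \<open>
  Choose logarithms \<open>L\<^sub>+\<close> of \<open>z - t\<close> off \<open>\<Lambda>\<^sub>\<infinity>\<close> and \<open>L\<^sub>-\<close> of \<open>1 - t/z\<close> off \<open>\<Lambda>\<^sub>0\<close> whose difference is
  \<open>log |\<tau>| + i \<alpha>(\<tau>)\<close> on \<open>\<Gamma> - {t}\<close>, and put \<open>a\<^sub>+ = exp ((\<gamma> - k) L\<^sub>+)\<close>, \<open>a\<^sub>- = exp ((k - \<gamma>) L\<^sub>-)\<close>; this gives
  the displayed identity. Any continuous logarithm of \<open>\<tau>\<close> on \<open>\<Gamma> - {t}\<close> is bounded, so \<open>|a\<^sub>-|\<close> is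
  comparable to \<open>1/|a\<^sub>+|\<close>, and \<open>|a\<^sub>+|\<close> is a constant multiple of \<open>\<phi>\<close> with exponent \<open>\<gamma> - k\<close>.
  Boundedness of \<open>u S v I\<close> forces \<open>v \<in> X'\<^sub>1\<^sub>/\<^sub>w\<close> and \<open>u \<in> X\<^sub>w\<close> (test \<open>S\<close> away from the support of the argument),
  which yields all the memberships, and integrability of \<open>h = a\<^sub>+, 1/a\<^sub>+, a\<^sub>-, 1/a\<^sub>-\<close>.

  It remains to compute \<open>S h\<close>. At almost every \<open>s\<close> the principal value of \<open>\<integral> d\<tau>/(\<tau> - s)\<close> is \<open>\<pi> i\<close>, so
  \<open>S h (s) - h s\<close> is \<open>1/(\<pi> i)\<close> times the integral of \<open>(h \<tau> - h s)/(\<tau> - s)\<close>. For \<open>h = a\<^sub>+\<close> or \<open>1/a\<^sub>+\<close> this quotient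
  is holomorphic inside \<open>\<Gamma>\<close> and across \<open>\<Gamma> - {t}\<close>, and its primitive has no jump at \<open>t\<close>: arcs of small circles
  around \<open>t\<close> cross \<open>D\<^sup>+\<close> from one branch of \<open>\<Gamma>\<close> to the other, and integrability of \<open>h\<close> makes the integral over
  suitable arcs tend to \<open>0\<close>. Hence \<open>S h = h\<close>. The inversion \<open>z \<mapsto> 1/z\<close> reduces \<open>a\<^sub>-\<close> and \<open>1/a\<^sub>-\<close> to the same
  situation and gives \<open>S h = 2 - h\<close>.
\<close>

section \<open>Lipschitz functions and paths\<close>

text \<open>The curve is merely rectifiable: near \<open>t\<close> it may spiral and oscillate, and
  \<open>h\<close> is known to be integrable on it but not to be bounded inside \<open>D^+\<close>.
  Hence no limit along interior curves is taken, and circles about \<open>t\<close> are used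
  instead. On a circle of radius \<open>r\<close> a logarithm of \<open>z - t\<close> equals
  \<open>ln r + i \<theta>\<close> up to a constant, so \<open>|exp (\<delta> L)|\<close> varies by
  at most the factor \<open>exp (2 pi |\<delta>|)\<close> along an arc, whatever the domain looks
  like around it. The value at one endpoint, a point of the curve, therefore controls the whole arc;
  and an integrable function on a rectifiable curve cannot have size at least
  \<open>\<epsilon> / r\<close> at a curve point on every small circle.

  Logarithms and not powers carry all branch choices. \<open>L_-\<close> is fixed by its value
  \<open>0\<close> at infinity, so the integer left over in comparing it with the given argument has
  to be absorbed by \<open>L_+\<close>.

  All contour integrals are ordinary integrals in the arc length parameter, where the curve is
  Lipschitz with constant 1 and has unit speed almost everywhere.\<close>

text \<open>The density is \<open>N' - C - 1\<close>, where \<open>N'\<close> is the Radon-Nikodym derivative of the image of Lebesgue measure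
  under the inverse of the homeomorphism \<open>x \<mapsto> f x + (C + 1) x\<close>.\<close>

lemma lipschitz_real_density:
  fixes f :: "real \<Rightarrow> real"
  assumes lip: "C-lipschitz_on UNIV f"
  obtains g where "g \<in> borel_measurable borel"
    "\<And>a b. a \<le> b \<Longrightarrow> (g has_integral (f b - f a)) {a..b}"
proof -
  have C0: "C \<ge> 0" using lip lipschitz_on_nonneg by blast
  \<comment> \<open>The slope \<open>C+1\<close> exceeds the Lipschitz constant by 1, so
    \<open>F\<close> does not shrink distances: it is a strictly increasing bijection of the
    line.\<close>
  define F where "F x = f x + (C+1) * x" for x
  have lipd: "\<bar>f x - f y\<bar> \<le> C * \<bar>x - y\<bar>" for x y
    using lipschitz_onD[OF lip, of x y] by (simp add: dist_real_def)
  have Fge: "F b - F a \<ge> b - a" if "a \<le> b" for a b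
  proof -
    have "f a - f b \<le> C * (b - a)" using lipd[of b a] that by (simp add: abs_le_iff)
    then show ?thesis by (simp add: F_def algebra_simps)
  qed
  have Fcont: "continuous_on UNIV F"
    unfolding F_def by (intro continuous_intros lipschitz_on_continuous_on[OF lip])
  have Fmono: "strict_mono F"
  proof (rule strict_monoI)
    fix x y :: real assume "x < y" then show "F x < F y" using Fge[of x y] by simp
  qed
  have Finj: "inj F" using Fmono by (simp add: strict_mono_imp_inj_on)
  have Fsurj: "\<exists>x. F x = y" for y
  proof -
    define r where "r = \<bar>y - F 0\<bar>"
    have "F (-r) \<le> y" "y \<le> F r" using Fge[of "-r" 0] Fge[of 0 r] unfolding r_def by auto
    then obtain x where "-r \<le> x" "x \<le> r" "F x = y"
      using IVT'[of F "-r" y r] continuous_on_subset[OF Fcont] unfolding r_def by fastforce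
    then show ?thesis by blast
  qed
  define G where "G = inv F"
  have GF: "G (F x) = x" for x unfolding G_def using Finj by simp
  have FG: "F (G x) = x" for x unfolding G_def using Fsurj by (meson f_inv_into_f rangeI surj_f_inv_f surjI)
  have Gle: "G x \<le> a \<longleftrightarrow> x \<le> F a" "a \<le> G x \<longleftrightarrow> F a \<le> x" "a < G x \<longleftrightarrow> F a < x" for x a
    using strict_mono_less_eq[OF Fmono, of "G x" a] strict_mono_less_eq[OF Fmono, of a "G x"] strict_mono_less[OF Fmono, of a "G x"] by (simp_all add: FG)
  have Gmeas: "G \<in> borel_measurable borel"
    by (rule borel_measurableI_le) (simp add: Gle(1))
  define N where "N = distr lborel borel G"
  have setsN: "sets N = sets lborel" unfolding N_def by simp
  have Nab: "emeasure N {a<..b} = ennreal (F b - F a)" if "a \<le> b" for a b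
  proof -
    have "emeasure N {a<..b} = emeasure lborel (G -` {a<..b} \<inter> space lborel)"
      unfolding N_def using Gmeas by (subst emeasure_distr) auto
    also have "G -` {a<..b} \<inter> space lborel = {F a<..F b}" by (auto simp: Gle)
    also have "emeasure lborel \<dots> = ennreal (F b - F a)"
      using Fge[OF that] that by (subst emeasure_lborel_Ioc) auto
    finally show ?thesis .
  qed
  \<comment> \<open>\<open>N\<close> measures a set by the Lebesgue measure of its image under
    \<open>F\<close>, and a Lipschitz map sends null sets to null sets.\<close>
  have "absolutely_continuous lborel N"
    unfolding absolutely_continuous_def
  proof
    fix A :: "real set" assume A: "A \<in> null_sets lborel"
    have Ab: "A \<in> sets borel" and "negligible A"
      using null_sets_completionI[OF A] null_setsD2[OF A] by (simp_all add: negligible_iff_null_sets)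
    have "negligible (F ` A)"
    proof (rule negligible_locally_Lipschitz_image)
      fix x :: real assume "x \<in> A"
      have "\<bar>F y - F x\<bar> \<le> (2*C+1) * \<bar>y - x\<bar>" for y
      proof -
        have "F y - F x = (f y - f x) + (C+1) * (y - x)" by (simp add: F_def algebra_simps)
        then have "\<bar>F y - F x\<bar> \<le> \<bar>f y - f x\<bar> + \<bar>(C+1) * (y - x)\<bar>" by linarith
        also have "\<bar>(C+1) * (y - x)\<bar> = (C+1) * \<bar>y-x\<bar>" using C0 by (simp add: abs_mult)
        finally show ?thesis using lipd[of y x] by (simp add: algebra_simps)
      qed
      then show "\<exists>T B. open T \<and> x \<in> T \<and> (\<forall>y\<in>A \<inter> T. norm (F y - F x) \<le> B * norm (y - x))"
        by (intro exI[of _ UNIV] exI[of _ "2*C+1"]) auto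
    qed (use \<open>negligible A\<close> in auto)
    moreover have "G -` A \<inter> space lborel = F ` A"
    proof -
      have "x \<in> F ` A" if "G x \<in> A" for x using that FG[of x] by (metis imageI)
      then show ?thesis by (auto simp: GF)
    qed
    moreover have "G -` A \<inter> space lborel \<in> sets lborel" using Gmeas Ab by (simp add: measurable_sets_borel)
    ultimately have "emeasure lborel (G -` A \<inter> space lborel) = 0"
      by (simp add: negligible_iff_null_sets null_sets_completion_iff null_setsD1)
    then show "A \<in> null_sets N" using Ab Gmeas unfolding N_def null_sets_def
      by (simp add: emeasure_distr)
  qed
  then obtain k where k: "k \<in> borel_measurable lborel" "density lborel k = N"
    using sigma_finite_measure.Radon_Nikodym[OF lborel.sigma_finite_measure_axioms _ setsN] by auto
  have kint: "(\<integral>\<^sup>+x\<in>{a..b}. k x \<partial>lborel) = ennreal (F b - F a)" if "a \<le> b" for a b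
  proof -
    have "(\<integral>\<^sup>+x\<in>{a..b}. k x \<partial>lborel) = (\<integral>\<^sup>+x\<in>{a<..b}. k x \<partial>lborel)"
      by (rule nn_integral_cong_AE) (use AE_lborel_singleton[of a] in eventually_elim, auto simp: indicator_def)
    also have "\<dots> = emeasure N {a<..b}" using k by (subst k(2)[symmetric], subst emeasure_density) auto
    finally show ?thesis using Nab[OF that] by simp
  qed
  define g where "g x = enn2real (k x) - (C+1)" for x
  have kmeas: "(\<lambda>x. enn2real (k x)) \<in> borel_measurable borel" using k(1) by auto
  show thesis
  proof
    show "g \<in> borel_measurable borel" unfolding g_def using kmeas by auto
    fix a b :: real assume ab: "a \<le> b"
    have kfin: "AE x in lborel. x \<in> {a..b} \<longrightarrow> k x \<noteq> \<infinity>"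
    proof -
      have "AE x in lborel. k x * indicator {a..b} x \<noteq> \<infinity>"
        by (rule nn_integral_PInf_AE) (use k(1) kint[OF ab] in auto)
      then show ?thesis by eventually_elim (auto simp: indicator_def)
    qed
    have "(\<integral>\<^sup>+x. ennreal (enn2real (k x) * indicator {a..b} x) \<partial>lborel) = (\<integral>\<^sup>+x\<in>{a..b}. k x \<partial>lborel)"
      by (rule nn_integral_cong_AE) (use kfin in eventually_elim, auto simp: indicator_def less_top)
    then have "(\<integral>\<^sup>+x. ennreal (enn2real (k x) * indicator {a..b} x) \<partial>lborel) = ennreal (F b - F a)"
      using kint[OF ab] by simp
    then have "has_bochner_integral lborel (\<lambda>x. enn2real (k x) * indicator {a..b} x) (F b - F a)"
      using Fge[OF ab] ab kmeas by (intro has_bochner_integral_nn_integral) (auto)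
    then have "((\<lambda>x. enn2real (k x) * indicator {a..b} x) has_integral (F b - F a)) UNIV"
      by (metis has_integral_integral_lborel has_bochner_integral_iff)
    moreover have "(\<lambda>x. enn2real (k x) * indicator {a..b} x) = (\<lambda>x. if x \<in> {a..b} then enn2real (k x) else 0)" by (auto simp: indicator_def)
    ultimately have "((\<lambda>x. enn2real (k x)) has_integral (F b - F a)) {a..b}"
      using has_integral_restrict_UNIV[of "{a..b}" "\<lambda>x. enn2real (k x)"] by simp
    moreover have "((\<lambda>x. C+1) has_integral (C+1) * (b - a)) {a..b}"
      using has_integral_const_real[of "C+1" a b] ab by (simp add: mult.commute)
    ultimately have "(g has_integral (F b - F a - (C+1) * (b-a))) {a..b}"
      unfolding g_def by (rule has_integral_diff)
    then show "(g has_integral (f b - f a)) {a..b}" by (simp add: F_def algebra_simps)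
  qed
qed

text \<open>Both one-sided difference quotients are taken with positive \<open>h\<close>, the form
  in which averages over small boxes with lower corner \<open>x\<close> deliver them.\<close>

lemma has_vector_derivativeI_right_left:
  fixes f :: "real \<Rightarrow> real" and x D :: real
  assumes r: "\<And>e. e > 0 \<Longrightarrow> \<exists>d>0. \<forall>h::real. 0 < h \<and> h < d \<longrightarrow> \<bar>(f (x + h) - f x) / h - D\<bar> < e"
    and l: "\<And>e. e > 0 \<Longrightarrow> \<exists>d>0. \<forall>h::real. 0 < h \<and> h < d \<longrightarrow> \<bar>(f x - f (x - h)) / h - D\<bar> < e"
  shows "(f has_real_derivative D) (at x)"
  unfolding DERIV_def LIM_def
proof (intro allI impI)
  fix e :: real assume e: "e > 0"
  obtain d1 where d1: "d1 > 0" "\<And>h. 0 < h \<Longrightarrow> h < d1 \<Longrightarrow> \<bar>(f (x + h) - f x) / h - D\<bar> < e" using r[OF e] by blast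
  obtain d2 where d2: "d2 > 0" "\<And>h. 0 < h \<Longrightarrow> h < d2 \<Longrightarrow> \<bar>(f x - f (x - h)) / h - D\<bar> < e" using l[OF e] by blast
  show "\<exists>s>0. \<forall>h::real. h \<noteq> 0 \<and> dist h 0 < s \<longrightarrow> dist ((f (x + h) - f x) / h) D < e"
  proof (intro exI[of _ "min d1 d2"] conjI allI impI)
    fix h :: real assume h: "h \<noteq> 0 \<and> dist h 0 < min d1 d2"
    show "dist ((f (x + h) - f x) / h) D < e"
    proof (cases "h > 0")
      case True then show ?thesis using d1(2)[of h] h by (simp add: dist_real_def)
    next
      case False
      have "(f x - f (x + h)) / (-h) = (f (x + h) - f x) / h" using h by (simp add: field_simps)
      then show ?thesis using d2(2)[of "-h"] h False by (simp add: dist_real_def)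
    qed
  qed (use d1 d2 in auto)
qed

text \<open>Averages of the density over \<open>[x, x+h]\<close> converge almost everywhere, which
  gives right derivatives. Left derivatives come from the same statement for the reflected density
  \<open>g (-x)\<close> at \<open>-x\<close>; its exceptional set \<open>N2\<close> is therefore
  reflected back.\<close>

lemma lipschitz_real_derivative:
  fixes f :: "real \<Rightarrow> real"
  assumes lip: "C-lipschitz_on UNIV f"
  obtains g N where "negligible N" "\<And>x. x \<notin> N \<Longrightarrow> (f has_real_derivative g x) (at x)"
    "\<And>a b. a \<le> b \<Longrightarrow> (g has_integral (f b - f a)) {a..b}"
proof -
  obtain g where g: "g \<in> borel_measurable borel"
    "\<And>a b. a \<le> b \<Longrightarrow> (g has_integral (f b - f a)) {a..b}"
    using lipschitz_real_density[OF lip] by blast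
  have i1: "g integrable_on cbox a b" for a b
    using g(2)[of a b] by (cases "a \<le> b") (auto simp: integrable_on_def)
  have i2': "((\<lambda>x. g (-x)) has_integral (f (-a) - f (-b))) {a..b}" if "a \<le> b" for a b
    using g(2)[of "-b" "-a"] that has_integral_reflect_real[where f=g and a="-b" and b="-a"] by auto
  have i2: "(\<lambda>x. g (-x)) integrable_on cbox a b" for a b
    using i2'[of a b] by (cases "a \<le> b") (auto simp: integrable_on_def)
  obtain N1 where N1: "negligible N1" "\<And>x e. \<lbrakk>x \<notin> N1; 0 < e\<rbrakk> \<Longrightarrow> \<exists>d>0. \<forall>h::real. 0 < h \<and> h < d \<longrightarrow>
      norm(integral (cbox x (x + h *\<^sub>R One)) g /\<^sub>R h ^ DIM(real) - g x) < e"
    using integrable_ccontinuous_explicit[OF i1] by metis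
  obtain N2 where N2: "negligible N2" "\<And>x e. \<lbrakk>x \<notin> N2; 0 < e\<rbrakk> \<Longrightarrow> \<exists>d>0. \<forall>h::real. 0 < h \<and> h < d \<longrightarrow>
      norm(integral (cbox x (x + h *\<^sub>R One)) (\<lambda>x. g (-x)) /\<^sub>R h ^ DIM(real) - g (-x)) < e"
    using integrable_ccontinuous_explicit[OF i2] by metis
  have "negligible ((\<lambda>x::real. -x) ` N2)"
    by (rule negligible_locally_Lipschitz_image[OF _ N2(1)])
      (use open_UNIV in \<open>auto intro!: exI[of _ UNIV] exI[of _ "1::real"]\<close>)
  then have N: "negligible (N1 \<union> (\<lambda>x. -x) ` N2)" using N1 by auto
  show thesis
  proof (rule that[OF N])
    fix x assume x: "x \<notin> N1 \<union> (\<lambda>x. -x) ` N2"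
    then have x1: "x \<notin> N1" and x2: "-x \<notin> N2" by (auto simp: image_iff)
    show "(f has_real_derivative g x) (at x)"
    proof (rule has_vector_derivativeI_right_left)
      fix e :: real assume e: "e > 0"
      obtain d where d: "d > 0" "\<And>h. 0 < h \<Longrightarrow> h < d \<Longrightarrow>
          norm(integral (cbox x (x + h *\<^sub>R One)) g /\<^sub>R h ^ DIM(real) - g x) < e" using N1(2)[OF x1 e] by blast
      show "\<exists>d>0. \<forall>h::real. 0 < h \<and> h < d \<longrightarrow> \<bar>(f (x + h) - f x) / h - g x\<bar> < e"
      proof (intro exI[of _ d] conjI allI impI d(1))
        fix h :: real assume h: "0 < h \<and> h < d"
        have "integral {x..x+h} g = f (x+h) - f x" using g(2)[of x "x+h"] h by (simp add: integral_unique)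
        then show "\<bar>(f (x + h) - f x) / h - g x\<bar> < e" using d(2)[of h] h by (simp add: divide_inverse mult.commute)
      qed
      obtain d where d: "d > 0" "\<And>h. 0 < h \<Longrightarrow> h < d \<Longrightarrow>
          norm(integral (cbox (-x) (-x + h *\<^sub>R One)) (\<lambda>x. g (-x)) /\<^sub>R h ^ DIM(real) - g x) < e" using N2(2)[OF x2 e] by auto
      show "\<exists>d>0. \<forall>h::real. 0 < h \<and> h < d \<longrightarrow> \<bar>(f x - f (x - h)) / h - g x\<bar> < e"
      proof (intro exI[of _ d] conjI allI impI d(1))
        fix h :: real assume h: "0 < h \<and> h < d"
        have "integral {-x..-x+h} (\<lambda>x. g (-x)) = f x - f (x-h)" using i2'[of "-x" "-x+h"] h by (simp add: integral_unique)
        then show "\<bar>(f x - f (x-h)) / h - g x\<bar> < e" using d(2)[of h] h by (simp add: divide_inverse mult.commute)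
      qed
    qed
  qed (use g in auto)
qed

text \<open>\<open>f\<close> is extended to the whole line by freezing it outside
  \<open>[a, b]\<close>. The extension keeps the constant \<open>C\<close>, and its real and
  imaginary parts fall under the scalar case. The endpoints are left out of the derivative claim,
  since the extension can have kinks there.\<close>

lemma lipschitz_complex_derivative:
  fixes f :: "real \<Rightarrow> complex"
  assumes lip: "C-lipschitz_on {a..b} f" and ab: "a \<le> b"
  obtains g N where "negligible N" "\<And>x. x \<in> {a<..<b} - N \<Longrightarrow> (f has_vector_derivative g x) (at x)"
    "(g has_integral (f b - f a)) {a..b}"
proof -
  have C0: "C \<ge> 0" using lip lipschitz_on_nonneg by blast
  define F where "F x = f (max a (min b x))" for x
  have lipF: "dist (F x) (F y) \<le> C * \<bar>x - y\<bar>" for x y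
  proof -
    have "dist (F x) (F y) \<le> C * dist (max a (min b x)) (max a (min b y))"
      unfolding F_def by (rule lipschitz_onD[OF lip]) (use ab in auto)
    also have "\<dots> \<le> C * \<bar>x-y\<bar>" using C0 by (intro mult_left_mono) (auto simp: dist_real_def)
    finally show ?thesis .
  qed
  have "C-lipschitz_on UNIV (\<lambda>x. Re (F x))" "C-lipschitz_on UNIV (\<lambda>x. Im (F x))"
  proof -
    have "\<bar>Re (F x) - Re (F y)\<bar> \<le> C * \<bar>x-y\<bar>" "\<bar>Im (F x) - Im (F y)\<bar> \<le> C * \<bar>x-y\<bar>" for x y
      using lipF[of x y] abs_Re_le_cmod[of "F x - F y"] abs_Im_le_cmod[of "F x - F y"] by (auto simp: dist_norm)
    then show "C-lipschitz_on UNIV (\<lambda>x. Re (F x))" "C-lipschitz_on UNIV (\<lambda>x. Im (F x))"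
      using C0 by (auto simp: lipschitz_on_def dist_real_def)
  qed
  then obtain g1 N1 g2 N2 where
    g1: "negligible N1" "\<And>x. x \<notin> N1 \<Longrightarrow> ((\<lambda>x. Re (F x)) has_real_derivative g1 x) (at x)"
    "\<And>a b. a \<le> b \<Longrightarrow> (g1 has_integral (Re (F b) - Re (F a))) {a..b}"
   and g2: "negligible N2" "\<And>x. x \<notin> N2 \<Longrightarrow> ((\<lambda>x. Im (F x)) has_real_derivative g2 x) (at x)"
    "\<And>a b. a \<le> b \<Longrightarrow> (g2 has_integral (Im (F b) - Im (F a))) {a..b}"
    using lipschitz_real_derivative by metis
  show thesis
  proof (rule that[of "N1 \<union> N2" "\<lambda>x. Complex (g1 x) (g2 x)"])
    show "negligible (N1 \<union> N2)" using g1 g2 by simp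
    fix x assume x: "x \<in> {a<..<b} - (N1 \<union> N2)"
    have "(F has_vector_derivative Complex (g1 x) (g2 x)) (at x)"
      unfolding has_vector_derivative_complex_iff using x g1(2)[of x] g2(2)[of x]
      by (auto simp: has_real_derivative_iff_has_vector_derivative o_def)
    then show "(f has_vector_derivative Complex (g1 x) (g2 x)) (at x)"
      by (rule has_vector_derivative_transform_within_open[of _ _ _ "{a<..<b}"]) (use x in \<open>auto simp: F_def\<close>)
  next
    have "F a = f a" "F b = f b" using ab by (auto simp: F_def)
    then show "((\<lambda>x. Complex (g1 x) (g2 x)) has_integral f b - f a) {a..b}"
      using g1(3)[OF ab] g2(3)[OF ab] by (auto simp: has_integral_componentwise_iff[of "\<lambda>x. Complex (g1 x) (g2 x)"] Basis_complex_def inner_complex_def)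
  qed
qed

section \<open>The fundamental theorem of calculus along Lipschitz paths\<close>

lemma has_vector_derivative_norm_le:
  fixes f :: "real \<Rightarrow> complex"
  assumes lip: "C-lipschitz_on {a..b} f" and x: "x \<in> {a<..<b}" and d: "(f has_vector_derivative d) (at x)"
  shows "norm d \<le> C"
proof -
  have "((\<lambda>h. (f (x + h) - f x) /\<^sub>R h) \<longlongrightarrow> d) (at 0)"
  proof -
    have "((\<lambda>h. norm (f (x + h) - f x - h *\<^sub>R d) / norm h) \<longlongrightarrow> 0) (at 0)"
      using d unfolding has_vector_derivative_def has_derivative_at by simp
    moreover have "\<forall>\<^sub>F h in at 0. norm (f (x + h) - f x - h *\<^sub>R d) / norm h = norm ((f (x + h) - f x) /\<^sub>R h - d)"
      unfolding eventually_at_filter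
    proof (intro always_eventually allI impI)
      fix h :: real assume "h \<noteq> 0"
      then have "(f (x + h) - f x) /\<^sub>R h - d = (f (x + h) - f x - h *\<^sub>R d) /\<^sub>R h" by (simp add: scaleR_diff_right)
      then show "norm (f (x + h) - f x - h *\<^sub>R d) / norm h = norm ((f (x + h) - f x) /\<^sub>R h - d)"
        by (simp add: divide_inverse mult.commute)
    qed
    ultimately have "((\<lambda>h. norm ((f (x + h) - f x) /\<^sub>R h - d)) \<longlongrightarrow> 0) (at 0)"
      by (rule Lim_transform_eventually)
    then show ?thesis by (simp add: tendsto_norm_zero_iff LIM_zero_iff)
  qed
  then show ?thesis
  proof (rule Lim_norm_ubound[rotated])
    have "\<forall>\<^sub>F h in at 0. h \<in> {a-x<..<b-x} - {0}" using x
      by (intro eventually_at_in_open) auto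
    then show "\<forall>\<^sub>F h in at 0. norm ((f (x + h) - f x) /\<^sub>R h) \<le> C"
    proof eventually_elim
      case (elim h)
      have "dist (f (x + h)) (f x) \<le> C * dist (x + h) x" using elim x by (intro lipschitz_onD[OF lip]) auto
      then show ?case using elim by (simp add: dist_norm divide_simps)
    qed
  qed auto
qed

text \<open>A derivative \<open>D\<close> prescribed almost everywhere agrees with the density off a
  null set, and the Lipschitz constant bounds it, which makes it absolutely integrable.\<close>

lemma lipschitz_fundamental_theorem:
  fixes f :: "real \<Rightarrow> complex"
  assumes lip: "C-lipschitz_on {a..b} f" and ab: "a \<le> b" and N: "negligible N"
    and D: "\<And>x. x \<in> {a<..<b} - N \<Longrightarrow> (f has_vector_derivative D x) (at x)"
  shows "D absolutely_integrable_on {a..b}" "(D has_integral (f b - f a)) {a..b}"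
proof -
  obtain g N' where g: "negligible N'" "\<And>x. x \<in> {a<..<b} - N' \<Longrightarrow> (f has_vector_derivative g x) (at x)"
    "(g has_integral (f b - f a)) {a..b}"
    using lipschitz_complex_derivative[OF lip ab] by metis
  define M where "M = N \<union> N' \<union> {a,b}"
  have M: "negligible M" using N g by (auto simp: M_def)
  have eq: "D x = g x" if "x \<in> {a..b} - M" for x
    using D[of x] g(2)[of x] that vector_derivative_unique_at by (fastforce simp: M_def)
  show i: "(D has_integral (f b - f a)) {a..b}"
    using has_integral_spike[OF M eq g(3)] by simp
  have bnd: "norm (D x) \<le> C" if "x \<in> {a..b} - M" for x
    using has_vector_derivative_norm_le[OF lip, of x "D x"] D[of x] that by (auto simp: M_def)
  \<comment> \<open>\<open>D\<close> is unconstrained on the null set \<open>M\<close>; setting it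
    to \<open>0\<close> there gives the bound \<open>C\<close> at every point.\<close>
  define D' where "D' x = (if x \<in> M then 0 else D x)" for x
  have C0: "C \<ge> 0" by (rule lipschitz_on_nonneg[OF lip])
  have "D' absolutely_integrable_on {a..b}"
  proof (rule absolutely_integrable_integrable_bound[where g = "\<lambda>_. C"])
    show "norm (D' x) \<le> C" if "x \<in> {a..b}" for x using bnd that C0 by (auto simp: D'_def)
    have "(D' has_integral (f b - f a)) {a..b}"
      using has_integral_spike[OF M _ i, of D'] by (auto simp: D'_def)
    then show "D' integrable_on {a..b}" by blast
  qed auto
  then show "D absolutely_integrable_on {a..b}"
    by (rule absolutely_integrable_spike[OF _ M]) (auto simp: D'_def)
qed

text \<open>The composite of a path with a holomorphic primitive is Lipschitz near each parameter,
  with a constant that depends on the place. \<open>Bolzano\<close> glues the local statements: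
  \<open>P\<close> is additive over adjacent intervals and holds on all short intervals around each
  point.\<close>

lemma locally_lipschitz_fundamental_theorem:
  fixes f :: "real \<Rightarrow> complex"
  assumes lip: "\<And>x. x \<in> {a..b} \<Longrightarrow> \<exists>d>0. \<exists>C. C-lipschitz_on ({a..b} \<inter> ball x d) f"
    and ab: "a \<le> b" and N: "negligible N"
    and D: "\<And>x. x \<in> {a<..<b} - N \<Longrightarrow> (f has_vector_derivative D x) (at x)"
  shows "D absolutely_integrable_on {a..b}" "(D has_integral (f b - f a)) {a..b}"
proof -
  define P where "P u v \<longleftrightarrow> (a \<le> u \<and> u \<le> v \<and> v \<le> b \<longrightarrow> D absolutely_integrable_on {u..v} \<and> (D has_integral (f v - f u)) {u..v})" for u v
  have "P a b"
  proof (rule Bolzano[OF ab])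
    fix u v w assume uv: "P u v" "P v w" "u \<le> v" "v \<le> w"
    show "P u w" unfolding P_def
    proof (intro impI conjI)
      assume "a \<le> u \<and> u \<le> w \<and> w \<le> b"
      then have *: "D absolutely_integrable_on {u..v}" "(D has_integral (f v - f u)) {u..v}"
         "D absolutely_integrable_on {v..w}" "(D has_integral (f w - f v)) {v..w}" using uv by (auto simp: P_def)
      show "D absolutely_integrable_on {u..w}" using absolutely_integrable_on_combine[OF *(1,3)] uv by simp
      show "(D has_integral f w - f u) {u..w}" using has_integral_combine[OF uv(3,4) *(2,4)] by simp
    qed
  next
    fix x assume x: "a \<le> x" "x \<le> b"
    then obtain d C where d: "d > 0" "C-lipschitz_on ({a..b} \<inter> ball x d) f" using lip[of x] by auto
    show "\<exists>d>0. \<forall>u v. u \<le> x \<and> x \<le> v \<and> v - u < d \<longrightarrow> P u v"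
    proof (intro exI[of _ d] conjI allI impI d(1))
      fix u v assume uv: "u \<le> x \<and> x \<le> v \<and> v - u < d"
      show "P u v" unfolding P_def
      proof (intro impI)
        assume *: "a \<le> u \<and> u \<le> v \<and> v \<le> b"
        have "C-lipschitz_on {u..v} f"
          by (rule lipschitz_on_subset[OF d(2)]) (use * uv in \<open>auto simp: dist_real_def\<close>)
        then show "D absolutely_integrable_on {u..v} \<and> (D has_integral f v - f u) {u..v}"
          using lipschitz_fundamental_theorem[of C u v f N D] * N D by auto
      qed
    qed
  qed
  then show "D absolutely_integrable_on {a..b}" "(D has_integral (f b - f a)) {a..b}" using ab by (auto simp: P_def)
qed

text \<open>On a small disc around \<open>c x\<close> the derivative \<open>q\<close> is bounded, so
  \<open>Q\<close> is Lipschitz there and \<open>Q \<circ> c\<close> is locally Lipschitz; the chain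
  rule holds off \<open>N\<close>. This is the evaluation of contour integrals by primitives for
  paths that are only Lipschitz.\<close>

lemma lipschitz_path_primitive:
  fixes c :: "real \<Rightarrow> complex"
  assumes lip: "C-lipschitz_on {a..b} c" and ab: "a \<le> b" and N: "negligible N"
    and D: "\<And>x. x \<in> {a<..<b} - N \<Longrightarrow> (c has_vector_derivative D x) (at x)"
    and S: "open S" "c ` {a..b} \<subseteq> S" and Q: "\<And>z. z \<in> S \<Longrightarrow> (Q has_field_derivative q z) (at z)"
  shows "(\<lambda>x. q (c x) * D x) absolutely_integrable_on {a..b}"
    "((\<lambda>x. q (c x) * D x) has_integral (Q (c b) - Q (c a))) {a..b}"
proof -
  have C0: "C \<ge> 0" by (rule lipschitz_on_nonneg[OF lip])
  have cc: "continuous_on {a..b} c" by (rule lipschitz_on_continuous_on[OF lip])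
  have hol: "Q holomorphic_on S" unfolding holomorphic_on_open[OF S(1)] using Q by auto
  have qd: "q z = deriv Q z" if "z \<in> S" for z using Q[OF that] DERIV_imp_deriv by fastforce
  have qc: "continuous_on S q"
    using holomorphic_on_imp_continuous_on[OF holomorphic_deriv[OF hol S(1)]] qd by (simp cong: continuous_on_cong)
  have ll: "\<exists>d>0. \<exists>C. C-lipschitz_on ({a..b} \<inter> ball x d) (Q \<circ> c)" if x: "x \<in> {a..b}" for x
  proof -
    have "c x \<in> S" using S x by auto
    then obtain e where e: "e > 0" "cball (c x) e \<subseteq> S" using S(1) unfolding open_contains_cball by blast
    have "compact (q ` cball (c x) e)" by (rule compact_continuous_image[OF continuous_on_subset[OF qc e(2)] compact_cball])
    then have "\<exists>B. \<forall>z\<in>cball (c x) e. norm (q z) \<le> B"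
      by (auto dest!: compact_imp_bounded simp: bounded_iff)
    then obtain B where B: "\<And>z. z \<in> cball (c x) e \<Longrightarrow> norm (q z) \<le> B" by metis
    have B0: "B \<ge> 0" using B[of "c x"] e by (intro order_trans[OF norm_ge_zero]) auto
    have QL: "norm (Q z - Q y) \<le> B * norm (z - y)" if "z \<in> cball (c x) e" "y \<in> cball (c x) e" for z y
    proof (rule field_differentiable_bound[OF convex_cball])
      show "(Q has_field_derivative q w) (at w within cball (c x) e)" if "w \<in> cball (c x) e" for w
        using Q[of w] subsetD[OF e(2) that] by (auto intro: has_field_derivative_at_within)
      show "norm (q w) \<le> B" if "w \<in> cball (c x) e" for w by (rule B[OF that])
    qed (use that in auto)
    obtain d where d: "d > 0" "\<And>y. y \<in> {a..b} \<Longrightarrow> dist y x < d \<Longrightarrow> dist (c y) (c x) < e"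
      using cc x e(1) unfolding continuous_on_iff by metis
    have "(B*C)-lipschitz_on ({a..b} \<inter> ball x d) (Q \<circ> c)"
    proof (rule lipschitz_onI)
      fix u v assume uv: "u \<in> {a..b} \<inter> ball x d" "v \<in> {a..b} \<inter> ball x d"
      have "norm (Q (c u) - Q (c v)) \<le> B * norm (c u - c v)"
        using uv d(2)[of u] d(2)[of v] by (intro QL) (auto simp: dist_commute less_imp_le)
      also have "\<dots> \<le> B * (C * dist u v)"
        using lipschitz_onD[OF lip, of u v] uv B0 by (intro mult_left_mono) (auto simp: dist_norm)
      finally show "dist ((Q \<circ> c) u) ((Q \<circ> c) v) \<le> (B*C) * dist u v" by (simp add: dist_norm mult.assoc)
    qed (use B0 C0 in auto)
    then show ?thesis using d by blast
  qed
  have dd: "((Q \<circ> c) has_vector_derivative (q (c x) * D x)) (at x)" if "x \<in> {a<..<b} - N" for x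
  proof -
    have "c x \<in> S" using S that by auto
    then show ?thesis using field_vector_diff_chain_at[OF D[OF that] Q[of "c x"]] by (simp add: mult.commute)
  qed
  show "(\<lambda>x. q (c x) * D x) absolutely_integrable_on {a..b}"
    "((\<lambda>x. q (c x) * D x) has_integral (Q (c b) - Q (c a))) {a..b}"
    using locally_lipschitz_fundamental_theorem[OF ll ab N dd] by auto
qed

section \<open>Crosscuts of Jordan domains\<close>

lemma simple_path_eq_interior:
  assumes "simple_path c" "c x = c y" "0 < x" "x < 1" "0 \<le> y" "y \<le> 1"
  shows "x = y"
  using assms unfolding simple_path_def loop_free_def by force

text \<open>The two arcs of the curve between \<open>c u\<close> and \<open>c v\<close> form a theta
  curve with the crosscut \<open>j\<close>, and the inside splits into the insides of the two Jordan
  curves through \<open>j\<close>. What is used later is the last claim: the frontier of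
  \<open>U\<close> meets the curve only at parameters in \<open>[u, v]\<close>.\<close>

lemma crosscut_splits_inside:
  fixes c j :: "real \<Rightarrow> complex"
  assumes c: "simple_path c" "pathfinish c = pathstart c"
    and uv: "0 < u" "u < v" "v < 1"
    and j: "arc j" "pathstart j = c u" "pathfinish j = c v"
      "path_image j - {c u, c v} \<subseteq> inside (path_image c)"
  obtains U V where "open U" "open V" "connected U" "connected V" "U \<inter> V = {}"
    "U \<union> V = inside (path_image c) - path_image j"
    "frontier U \<subseteq> c ` {u..v} \<union> path_image j"
proof -
  define c1 where "c1 = subpath u v c"
  \<comment> \<open>The complementary arc passes through the base point \<open>c 1 = c 0\<close>, so
    it is joined from two subpaths and then reversed in order to start at
    \<open>c u\<close>.\<close>
  define c2' where "c2' = subpath v 1 c +++ subpath 0 u c"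
  define c2 where "c2 = reversepath c2'"
  have ne: "c u \<noteq> c v" using simple_path_eq_interior[OF c(1), of u v] uv by auto
  have c01: "c 1 = c 0" using c(2) by (simp add: pathstart_def pathfinish_def)
  have cv1: "c v \<noteq> c 1" "c 0 \<noteq> c u"
    using simple_path_eq_interior[OF c(1), of v 1] simple_path_eq_interior[OF c(1), of u 0] uv by auto
  have pi1: "path_image c1 = c ` {u..v}" unfolding c1_def using uv by (simp add: path_image_subpath)
  have pia: "path_image (subpath v 1 c) = c ` {v..1}" "path_image (subpath 0 u c) = c ` {0..u}"
    using uv by (simp_all add: path_image_subpath)
  have fs: "pathfinish (subpath v 1 c) = pathstart (subpath 0 u c)" using c01 by simp
  have pi2: "path_image c2 = c ` {v..1} \<union> c ` {0..u}"
    unfolding c2_def c2'_def using fs pia by (simp add: path_image_join)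
  have arcs: "arc (subpath v 1 c)" "arc (subpath 0 u c)" "arc c1"
    unfolding c1_def using uv cv1 ne by (auto intro!: arc_simple_path_subpath[OF c(1)])
  have "arc c2'" unfolding c2'_def
  proof (rule arc_join[OF arcs(1,2) fs])
    show "path_image (subpath v 1 c) \<inter> path_image (subpath 0 u c) \<subseteq> {pathstart (subpath 0 u c)}"
    proof
      fix z assume "z \<in> path_image (subpath v 1 c) \<inter> path_image (subpath 0 u c)"
      then have "z \<in> c ` {v..1}" "z \<in> c ` {0..u}" unfolding pia by auto
      then obtain s s' where s: "s \<in> {v..1}" "s' \<in> {0..u}" "z = c s" "z = c s'" by (elim imageE) metis
      have "s = 1" using simple_path_eq_interior[OF c(1), of s s'] s uv by force
      then show "z \<in> {pathstart (subpath 0 u c)}" using s c01 by (simp add: pathstart_def subpath_def)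
    qed
  qed
  then have sp2: "simple_path c2" unfolding c2_def by (simp add: arc_imp_simple_path simple_path_reversepath)
  have se2: "pathstart c2 = c u" "pathfinish c2 = c v" unfolding c2_def c2'_def by simp_all
  have se1: "pathstart c1 = c u" "pathfinish c1 = c v" unfolding c1_def by simp_all
  have sp1: "simple_path c1" using arcs arc_imp_simple_path by blast
  have spj: "simple_path j" using j arc_imp_simple_path by blast
  have un: "path_image c1 \<union> path_image c2 = path_image c"
  proof -
    have "{u..v} \<union> ({v..1} \<union> {0..u}) = {0..1}" using uv by auto
    then show ?thesis unfolding pi1 pi2 path_image_def[of c] by (simp add: image_Un[symmetric])
  qed
  have disj: "inside (path_image c) \<inter> path_image c = {}" by (rule inside_no_overlap)
  have "path_image c1 \<inter> path_image c2 = {c u, c v}"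
  proof
    show "path_image c1 \<inter> path_image c2 \<subseteq> {c u, c v}"
    proof
      fix z assume "z \<in> path_image c1 \<inter> path_image c2"
      then have "z \<in> c ` {u..v}" "z \<in> c ` ({v..1} \<union> {0..u})" unfolding pi1 pi2 by (auto simp: image_Un)
      then obtain s s' where s: "s \<in> {u..v}" "s' \<in> {v..1} \<union> {0..u}" "z = c s" "z = c s'" by (elim imageE) metis
      have "s = s'" using simple_path_eq_interior[OF c(1), of s s'] s uv by auto
      then show "z \<in> {c u, c v}" using s by auto
    qed
    show "{c u, c v} \<subseteq> path_image c1 \<inter> path_image c2" unfolding pi1 pi2 using uv by auto
  qed
  moreover have jends: "{c u, c v} \<subseteq> path_image j" using j by (metis empty_subsetI insert_subset pathfinish_in_path_image pathstart_in_path_image)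
  have ends12: "{c u, c v} \<subseteq> path_image c1" "{c u, c v} \<subseteq> path_image c2" unfolding pi1 pi2 using uv by auto
  have "path_image c1 \<inter> path_image j = {c u, c v}" "path_image c2 \<inter> path_image j = {c u, c v}"
  proof -
    have "z \<in> {c u, c v}" if "z \<in> path_image c" "z \<in> path_image j" for z
      using that j(4) disj by blast
    then show "path_image c1 \<inter> path_image j = {c u, c v}" "path_image c2 \<inter> path_image j = {c u, c v}"
      using jends ends12 unfolding un[symmetric] by auto
  qed
  moreover have jh: "j (1/2) \<in> path_image j" "j (1/2) \<noteq> c u" "j (1/2) \<noteq> c v"
  proof -
    have ij: "inj_on j {0..1}" using j(1) by (simp add: arc_def)
    show "j (1/2) \<in> path_image j" by (simp add: path_image_def)
    show "j (1/2) \<noteq> c u" using inj_onD[OF ij, of "1/2" 0] j(2) by (auto simp: pathstart_def)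
    show "j (1/2) \<noteq> c v" using inj_onD[OF ij, of "1/2" 1] j(3) by (auto simp: pathfinish_def)
  qed
  have "path_image j \<inter> inside (path_image c1 \<union> path_image c2) \<noteq> {}" using jh j(4) un by auto
  ultimately have P: "path_image c1 \<inter> path_image c2 = {c u, c v}" "path_image c1 \<inter> path_image j = {c u, c v}" "path_image c2 \<inter> path_image j = {c u, c v}" "path_image j \<inter> inside (path_image c1 \<union> path_image c2) \<noteq> {}"
    using \<open>path_image c1 \<inter> path_image j = {c u, c v}\<close> \<open>path_image c2 \<inter> path_image j = {c u, c v}\<close> by auto
  obtain sp: "inside(path_image c1 \<union> path_image j) \<inter> inside(path_image c2 \<union> path_image j) = {}"
          "inside(path_image c1 \<union> path_image j) \<union> inside(path_image c2 \<union> path_image j) \<union>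
           (path_image j - {c u,c v}) = inside(path_image c1 \<union> path_image c2)"
    by (rule split_inside_simple_closed_curve[OF sp1 se1 sp2 se2 spj j(2,3) ne P])
  have jord: "open (inside (path_image k \<union> path_image j)) \<and> connected (inside (path_image k \<union> path_image j))
     \<and> frontier (inside (path_image k \<union> path_image j)) = path_image k \<union> path_image j"
    if k: "arc k" "pathstart k = c u" "pathfinish k = c v" "path_image k \<inter> path_image j = {c u, c v}" for k
  proof -
    have "simple_path (k +++ reversepath j)"
      using k j by (subst simple_path_join_loop_eq) (auto simp: arc_reversepath)
    moreover have "pathfinish (k +++ reversepath j) = pathstart (k +++ reversepath j)" using k j by simp
    moreover have "path_image (k +++ reversepath j) = path_image k \<union> path_image j" using k j by (simp add: path_image_join)
    ultimately show ?thesis using Jordan_inside_outside[of "k +++ reversepath j"] by auto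
  qed
  have ac2: "arc c2" unfolding c2_def using \<open>arc c2'\<close> by (simp add: arc_reversepath)
  note j1 = jord[OF arcs(3) se1 \<open>path_image c1 \<inter> path_image j = {c u, c v}\<close>]
  note j2 = jord[OF ac2 se2 \<open>path_image c2 \<inter> path_image j = {c u, c v}\<close>]
  show thesis
  proof (rule that[of "inside(path_image c1 \<union> path_image j)" "inside(path_image c2 \<union> path_image j)"])
    have "inside(path_image c1 \<union> path_image j) \<inter> (path_image c1 \<union> path_image j) = {}"
         "inside(path_image c2 \<union> path_image j) \<inter> (path_image c2 \<union> path_image j) = {}" by (rule inside_no_overlap)+
    then have d: "(inside (path_image c1 \<union> path_image j) \<union> inside (path_image c2 \<union> path_image j)) \<inter> path_image j = {}" by blast
    have "{c u, c v} \<subseteq> path_image c" using ends12 un by blast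
    then have "inside (path_image c) \<inter> {c u, c v} = {}" using disj by blast
    then show "inside (path_image c1 \<union> path_image j) \<union> inside (path_image c2 \<union> path_image j) =
      inside (path_image c) - path_image j" using d unfolding sp(2)[unfolded un, symmetric] by auto
  qed (use j1 j2 sp pi1 in auto)
qed

text \<open>The arc is the component of the circle in the domain that separates \<open>0\<close> from the end of \<open>\<eta>\<close>.\<close>

lemma circle_arc_separating:
  fixes c \<eta> :: "real \<Rightarrow> complex"
  assumes c: "simple_path c" "pathstart c = t" "pathfinish c = t"
    and z0: "0 \<in> inside (path_image c)"
    and eta: "continuous_on {0..1} \<eta>" "\<eta> 0 = 0" "\<eta> 1 = t" "\<eta> ` {0..<1} \<subseteq> inside (path_image c)"
  obtains m where "0 < m" "m < 1"
    "\<And>r. \<lbrakk>0 < r; r < cmod t\<rbrakk> \<Longrightarrow> \<exists>a b x y. a < b \<and> b - a \<le> 2 * pi \<and>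
       (\<forall>\<theta>\<in>{a<..<b}. t + of_real r * cis \<theta> \<in> inside (path_image c)) \<and>
       t + of_real r * cis a = c x \<and> t + of_real r * cis b = c y \<and>
       (0 < x \<and> x < m \<and> m < y \<and> y < 1 \<or> 0 < y \<and> y < m \<and> m < x \<and> x < 1)"
proof -
  define D where "D = inside (path_image c)"
  have cc: "pathfinish c = pathstart c" using c by simp
  have jord: "open D" "connected D" "bounded D" "frontier D = path_image c"
    using Jordan_inside_outside[OF c(1) cc] unfolding D_def by auto
  have disj: "D \<inter> path_image c = {}" unfolding D_def by (rule inside_no_overlap)
  have c01: "c 0 = t" "c 1 = t" using c by (auto simp: pathstart_def pathfinish_def)
  have tG: "t \<in> path_image c" using c by (metis pathstart_in_path_image)
  have tD: "t \<notin> D" using tG disj by auto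
  have t0: "t \<noteq> 0" using z0 tD by (auto simp: D_def)
  have inter: "interior D = D" using jord by (simp add: interior_open)
  have cont: "continuous_on {0..1} c" using c(1) by (simp add: simple_path_def path_def)
  \<comment> \<open>The ray from \<open>0\<close> pointing away from \<open>t\<close> first leaves
    \<open>D\<close> at the point \<open>c m\<close>. Along it the distance to \<open>t\<close>
    never drops below \<open>|t|\<close>, so it avoids every circle of radius
    \<open>r < |t|\<close>, and one \<open>m\<close> serves all radii.\<close>
  obtain d where d: "0 < d" "0 + d *\<^sub>R (-t) \<in> frontier D" "\<And>e. 0 \<le> e \<Longrightarrow> e < d \<Longrightarrow> 0 + e *\<^sub>R (-t) \<in> interior D"
    using ray_to_frontier[OF jord(3), of 0 "-t"] z0 t0 inter by (metis D_def neg_equal_0_iff_equal)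
  obtain m where m: "m \<in> {0..1}" "c m = - of_real d * t"
    using d(2) unfolding jord(4) path_image_def by (auto simp: scaleR_conv_of_real)
  have cmt: "cmod (c m - t) = (1 + d) * cmod t"
  proof -
    have "c m - t = - of_real (1 + d) * t" using m by (simp add: algebra_simps)
    then show ?thesis using d(1) by (simp add: norm_mult del: of_real_add)
  qed
  have cmt': "cmod (c m - t) > cmod t" using cmt d(1) t0 by simp
  have m01: "0 < m" "m < 1"
  proof -
    have "m \<noteq> 0" "m \<noteq> 1" using cmt' c01 by auto
    then show "0 < m" "m < 1" using m by auto
  qed
  show thesis
  proof (rule that[OF m01])
    fix r :: real assume r: "0 < r" "r < cmod t"
    define z where "z \<theta> = t + of_real r * cis \<theta>" for \<theta>
    have zr: "cmod (z \<theta> - t) = r" for \<theta> unfolding z_def using r by (simp add: norm_mult)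
    have zper: "z (\<theta> + 2*pi) = z \<theta>" "z (\<theta> - 2*pi) = z \<theta>" for \<theta>
      unfolding z_def by (simp_all add: cis_mult[symmetric] cis_divide[symmetric])
    have zcont: "continuous_on A z" for A unfolding z_def by (intro continuous_intros)
    have zinj: "\<exists>k::int. \<theta> = \<theta>' + 2 * pi * k" if "z \<theta> = z \<theta>'" for \<theta> \<theta>'
    proof -
      have "cis \<theta> = cis \<theta>'" using that r unfolding z_def by simp
      then have "cos \<theta> = cos \<theta>' \<and> sin \<theta> = sin \<theta>'" by (simp add: complex_eq_iff)
      then show ?thesis using sin_cos_eq_iff[of \<theta> \<theta>'] by (metis mult.commute mult.left_commute)
    qed
    have zsurj: "\<exists>\<theta>. a \<le> \<theta> \<and> \<theta> < a + 2*pi \<and> z \<theta> = w" if "cmod (w - t) = r" for w a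
    proof -
      define \<theta> where "\<theta> = Arg (w - t)"
      have th: "w - t = of_real r * cis \<theta>" using rcis_cmod_Arg[of "w - t"] that by (simp add: rcis_def \<theta>_def)
      define k where "k = \<lfloor>(\<theta> - a) / (2*pi)\<rfloor>"
      have k: "of_int k \<le> (\<theta> - a)/(2*pi)" "(\<theta> - a)/(2*pi) < of_int k + 1" unfolding k_def by linarith+
      then have "a \<le> \<theta> - 2 * pi * real_of_int k" "\<theta> - 2 * pi * real_of_int k < a + 2*pi" by (simp_all add: field_simps)
      moreover have "cis (\<theta> - 2 * pi * real_of_int k) = cis \<theta>"
        by (simp add: cis_divide[symmetric] cis_multiple_2pi)
      then have "z (\<theta> - 2 * pi * real_of_int k) = w" unfolding z_def by (simp add: th[symmetric])
      ultimately show ?thesis by blast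
    qed
    \<comment> \<open>The circle intersected with \<open>D\<close> is closed only relative to
      \<open>D\<close>, while separation by a component concerns closed sets of the plane. A
      homeomorphism of \<open>D\<close> with the plane removes the difference.\<close>
    have "simply_connected D" unfolding D_def by (rule simply_connected_inside_simple_path[OF c(1)])
    then have "D homeomorphic ball (0::complex) 1"
      using simply_connected_eq_homeomorphic_to_disc[OF jord(1)] z0 by (auto simp: D_def)
    then have "D homeomorphic (UNIV::complex set)"
      by (rule homeomorphic_trans) (rule homeomorphic_ball_UNIV, simp)
    then obtain f g where fg: "homeomorphism D (UNIV::complex set) f g" unfolding homeomorphic_def by metis
    have gf: "\<And>x. x \<in> D \<Longrightarrow> g (f x) = x" and fgy: "\<And>y. f (g y) = y" and gD: "\<And>y. g y \<in> D"
      and fc: "continuous_on D f" and gc: "continuous_on UNIV g"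
      using fg by (auto simp: homeomorphism_def)
    have "\<exists>x1<1. 0 \<le> x1 \<and> \<eta> ` {x1..1} \<subseteq> ball t r"
    proof -
      obtain e where e: "e > 0" "\<And>x. x \<in> {0..1} \<Longrightarrow> dist x 1 < e \<Longrightarrow> dist (\<eta> x) (\<eta> 1) < r"
        using eta(1) r(1) unfolding continuous_on_iff by (metis atLeastAtMost_iff order_refl zero_le_one)
      show ?thesis
      proof (intro exI[of _ "max 0 (1 - e/2)"] conjI)
        show "\<eta> ` {max 0 (1 - e / 2)..1} \<subseteq> ball t r"
        proof
          fix w assume "w \<in> \<eta> ` {max 0 (1 - e / 2)..1}"
          then obtain s where s: "max 0 (1-e/2) \<le> s" "s \<le> 1" "w = \<eta> s" by auto
          then show "w \<in> ball t r" using e(2)[of s] e(1) eta(3) by (auto simp: dist_real_def dist_commute)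
        qed
      qed (use e in auto)
    qed
    then obtain x1 where x1: "x1 < 1" "0 \<le> x1" "\<eta> ` {x1..1} \<subseteq> ball t r" by blast
    define z1 where "z1 = \<eta> x1"
    have z1D: "z1 \<in> D" unfolding z1_def D_def using eta(4) x1 by auto
    have z1b: "cmod (z1 - t) < r"
    proof -
      have "\<eta> x1 \<in> \<eta> ` {x1..1}" using x1 by auto
      then have "\<eta> x1 \<in> ball t r" using x1(3) by blast
      then show ?thesis by (simp add: z1_def dist_norm norm_minus_commute)
    qed
    define Cr where "Cr = D \<inter> sphere t r"
    define S where "S = f ` Cr"
    have "closedin (top_of_set D) Cr" unfolding Cr_def by (simp add: closedin_closed_Int)
    then have "closed S" unfolding S_def using homeomorphism_imp_closed_map[OF fg] by auto
    \<comment> \<open>The distance to \<open>t\<close> is below \<open>r\<close> at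
      \<open>z1\<close> and above \<open>r\<close> at \<open>0\<close>, so every connected subset of
      \<open>D\<close> containing both points meets the circle.\<close>
    have "\<not> connected_component (- S) (f 0) (f z1)"
    proof
      assume "connected_component (- S) (f 0) (f z1)"
      then obtain T where T: "connected T" "T \<subseteq> - S" "f 0 \<in> T" "f z1 \<in> T" unfolding connected_component_def by auto
      have "connected (g ` T)" by (rule connected_continuous_image[OF continuous_on_subset[OF gc] T(1)]) auto
      then have cn: "connected ((\<lambda>w. cmod (w - t)) ` g ` T)" by (intro connected_continuous_image[of "g ` T"] continuous_intros)
      have inz: "cmod (0 - t) \<in> (\<lambda>w. cmod (w - t)) ` g ` T" "cmod (z1 - t) \<in> (\<lambda>w. cmod (w - t)) ` g ` T"
      proof -
        have "g (f 0) = 0" "g (f z1) = z1" using gf z0 z1D by (auto simp: D_def)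
        then have *: "0 \<in> g ` T" "z1 \<in> g ` T" using T by (metis imageI)+
        show "cmod (0 - t) \<in> (\<lambda>w. cmod (w - t)) ` g ` T" using *(1) by (rule imageI)
        show "cmod (z1 - t) \<in> (\<lambda>w. cmod (w - t)) ` g ` T" using *(2) by (rule imageI)
      qed
      have "r \<in> (\<lambda>w. cmod (w - t)) ` g ` T"
        by (rule connectedD_interval[OF cn inz(2,1)]) (use z1b r in auto)
      then obtain y where y: "y \<in> T" "r = cmod (g y - t)" by auto
      then have "g y \<in> Cr" unfolding Cr_def using gD by (auto simp: dist_norm norm_minus_commute)
      then have "y \<in> S" unfolding S_def using fgy by (metis imageI)
      then show False using y T by auto
    qed
    then obtain C where C: "C \<in> components S" "\<not> connected_component (- C) (f 0) (f z1)"
      using separation_by_component_closed_pointwise[of S "f 0" "f z1"] \<open>closed S\<close> by metis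
    define J where "J = g ` C"
    have CS: "C \<subseteq> S" "connected C" "C \<noteq> {}" using in_components_subset[OF C(1)] in_components_connected[OF C(1)] in_components_nonempty[OF C(1)] by auto
    have "g ` S = Cr" unfolding S_def image_image using gf by (auto simp: Cr_def)
    then have J: "connected J" "J \<subseteq> Cr" "J \<noteq> {}"
      using CS connected_continuous_image[OF continuous_on_subset[OF gc] CS(2)] unfolding J_def by auto
    have Jsep: False if V: "connected V" "V \<subseteq> D - J" "0 \<in> V" "z1 \<in> V" for V
    proof -
      have "connected (f ` V)" using V by (intro connected_continuous_image continuous_on_subset[OF fc]) auto
      moreover have "f ` V \<subseteq> - C" using V(2) gf unfolding J_def by force
      ultimately have "connected_component (- C) (f 0) (f z1)" unfolding connected_component_def using V by blast
      then show False using C by blast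
    qed
    \<comment> \<open>The circle meets both branches of the curve by the intermediate value theorem.
      These two points show below that it leaves \<open>D\<close>, and that it does so at more than
      one point.\<close>
    obtain xa ya where xa: "0 < xa" "xa < m" "cmod (c xa - t) = r" and ya: "m < ya" "ya < 1" "cmod (c ya - t) = r"
    proof -
      have cn: "continuous_on {0..1} (\<lambda>x. cmod (c x - t))" by (intro continuous_intros cont)
      have "\<exists>x\<ge>0. x \<le> m \<and> cmod (c x - t) = r"
        using m01 r cmt' c01 by (intro IVT' continuous_on_subset[OF cn]) auto
      then obtain xa where xa: "xa \<ge> 0" "xa \<le> m" "cmod (c xa - t) = r" by blast
      have "\<exists>x\<ge>m. x \<le> 1 \<and> cmod (c x - t) = r"
        using m01 r cmt' c01 by (intro IVT2' continuous_on_subset[OF cn]) auto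
      then obtain ya where ya: "ya \<ge> m" "ya \<le> 1" "cmod (c ya - t) = r" by blast
      have "xa \<noteq> 0" "xa \<noteq> m" "ya \<noteq> m" "ya \<noteq> 1" using xa ya c01 r cmt' by auto
      then show ?thesis using that[of xa ya] xa ya by force
    qed
    have cxG: "c xa \<in> path_image c" "c ya \<in> path_image c" using xa ya m01 by (auto simp: path_image_def)
    obtain \<theta>0 where th0: "z \<theta>0 \<in> J"
    proof -
      obtain w where w: "w \<in> J" using J by auto
      then have "cmod (w - t) = r" using J(2) by (auto simp: Cr_def dist_norm norm_minus_commute)
      then show ?thesis using zsurj[of w 0] w that by auto
    qed
    have JD: "J \<subseteq> D" using J by (auto simp: Cr_def)
    \<comment> \<open>The angles outside \<open>D\<close>. The nearest ones on either side of
      \<open>\<theta>0\<close> bound the arc; the angle of \<open>c xa\<close> and its translate by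
      \<open>- 2 pi\<close> show that they exist.\<close>
    define A where "A = {\<theta>. z \<theta> \<notin> D}"
    have Acl: "closed A"
    proof -
      have "A = z -` (- D)" by (auto simp: A_def)
      then show ?thesis using jord(1) zcont[of UNIV] by (simp add: continuous_closed_vimage continuous_on_eq_continuous_at closed_Compl)
    qed
    obtain tx where tx: "\<theta>0 \<le> tx" "tx < \<theta>0 + 2*pi" "z tx = c xa" using zsurj[OF xa(3)] by blast
    have txA: "tx \<in> A" "tx - 2*pi \<in> A" using tx zper(2)[of tx] cxG disj by (auto simp: A_def)
    define b where "b = Inf (A \<inter> {\<theta>0..})"
    define a where "a = Sup (A \<inter> {..\<theta>0})"
    have bA: "b \<in> A \<inter> {\<theta>0..}" unfolding b_def
      by (rule closed_contains_Inf) (use txA tx Acl in auto)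
    have aA: "a \<in> A \<inter> {..\<theta>0}" unfolding a_def
      by (rule closed_contains_Sup) (use txA tx Acl in \<open>auto intro!: exI[of _ "tx - 2*pi"]\<close>)
    have bmin: "b \<le> \<theta>" if "\<theta> \<in> A" "\<theta>0 \<le> \<theta>" for \<theta>
      unfolding b_def by (rule cInf_lower) (use that in auto)
    have amax: "\<theta> \<le> a" if "\<theta> \<in> A" "\<theta> \<le> \<theta>0" for \<theta>
      unfolding a_def by (rule cSup_upper) (use that in auto)
    have th0A: "\<theta>0 \<notin> A" using th0 JD by (auto simp: A_def)
    have ab: "a < \<theta>0" "\<theta>0 < b" using aA bA th0A by (auto simp: order_le_less)
    have abD: "z \<theta> \<in> D" if "a < \<theta>" "\<theta> < b" for \<theta>
      using that bmin[of \<theta>] amax[of \<theta>] by (force simp: A_def)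
    have zaD: "z a \<notin> D" "z b \<notin> D" using aA bA by (auto simp: A_def)
    have ba: "b - a \<le> 2*pi"
    proof -
      have "b - 2*pi \<in> A" using bA zper(2)[of b] by (auto simp: A_def)
      then show ?thesis using amax[of "b - 2*pi"] bmin[of "b - 2*pi"] pi_gt_zero by (cases "b - 2*pi \<le> \<theta>0") auto
    qed
    have zcl: "z ` {a..b} \<subseteq> closure D"
    proof -
      have "z ` closure {a<..<b} \<subseteq> closure D"
        by (rule image_closure_subset[OF zcont]) (use abD closure_subset[of D] in \<open>auto simp: subset_iff\<close>)
      then show ?thesis using ab by simp
    qed
    have zaG: "z a \<in> path_image c" "z b \<in> path_image c"
    proof -
      have "z a \<in> closure D" "z b \<in> closure D" using zcl ab by (auto simp: image_subset_iff)
      then show "z a \<in> path_image c" "z b \<in> path_image c" unfolding jord(4)[symmetric] frontier_def inter using zaD by auto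
    qed
    \<comment> \<open>If the arc went all the way round, the circle would meet the curve in a single
      point, but \<open>c xa\<close> and \<open>c ya\<close> are two.\<close>
    have ba2: "b < a + 2*pi"
    proof (rule ccontr)
      assume "\<not> ?thesis"
      then have bb: "b = a + 2*pi" using ba by auto
      have "w = z a" if w: "cmod (w - t) = r" "w \<in> path_image c" for w
      proof -
        obtain \<theta> where th: "a \<le> \<theta>" "\<theta> < a + 2*pi" "z \<theta> = w" using zsurj[OF w(1), of a] by blast
        then have "\<theta> = a" using abD[of \<theta>] bb w disj by force
        then show ?thesis using th by simp
      qed
      then have "c xa = c ya" using cxG xa ya by metis
      then show False using simple_path_eq_interior[OF c(1), of xa ya] xa ya m01 by auto
    qed
    have zne: "z a \<noteq> z b"
    proof
      assume "z a = z b"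
      then obtain k::int where k: "b = a + 2*pi*k" using zinj[of b a] by auto
      then have "0 < 2*pi*k" "2*pi*k < 2*pi*1" using ab ba2 by auto
      then show False by (simp add: zero_less_mult_iff)
    qed
    \<comment> \<open>The endpoints divide the circle into two closed arcs that meet only at these
      endpoints. The endpoints are not in \<open>D\<close>, so the connected set \<open>J\<close>
      lies in one of the arcs.\<close>
    have Jsub: "J \<subseteq> z ` {a<..<b}"
    proof -
      have "J \<inter> z ` {b..a+2*pi} = {}"
      proof (rule ccontr)
        assume ne: "J \<inter> z ` {b..a+2*pi} \<noteq> {}"
        have "closed (z ` {a..b})" "closed (z ` {b..a+2*pi})"
          by (intro compact_imp_closed compact_continuous_image zcont; simp)+
        moreover have "J \<subseteq> z ` {a..b} \<union> z ` {b..a+2*pi}"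
        proof
          fix w assume w: "w \<in> J"
          then have "cmod (w - t) = r" using J(2) by (auto simp: Cr_def dist_norm norm_minus_commute)
          then obtain \<theta> where "a \<le> \<theta>" "\<theta> < a + 2*pi" "z \<theta> = w" using zsurj[of w a] by blast
          then show "w \<in> z ` {a..b} \<union> z ` {b..a+2*pi}" by (cases "\<theta> \<le> b") auto
        qed
        moreover have "z ` {a..b} \<inter> z ` {b..a+2*pi} \<inter> J = {}"
        proof (rule ccontr)
          assume "\<not> ?thesis"
          then obtain w where "w \<in> z ` {a..b}" "w \<in> z ` {b..a+2*pi}" "w \<in> J" by blast
          then obtain \<theta> \<theta>' where th: "\<theta> \<in> {a..b}" "\<theta>' \<in> {b..a+2*pi}" "z \<theta> = z \<theta>'" "z \<theta> \<in> J" by (elim imageE) metis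
          obtain k::int where k: "\<theta>' = \<theta> + 2*pi*k" using zinj[of \<theta>' \<theta>] th by auto
          have "0 \<le> 2*pi*k" "2*pi*k \<le> 2*pi*1" using th(1,2) k unfolding atLeastAtMost_iff by linarith+
          then have "0 \<le> real_of_int k" "real_of_int k \<le> 1" using pi_gt_zero by (simp_all add: zero_le_mult_iff mult_le_cancel_left)
          then have "k = 0 \<or> k = 1" by linarith
          then have "\<theta> = b \<or> \<theta> = a" using th k by auto
          then show False using th(4) zaD JD by auto
        qed
        moreover have "z ` {a..b} \<inter> J \<noteq> {}"
        proof -
          have "z \<theta>0 \<in> z ` {a..b}" using ab by (intro imageI) auto
          then show ?thesis using th0 by blast
        qed
        moreover have "z ` {b..a+2*pi} \<inter> J \<noteq> {}" using ne by auto
        ultimately show False using J(1) unfolding connected_closed by blast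
      qed
      show ?thesis
      proof
        fix w assume w: "w \<in> J"
        then have "cmod (w - t) = r" using J(2) by (auto simp: Cr_def dist_norm norm_minus_commute)
        then obtain \<theta> where th: "a \<le> \<theta>" "\<theta> < a + 2*pi" "z \<theta> = w" using zsurj[of w a] by blast
        have "\<theta> < b" using \<open>J \<inter> z ` {b..a+2*pi} = {}\<close> w th by force
        moreover have "\<theta> \<noteq> a" using zaD w JD th by auto
        ultimately show "w \<in> z ` {a<..<b}" using th by auto
      qed
    qed
    define j where "j s = z (a + s * (b - a))" for s
    have jim: "path_image j = z ` {a..b}"
    proof -
      have "(\<lambda>s. a + s * (b - a)) ` {0..1} = {a..b}"
        using ab image_affinity_atLeastAtMost[of "b - a" a 0 1] by (auto simp: algebra_simps mult.commute)
      then show ?thesis unfolding path_image_def j_def by (metis image_image)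
    qed
    have arcj: "arc j"
    proof -
      have "path j" unfolding path_def j_def z_def by (intro continuous_intros)
      moreover have "inj_on j {0..1}"
      proof (rule inj_onI)
        fix s s' assume s: "s \<in> {0..1}" "s' \<in> {0..1}" "j s = j s'"
        then obtain k::int where k: "a + s*(b-a) = a + s'*(b-a) + 2*pi*k" using zinj unfolding j_def by blast
        then have k': "(s - s')*(b-a) = 2*pi*k" by (simp add: algebra_simps)
        have "\<bar>s - s'\<bar> * (b-a) \<le> 1 * (b - a)" using s ab by (intro mult_right_mono) auto
        then have "\<bar>s - s'\<bar> * (b-a) < 2*pi" using ba2 by auto
        then have "\<bar>(s - s')*(b-a)\<bar> < 2*pi*1" using ab by (simp add: abs_mult)
        then have "2*pi*\<bar>k\<bar> < 2*pi*1" unfolding k' by (simp add: abs_mult)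
        then have "k = 0" by simp
        then show "s = s'" using k' ab by auto
      qed
      ultimately show ?thesis by (simp add: arc_def)
    qed
    have jends: "pathstart j = z a" "pathfinish j = z b" by (simp_all add: j_def pathstart_def pathfinish_def)
    \<comment> \<open>With both endpoints on the same side of \<open>m\<close>, the arc would cut
      off a piece \<open>U\<close> whose frontier contains neither \<open>t\<close> nor
      \<open>c m\<close>. The tail \<open>T1\<close> of \<open>\<eta>\<close> and the segment
      \<open>T2\<close> avoid the circle and accumulate at these two points, so both lie in
      \<open>V\<close>; then the connected set \<open>V\<close> joins \<open>0\<close> to
      \<open>z1\<close> without meeting \<open>J\<close>.\<close>
    have contra: False if uv: "0 < u" "u < v" "v < 1" "m \<notin> {u..v}"
      and k: "arc k" "pathstart k = c u" "pathfinish k = c v" "path_image k = z ` {a..b}" "{c u, c v} = {z a, z b}" for u v k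
    proof -
      have "path_image k - {c u, c v} \<subseteq> inside (path_image c)"
      proof
        fix w assume w: "w \<in> path_image k - {c u, c v}"
        then obtain \<theta> where th: "a \<le> \<theta>" "\<theta> \<le> b" "w = z \<theta>" using k by auto
        then have "\<theta> \<noteq> a" "\<theta> \<noteq> b" using w k(5) by auto
        then show "w \<in> inside (path_image c)" using th abD[of \<theta>] by (auto simp: D_def)
      qed
      then obtain U V where UV: "open U" "open V" "connected U" "connected V" "U \<inter> V = {}"
        "U \<union> V = D - z ` {a..b}" "frontier U \<subseteq> c ` {u..v} \<union> z ` {a..b}"
        using crosscut_splits_inside[OF c(1) cc uv(1-3) k(1-3)] unfolding D_def k(4) by metis
      have split: "T \<subseteq> U \<or> T \<subseteq> V" if T: "connected T" "T \<subseteq> D" "T \<inter> sphere t r = {}" for T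
      proof -
        have "z ` {a..b} \<subseteq> sphere t r" using zr by (auto simp: dist_norm norm_minus_commute)
        then have "T \<subseteq> U \<union> V" using T UV by auto
        then show ?thesis using T(1) UV(1,2,5) connectedD[OF T(1) UV(1,2)] by blast
      qed
      have closU: "w \<in> c ` {u..v}" if "w \<in> closure T" "T \<subseteq> U" "w \<notin> D" "cmod (w - t) \<noteq> r" for w T
      proof -
        have "w \<in> closure U" using that closure_mono by blast
        moreover have "w \<notin> U" using that UV(6) by auto
        ultimately have "w \<in> frontier U" using UV(1) by (simp add: frontier_def interior_open)
        then show ?thesis using UV(7) that(4) zr by auto
      qed
      define T1 where "T1 = \<eta> ` {x1..<1}"
      have c1: "continuous_on {x1..1} \<eta>" using x1 by (intro continuous_on_subset[OF eta(1)]) auto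
      have T1: "connected T1" "T1 \<subseteq> D" "T1 \<inter> sphere t r = {}"
      proof -
        show "connected T1" unfolding T1_def by (rule connected_continuous_image[OF continuous_on_subset[OF c1]]) auto
        show "T1 \<subseteq> D" unfolding T1_def D_def using eta(4) x1 by auto
        have "T1 \<subseteq> ball t r" unfolding T1_def using x1 by auto
        then show "T1 \<inter> sphere t r = {}" by auto
      qed
      have "t \<in> closure T1"
      proof -
        have "\<eta> ` closure {x1..<1} \<subseteq> closure T1"
          unfolding T1_def by (rule image_closure_subset[OF continuous_on_subset[OF c1]]) (use x1 in \<open>auto intro: closure_subset[THEN subsetD]\<close>)
        then have "\<eta> 1 \<in> closure T1" using x1 by (auto simp: image_subset_iff)
        then show ?thesis using eta(3) by simp
      qed
      have "\<not> T1 \<subseteq> U"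
      proof
        assume "T1 \<subseteq> U"
        then have "t \<in> c ` {u..v}" using closU[OF \<open>t \<in> closure T1\<close>] tD r by auto
        then obtain s where "s \<in> {u..v}" "c s = c 0" using c01 by auto
        then show False using simple_path_eq_interior[OF c(1), of s 0] uv by auto
      qed
      then have T1V: "T1 \<subseteq> V" using split[OF T1] by blast
      define T2 where "T2 = (\<lambda>e. of_real e * (-t)) ` {0..<d}"
      have T2: "connected T2" "T2 \<subseteq> D" "T2 \<inter> sphere t r = {}"
      proof -
        show "connected T2" unfolding T2_def by (intro connected_continuous_image continuous_intros) auto
        show "T2 \<subseteq> D" unfolding T2_def using d(3) inter by (auto simp: scaleR_conv_of_real)
        show "T2 \<inter> sphere t r = {}"
        proof (rule ccontr)
          assume "\<not> ?thesis"
          then obtain w where "w \<in> T2 \<inter> sphere t r" by blast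
          then have w: "w \<in> T2" "dist t w = r" by auto
          then obtain e where e: "0 \<le> e" "e < d" "dist t (of_real e * (-t)) = r" unfolding T2_def by auto
          have "t - of_real e * (-t) = of_real (1 + e) * t" by (simp add: algebra_simps)
          then have "r = (1 + e) * cmod t" using e by (simp add: dist_norm norm_mult del: of_real_add)
          moreover have "1 * cmod t \<le> (1 + e) * cmod t" using e by (intro mult_right_mono) auto
          ultimately show False using r by simp
        qed
      qed
      have "c m \<in> closure T2"
      proof -
        have "(\<lambda>e. of_real e * (-t)) ` closure {0..<d} \<subseteq> closure T2"
          unfolding T2_def by (rule image_closure_subset) (auto intro!: continuous_intros closure_subset[THEN subsetD])
        then show ?thesis using d m(2) by (auto simp: image_subset_iff)
      qed
      have "c m \<in> path_image c" using m(1) unfolding path_image_def by (rule imageI)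
      then have cmD: "c m \<notin> D" using disj by auto
      have "\<not> T2 \<subseteq> U"
      proof
        assume "T2 \<subseteq> U"
        then have "c m \<in> c ` {u..v}" using closU[OF \<open>c m \<in> closure T2\<close>] cmD cmt' r by auto
        then obtain s where "s \<in> {u..v}" "c m = c s" by auto
        then show False using simple_path_eq_interior[OF c(1), of m s] uv m01 by auto
      qed
      then have T2V: "T2 \<subseteq> V" using split[OF T2] by blast
      have "0 \<in> T2" unfolding T2_def using d by (auto simp: image_iff)
      moreover have "z1 \<in> T1" unfolding T1_def z1_def using x1 by auto
      moreover have "V \<subseteq> D - J"
      proof -
        have "z ` {a<..<b} \<subseteq> z ` {a..b}" by (rule image_mono) auto
        then show ?thesis using UV(6) Jsub by blast
      qed
      ultimately show False using Jsep[OF UV(4)] T1V T2V by auto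
    qed
    obtain x where x: "x \<in> {0..1}" "c x = z a" using zaG unfolding path_image_def by auto
    obtain y where y: "y \<in> {0..1}" "c y = z b" using zaG unfolding path_image_def by auto
    have "x \<noteq> 0" "x \<noteq> 1" "x \<noteq> m" "y \<noteq> 0" "y \<noteq> 1" "y \<noteq> m"
      using x y zr[of a] zr[of b] c01 r cmt' by auto
    then have xy: "0 < x" "x < 1" "x \<noteq> m" "0 < y" "y < 1" "y \<noteq> m" using x y by auto
    have xny: "x \<noteq> y" using x y zne by auto
    have 1: False if "x < y" "m \<notin> {x..y}"
      using contra[OF xy(1) that(1) xy(5) that(2) arcj] jends x y jim by auto
    have 2: False if "y < x" "m \<notin> {y..x}"
      using contra[OF xy(4) that(1) xy(2) that(2), of "reversepath j"] arcj jends x y jim by (auto simp: arc_reversepath)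
    have main: "0 < x \<and> x < m \<and> m < y \<and> y < 1 \<or> 0 < y \<and> y < m \<and> m < x \<and> x < 1"
      using 1 2 xny xy by (cases "x < m"; cases "y < m"; cases "x < y") auto
    show "\<exists>a b x y. a < b \<and> b - a \<le> 2 * pi \<and>
       (\<forall>\<theta>\<in>{a<..<b}. t + of_real r * cis \<theta> \<in> inside (path_image c)) \<and>
       t + of_real r * cis a = c x \<and> t + of_real r * cis b = c y \<and>
       (0 < x \<and> x < m \<and> m < y \<and> y < 1 \<or> 0 < y \<and> y < m \<and> m < x \<and> x < 1)"
      by (rule exI[of _ a], rule exI[of _ b], rule exI[of _ x], rule exI[of _ y])
        (use ab ba abD x y main in \<open>auto simp: z_def D_def\<close>)
  qed
qed

section \<open>Cauchy's theorem with a singularity on the boundary\<close>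

text \<open>A Lipschitz map enlarges length at most by the factor \<open>K\<close>; the image is not
  assumed to be measurable. \<open>A\<close> is enclosed in an open set of nearly the same measure
  and covered by non-overlapping intervals inside it, each of which is mapped onto an interval at
  most \<open>K\<close> times as long.\<close>

lemma lipschitz_image_covers_interval:
  fixes u :: "real \<Rightarrow> real"
  assumes lip: "K-lipschitz_on UNIV u" and A: "A \<in> lmeasurable" "A \<subseteq> {a..b}" and cov: "{p..<q} \<subseteq> u ` A"
  shows "q - p \<le> K * measure lebesgue A"
proof (cases "p < q")
  case False
  then show ?thesis using lipschitz_on_nonneg[OF lip] by (smt (verit) mult_nonneg_nonneg measure_nonneg)
next
  case True
  have K0: "K \<ge> 0" by (rule lipschitz_on_nonneg[OF lip])
  have Ane: "A \<noteq> {}" using cov True by auto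
  have ab: "a < b + 1" "A \<subseteq> cbox a (b+1)" using A(2) Ane by (auto simp: subset_iff)
  have ucont: "continuous_on S u" for S
    using lipschitz_on_continuous_on[OF lip] continuous_on_subset by blast
  have key: "q - p \<le> K * (measure lebesgue A + e)" if e: "e > 0" for e
  proof -
    obtain T where T: "open T" "A \<subseteq> T" "(T - A) \<in> lmeasurable" "emeasure lebesgue (T - A) < ennreal e"
      using sets_lebesgue_outer_open[of A e] A(1) e by auto
    have Tm: "T \<in> lmeasurable" using fmeasurable.Un[OF A(1) T(3)] T(2) by (simp add: Un_absorb1)
    have mT: "measure lebesgue T \<le> measure lebesgue A + e"
    proof -
      have "measure lebesgue T = measure lebesgue (A \<union> (T - A))" using T(2) by (simp add: Un_absorb1)
      also have "\<dots> \<le> measure lebesgue A + measure lebesgue (T - A)" using A(1) T(3) by (intro measure_Un_le) auto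
      also have "measure lebesgue (T - A) \<le> e" unfolding measure_def
        using T(4) e by (intro enn2real_leI) auto
      finally show ?thesis by simp
    qed
    \<comment> \<open>This gauge forces each covering interval, having a tag in \<open>A\<close>, to
      lie inside \<open>T\<close>.\<close>
    define \<gamma> where "\<gamma> x = (if x \<in> T then T else UNIV)" for x
    have "gauge \<gamma>" using T(1) by (auto simp: gauge_def \<gamma>_def)
    have bne: "box a (b+1) \<noteq> {}" using ab(1) by (simp add: box_real)
    have "\<exists>\<D>. countable \<D> \<and> (\<forall>K\<in>\<D>. interior K \<noteq> {} \<and> (\<exists>c d. K = cbox c d)) \<and>
      pairwise (\<lambda>A B. interior A \<inter> interior B = {}) \<D> \<and> (\<forall>K\<in>\<D>. \<exists>x\<in>A \<inter> K. K \<subseteq> \<gamma> x) \<and> A \<subseteq> \<Union>\<D>"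
    proof (rule covering_lemma[OF ab(2) bne \<open>gauge \<gamma>\<close>])
      fix \<D> :: "real set set"
      assume 1: "countable \<D>" "\<And>K. K \<in> \<D> \<Longrightarrow> interior K \<noteq> {} \<and> (\<exists>c d. K = cbox c d)"
        "pairwise (\<lambda>A B. interior A \<inter> interior B = {}) \<D>" "\<And>K. K \<in> \<D> \<Longrightarrow> \<exists>x\<in>A \<inter> K. K \<subseteq> \<gamma> x" "A \<subseteq> \<Union>\<D>"
      show ?thesis by (rule exI[of _ \<D>]) (intro conjI ballI 1; assumption)
    qed
    then obtain \<D> where D1: "countable \<D>" and D2: "\<forall>K\<in>\<D>. interior K \<noteq> {} \<and> (\<exists>c d. K = cbox c d)" and
      D3: "pairwise (\<lambda>A B. interior A \<inter> interior B = {}) \<D>" and D4: "\<forall>K\<in>\<D>. \<exists>x\<in>A \<inter> K. K \<subseteq> \<gamma> x" and D5: "A \<subseteq> \<Union>\<D>"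
      by (elim exE conjE)
    have DT: "X \<subseteq> T" if XD: "X \<in> \<D>" for X
    proof -
      obtain x where x: "x \<in> A \<inter> X" "X \<subseteq> \<gamma> x" using bspec[OF D4 XD] by blast
      then have "x \<in> T" using T(2) by auto
      then show ?thesis using x(2) by (simp add: \<gamma>_def)
    qed
    have DM: "X \<in> lmeasurable" if "X \<in> \<D>" for X using bspec[OF D2 that] by auto
    have DI: "emeasure lborel (u ` X) \<le> ennreal (K * measure lebesgue X) \<and> u ` X \<in> sets borel" if XD: "X \<in> \<D>" for X
    proof -
      obtain c d where cd: "X = cbox c d" using bspec[OF D2 XD] by blast
      have "interior X \<noteq> {}" using bspec[OF D2 XD] by blast
      then have "X \<noteq> {}" using interior_subset[of X] by blast
      then have X: "X = {c..d}" "c \<le> d" using cd by (auto simp: box_real)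
      obtain p' q' where im: "u ` X = {p'..q'}" "p' \<le> q'"
        using continuous_image_closed_interval[OF X(2) ucont[of "{c..d}"]] X(1) by blast
      have "p' \<in> u ` {c..d}" "q' \<in> u ` {c..d}" using im X(1) by auto
      then obtain s s' where s: "s \<in> {c..d}" "s' \<in> {c..d}" "p' = u s" "q' = u s'" by blast
      have "q' - p' \<le> K * \<bar>s' - s\<bar>" using lipschitz_onD[OF lip, of s' s] s by (auto simp: dist_real_def)
      also have "\<dots> \<le> K * (d - c)" using s K0 by (intro mult_left_mono) auto
      finally have "q' - p' \<le> K * (d - c)" .
      then show ?thesis using im X by (auto simp: ennreal_leI)
    qed
    have neg: "pairwise (\<lambda>S T. negligible (S \<inter> T)) \<D>"
    proof (rule pairwiseI)
      fix X Y assume XY: "X \<in> \<D>" "Y \<in> \<D>" "X \<noteq> Y"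
      have "interior (X \<inter> Y) = {}" using D3 XY by (auto simp: pairwise_def)
      moreover have "convex (X \<inter> Y)" using bspec[OF D2 XY(1)] bspec[OF D2 XY(2)] by (metis convex_Int convex_box(1))
      ultimately show "negligible (X \<inter> Y)" by (simp add: negligible_convex_interior)
    qed
    have "\<D> \<noteq> {}" using D5 Ane by auto
    then obtain en :: "nat \<Rightarrow> real set" where en: "range en = \<D>" using D1 uncountable_def by metis
    define W where "W n = (\<Union>i\<in>{..<n}. u ` en i)" for n :: nat
    have enD: "en i \<in> \<D>" for i using en by auto
    have Wb: "W n \<in> sets lborel" for n unfolding W_def using DI enD by (auto intro!: sets.finite_UN)
    have Wle: "emeasure lborel (W n) \<le> ennreal (K * measure lebesgue T)" for n
    proof -
      define J where "J = en ` {..<n}"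
      have J: "finite J" "J \<subseteq> \<D>" unfolding J_def using enD by auto
      have "W n = (\<Union>X\<in>J. u ` X)" unfolding W_def J_def by auto
      then have "emeasure lborel (W n) \<le> (\<Sum>X\<in>J. emeasure lborel (u ` X))"
        using J DI by (simp only:) (intro emeasure_subadditive_finite, auto)
      also have "\<dots> \<le> (\<Sum>X\<in>J. ennreal (K * measure lebesgue X))" using J DI by (intro sum_mono) auto
      also have "\<dots> = ennreal (K * (\<Sum>X\<in>J. measure lebesgue X))" using K0 by (simp add: sum_ennreal sum_distrib_left)
      also have "(\<Sum>X\<in>J. measure lebesgue X) = measure lebesgue (\<Union>J)"
        by (rule measure_negligible_finite_Union[symmetric]) (use J DM neg pairwise_subset in blast)+
      also have "ennreal (K * measure lebesgue (\<Union>J)) \<le> ennreal (K * measure lebesgue T)"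
        using K0 J DT DM Tm by (intro ennreal_leI mult_left_mono measure_mono_fmeasurable) (auto intro!: fmeasurable.finite_Union fmeasurableD)
      finally show ?thesis .
    qed
    have "incseq W" unfolding W_def incseq_def by (intro allI impI UN_mono) auto
    then have "emeasure lborel (\<Union>n. W n) = (SUP n. emeasure lborel (W n))"
      using Wb by (intro SUP_emeasure_incseq[symmetric]) auto
    also have "\<dots> \<le> ennreal (K * measure lebesgue T)" by (intro SUP_least Wle)
    finally have 1: "emeasure lborel (\<Union>n. W n) \<le> ennreal (K * measure lebesgue T)" .
    have "{p..<q} \<subseteq> (\<Union>n. W n)"
    proof
      fix y assume "y \<in> {p..<q}"
      then obtain x where "x \<in> A" "y = u x" using cov by auto
      then obtain i where "x \<in> en i" using D5 en by blast
      then have "y \<in> W (Suc i)" unfolding W_def using \<open>y = u x\<close> by auto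
      then show "y \<in> (\<Union>n. W n)" by blast
    qed
    then have "emeasure lborel {p..<q} \<le> emeasure lborel (\<Union>n. W n)"
      by (rule emeasure_mono) (use Wb in auto)
    then have "ennreal (q - p) \<le> ennreal (K * measure lebesgue T)" using 1 True by simp
    then have "q - p \<le> K * measure lebesgue T" using K0 by (simp add: ennreal_le_iff)
    also have "\<dots> \<le> K * (measure lebesgue A + e)" using mT K0 by (intro mult_left_mono)
    finally show ?thesis .
  qed
  have "q - p \<le> K * measure lebesgue A + e" if "e > 0" for e
  proof -
    have "q - p \<le> K * (measure lebesgue A + e / (K+1))" using key[of "e/(K+1)"] that K0 by simp
    also have "\<dots> = K * measure lebesgue A + (K/(K+1)) * e" by (simp add: algebra_simps)
    also have "(K/(K+1)) * e \<le> 1 * e" using K0 that by (intro mult_right_mono) auto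
    finally show ?thesis by simp
  qed
  then show ?thesis by (rule field_le_epsilon)
qed

text \<open>Otherwise \<open>g\<close> would dominate a multiple of \<open>1/|c - t|\<close> on a set that is mapped onto an interval of radii.\<close>

lemma integrable_small_on_circles:
  fixes c :: "real \<Rightarrow> complex" and g :: "real \<Rightarrow> real"
  assumes lip: "K-lipschitz_on {0..1} c" and g: "g absolutely_integrable_on {0..1}" "\<And>x. g x \<ge> 0"
    and x0: "\<And>r. 0 < r \<Longrightarrow> r < r1 \<Longrightarrow> x0 r \<in> {0..1} \<and> cmod (c (x0 r) - t) = r"
    and pos: "0 < \<epsilon>" "0 < \<rho>" "\<rho> \<le> r1"
  shows "\<exists>r. 0 < r \<and> r < \<rho> \<and> r * g (x0 r) < \<epsilon>"
proof (rule ccontr)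
  assume "\<not> ?thesis"
  then have big: "r * g (x0 r) \<ge> \<epsilon>" if "0 < r" "r < \<rho>" for r using that by force
  have K0: "K \<ge> 0" by (rule lipschitz_on_nonneg[OF lip])
  define u where "u x = cmod (c (max 0 (min 1 x)) - t)" for x :: real
  have ulip: "K-lipschitz_on UNIV u"
  proof (rule lipschitz_onI)
    fix x y :: real
    have "dist (u x) (u y) \<le> dist (c (max 0 (min 1 x))) (c (max 0 (min 1 y)))"
      unfolding u_def dist_real_def dist_norm by (metis diff_diff_eq2 diff_add_cancel norm_triangle_ineq3)
    also have "\<dots> \<le> K * dist (max 0 (min 1 x)) (max 0 (min 1 y))" by (rule lipschitz_onD[OF lip]) auto
    also have "\<dots> \<le> K * dist x y" using K0 by (intro mult_left_mono) (auto simp: dist_real_def)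
    finally show "dist (u x) (u y) \<le> K * dist x y" .
  qed (rule K0)
  have ux: "u x = cmod (c x - t)" if "x \<in> {0..1}" for x using that by (simp add: u_def)
  define pn where "pn j = \<rho> * (1/2)^j" for j :: nat
  have pn: "pn j > 0" "pn j \<le> \<rho>" "pn (Suc j) = pn j / 2" for j
    using pos by (auto simp: pn_def power_le_one)
  \<comment> \<open>The selection \<open>x0\<close> need not be measurable, so membership is
    expressed by the inequality that \<open>x0\<close> satisfies. By \<open>cov\<close> the image of
    \<open>A j\<close> under \<open>u\<close> still contains a whole dyadic range of radii.\<close>
  define A where "A j = {x\<in>{0..1}. pn (Suc j) \<le> u x \<and> u x < pn j \<and> \<epsilon> \<le> u x * g x}" for j
  have umeas: "u \<in> borel_measurable (lebesgue_on {0..1})"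
    by (intro continuous_imp_measurable_on_sets_lebesgue lipschitz_on_continuous_on[OF lipschitz_on_subset[OF ulip]]) auto
  have gmeas: "g \<in> borel_measurable (lebesgue_on {0..1})"
    using g(1) by (simp add: absolutely_integrable_measurable)
  have Asets: "A j \<in> sets lebesgue" for j
  proof -
    have "{x\<in>space (lebesgue_on {0..1}). pn (Suc j) \<le> u x \<and> u x < pn j \<and> \<epsilon> \<le> u x * g x} \<in> sets (lebesgue_on {0..1})"
      using umeas gmeas by measurable
    then show ?thesis unfolding A_def by (simp add: sets_restrict_space_iff)
  qed
  have Asub: "A j \<subseteq> {0..1}" for j by (auto simp: A_def)
  have Am: "A j \<in> lmeasurable" for j
    by (rule fmeasurableI2[OF _ Asub Asets]) auto
  have cov: "{pn (Suc j)..<pn j} \<subseteq> u ` A j" for j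
  proof
    fix r assume r: "r \<in> {pn (Suc j)..<pn j}"
    then have r': "0 < r" "r < \<rho>" using pn[of j] pn[of "Suc j"] by (auto intro: less_le_trans)
    then have x: "x0 r \<in> {0..1}" "cmod (c (x0 r) - t) = r" using x0[of r] pos by auto
    then have "u (x0 r) = r" using ux by auto
    then have "x0 r \<in> A j" unfolding A_def using x r big[OF r'] by auto
    then show "r \<in> u ` A j" using \<open>u (x0 r) = r\<close> by force
  qed
  have meas: "pn j / 2 \<le> K * measure lebesgue (A j)" for j
    using lipschitz_image_covers_interval[OF ulip Am Asub cov[of j]] pn(3)[of j] by simp
  have Kpos: "K > 0" using meas[of 0] pn(1)[of 0] K0 by (cases "K = 0") auto
  define f where "f j x = (if x \<in> A j then g x else 0)" for j x
  have fi: "f j integrable_on {0..1}" for j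
  proof -
    have "g absolutely_integrable_on A j"
      by (rule set_integrable_subset[OF g(1)]) (use Asub Asets in auto)
    then have "g integrable_on A j" using set_lebesgue_integral_eq_integral(1) by blast
    then show ?thesis unfolding f_def using integrable_restrict_Int[of "A j" g "{0..1}"] Asub[of j]
      by (simp add: Int_absorb1 Int_absorb2)
  qed
  have gi: "g integrable_on {0..1}" using g(1) set_lebesgue_integral_eq_integral(1) by blast
  have conv: "(\<lambda>j. f j x) \<longlonglongrightarrow> 0" if x: "x \<in> {0..1}" for x
  proof -
    have "pn \<longlonglongrightarrow> 0" unfolding pn_def by (intro tendsto_mult_right_zero LIMSEQ_power_zero) auto
    have "\<forall>\<^sub>F j in sequentially. f j x = 0"
    proof (cases "u x > 0")
      case True
      then have "\<forall>\<^sub>F j in sequentially. pn j < u x" using order_tendstoD(2)[OF \<open>pn \<longlonglongrightarrow> 0\<close>] by blast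
      then show ?thesis by eventually_elim (auto simp: f_def A_def)
    next
      case False
      then have "x \<notin> A j" for j using pn(1)[of "Suc j"] by (auto simp: A_def)
      then show ?thesis by (simp add: f_def)
    qed
    then show ?thesis by (rule tendsto_eventually)
  qed
  have lim: "(\<lambda>j. integral {0..1} (f j)) \<longlonglongrightarrow> integral {0..1} (\<lambda>x::real. 0::real)"
  proof (rule dominated_convergence(2)[where h = g])
    show "norm (f k x) \<le> g x" for k x using g(2)[of x] by (auto simp: f_def)
  qed (use fi gi conv in auto)
  \<comment> \<open>On \<open>A j\<close> the function \<open>g\<close> is at least
    \<open>\<epsilon> / pn j\<close>, and \<open>A j\<close> has measure at least
    \<open>pn j / (2 * K)\<close>. The radii cancel, so these integrals stay away from
    \<open>0\<close>, against dominated convergence.\<close>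
  have low: "integral {0..1} (f j) \<ge> \<epsilon> / (2*K)" for j
  proof -
    have ci: "((\<lambda>x. if x \<in> A j then \<epsilon> / pn j else 0) has_integral (\<epsilon> / pn j * measure lebesgue (A j))) {0..1}"
    proof -
      have "((\<lambda>x. 1::real) has_integral measure lebesgue (A j)) (A j)"
        unfolding lmeasure_integral[OF Am] using Am[of j] by (intro integrable_integral) (simp add: lmeasurable_iff_integrable_on)
      then have "((\<lambda>x. if x \<in> A j then 1::real else 0) has_integral measure lebesgue (A j)) {0..1}"
        by (subst has_integral_restrict[OF Asub[of j]])
      then have "((\<lambda>x. \<epsilon> / pn j * (if x \<in> A j then 1::real else 0)) has_integral (\<epsilon> / pn j * measure lebesgue (A j))) {0..1}"
        by (rule has_integral_mult_right)
      moreover have "(\<lambda>x. \<epsilon> / pn j * (if x \<in> A j then 1::real else 0)) = (\<lambda>x. if x \<in> A j then \<epsilon> / pn j else 0)" by auto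
      ultimately show ?thesis by simp
    qed
    have "\<epsilon> / pn j * (pn j / 2 / K) \<le> \<epsilon> / pn j * measure lebesgue (A j)"
      using meas[of j] pn(1)[of j] pos Kpos by (intro mult_left_mono) (auto simp: field_simps)
    moreover have "\<epsilon> / pn j * (pn j / 2 / K) = \<epsilon> / (2*K)" using pn(1)[of j] by simp
    moreover have "\<epsilon> / pn j * measure lebesgue (A j) \<le> integral {0..1} (f j)"
    proof (rule has_integral_le[OF ci integrable_integral[OF fi]])
      fix x assume "x \<in> {0..1::real}"
      show "(if x \<in> A j then \<epsilon> / pn j else 0) \<le> f j x"
      proof (cases "x \<in> A j")
        case True
        then have *: "\<epsilon> \<le> u x * g x" "u x < pn j" by (auto simp: A_def)
        have "u x * g x \<le> pn j * g x" using * g(2)[of x] by (intro mult_right_mono) auto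
        then show ?thesis using True * pn(1)[of j] by (simp add: f_def field_simps)
      qed (use g(2) in \<open>auto simp: f_def\<close>)
    qed
    ultimately show ?thesis by linarith
  qed
  have "\<epsilon> / (2*K) \<le> integral {0..1} (\<lambda>x::real. 0::real)"
    by (rule LIMSEQ_le_const[OF lim]) (use low in auto)
  moreover have "0 < \<epsilon> / (2*K)" using pos Kpos by simp
  ultimately show False by simp
qed

text \<open>The difference takes its values among the multiples of \<open>2 pi i\<close>, which are
  \<open>2 pi\<close> apart, so on a connected set it is constant.\<close>

lemma continuous_logs_differ_by_const:
  fixes f g :: "'a::topological_space \<Rightarrow> complex"
  assumes S: "connected S" and f: "continuous_on S f" and g: "continuous_on S g"
    and eq: "\<And>x. x \<in> S \<Longrightarrow> exp (f x) = exp (g x)"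
  obtains n :: int where "\<And>x. x \<in> S \<Longrightarrow> f x = g x + 2 * of_int n * of_real pi * \<i>"
proof (cases "S = {}")
  case True then show ?thesis using that[of 0] by auto
next
  case False
  have "(\<lambda>x. f x - g x) constant_on S"
  proof (rule continuous_discrete_range_constant[OF S])
    show "continuous_on S (\<lambda>x. f x - g x)" using f g by (intro continuous_intros)
    fix x assume x: "x \<in> S"
    have "2 * pi \<le> cmod (f y - g y - (f x - g x))" if y: "y \<in> S" "f y - g y \<noteq> f x - g x" for y
    proof -
      obtain n m :: int where n: "f x = g x + of_int (2 * n) * of_real pi * \<i>" "f y = g y + of_int (2 * m) * of_real pi * \<i>"
        using eq[OF x] eq[OF y(1)] unfolding exp_eq by auto
      have e: "f y - g y - (f x - g x) = of_real (2 * pi * of_int (m - n)) * \<i>" using n by (simp add: algebra_simps)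
      have "m - n \<noteq> 0" using y(2) n by auto
      then have "1 \<le> \<bar>m - n\<bar>" by linarith
      then have "2 * pi * 1 \<le> 2 * pi * real_of_int \<bar>m - n\<bar>" by (intro mult_left_mono) auto
      then show ?thesis unfolding e norm_mult norm_of_real by (simp add: abs_mult)
    qed
    then show "\<exists>e>0. \<forall>y. y \<in> S \<and> f y - g y \<noteq> f x - g x \<longrightarrow> e \<le> cmod (f y - g y - (f x - g x))"
      using pi_gt_zero by (intro exI[of _ "2*pi"]) auto
  qed
  then obtain k where k: "\<And>x. x \<in> S \<Longrightarrow> f x - g x = k" unfolding constant_on_def by blast
  obtain x where x: "x \<in> S" using False by blast
  obtain n :: int where "f x = g x + of_int (2 * n) * of_real pi * \<i>" using eq[OF x] unfolding exp_eq by auto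
  then have "k = 2 * of_int n * of_real pi * \<i>" using k[OF x] by (simp add: algebra_simps)
  then show ?thesis using that[of n] k by (simp add: diff_eq_eq add.commute)
qed

text \<open>On the arc \<open>L\<close> equals \<open>ln r + i \<theta>\<close> up to a constant, so
  \<open>\<delta> * L\<close> moves by at most \<open>2 * pi * cmod \<delta>\<close>. Hence the
  integrand on the whole arc is controlled by the power at the starting angle \<open>a\<close>,
  which the application places on the curve.\<close>

lemma circle_arc_primitive_bound:
  fixes L q Q h :: "complex \<Rightarrow> complex"
  assumes r: "0 < r" and ab: "a < b" "b - a \<le> 2 * pi"
    and zS: "\<And>\<theta>. \<theta> \<in> {a..b} \<Longrightarrow> t + of_real r * cis \<theta> \<in> S"
    and L: "continuous_on S L" "\<And>z. z \<in> S \<Longrightarrow> exp (L z) = z - t"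
    and Q: "\<And>z. z \<in> S \<Longrightarrow> (Q has_field_derivative q z) (at z)"
    and q: "\<And>z. z \<in> S \<Longrightarrow> cmod (z - t) = r \<Longrightarrow> cmod (q z) \<le> B * (1 + cmod (exp (\<delta> * L z)))"
    and B: "0 \<le> B"
  shows "cmod (Q (t + of_real r * cis b) - Q (t + of_real r * cis a)) \<le>
    2 * pi * r * (B * (1 + exp (2 * pi * cmod \<delta>) * cmod (exp (\<delta> * L (t + of_real r * cis a)))))"
proof -
  define z where "z \<theta> = t + of_real r * cis \<theta>" for \<theta>
  have zS': "z \<theta> \<in> S" if "\<theta> \<in> {a..b}" for \<theta> using zS[OF that] by (simp add: z_def)
  have zr: "cmod (z \<theta> - t) = r" for \<theta> using r by (simp add: z_def norm_mult)
  have zc: "continuous_on {a..b} z" unfolding z_def by (intro continuous_intros)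
  have Lz: "continuous_on {a..b} (\<lambda>\<theta>. L (z \<theta>))"
    by (rule continuous_on_compose2[OF L(1) zc]) (use zS' in auto)
  obtain n where n: "\<And>\<theta>. \<theta> \<in> {a..b} \<Longrightarrow> L (z \<theta>) = (of_real (ln r) + \<i> * of_real \<theta>) + 2 * of_int n * of_real pi * \<i>"
  proof (rule continuous_logs_differ_by_const[of "{a..b}" "\<lambda>\<theta>. L (z \<theta>)" "\<lambda>\<theta>. of_real (ln r) + \<i> * of_real \<theta>"])
    fix \<theta> assume "\<theta> \<in> {a..b}"
    then have "exp (L (z \<theta>)) = of_real r * cis \<theta>" using L(2)[OF zS'] by (simp add: z_def)
    then show "exp (L (z \<theta>)) = exp (of_real (ln r) + \<i> * of_real \<theta>)"
      using r by (simp add: exp_add exp_of_real cis_conv_exp)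
  qed (use Lz in \<open>auto intro!: continuous_intros\<close>)
  have hb: "cmod (exp (\<delta> * L (z \<theta>))) \<le> exp (2 * pi * cmod \<delta>) * cmod (exp (\<delta> * L (z a)))" if "\<theta> \<in> {a..b}" for \<theta>
  proof -
    have "\<delta> * L (z \<theta>) = \<delta> * L (z a) + \<delta> * (\<i> * of_real (\<theta> - a))"
      using n[OF that] n[of a] ab by (simp add: algebra_simps)
    then have "cmod (exp (\<delta> * L (z \<theta>))) = cmod (exp (\<delta> * L (z a))) * exp (Re (\<delta> * (\<i> * of_real (\<theta> - a))))"
      by (simp only: exp_add norm_mult norm_exp_eq_Re)
    also have "Re (\<delta> * (\<i> * of_real (\<theta> - a))) \<le> cmod (\<delta> * (\<i> * of_real (\<theta> - a)))" by (rule complex_Re_le_cmod)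
    also have "\<dots> = cmod \<delta> * (\<theta> - a)" using that by (simp add: norm_mult del: of_real_diff)
    also have "\<dots> \<le> cmod \<delta> * (2 * pi)" using that ab by (intro mult_left_mono) auto
    finally show ?thesis by (simp add: mult.commute mult_left_mono)
  qed
  define M where "M = B * (1 + exp (2 * pi * cmod \<delta>) * cmod (exp (\<delta> * L (z a))))"
  have M0: "M \<ge> 0" unfolding M_def using B by (intro mult_nonneg_nonneg add_nonneg_nonneg) auto
  have qM: "cmod (q (z \<theta>)) \<le> M" if "\<theta> \<in> {a..b}" for \<theta>
    using q[OF zS'[OF that] zr] mult_left_mono[OF add_left_mono[OF hb[OF that], of 1] B] unfolding M_def by linarith
  have d: "((\<lambda>\<theta>. Q (z \<theta>)) has_vector_derivative (of_real r * (\<i> * cis \<theta>)) * q (z \<theta>)) (at \<theta> within {a..b})"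
    if "\<theta> \<in> {a..b}" for \<theta>
  proof -
    have "(z has_vector_derivative (of_real r * (\<i> * cis \<theta>))) (at \<theta>)"
    proof -
      have "((\<lambda>x. cis x) has_vector_derivative (\<i> * cis \<theta>)) (at \<theta>)"
        unfolding has_vector_derivative_def by (rule has_derivative_cis[OF has_derivative_ident])
      then show ?thesis unfolding z_def
        using has_vector_derivative_add[OF has_vector_derivative_const has_vector_derivative_mult_right] by fastforce
    qed
    then have "((Q \<circ> z) has_vector_derivative (of_real r * (\<i> * cis \<theta>)) * q (z \<theta>)) (at \<theta>)"
      by (rule field_vector_diff_chain_at) (rule Q[OF zS'[OF that]])
    then show ?thesis by (simp add: o_def has_vector_derivative_at_within)
  qed
  have "cmod (Q (z b) - Q (z a)) \<le> (r * M) * norm (b - a)"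
  proof (rule differentiable_bound[of "{a..b}" "\<lambda>\<theta>. Q (z \<theta>)" "\<lambda>\<theta> h. h *\<^sub>R ((of_real r * (\<i> * cis \<theta>)) * q (z \<theta>))"])
    fix \<theta> assume th: "\<theta> \<in> {a..b}"
    show "((\<lambda>\<theta>. Q (z \<theta>)) has_derivative (\<lambda>h. h *\<^sub>R ((of_real r * (\<i> * cis \<theta>)) * q (z \<theta>)))) (at \<theta> within {a..b})"
      using d[OF th] by (simp add: has_vector_derivative_def)
    show "onorm (\<lambda>h. h *\<^sub>R ((of_real r * (\<i> * cis \<theta>)) * q (z \<theta>))) \<le> r * M"
      using qM[OF th] r M0 by (intro onorm_bound) (auto simp: norm_mult mult.commute mult_left_mono)
  qed (use ab in auto)
  also have "\<dots> \<le> (r * M) * (2*pi)" using ab r M0 by (intro mult_left_mono) auto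
  finally show ?thesis unfolding M_def z_def by (simp add: mult_ac)
qed

text \<open>The primitive \<open>Q\<close> is available only off \<open>t\<close>, so the integral
  is evaluated between parameters \<open>X r\<close> and \<open>Y r\<close> near the two ends of the
  loop, at which the curve meets the circle of radius \<open>r\<close>. The resulting difference of
  \<open>Q\<close> is estimated over the arc inside the domain, and the two end pieces are small by
  continuity of the indefinite integral.\<close>

lemma integral_closed_curve_eq_0:
  fixes c \<eta> D :: "real \<Rightarrow> _" and L q :: "complex \<Rightarrow> complex"
  assumes c: "simple_path c" "pathstart c = t" "pathfinish c = t"
    and z0: "0 \<in> inside (path_image c)"
    and eta: "continuous_on {0..1} \<eta>" "\<eta> 0 = 0" "\<eta> 1 = t" "\<eta> ` {0..<1} \<subseteq> inside (path_image c)"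
    and lip: "K-lipschitz_on {0..1} c" and N: "negligible N"
    and D: "\<And>x. x \<in> {0<..<1} - N \<Longrightarrow> (c has_vector_derivative D x) (at x)"
    and S: "open S" "simply_connected S" "inside (path_image c) \<subseteq> S" "path_image c - {t} \<subseteq> S"
    and L: "continuous_on S L" "\<And>z. z \<in> S \<Longrightarrow> exp (L z) = z - t"
    and q: "q holomorphic_on S"
    and r0: "0 < r0" and B: "\<And>z. z \<in> S \<Longrightarrow> cmod (z - t) < r0 \<Longrightarrow> cmod (q z) \<le> B * (1 + cmod (exp (\<delta> * L z)))"
    and hint: "(\<lambda>x. exp (\<delta> * L (c x))) absolutely_integrable_on {0..1}"
    and qint: "(\<lambda>x. q (c x) * D x) absolutely_integrable_on {0..1}"
  shows "integral {0..1} (\<lambda>x. q (c x) * D x) = 0"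
proof -
  \<comment> \<open>Raising the constant to at least \<open>1\<close> makes it positive; it occurs
    in denominators below.\<close>
  define B' where "B' = max B 1"
  have B': "0 < B'" "\<And>z. z \<in> S \<Longrightarrow> cmod (z - t) < r0 \<Longrightarrow> cmod (q z) \<le> B' * (1 + cmod (exp (\<delta> * L z)))"
  proof -
    fix z assume z: "z \<in> S" "cmod (z - t) < r0"
    have "B * (1 + cmod (exp (\<delta> * L z))) \<le> B' * (1 + cmod (exp (\<delta> * L z)))"
      by (intro mult_right_mono) (auto simp: B'_def)
    then show "cmod (q z) \<le> B' * (1 + cmod (exp (\<delta> * L z)))" using B[OF z] by linarith
  qed (auto simp: B'_def)
  define h where "h x = cmod (exp (\<delta> * L (c x)))" for x
  define E where "E = exp (2 * pi * cmod \<delta>)"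
  have E0: "E > 0" by (simp add: E_def)
  obtain Q where Q: "\<And>z. z \<in> S \<Longrightarrow> (Q has_field_derivative q z) (at z)"
    using S(2) q unfolding simply_connected_eq_global_primitive[OF S(1)] by blast
  have cc: "continuous_on {0..1} c" by (rule lipschitz_on_continuous_on[OF lip])
  have c01: "c 0 = t" "c 1 = t" using c by (auto simp: pathstart_def pathfinish_def)
  have cS: "c x \<in> S" if "0 < x" "x < 1" for x
  proof -
    have "c x \<noteq> t" using simple_path_eq_interior[OF c(1), of x 0] c01 that by auto
    then show ?thesis using S(4) that by (auto simp: path_image_def)
  qed
  have t0: "t \<noteq> 0"
  proof
    assume "t = 0"
    then have "0 \<in> path_image c" using pathstart_in_path_image[of c] c by auto
    then show False using z0 inside_no_overlap[of "path_image c"] by blast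
  qed
  obtain m where m: "0 < m" "m < 1" and arcs: "\<And>r. \<lbrakk>0 < r; r < cmod t\<rbrakk> \<Longrightarrow> \<exists>a b x y. a < b \<and> b - a \<le> 2 * pi \<and>
       (\<forall>\<theta>\<in>{a<..<b}. t + of_real r * cis \<theta> \<in> inside (path_image c)) \<and>
       t + of_real r * cis a = c x \<and> t + of_real r * cis b = c y \<and>
       (0 < x \<and> x < m \<and> m < y \<and> y < 1 \<or> 0 < y \<and> y < m \<and> m < x \<and> x < 1)"
    using circle_arc_separating[OF c z0 eta] by blast
  define r1 where "r1 = min r0 (cmod t)"
  have r1: "r1 > 0" using r0 t0 by (simp add: r1_def)
  define f where "f x = q (c x) * D x" for x
  have fint: "f integrable_on {0..1}" unfolding f_def using qint set_lebesgue_integral_eq_integral(1) by blast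
  have Qint: "(f has_integral (Q (c y) - Q (c x))) {x..y}" if "0 < x" "x \<le> y" "y < 1" for x y
    unfolding f_def
  proof (rule lipschitz_path_primitive(2)[OF _ that(2) N _ S(1) _ Q])
    show "K-lipschitz_on {x..y} c" by (rule lipschitz_on_subset[OF lip]) (use that in auto)
  qed (use D cS that in auto)
  have "\<exists>x y z. 0 < x \<and> x < m \<and> m < y \<and> y < 1 \<and> cmod (c x - t) = r \<and> cmod (c y - t) = r \<and> z \<in> {0..1} \<and> cmod (c z - t) = r \<and>
     cmod (Q (c y) - Q (c x)) \<le> 2 * pi * r * (B' * (1 + E * h z))" if r: "0 < r" "r < r1" for r
  proof -
    have rt: "r < cmod t" "r < r0" using r by (auto simp: r1_def)
    obtain a b x y where ab: "a < b" "b - a \<le> 2 * pi" "\<forall>\<theta>\<in>{a<..<b}. t + of_real r * cis \<theta> \<in> inside (path_image c)"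
       "t + of_real r * cis a = c x" "t + of_real r * cis b = c y"
       and xy: "0 < x \<and> x < m \<and> m < y \<and> y < 1 \<or> 0 < y \<and> y < m \<and> m < x \<and> x < 1"
      using arcs[OF r(1) rt(1)] by blast
    have xy01: "0 < x" "x < 1" "0 < y" "y < 1" using xy m by auto
    have zS: "t + of_real r * cis \<theta> \<in> S" if "\<theta> \<in> {a..b}" for \<theta>
    proof -
      have "\<theta> = a \<or> \<theta> = b \<or> \<theta> \<in> {a<..<b}" using that by auto
      then show ?thesis using ab cS[OF xy01(1,2)] cS[OF xy01(3,4)] S(3) by auto
    qed
    have bound: "cmod (Q (c y) - Q (c x)) \<le> 2 * pi * r * (B' * (1 + E * h x))"
      using circle_arc_primitive_bound[OF r(1) ab(1,2) zS L Q, of B' \<delta>] B' rt unfolding ab h_def E_def by auto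
    have nr: "cmod (c x - t) = r" "cmod (c y - t) = r" using r by (simp_all add: ab(4,5)[symmetric] norm_mult)
    show ?thesis
    \<comment> \<open>The estimate refers to the starting endpoint of the arc, which may lie on
      either branch. Hence a third witness besides the ordered pair of endpoints.\<close>
    proof (cases "x < m")
      case True
      then show ?thesis using xy bound nr xy01 by (intro exI[of _ x] exI[of _ y] exI[of _ x]) auto
    next
      case False
      then show ?thesis using xy bound nr xy01 by (intro exI[of _ y] exI[of _ x] exI[of _ x]) (auto simp: norm_minus_commute)
    qed
  qed
  then obtain X Y Z where XYZ: "\<And>r. 0 < r \<Longrightarrow> r < r1 \<Longrightarrow> 0 < X r \<and> X r < m \<and> m < Y r \<and> Y r < 1 \<and> cmod (c (X r) - t) = r \<and>
     cmod (c (Y r) - t) = r \<and> Z r \<in> {0..1} \<and> cmod (c (Z r) - t) = r \<and>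
     cmod (Q (c (Y r)) - Q (c (X r))) \<le> 2 * pi * r * (B' * (1 + E * h (Z r)))" by metis
  define F where "F x = integral {0..x} f" for x
  have Fc: "continuous_on {0..1} F" unfolding F_def by (rule indefinite_integral_continuous_1[OF fint])
  have F0: "F 0 = 0" by (simp add: F_def)
  have FQ: "F y - F x = Q (c y) - Q (c x)" if "0 < x" "x \<le> y" "y < 1" for x y
  proof -
    have "f integrable_on {0..y}" by (rule integrable_subinterval_real[OF fint]) (use that in auto)
    then have "integral {0..x} f + integral {x..y} f = integral {0..y} f"
      using that by (intro Henstock_Kurzweil_Integration.integral_combine) auto
    then show ?thesis using integral_unique[OF Qint[OF that]] by (simp add: F_def algebra_simps)
  qed
  have "cmod (F 1) \<le> e" if e: "e > 0" for e
  proof -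
    obtain d0 where d0: "d0 > 0" "\<And>x. x \<in> {0..1} \<Longrightarrow> dist x 0 < d0 \<Longrightarrow> dist (F x) (F 0) < e/4"
      using Fc e unfolding continuous_on_iff by (metis atLeastAtMost_iff order_refl zero_le_one zero_less_divide_iff zero_less_numeral)
    obtain d1 where d1: "d1 > 0" "\<And>x. x \<in> {0..1} \<Longrightarrow> dist x 1 < d1 \<Longrightarrow> dist (F x) (F 1) < e/4"
      using Fc e unfolding continuous_on_iff by (metis atLeastAtMost_iff order_refl zero_le_one zero_less_divide_iff zero_less_numeral)
    define k where "k = min (min d0 d1) (min m (1 - m))"
    have k: "k > 0" "k \<le> d0" "k \<le> d1" "k \<le> m" "k \<le> 1 - m" using d0 d1 m by (auto simp: k_def)
    \<comment> \<open>Away from its ends the loop keeps a distance of at least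
      \<open>\<kappa>\<close> from \<open>t\<close>, so a radius below \<open>\<kappa>\<close>
      forces \<open>X r < k\<close> and \<open>Y r > 1 - k\<close>.\<close>
    obtain \<kappa> where kap: "\<kappa> > 0" "\<And>x. x \<in> {k..1-k} \<Longrightarrow> \<kappa> \<le> cmod (c x - t)"
    proof -
      have ne: "{k..1-k} \<noteq> {}" using k by auto
      have "continuous_on {k..1-k} (\<lambda>x. cmod (c x - t))" using k by (intro continuous_intros continuous_on_subset[OF cc]) auto
      from continuous_attains_inf[OF _ ne this] obtain x where x: "x \<in> {k..1-k}" "\<And>y. y \<in> {k..1-k} \<Longrightarrow> cmod (c x - t) \<le> cmod (c y - t)" by auto
      have "c x \<noteq> t" using simple_path_eq_interior[OF c(1), of x 0] c01 x k by auto
      then show ?thesis using that[of "cmod (c x - t)"] x by auto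
    qed
    \<comment> \<open>With this \<open>\<epsilon>\<close> and the following \<open>\<rho>\<close>,
      each of the two summands of the arc estimate is at most \<open>e/8\<close>.\<close>
    define \<epsilon> where "\<epsilon> = e / (16 * pi * B' * E)"
    have eps: "\<epsilon> > 0" using e B' E0 by (simp add: \<epsilon>_def)
    define \<rho> where "\<rho> = min (min \<kappa> r1) (e / (16 * pi * B'))"
    have rho: "0 < \<rho>" "\<rho> \<le> r1" "\<rho> \<le> \<kappa>" "\<rho> \<le> e / (16 * pi * B')" using kap r1 e B' by (auto simp: \<rho>_def)
    have "\<exists>r. 0 < r \<and> r < \<rho> \<and> r * h (Z r) < \<epsilon>"
    proof (rule integrable_small_on_circles[where g = h and ?x0.0 = Z, OF lip _ _ _ eps rho(1,2)])
      show "h absolutely_integrable_on {0..1}" unfolding h_def using absolutely_integrable_norm[OF hint] by (simp add: o_def)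
      show "Z r \<in> {0..1} \<and> cmod (c (Z r) - t) = r" if "0 < r" "r < r1" for r using XYZ[OF that] by blast
    qed (simp add: h_def)
    then obtain r where r: "0 < r" "r < \<rho>" "r * h (Z r) < \<epsilon>" by blast
    have P: "0 < X r" "X r < m" "m < Y r" "Y r < 1" "cmod (c (X r) - t) = r" "cmod (c (Y r) - t) = r"
      "cmod (Q (c (Y r)) - Q (c (X r))) \<le> 2 * pi * r * (B' * (1 + E * h (Z r)))" using XYZ[of r] r rho by auto
    have "X r < k" using kap(2)[of "X r"] P r rho k by (force simp: not_le)
    moreover have "Y r > 1 - k" using kap(2)[of "Y r"] P r rho k by (force simp: not_le)
    ultimately have xd: "dist (X r) 0 < d0" "dist (Y r) 1 < d1" "X r \<in> {0..1}" "Y r \<in> {0..1}"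
      using P(1-4) k m by (auto simp: dist_real_def)
    have 1: "dist (F (X r)) (F 0) < e/4" "dist (F (Y r)) (F 1) < e/4"
      using d0(2)[OF xd(3,1)] d1(2)[OF xd(4,2)] by auto
    have "2 * pi * r * (B' * (1 + E * h (Z r))) = 2 * pi * B' * r + 2 * pi * B' * E * (r * h (Z r))" by (simp add: algebra_simps)
    also have "\<dots> \<le> 2 * pi * B' * (e / (16 * pi * B')) + 2 * pi * B' * E * \<epsilon>"
      using r rho B' E0 by (intro add_mono mult_left_mono) auto
    also have "\<dots> = e/4" unfolding \<epsilon>_def using B' E0 by (simp add: field_simps)
    finally have "cmod (F (Y r) - F (X r)) \<le> e/4" using P FQ[of "X r" "Y r"] by auto
    moreover have "F 1 - F 0 = (F (X r) - F 0) + (F (Y r) - F (X r)) - (F (Y r) - F 1)" by simp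
    then have "cmod (F 1 - F 0) \<le> cmod (F (X r) - F 0) + cmod (F (Y r) - F (X r)) + cmod (F (Y r) - F 1)"
      by (metis norm_triangle_ineq norm_triangle_ineq4 add_right_mono order_trans)
    ultimately have "cmod (F 1 - F 0) \<le> e/4 + e/4 + e/4" using 1 unfolding dist_norm by linarith
    then show ?thesis using F0 e by simp
  qed
  then have "cmod (F 1) \<le> 0" using field_le_epsilon[of "cmod (F 1)" 0] by simp
  then show ?thesis by (simp add: F_def f_def[abs_def])
qed

section \<open>Arc length parametrization\<close>

locale rectifiable_loop =
  fixes p :: "real \<Rightarrow> complex"
  assumes rect: "rectifiable_Jordan_curve p"
begin

definition len :: real where "len = arc_length p 1"

definition nat_par :: "real \<Rightarrow> complex" where "nat_par = natural_param p"

lemma simple: "simple_path p" and closed_p: "pathfinish p = pathstart p" and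
  bdd: "bdd_above (inscribed_lengths p 0 1)"
  using rect by (auto simp: rectifiable_Jordan_curve_def)

lemma p_cont: "continuous_on {0..1} p"
  using simple by (simp add: simple_path_def path_def)

lemma p01: "p 0 = p 1"
  using closed_p by (simp add: pathfinish_def pathstart_def)

section \<open>Arc length as a continuous, strictly increasing function of the parameter\<close>

lemma bdd_sub: "x \<le> 1 \<Longrightarrow> bdd_above (inscribed_lengths p 0 x)"
proof (rule bdd_above_mono[OF bdd], rule subsetI)
  fix s assume "x \<le> 1" "s \<in> inscribed_lengths p 0 x"
  then obtain n y where y: "s = (\<Sum>i<n. dist (p (y i)) (p (y (Suc i))))"
     "\<forall>i\<le>n. y i \<in> {0..x}" "\<forall>i<n. y i \<le> y (Suc i)" by (auto simp: inscribed_lengths_def)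
  then have "\<forall>i\<le>n. y i \<in> {0..1}" using \<open>x \<le> 1\<close> by fastforce
  then show "s \<in> inscribed_lengths p 0 1" unfolding inscribed_lengths_def using y by blast
qed

lemma zero_in_inscribed_lengths: "0 \<le> x \<Longrightarrow> 0 \<in> inscribed_lengths p 0 x"
  unfolding inscribed_lengths_def by (intro CollectI exI[of _ 0] exI[of _ "\<lambda>_. 0"]) auto

lemma arc_length_upper:
  assumes "x \<le> 1" "\<And>i. i \<le> n \<Longrightarrow> y i \<in> {0..x}" "\<And>i. i < n \<Longrightarrow> y i \<le> y (Suc i)"
  shows "(\<Sum>i<n. dist (p (y i)) (p (y (Suc i)))) \<le> arc_length p x"
  unfolding arc_length_def
proof (rule cSup_upper[OF _ bdd_sub[OF assms(1)]])
  show "(\<Sum>i<n. dist (p (y i)) (p (y (Suc i)))) \<in> inscribed_lengths p 0 x"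
    unfolding inscribed_lengths_def by (intro CollectI exI[of _ n] exI[of _ y]) (use assms in auto)
qed

text \<open>A partition of \<open>[0, a]\<close> is prolonged by the vertices \<open>a\<close> and
  \<open>b\<close>, which adds the chord and another nonnegative term. Below, this inequality stands
  in for additivity of arc length.\<close>

lemma dist_le_arc_length:
  assumes "0 \<le> a" "a \<le> b" "b \<le> 1"
  shows "dist (p a) (p b) \<le> arc_length p b - arc_length p a"
proof -
  have "arc_length p a \<le> arc_length p b - dist (p a) (p b)"
    unfolding arc_length_def[of p a]
  proof (rule cSup_least)
    show "inscribed_lengths p 0 a \<noteq> {}"
      using zero_in_inscribed_lengths assms by blast
    fix s assume "s \<in> inscribed_lengths p 0 a"
    then obtain n y where s: "s = (\<Sum>i<n. dist (p (y i)) (p (y (Suc i))))"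
      and y: "\<forall>i\<le>n. y i \<in> {0..a}" "\<forall>i<n. y i \<le> y (Suc i)" by (auto simp: inscribed_lengths_def)
    define y' where "y' i = (if i \<le> n then y i else if i = Suc n then a else b)" for i
    have "(\<Sum>i<Suc (Suc n). dist (p (y' i)) (p (y' (Suc i)))) \<le> arc_length p b"
      by (rule arc_length_upper[OF assms(3)]) (use y assms in \<open>auto simp: y'_def\<close>)
    moreover have "(\<Sum>i<n. dist (p (y' i)) (p (y' (Suc i)))) = s"
      unfolding s by (rule sum.cong) (auto simp: y'_def)
    then have "(\<Sum>i<Suc (Suc n). dist (p (y' i)) (p (y' (Suc i)))) = s + dist (p (y n)) (p a) + dist (p a) (p b)"
      by (simp add: y'_def)
    moreover have "dist (p (y n)) (p a) \<ge> 0" by simp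
    ultimately show "s \<le> arc_length p b - dist (p a) (p b)" by linarith
  qed
  then show ?thesis by simp
qed

lemma arc_length_mono: "0 \<le> a \<Longrightarrow> a \<le> b \<Longrightarrow> b \<le> 1 \<Longrightarrow> arc_length p a \<le> arc_length p b"
  using dist_le_arc_length[of a b] zero_le_dist[of "p a" "p b"] by linarith

lemma arc_length_strict: "0 \<le> a \<Longrightarrow> a < b \<Longrightarrow> b \<le> 1 \<Longrightarrow> arc_length p a < arc_length p b"
proof -
  assume ab: "0 \<le> a" "a < b" "b \<le> 1"
  \<comment> \<open>The chord from \<open>p a\<close> to \<open>p b\<close> may vanish, namely for
    \<open>a = 0\<close> and \<open>b = 1\<close>; the chord to the midpoint does not.\<close>
  define m where "m = (a + b) / 2"
  have m: "a < m" "m < b" "0 < m" "m < 1" using ab by (auto simp: m_def)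
  have "p m \<noteq> p a" using simple_path_eq_interior[OF simple, of m a] m ab by auto
  then have "0 < dist (p a) (p m)" by auto
  then show ?thesis using dist_le_arc_length[of a m] arc_length_mono[of m b] m ab by linarith
qed

lemma arc_length_0: "arc_length p 0 = 0"
proof -
  have "inscribed_lengths p 0 0 = {0}"
  proof
    show "inscribed_lengths p 0 0 \<subseteq> {0}" by (auto simp: inscribed_lengths_def)
  qed (use zero_in_inscribed_lengths in auto)
  then show ?thesis by (simp add: arc_length_def)
qed

lemma len_pos: "len > 0"
  using arc_length_strict[of 0 1] arc_length_0 by (simp add: len_def)

lemma arc_length_inj: "inj_on (arc_length p) {0..1}"
  by (rule linorder_inj_onI) (use arc_length_strict in force)+

text \<open>An inscribed polygon within \<open>\<epsilon>\<close> of the total length has a defect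
  of at most \<open>\<epsilon>\<close> on each cell and misses at most \<open>\<epsilon>\<close> at
  either end. So on an interval without vertices in its interior the length exceeds the chord by at
  most \<open>\<epsilon>\<close>, and the chord is small by continuity of \<open>p\<close>.\<close>

lemma arc_length_continuous: "continuous_on {0..1} (arc_length p)"
  unfolding continuous_on_iff
proof (intro ballI allI impI)
  fix t0 e :: real assume t0: "t0 \<in> {0..1}" and e: "e > 0"
  define \<epsilon> where "\<epsilon> = e / 3"
  have eps: "\<epsilon> > 0" using e by (simp add: \<epsilon>_def)
  have "\<exists>s\<in>inscribed_lengths p 0 1. len - \<epsilon> < s"
  proof -
    have "len - \<epsilon> < Sup (inscribed_lengths p 0 1)" using eps by (simp add: len_def arc_length_def)
    moreover have "inscribed_lengths p 0 1 \<noteq> {}" using zero_in_inscribed_lengths[of 1] by auto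
    ultimately show ?thesis using less_cSup_iff[OF _ bdd] by blast
  qed
  then obtain n y where s: "len - \<epsilon> < (\<Sum>i<n. dist (p (y i)) (p (y (Suc i))))"
    and y: "\<forall>i\<le>n. y i \<in> {0..1}" "\<forall>i<n. y i \<le> y (Suc i)" by (auto simp: inscribed_lengths_def)
  define \<Delta> where "\<Delta> i = arc_length p (y (Suc i)) - arc_length p (y i) - dist (p (y i)) (p (y (Suc i)))" for i
  have D0: "\<Delta> i \<ge> 0" if "i < n" for i
    using dist_le_arc_length[of "y i" "y (Suc i)"] y that unfolding \<Delta>_def by auto
  have tel: "(\<Sum>i<n. arc_length p (y (Suc i)) - arc_length p (y i)) = arc_length p (y n) - arc_length p (y 0)"
    by (rule sum_lessThan_telescope)
  have y0: "0 \<le> arc_length p (y 0)" using arc_length_mono[of 0 "y 0"] y arc_length_0 by auto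
  have yn: "arc_length p (y n) \<le> len" using arc_length_mono[of "y n" 1] y by (auto simp: len_def)
  have "(\<Sum>i<n. \<Delta> i) = arc_length p (y n) - arc_length p (y 0) - (\<Sum>i<n. dist (p (y i)) (p (y (Suc i))))"
    unfolding \<Delta>_def sum_subtractf using tel by (simp add: sum_subtractf)
  then have S: "(\<Sum>i<n. \<Delta> i) < arc_length p (y n) - arc_length p (y 0) - len + \<epsilon>" using s by linarith
  have Dle: "\<Delta> i \<le> \<epsilon>" if "i < n" for i
  proof -
    have "\<Delta> i \<le> (\<Sum>i<n. \<Delta> i)" using that D0 by (intro member_le_sum) auto
    then show ?thesis using S y0 yn by linarith
  qed
  have "0 \<le> (\<Sum>i<n. \<Delta> i)" using D0 by (intro sum_nonneg) auto
  then have e0: "arc_length p (y 0) \<le> \<epsilon>" "len - arc_length p (y n) \<le> \<epsilon>" using S y0 yn by linarith+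
  have cell: "arc_length p b - arc_length p a \<le> dist (p a) (p b) + \<epsilon>"
    if ab: "0 \<le> a" "a < b" "b \<le> 1" and no: "\<forall>i\<le>n. \<not> (a < y i \<and> y i < b)" for a b
  proof (cases "a < y 0")
    case True
    then have "b \<le> y 0" using no[rule_format, of 0] by auto
    then have "arc_length p b \<le> \<epsilon>" using arc_length_mono[of b "y 0"] e0 ab y by force
    moreover have "0 \<le> arc_length p a" using arc_length_mono[of 0 a] ab arc_length_0 by auto
    ultimately show ?thesis using zero_le_dist[of "p a" "p b"] by linarith
  next
    case a0: False
    show ?thesis
    proof (cases "y n < b")
      case True
      then have "y n \<le> a" using no[rule_format, of n] by auto
      then have "len - arc_length p a \<le> \<epsilon>" using arc_length_mono[of "y n" a] e0 ab y by force
      moreover have "arc_length p b \<le> len" using arc_length_mono[of b 1] ab by (auto simp: len_def)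
      ultimately show ?thesis using zero_le_dist[of "p a" "p b"] by linarith
    next
      case bn: False
      define i where "i = Max {i. i \<le> n \<and> y i \<le> a}"
      have fin: "finite {i. i \<le> n \<and> y i \<le> a}" by auto
      moreover have "{i. i \<le> n \<and> y i \<le> a} \<noteq> {}" using a0 by (auto intro!: exI[of _ 0])
      ultimately have i: "i \<le> n" "y i \<le> a" unfolding i_def using Max_in by blast+
      have "i \<noteq> n" using i bn ab by auto
      then have i1: "i < n" using i by auto
      have "\<not> y (Suc i) \<le> a"
      proof
        assume "y (Suc i) \<le> a"
        then have "Suc i \<le> i" unfolding i_def using i1 by (intro Max_ge[OF fin]) (auto simp: i_def)
        then show False by simp
      qed
      then have b1: "b \<le> y (Suc i)" using no[rule_format, of "Suc i"] i1 by auto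
      have Y: "0 \<le> y i" "y (Suc i) \<le> 1" using y i1 by auto
      have "arc_length p (y (Suc i)) - arc_length p (y i) \<le> dist (p (y i)) (p (y (Suc i))) + \<epsilon>"
        using Dle[OF i1] by (simp add: \<Delta>_def)
      also have "dist (p (y i)) (p (y (Suc i))) \<le> dist (p (y i)) (p a) + dist (p a) (p b) + dist (p b) (p (y (Suc i)))"
        using dist_triangle[of "p (y i)" "p (y (Suc i))" "p a"] dist_triangle[of "p a" "p (y (Suc i))" "p b"] by linarith
      finally show ?thesis
        using dist_le_arc_length[of "y i" a] dist_le_arc_length[of b "y (Suc i)"] Y i b1 ab by linarith
    qed
  qed
  obtain d1 where d1: "d1 > 0" "\<And>s. s \<in> {0..1} \<Longrightarrow> dist s t0 < d1 \<Longrightarrow> dist (p s) (p t0) < \<epsilon>"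
    using p_cont t0 eps unfolding continuous_on_iff by metis
  have "finite (y ` {..n} - {t0})" by auto
  then obtain d2 where d2: "d2 > 0" "\<And>v. v \<in> y ` {..n} - {t0} \<Longrightarrow> d2 \<le> dist t0 v"
    using finite_set_avoid[of "y ` {..n} - {t0}" t0] by (metis Diff_iff insertI1)
  show "\<exists>d>0. \<forall>x'\<in>{0..1}. dist x' t0 < d \<longrightarrow> dist (arc_length p x') (arc_length p t0) < e"
  proof (intro exI[of _ "min d1 d2"] conjI ballI impI)
    fix x assume x: "x \<in> {0..1}" "dist x t0 < min d1 d2"
    have no: "\<forall>i\<le>n. \<not> (min x t0 < y i \<and> y i < max x t0)"
    proof (intro allI impI notI)
      fix i assume i: "i \<le> n" "min x t0 < y i \<and> y i < max x t0"
      then have "d2 \<le> dist t0 (y i)" by (intro d2(2)) auto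
      moreover have "dist t0 (y i) < dist x t0" using i(2) by (auto simp: dist_real_def min_def max_def split: if_splits)
      ultimately show False using x by auto
    qed
    have pd: "dist (p x) (p t0) < \<epsilon>" using d1(2) x by auto
    consider "x = t0" | "x < t0" | "t0 < x" by linarith
    then show "dist (arc_length p x) (arc_length p t0) < e"
    proof cases
      case 1 then show ?thesis using e by simp
    next
      case 2
      then have "arc_length p t0 - arc_length p x \<le> dist (p x) (p t0) + \<epsilon>" using no x t0 by (intro cell) (auto simp: min_def max_def)
      moreover have "arc_length p x \<le> arc_length p t0" using arc_length_mono[of x t0] 2 x t0 by auto
      ultimately show ?thesis using pd e by (simp add: dist_real_def \<epsilon>_def)
    next
      case 3
      then have "arc_length p x - arc_length p t0 \<le> dist (p t0) (p x) + \<epsilon>" using no x t0 by (intro cell) (auto simp: min_def max_def)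
      moreover have "arc_length p t0 \<le> arc_length p x" using arc_length_mono[of t0 x] 3 x t0 by auto
      ultimately show ?thesis using pd e by (simp add: dist_real_def \<epsilon>_def dist_commute)
    qed
  qed (use d1 d2 in auto)
qed

lemma arc_length_image: "arc_length p ` {0..1} = {0..len}"
proof
  show "arc_length p ` {0..1} \<subseteq> {0..len}"
    using arc_length_mono[of 0] arc_length_mono[of _ 1] arc_length_0 by (auto simp: len_def)
  show "{0..len} \<subseteq> arc_length p ` {0..1}"
  proof
    fix s assume "s \<in> {0..len}"
    then have "\<exists>x\<ge>0. x \<le> 1 \<and> arc_length p x = s"
      by (intro IVT' arc_length_continuous) (auto simp: len_def arc_length_0)
    then show "s \<in> arc_length p ` {0..1}" by auto
  qed
qed

lemma nat_par_arc_length: "x \<in> {0..1} \<Longrightarrow> nat_par (arc_length p x) = p x"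
  by (simp add: nat_par_def natural_param_def arc_length_inj)

lemma nat_par_lipschitz: "1-lipschitz_on {0..len} nat_par"
proof (rule lipschitz_onI)
  fix s s' assume s: "s \<in> {0..len}" "s' \<in> {0..len}"
  then obtain x x' where x: "x \<in> {0..1}" "x' \<in> {0..1}" "s = arc_length p x" "s' = arc_length p x'"
    using arc_length_image by (metis imageE)
  show "dist (nat_par s) (nat_par s') \<le> 1 * dist s s'"
    using dist_le_arc_length[of x x'] dist_le_arc_length[of x' x] x
    by (cases "x \<le> x'") (auto simp: nat_par_arc_length dist_real_def dist_commute)
qed auto

lemma nat_par_cont: "continuous_on {0..len} nat_par"
  by (rule lipschitz_on_continuous_on[OF nat_par_lipschitz])

lemma nat_par_image: "nat_par ` {0..len} = path_image p"
  unfolding arc_length_image[symmetric] path_image_def image_image using nat_par_arc_length by auto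

lemma nat_par_ends: "nat_par 0 = p 0" "nat_par len = p 0"
  using nat_par_arc_length[of 0] nat_par_arc_length[of 1] p01 by (auto simp: arc_length_0 len_def)

lemma nat_par_inj:
  assumes "nat_par s = nat_par s'" "s \<in> {0<..<len}" "s' \<in> {0..len}"
  shows "s = s'"
proof -
  obtain x x' where x: "x \<in> {0..1}" "x' \<in> {0..1}" "s = arc_length p x" "s' = arc_length p x'"
    using arc_length_image assms by (metis imageE greaterThanLessThan_iff atLeastAtMost_iff less_imp_le)
  have "x \<noteq> 0" "x \<noteq> 1" using x assms by (auto simp: arc_length_0 len_def)
  then show ?thesis using simple_path_eq_interior[OF simple, of x x'] assms(1) x by (auto simp: nat_par_arc_length)
qed

lemma nat_par_inj_on: "inj_on nat_par {0..<len}"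
proof (rule inj_onI)
  fix x y assume "x \<in> {0..<len}" "y \<in> {0..<len}" "nat_par x = nat_par y"
  then show "x = y" using nat_par_inj[of x y] nat_par_inj[of y x] by (cases "x = 0"; cases "y = 0") auto
qed

lemma nat_par_image': "nat_par ` {0..<len} = path_image p"
proof -
  have "{0..len} = insert len {0..<len}" "0 \<in> {0..<len}" using len_pos by auto
  then show ?thesis using nat_par_image nat_par_ends by (metis image_insert insert_absorb imageI)
qed

section \<open>Unit speed and the winding number in the arc length parameter\<close>

definition dpar :: "real \<Rightarrow> complex" where "dpar s = vector_derivative nat_par (at s)"

text \<open>The Lipschitz constant gives \<open>cmod (dpar s) \<le> 1\<close>, and every inscribed
  polygon is bounded by the integral of \<open>cmod dpar\<close>, so this integral is at least
  \<open>len\<close>. The nonnegative function \<open>1 - cmod dpar\<close> thus has integral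
  \<open>0\<close> and vanishes almost everywhere.\<close>

lemma dpar_unit:
  obtains N where "negligible N"
    "\<And>s. s \<in> {0<..<len} - N \<Longrightarrow> (nat_par has_vector_derivative dpar s) (at s) \<and> cmod (dpar s) = 1"
proof -
  obtain g N where g: "negligible N" "\<And>x. x \<in> {0<..<len} - N \<Longrightarrow> (nat_par has_vector_derivative g x) (at x)"
    using lipschitz_complex_derivative[OF nat_par_lipschitz] len_pos by (metis less_imp_le)
  have d: "(nat_par has_vector_derivative dpar x) (at x)" if "x \<in> {0<..<len} - N" for x
    using g(2)[OF that] unfolding dpar_def by (simp add: vector_derivative_at)
  have n1: "cmod (dpar x) \<le> 1" if "x \<in> {0<..<len} - N" for x
    by (rule has_vector_derivative_norm_le[OF nat_par_lipschitz _ d]) (use that in auto)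
  have sub: "dpar absolutely_integrable_on {a..b}" "(dpar has_integral (nat_par b - nat_par a)) {a..b}" if "0 \<le> a" "a \<le> b" "b \<le> len" for a b
    using lipschitz_fundamental_theorem[OF lipschitz_on_subset[OF nat_par_lipschitz, of "{a..b}"] that(2) g(1) d] that by auto
  define nd where "nd x = cmod (dpar x)" for x
  have ni: "nd integrable_on {a..b}" if "0 \<le> a" "a \<le> b" "b \<le> len" for a b
    using absolutely_integrable_norm[OF sub(1)[OF that]] set_lebesgue_integral_eq_integral(1) unfolding nd_def o_def by blast
  have dle: "dist (nat_par a) (nat_par b) \<le> integral {a..b} nd" if "0 \<le> a" "a \<le> b" "b \<le> len" for a b
  proof -
    have "dist (nat_par a) (nat_par b) = norm (integral {a..b} dpar)"
      using integral_unique[OF sub(2)[OF that]] by (simp add: dist_norm norm_minus_commute)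
    also have "\<dots> \<le> integral {a..b} nd"
      using sub(2)[OF that] by (intro integral_norm_bound_integral ni[OF that]) (auto simp: nd_def)
    finally show ?thesis .
  qed
  have "len \<le> integral {0..len} nd"
    unfolding len_def[unfolded arc_length_def]
  proof (rule cSup_least)
    show "inscribed_lengths p 0 1 \<noteq> {}" using zero_in_inscribed_lengths[of 1] by auto
    fix s assume "s \<in> inscribed_lengths p 0 1"
    then obtain n y where s: "s = (\<Sum>i<n. dist (p (y i)) (p (y (Suc i))))"
      and y: "\<forall>i\<le>n. y i \<in> {0..1}" "\<forall>i<n. y i \<le> y (Suc i)" by (auto simp: inscribed_lengths_def)
    define \<sigma> where "\<sigma> i = arc_length p (y i)" for i
    have sg: "\<sigma> i \<in> {0..len}" if "i \<le> n" for i using arc_length_image y that unfolding \<sigma>_def by blast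
    have sm: "\<sigma> i \<le> \<sigma> (Suc i)" if "i < n" for i using y that unfolding \<sigma>_def by (intro arc_length_mono) auto
    have "(\<Sum>i<k. dist (p (y i)) (p (y (Suc i)))) \<le> integral {0..\<sigma> k} nd" if "k \<le> n" for k
      using that
    proof (induction k)
      case 0
      have "0 \<le> integral {0..\<sigma> 0} nd" using sg[of 0] by (intro integral_nonneg ni) (auto simp: nd_def)
      then show ?case by simp
    next
      case (Suc k)
      have k: "0 \<le> \<sigma> k" "\<sigma> k \<le> \<sigma> (Suc k)" "\<sigma> (Suc k) \<le> len" using sg[of k] sg[of "Suc k"] sm[of k] Suc by auto
      have "dist (p (y k)) (p (y (Suc k))) = dist (nat_par (\<sigma> k)) (nat_par (\<sigma> (Suc k)))"
        using y Suc by (simp add: \<sigma>_def nat_par_arc_length)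
      also have "\<dots> \<le> integral {\<sigma> k..\<sigma> (Suc k)} nd" by (rule dle[OF k])
      moreover have "integral {0..\<sigma> k} nd + integral {\<sigma> k..\<sigma> (Suc k)} nd = integral {0..\<sigma> (Suc k)} nd"
        using k by (intro Henstock_Kurzweil_Integration.integral_combine ni) auto
      ultimately show ?case using Suc by auto
    qed
    then have "s \<le> integral {0..\<sigma> n} nd" unfolding s by simp
    also have "\<dots> \<le> integral {0..len} nd"
      using sg[of n] by (intro integral_subset_le ni) (auto simp: nd_def)
    finally show "s \<le> integral {0..Sup (inscribed_lengths p 0 1)} nd" by (simp add: len_def arc_length_def)
  qed
  define M where "M = N \<union> {0, len}"
  have M: "negligible M" using g by (simp add: M_def)
  define k where "k x = (if x \<in> M then 0 else 1 - nd x)" for x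
  have ki: "(k has_integral (len - integral {0..len} nd)) {0..len}"
  proof -
    have "((\<lambda>x. 1 - nd x) has_integral (len - integral {0..len} nd)) {0..len}"
      using has_integral_diff[OF has_integral_const_real[of "1::real" 0 len] integrable_integral[OF ni[of 0 len]]] len_pos by simp
    then show ?thesis by (rule has_integral_spike[OF M, rotated]) (simp add: k_def)
  qed
  have k0: "k x \<ge> 0" if "x \<in> {0..len}" for x using n1[of x] that by (auto simp: k_def M_def nd_def)
  have "(k has_integral 0) {0..len}"
  proof -
    have "len - integral {0..len} nd = 0" using has_integral_nonneg[OF ki k0] \<open>len \<le> integral {0..len} nd\<close> by linarith
    then show ?thesis using ki by simp
  qed
  then have k1: "k absolutely_integrable_on {0..len}" "integral {0..len} k = 0"
    using nonnegative_absolutely_integrable_1[of k "{0..len}"] k0 by auto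
  have "integral\<^sup>L lebesgue (\<lambda>x. indicator {0..len} x *\<^sub>R k x) = 0"
    using set_lebesgue_integral_eq_integral(2)[OF k1(1)] k1(2) by (simp add: set_lebesgue_integral_def)
  then have "AE x in lebesgue. indicator {0..len} x *\<^sub>R k x = 0"
    using k1(1) k0 by (subst (asm) integral_nonneg_eq_0_iff_AE) (auto simp: set_integrable_def indicator_def)
  then obtain N' where "N' \<in> null_sets lebesgue" "{x \<in> space lebesgue. \<not> (indicator {0..len} x *\<^sub>R k x = 0)} \<subseteq> N'"
    unfolding eventually_ae_filter by auto
  then have "negligible {x \<in> {0..len}. k x \<noteq> 0}"
    using negligible_subset[of N' "{x \<in> {0..len}. k x \<noteq> 0}"] by (auto simp: negligible_iff_null_sets subset_iff)
  then have N': "negligible (M \<union> {x \<in> {0..len}. k x \<noteq> 0})" using M by simp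
  show thesis
    by (rule that[OF N']) (use d in \<open>auto simp: M_def k_def nd_def\<close>)
qed


text \<open>For a path without smoothness the winding number is the increment of a continuous
  logarithm of \<open>p - z\<close>. Carried over to arc length, this logarithm differs by a
  constant from the local primitive \<open>Ln ((w - z) / w0)\<close> of \<open>1 / (w - z)\<close>
  on each short parameter interval, and the pieces are glued by \<open>Bolzano\<close>.\<close>

lemma winding_number_integral:
  assumes z: "z \<notin> path_image p"
  shows "((\<lambda>s. dpar s / (nat_par s - z)) has_integral (2 * of_real pi * \<i> * winding_number p z)) {0..len}"
    and "(\<lambda>s. dpar s / (nat_par s - z)) absolutely_integrable_on {0..len}"
proof -
  have "path p" using simple by (rule simple_path_imp_path)
  then obtain q where q: "path q" "pathfinish q - pathstart q = 2 * of_real pi * \<i> * winding_number p z"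
     "\<And>t. t \<in> {0..1} \<Longrightarrow> p t = z + exp (q t)" using winding_number_as_continuous_log[OF _ z] by metis
  define \<nu> where "\<nu> = the_inv_into {0..1} (arc_length p)"
  have \<nu>: "\<nu> s \<in> {0..1}" "arc_length p (\<nu> s) = s" if "s \<in> {0..len}" for s
    using the_inv_into_into[OF arc_length_inj, of s "{0..1}"] f_the_inv_into_f[OF arc_length_inj, of s] that arc_length_image
    by (auto simp: \<nu>_def)
  have \<nu>c: "continuous_on {0..len} \<nu>"
    unfolding \<nu>_def arc_length_image[symmetric]
    by (rule continuous_on_inv_into[OF arc_length_continuous compact_Icc arc_length_inj])
  define \<Lambda> where "\<Lambda> s = q (\<nu> s)" for s
  have \<Lambda>c: "continuous_on {0..len} \<Lambda>" unfolding \<Lambda>_def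
    by (rule continuous_on_compose2[OF _ \<nu>c]) (use q(1) \<nu> in \<open>auto simp: path_def\<close>)
  have \<Lambda>e: "nat_par s - z = exp (\<Lambda> s)" if "s \<in> {0..len}" for s
    using q(3)[OF \<nu>(1)[OF that]] nat_par_arc_length[OF \<nu>(1)[OF that]] \<nu>(2)[OF that] by (simp add: \<Lambda>_def)
  have npz: "nat_par s \<noteq> z" if "s \<in> {0..len}" for s using \<Lambda>e[OF that] by auto
  have "\<nu> 0 = 0" "\<nu> len = 1"
    using the_inv_into_f_f[OF arc_length_inj, of 0] the_inv_into_f_f[OF arc_length_inj, of 1]
    by (auto simp: \<nu>_def arc_length_0 len_def)
  then have ends: "\<Lambda> len - \<Lambda> 0 = 2 * of_real pi * \<i> * winding_number p z"
    using q(2) by (simp add: \<Lambda>_def pathfinish_def pathstart_def)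
  obtain N where N: "negligible N" "\<And>s. s \<in> {0<..<len} - N \<Longrightarrow> (nat_par has_vector_derivative dpar s) (at s) \<and> cmod (dpar s) = 1"
    using dpar_unit by metis
  define f where "f s = dpar s / (nat_par s - z)" for s
  define P where "P u v \<longleftrightarrow> (0 \<le> u \<and> u \<le> v \<and> v \<le> len \<longrightarrow> f absolutely_integrable_on {u..v} \<and> (f has_integral (\<Lambda> v - \<Lambda> u)) {u..v})" for u v
  have "P 0 len"
  proof (rule Bolzano[OF less_imp_le[OF len_pos]])
    fix u v w assume uv: "P u v" "P v w" "u \<le> v" "v \<le> w"
    show "P u w" unfolding P_def
    proof (intro impI conjI)
      assume "0 \<le> u \<and> u \<le> w \<and> w \<le> len"
      then have *: "f absolutely_integrable_on {u..v}" "(f has_integral (\<Lambda> v - \<Lambda> u)) {u..v}"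
         "f absolutely_integrable_on {v..w}" "(f has_integral (\<Lambda> w - \<Lambda> v)) {v..w}" using uv by (auto simp: P_def)
      show "f absolutely_integrable_on {u..w}" using absolutely_integrable_on_combine[OF *(1,3)] uv by simp
      show "(f has_integral \<Lambda> w - \<Lambda> u) {u..w}" using has_integral_combine[OF uv(3,4) *(2,4)] by simp
    qed
  next
    fix x assume x: "0 \<le> x" "x \<le> len"
    define w0 where "w0 = nat_par x - z"
    have w0: "w0 \<noteq> 0" using npz[of x] x by (simp add: w0_def)
    \<comment> \<open>On this disc \<open>(w - z) / w0\<close> has distance less than
      \<open>1\<close> from \<open>1\<close>, hence avoids the cut of \<open>Ln\<close>. As the
      curve has Lipschitz constant 1, \<open>cmod w0\<close> is also an admissible length for the
      parameter intervals.\<close>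
    define S where "S = ball (nat_par x) (cmod w0)"
    have nonpos: "(w - z) / w0 \<notin> \<real>\<^sub>\<le>\<^sub>0" "w \<noteq> z" if "w \<in> S" for w
    proof -
      have "(w - z) / w0 - 1 = (w - nat_par x) / w0" using w0 by (simp add: field_simps w0_def)
      then have "cmod ((w - z) / w0 - 1) < 1" using that w0 by (simp add: S_def norm_divide dist_norm norm_minus_commute)
      then have "\<bar>Re ((w - z) / w0 - 1)\<bar> < 1" using abs_Re_le_cmod order_le_less_trans by blast
      then have *: "Re ((w - z) / w0) > 0" by simp
      show "(w - z) / w0 \<notin> \<real>\<^sub>\<le>\<^sub>0" using * by (auto simp: complex_nonpos_Reals_iff)
      show "w \<noteq> z" using * by auto
    qed
    have Q: "((\<lambda>w. Ln ((w - z) / w0)) has_field_derivative 1 / (w - z)) (at w)" if "w \<in> S" for w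
      using nonpos[OF that] w0 by (auto intro!: derivative_eq_intros simp: field_simps)
    show "\<exists>d>0. \<forall>u v. u \<le> x \<and> x \<le> v \<and> v - u < d \<longrightarrow> P u v"
    proof (intro exI[of _ "cmod w0"] conjI allI impI)
      fix u v assume uv: "u \<le> x \<and> x \<le> v \<and> v - u < cmod w0"
      show "P u v" unfolding P_def
      proof (intro impI)
        assume *: "0 \<le> u \<and> u \<le> v \<and> v \<le> len"
        have lip: "1-lipschitz_on {u..v} nat_par" by (rule lipschitz_on_subset[OF nat_par_lipschitz]) (use * in auto)
        have im: "nat_par ` {u..v} \<subseteq> S"
        proof
          fix y assume "y \<in> nat_par ` {u..v}"
          then obtain s where s: "s \<in> {u..v}" "y = nat_par s" by auto
          have "dist (nat_par x) (nat_par s) \<le> 1 * dist x s" using s * uv by (intro lipschitz_onD[OF lip]) auto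
          also have "\<dots> < cmod w0" using s uv by (auto simp: dist_real_def)
          finally show "y \<in> S" using s by (simp add: S_def)
        qed
        have "open S" by (simp add: S_def)
        have D: "(nat_par has_vector_derivative dpar s) (at s)" if "s \<in> {u<..<v} - N" for s using N(2)[of s] that * by auto
        note fund = lipschitz_path_primitive[OF lip _ N(1) D \<open>open S\<close> im Q]
        have "\<exists>n::int. \<forall>s\<in>{u..v}. \<Lambda> s = (Ln ((nat_par s - z) / w0) + \<Lambda> x) + 2 * of_int n * of_real pi * \<i>"
        proof (rule continuous_logs_differ_by_const[of "{u..v}" \<Lambda> "\<lambda>s. Ln ((nat_par s - z) / w0) + \<Lambda> x"])
          show "continuous_on {u..v} \<Lambda>" by (rule continuous_on_subset[OF \<Lambda>c]) (use * in auto)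
          show "continuous_on {u..v} (\<lambda>s. Ln ((nat_par s - z) / w0) + \<Lambda> x)"
          proof (intro continuous_intros lipschitz_on_continuous_on[OF lip])
            fix s assume "s \<in> {u..v}"
            then have "nat_par s \<in> S" using im by blast
            then show "(nat_par s - z) / w0 \<notin> \<real>\<^sub>\<le>\<^sub>0" by (rule nonpos)
          qed (use w0 in auto)
          show "exp (\<Lambda> s) = exp (Ln ((nat_par s - z) / w0) + \<Lambda> x)" if "s \<in> {u..v}" for s
          proof -
            have "nat_par s \<noteq> z" using npz[of s] that * by auto
            then have "exp (Ln ((nat_par s - z) / w0)) = (nat_par s - z) / w0" using w0 by simp
            moreover have "exp (\<Lambda> x) = w0" using \<Lambda>e[of x] x by (simp add: w0_def)
            ultimately show ?thesis using \<Lambda>e[of s] that * w0 by (simp add: exp_add)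
          qed
        qed auto
        then have "Ln ((nat_par v - z) / w0) - Ln ((nat_par u - z) / w0) = \<Lambda> v - \<Lambda> u" using * by force
        then show "f absolutely_integrable_on {u..v} \<and> (f has_integral \<Lambda> v - \<Lambda> u) {u..v}"
          using fund * by (simp add: f_def[abs_def])
      qed
    qed (use w0 in auto)
  qed
  then have "f absolutely_integrable_on {0..len}" "(f has_integral (\<Lambda> len - \<Lambda> 0)) {0..len}" using len_pos by (auto simp: P_def)
  then show "((\<lambda>s. dpar s / (nat_par s - z)) has_integral (2 * of_real pi * \<i> * winding_number p z)) {0..len}"
    "(\<lambda>s. dpar s / (nat_par s - z)) absolutely_integrable_on {0..len}" by (simp_all add: ends f_def[abs_def])
qed

section \<open>Moving the base point of the loop to the singularity\<close>

definition shift_par :: "real \<Rightarrow> real \<Rightarrow> real" where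
  "shift_par s0 x = (if s0 + len * x \<le> len then s0 + len * x else s0 + len * x - len)"

text \<open>The loop starts at \<open>nat_par s0\<close> and runs over \<open>[0, 1]\<close>, so
  that the exceptional point becomes the common endpoint, as in the closed curve theorem. At the
  wrap \<open>shift_par\<close> takes the value \<open>len\<close> and not \<open>0\<close>; both
  parameters name the same point.\<close>

definition shifted :: "real \<Rightarrow> real \<Rightarrow> complex" where
  "shifted s0 x = nat_par (shift_par s0 x)"

lemma shift_par_range: "s0 \<in> {0..<len} \<Longrightarrow> x \<in> {0..1} \<Longrightarrow> shift_par s0 x \<in> {0..len}"
proof -
  assume "s0 \<in> {0..<len}" "x \<in> {0..1}"
  then have "0 \<le> len * x" "len * x \<le> len * 1" using len_pos by (auto intro: mult_nonneg_nonneg mult_left_mono simp del: mult_1_right)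
  then show ?thesis using \<open>s0 \<in> {0..<len}\<close> unfolding shift_par_def atLeastAtMost_iff atLeastLessThan_iff
    by (cases "s0 + len * x \<le> len"; simp only: if_True if_False mult_1_right; linarith)
qed

lemma shifted_ends: "s0 \<in> {0..<len} \<Longrightarrow> shifted s0 0 = nat_par s0" "s0 \<in> {0..<len} \<Longrightarrow> shifted s0 1 = nat_par s0"
  using nat_par_ends by (auto simp: shifted_def shift_par_def)

lemma shifted_lipschitz:
  assumes s0: "s0 \<in> {0..<len}"
  shows "len-lipschitz_on {0..1} (shifted s0)"
proof (rule lipschitz_onI)
  have main: "dist (shifted s0 x) (shifted s0 y) \<le> len * (y - x)" if xy: "x \<in> {0..1}" "y \<in> {0..1}" "x \<le> y" for x y
  proof -
    have r: "shift_par s0 x \<in> {0..len}" "shift_par s0 y \<in> {0..len}" using shift_par_range[OF s0] xy by auto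
    have le: "len * x \<le> len * y" using xy len_pos by (intro mult_left_mono) auto
    have L: "dist (nat_par a) (nat_par b) \<le> \<bar>a - b\<bar>" if "a \<in> {0..len}" "b \<in> {0..len}" for a b
      using lipschitz_onD[OF nat_par_lipschitz that] by (simp add: dist_real_def)
    show ?thesis
    proof (cases "s0 + len * x \<le> len \<longleftrightarrow> s0 + len * y \<le> len")
      case True
      then have "shift_par s0 y - shift_par s0 x = len * (y - x)" by (auto simp: shift_par_def algebra_simps)
      then show ?thesis using L[OF r] le unfolding shifted_def by (simp add: algebra_simps)
    next
      case False
      then have c: "s0 + len * x \<le> len" "\<not> s0 + len * y \<le> len" using le by auto
      have "dist (shifted s0 x) (shifted s0 y) \<le> dist (shifted s0 x) (nat_par len) + dist (nat_par 0) (shifted s0 y)"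
        using dist_triangle[of "shifted s0 x" "shifted s0 y" "nat_par len"] nat_par_ends by simp
      also have "\<dots> \<le> (len - shift_par s0 x) + shift_par s0 y"
        using L[OF r(1), of len] L[OF _ r(2), of 0] r len_pos unfolding shifted_def by (auto simp: algebra_simps)
      also have "\<dots> = len * (y - x)" using c by (simp add: shift_par_def algebra_simps)
      finally show ?thesis .
    qed
  qed
  fix x y :: real assume "x \<in> {0..1}" "y \<in> {0..1}"
  then show "dist (shifted s0 x) (shifted s0 y) \<le> len * dist x y"
    using main[of x y] main[of y x] by (cases "x \<le> y") (auto simp: dist_real_def dist_commute)
qed (use len_pos in auto)

lemma shifted_image:
  assumes s0: "s0 \<in> {0..<len}"
  shows "path_image (shifted s0) = path_image p"
proof
  show "path_image (shifted s0) \<subseteq> path_image p"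
    using shift_par_range[OF s0] unfolding nat_par_image[symmetric] path_image_def[of "shifted s0"] shifted_def by auto
  show "path_image p \<subseteq> path_image (shifted s0)"
  proof
    fix z assume "z \<in> path_image p"
    then obtain s where s: "s \<in> {0..len}" "z = nat_par s" unfolding nat_par_image[symmetric] by auto
    show "z \<in> path_image (shifted s0)"
    proof (cases "s0 \<le> s")
      case True
      have "shift_par s0 ((s - s0) / len) = s" using s len_pos by (simp add: shift_par_def)
      moreover have "(s - s0) / len \<in> {0..1}" using s s0 True len_pos by (auto simp: field_simps)
      ultimately show ?thesis using s unfolding path_image_def shifted_def by (metis image_eqI)
    next
      case False
      show ?thesis
      \<comment> \<open>For \<open>s0 > 0\<close> the value \<open>0\<close> is not attained by
        \<open>shift_par\<close>; the point is reached through the parameter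
        \<open>len\<close>.\<close>
      proof (cases "s = 0")
        case True
        have "shift_par s0 ((len - s0) / len) = len" using len_pos by (simp add: shift_par_def)
        moreover have "(len - s0) / len \<in> {0..1}" using s0 len_pos by (auto simp: field_simps)
        ultimately show ?thesis using s True nat_par_ends unfolding path_image_def shifted_def by (metis image_eqI)
      next
        case s0': False
        have "shift_par s0 ((s + len - s0) / len) = s" using s s0' len_pos by (simp add: shift_par_def)
        moreover have "(s + len - s0) / len \<in> {0..1}" using s s0 False len_pos by (auto simp: field_simps)
        ultimately show ?thesis using s unfolding path_image_def shifted_def by (metis image_eqI)
      qed
    qed
  qed
qed

lemma shifted_simple:
  assumes s0: "s0 \<in> {0..<len}"
  shows "simple_path (shifted s0)"
proof -
  have "x = y \<or> x = 0 \<and> y = 1 \<or> x = 1 \<and> y = 0"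
    if xy: "x \<in> {0..1}" "y \<in> {0..1}" "shifted s0 x = shifted s0 y" for x y
  proof -
    have *: "shift_par s0 x \<in> {0..len}" "shift_par s0 y \<in> {0..len}" using shift_par_range[OF s0] xy by auto
    have lx: "0 \<le> len * x" "len * x \<le> len" "0 \<le> len * y" "len * y \<le> len" using xy len_pos by auto
    have disj: "shift_par s0 x = shift_par s0 y \<or>
      (shift_par s0 x = 0 \<or> shift_par s0 x = len) \<and> (shift_par s0 y = 0 \<or> shift_par s0 y = len)"
    proof (cases "shift_par s0 x \<in> {0<..<len} \<or> shift_par s0 y \<in> {0<..<len}")
      case True
      then show ?thesis
        using nat_par_inj[of "shift_par s0 x" "shift_par s0 y"] nat_par_inj[of "shift_par s0 y" "shift_par s0 x"] xy(3) *
        unfolding shifted_def by metis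
    next
      case False
      then have "shift_par s0 x = 0 \<or> shift_par s0 x = len" "shift_par s0 y = 0 \<or> shift_par s0 y = len" using * by force+
      then show ?thesis by auto
    qed
    have K: "X = Y \<or> (X = 0 \<and> Y = len) \<or> (X = len \<and> Y = 0)"
      if "(if s0 + X \<le> len then s0 + X else s0 + X - len) = (if s0 + Y \<le> len then s0 + Y else s0 + Y - len) \<or>
        ((if s0 + X \<le> len then s0 + X else s0 + X - len) = 0 \<or> (if s0 + X \<le> len then s0 + X else s0 + X - len) = len) \<and>
        ((if s0 + Y \<le> len then s0 + Y else s0 + Y - len) = 0 \<or> (if s0 + Y \<le> len then s0 + Y else s0 + Y - len) = len)"
        "0 \<le> X" "X \<le> len" "0 \<le> Y" "Y \<le> len" for X Y :: real
      using that s0 by (cases "s0 + X \<le> len"; cases "s0 + Y \<le> len"; auto)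
    have "len * x = len * y \<or> (len * x = 0 \<and> len * y = len) \<or> (len * x = len \<and> len * y = 0)"
      by (rule K[OF disj[unfolded shift_par_def] lx])
    then show ?thesis using len_pos by auto
  qed
  then show ?thesis
    using lipschitz_on_continuous_on[OF shifted_lipschitz[OF s0]] by (auto simp: simple_path_def path_def loop_free_def)
qed

lemma shifted_split:
  assumes s0: "s0 \<in> {0..<len}"
  defines "x1 \<equiv> (len - s0) / len"
  shows "0 < x1" "x1 \<le> 1" "x \<le> x1 \<Longrightarrow> shift_par s0 x = s0 + len * x" "x1 < x \<Longrightarrow> shift_par s0 x = s0 + len * x - len"
  using s0 len_pos by (auto simp: x1_def shift_par_def field_simps)

lemma shifted_integral:
  fixes F :: "real \<Rightarrow> complex"
  assumes s0: "s0 \<in> {0..<len}" and F: "F absolutely_integrable_on {0..len}"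
  shows "(\<lambda>x. of_real len * F (shift_par s0 x)) absolutely_integrable_on {0..1}"
    "integral {0..1} (\<lambda>x. of_real len * F (shift_par s0 x)) = integral {0..len} F"
proof -
  define x1 where "x1 = (len - s0) / len"
  note x1 = shifted_split[OF s0, folded x1_def]
  have lx1: "len * x1 = len - s0" using len_pos by (simp add: x1_def)
  have im1: "(\<lambda>x. s0 + len * x) ` {0..x1} = {s0..len}"
    using image_affinity_atLeastAtMost[of len s0 0 x1] x1 len_pos lx1 by (auto simp: add.commute)
  have im2: "(\<lambda>x. s0 + len * x - len) ` {x1..1} = {0..s0}"
    using image_affinity_atLeastAtMost[of len "s0 - len" x1 1] x1 len_pos lx1 by (auto simp: algebra_simps)
  have inj: "inj_on (\<lambda>x. s0 + len * x) A" "inj_on (\<lambda>x. s0 + len * x - len) A" for A using len_pos by (auto simp: inj_on_def)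
  have F1: "F absolutely_integrable_on {s0..len}" "F absolutely_integrable_on {0..s0}"
    using s0 by (auto intro!: set_integrable_subset[OF F])
  have a1: "(\<lambda>x. \<bar>len\<bar> *\<^sub>R F (s0 + len * x)) absolutely_integrable_on {0..x1} \<and> integral {0..x1} (\<lambda>x. \<bar>len\<bar> *\<^sub>R F (s0 + len * x)) = integral {s0..len} F"
    by (subst has_absolute_integral_change_of_variables_real[where g = "\<lambda>x. s0 + len * x" and h = "\<lambda>_. len"])
      (auto intro!: derivative_eq_intros inj F1 simp: im1)
  have a2: "(\<lambda>x. \<bar>len\<bar> *\<^sub>R F (s0 + len * x - len)) absolutely_integrable_on {x1..1} \<and> integral {x1..1} (\<lambda>x. \<bar>len\<bar> *\<^sub>R F (s0 + len * x - len)) = integral {0..s0} F"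
    by (subst has_absolute_integral_change_of_variables_real[where g = "\<lambda>x. s0 + len * x - len" and h = "\<lambda>_. len"])
      (auto intro!: derivative_eq_intros inj F1 simp: im2)
  let ?G = "\<lambda>x. of_real len * F (shift_par s0 x)"
  have b1: "?G absolutely_integrable_on {0..x1}"
    by (rule absolutely_integrable_spike[OF conjunct1[OF a1], of "{}"]) (use x1 len_pos in \<open>auto simp: scaleR_conv_of_real\<close>)
  have b1': "integral {0..x1} ?G = integral {s0..len} F"
    unfolding conjunct2[OF a1, symmetric] by (rule integral_cong) (use x1 len_pos in \<open>auto simp: scaleR_conv_of_real\<close>)
  have b2: "?G absolutely_integrable_on {x1..1}"
    by (rule absolutely_integrable_spike[OF conjunct1[OF a2], of "{x1}"]) (use x1 len_pos in \<open>auto simp: scaleR_conv_of_real\<close>)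
  have b2': "integral {x1..1} ?G = integral {0..s0} F"
    unfolding conjunct2[OF a2, symmetric] by (rule integral_spike[of "{x1}"]) (use x1 len_pos in \<open>auto simp: scaleR_conv_of_real\<close>)
  show G: "?G absolutely_integrable_on {0..1}"
    using absolutely_integrable_on_combine[OF b1 b2] x1 by auto
  have "integral {0..x1} ?G + integral {x1..1} ?G = integral {0..1} ?G"
    using x1 G set_lebesgue_integral_eq_integral(1) by (intro Henstock_Kurzweil_Integration.integral_combine) auto
  moreover have "integral {0..s0} F + integral {s0..len} F = integral {0..len} F"
    using s0 F set_lebesgue_integral_eq_integral(1) by (intro Henstock_Kurzweil_Integration.integral_combine) auto
  ultimately show "integral {0..1} ?G = integral {0..len} F" unfolding b1' b2' by (metis add.commute)
qed

lemma shifted_derivative: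
  assumes s0: "s0 \<in> {0..<len}"
  obtains N where "negligible N"
    "\<And>x. x \<in> {0<..<1} - N \<Longrightarrow> (shifted s0 has_vector_derivative (of_real len * dpar (shift_par s0 x))) (at x)"
proof -
  define x1 where "x1 = (len - s0) / len"
  note x1 = shifted_split[OF s0, folded x1_def]
  have lx1: "len * x1 = len - s0" using len_pos by (simp add: x1_def)
  obtain N where N: "negligible N" "\<And>s. s \<in> {0<..<len} - N \<Longrightarrow> (nat_par has_vector_derivative dpar s) (at s) \<and> cmod (dpar s) = 1"
    using dpar_unit by metis
  have neg: "negligible ((\<lambda>s. (s + k) / len) ` N)" for k :: real
  proof (rule negligible_locally_Lipschitz_image[OF _ N(1)])
    fix x
    show "\<exists>T B. open T \<and> x \<in> T \<and> (\<forall>y\<in>N \<inter> T. norm ((y + k) / len - (x + k) / len) \<le> B * norm (y - x))"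
      by (intro exI[of _ UNIV] exI[of _ "1/len"]) (use len_pos in \<open>auto simp: diff_divide_distrib[symmetric]\<close>)
  qed simp
  show thesis
  proof (rule that)
    show "negligible ((\<lambda>s. (s + (- s0)) / len) ` N \<union> (\<lambda>s. (s + (len - s0)) / len) ` N \<union> {x1})" using neg[of "- s0"] neg[of "len - s0"] by simp
    fix x assume x: "x \<in> {0<..<1} - ((\<lambda>s. (s + (- s0)) / len) ` N \<union> (\<lambda>s. (s + (len - s0)) / len) ` N \<union> {x1})"
    have lx: "0 < len * x" "len * x < len" using x len_pos by auto
    show "(shifted s0 has_vector_derivative (of_real len * dpar (shift_par s0 x))) (at x)"
    proof (cases "x < x1")
      case True
      have "s0 + len * x \<notin> N"
      proof
        assume "s0 + len * x \<in> N"
        then have "(s0 + len * x + (- s0)) / len \<in> (\<lambda>s. (s + (- s0)) / len) ` N" by (rule imageI)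
        then show False using x len_pos by simp
      qed
      moreover have "len * x < len * x1" using True len_pos by simp
      ultimately have d: "(nat_par has_vector_derivative dpar (s0 + len * x)) (at (s0 + len * x))"
        using N(2)[of "s0 + len * x"] s0 lx lx1 by auto
      have "((\<lambda>x. s0 + len * x) has_real_derivative len) (at x)" by (auto intro!: derivative_eq_intros)
      then have "((nat_par \<circ> (\<lambda>x. s0 + len * x)) has_vector_derivative (len *\<^sub>R dpar (s0 + len * x))) (at x)"
        using d by (intro vector_diff_chain_at) (auto simp: has_real_derivative_iff_has_vector_derivative)
      then have "((nat_par \<circ> (\<lambda>x. s0 + len * x)) has_vector_derivative (of_real len * dpar (shift_par s0 x))) (at x)"
        using x1(3)[of x] True by (simp add: scaleR_conv_of_real)
      then show ?thesis
        by (rule has_vector_derivative_transform_within_open[of _ _ _ "{..<x1}"]) (use True x1 in \<open>auto simp: shifted_def\<close>)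
    next
      case False
      then have xx: "x1 < x" using x by auto
      have "s0 + len * x - len \<notin> N"
      proof
        assume "s0 + len * x - len \<in> N"
        then have "(s0 + len * x - len + (len - s0)) / len \<in> (\<lambda>s. (s + (len - s0)) / len) ` N" by (rule imageI)
        then show False using x len_pos by simp
      qed
      moreover have "len * x1 < len * x" using xx len_pos by simp
      ultimately have d: "(nat_par has_vector_derivative dpar (s0 + len * x - len)) (at (s0 + len * x - len))"
        using N(2)[of "s0 + len * x - len"] s0 lx lx1 by auto
      have "((\<lambda>x. s0 + len * x - len) has_real_derivative len) (at x)" by (auto intro!: derivative_eq_intros)
      then have "((nat_par \<circ> (\<lambda>x. s0 + len * x - len)) has_vector_derivative (len *\<^sub>R dpar (s0 + len * x - len))) (at x)"
        using d by (intro vector_diff_chain_at) (auto simp: has_real_derivative_iff_has_vector_derivative)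
      then have "((nat_par \<circ> (\<lambda>x. s0 + len * x - len)) has_vector_derivative (of_real len * dpar (shift_par s0 x))) (at x)"
        using x1(4)[of x] xx by (simp add: scaleR_conv_of_real)
      then show ?thesis
        by (rule has_vector_derivative_transform_within_open[of _ _ _ "{x1<..}"]) (use xx x1 in \<open>auto simp: shifted_def\<close>)
    qed
  qed
qed


section \<open>Integrals against the unit tangent\<close>

lemma mult_dpar_integrable:
  assumes k: "k absolutely_integrable_on S" and S: "S \<subseteq> {0..len}" "S \<in> sets lebesgue"
  shows "(\<lambda>x. k x * dpar x) absolutely_integrable_on S"
proof -
  obtain N where N: "negligible N" "\<And>s. s \<in> {0<..<len} - N \<Longrightarrow> (nat_par has_vector_derivative dpar s) (at s) \<and> cmod (dpar s) = 1"
    using dpar_unit by metis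
  define M where "M = N \<union> {0, len}"
  have M: "negligible M" using N by (simp add: M_def)
  \<comment> \<open>\<open>dpar\<close> is unspecified where \<open>nat_par\<close> is not
    differentiable; the version that vanishes there is bounded by \<open>1\<close> on the whole
    interval.\<close>
  define D where "D x = (if x \<in> M then 0 else dpar x)" for x
  have Db: "cmod (D x) \<le> 1" if "x \<in> {0..len}" for x using N(2)[of x] that by (auto simp: D_def M_def)
  have "dpar absolutely_integrable_on {0..len}"
    by (rule lipschitz_fundamental_theorem(1)[OF nat_par_lipschitz less_imp_le[OF len_pos] N(1)]) (use N(2) in auto)
  then have "D absolutely_integrable_on {0..len}"
    by (rule absolutely_integrable_spike[OF _ M]) (auto simp: D_def)
  then have "D absolutely_integrable_on S" by (rule set_integrable_subset) (use S in auto)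
  then have Dm: "D \<in> borel_measurable (lebesgue_on S)"
    using S absolutely_integrable_measurable by blast
  have "(\<lambda>x. D x * k x) absolutely_integrable_on S"
    by (rule absolutely_integrable_bounded_measurable_product[OF bilinear_times Dm S(2) _ k])
      (use Db S in \<open>auto simp: bounded_iff intro!: exI[of _ 1]\<close>)
  then show ?thesis
    by (rule absolutely_integrable_spike[OF _ M]) (auto simp: D_def)
qed

lemma continuous_mult_dpar_integrable:
  assumes "continuous_on S k" "compact S" "S \<subseteq> {0..len}"
  shows "(\<lambda>x. k x * dpar x) absolutely_integrable_on S"
proof (rule mult_dpar_integrable)
  have S: "S \<in> lmeasurable" using assms lmeasurable_compact by blast
  have "(\<lambda>x. k x * 1) absolutely_integrable_on S"
  proof (rule absolutely_integrable_bounded_measurable_product[OF bilinear_times])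
    show "k \<in> borel_measurable (lebesgue_on S)" using assms S by (intro continuous_imp_measurable_on_sets_lebesgue) auto
    show "bounded (k ` S)" using assms compact_continuous_image compact_imp_bounded by blast
    show "(\<lambda>x. 1::complex) absolutely_integrable_on S"
      using integrable_on_const[OF S, of "1::complex"] integrable_on_const[OF S, of "1::real"] by (auto simp: absolutely_integrable_on_def)
  qed (use S in auto)
  then show "k absolutely_integrable_on S" by simp
qed (use assms in \<open>auto intro: fmeasurableD lmeasurable_compact\<close>)

lemma mult_dpar_integral_bound:
  assumes i: "(\<lambda>x. k x * dpar x) absolutely_integrable_on S" and S: "S \<subseteq> {0..len}" "S \<in> lmeasurable"
    and k: "\<And>x. x \<in> S \<Longrightarrow> cmod (k x) \<le> C"
  shows "cmod (integral S (\<lambda>x. k x * dpar x)) \<le> C * measure lebesgue S"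
proof -
  obtain N where N: "negligible N" "\<And>s. s \<in> {0<..<len} - N \<Longrightarrow> (nat_par has_vector_derivative dpar s) (at s) \<and> cmod (dpar s) = 1"
    using dpar_unit by metis
  define M where "M = N \<union> {0, len}"
  have M: "negligible M" using N by (simp add: M_def)
  define g where "g x = (if x \<in> M then 0 else k x * dpar x)" for x
  have gi: "g integrable_on S"
    using absolutely_integrable_spike[OF i M, of g] set_lebesgue_integral_eq_integral(1) by (auto simp: g_def)
  have "integral S (\<lambda>x. k x * dpar x) = integral S g" by (rule integral_spike[OF M]) (auto simp: g_def)
  moreover have "norm (integral S g) \<le> integral S (\<lambda>x. C)"
  proof (rule integral_norm_bound_integral[OF gi])
    show "(\<lambda>x. C) integrable_on S" by (rule integrable_on_const[OF S(2)])
    fix x assume x: "x \<in> S"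
    show "norm (g x) \<le> C"
    proof (cases "x \<in> M")
      case True then show ?thesis using order_trans[OF norm_ge_zero k[OF x]] by (auto simp: g_def)
    next
      case False
      then have "x \<in> {0<..<len} - N" using S x by (force simp: M_def)
      then show ?thesis using N(2)[of x] k[OF x] False by (simp add: g_def norm_mult)
    qed
  qed
  moreover have "integral S (\<lambda>x. C) = C * measure lebesgue S"
    using lmeasure_integral[OF S(2)] integral_mult_right[of S C "\<lambda>x. 1"] by simp
  ultimately show ?thesis by simp
qed

section \<open>The principal value of the Cauchy kernel\<close>

lemma Ln_imaginary_rotations:
  assumes "Re a > 0"
  shows "Ln (\<i> * a) = Ln a + \<i> * of_real (pi / 2)" "Ln (- \<i> * a) = Ln a - \<i> * of_real (pi / 2)"
proof -
  have a0: "a \<noteq> 0" using assms by auto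
  have im: "\<bar>Im (Ln a)\<bar> < pi / 2" using assms Re_Ln_pos_lt[OF a0] by simp
  have ei: "exp (\<i> * of_real (pi / 2)) = \<i>" unfolding cis_conv_exp[symmetric] by simp
  have "Ln (exp (Ln a + \<i> * of_real (pi / 2))) = Ln a + \<i> * of_real (pi / 2)"
    by (rule Ln_exp) (use im in auto)
  moreover have "exp (Ln a + \<i> * of_real (pi / 2)) = \<i> * a" unfolding exp_add ei using a0 by simp
  ultimately show "Ln (\<i> * a) = Ln a + \<i> * of_real (pi / 2)" by simp
  have "Ln (exp (Ln a - \<i> * of_real (pi / 2))) = Ln a - \<i> * of_real (pi / 2)"
    by (rule Ln_exp) (use im in auto)
  moreover have "exp (Ln a - \<i> * of_real (pi / 2)) = - \<i> * a" unfolding exp_diff ei using a0 by (simp add: field_simps)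
  ultimately show "Ln (- \<i> * a) = Ln a - \<i> * of_real (pi / 2)" by simp
qed

lemma winding_number_0_1:
  assumes ccw: "counterclockwise_about_0 p" and z: "z \<notin> path_image p"
  shows "winding_number p z \<in> {0, 1}"
proof (cases "z \<in> inside (path_image p)")
  case True
  have 1: "0 \<in> inside (path_image p)" "winding_number p 0 = 1" using ccw by (auto simp: counterclockwise_about_0_def)
  show ?thesis
  proof (rule simple_closed_path_winding_number_inside[OF simple])
    assume "\<And>z. z \<in> inside (path_image p) \<Longrightarrow> winding_number p z = 1"
    then show ?thesis using True by auto
  next
    assume "\<And>z. z \<in> inside (path_image p) \<Longrightarrow> winding_number p z = -1"
    then have "winding_number p 0 = -1" using 1 by blast
    then show ?thesis using 1 by auto
  qed
next
  case False
  then have "z \<in> outside (path_image p)" using z inside_Un_outside[of "path_image p"] by blast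
  then have "winding_number p z = 0"
    by (rule winding_number_zero_in_outside[OF simple_path_imp_path[OF simple] closed_p])
  then show ?thesis by simp
qed

text \<open>Near a point with unit tangent \<open>e\<close> the curve lies in a double cone, so the two points at distance
  \<open>\<epsilon>\<close> on the normal are off the curve; the part of the curve near the point contributes to their winding
  numbers the same logarithms up to \<open>\<plusminus> \<pi>\<close>, which pins down the principal value.\<close>

lemma symmetric_pv_integral:
  assumes ccw: "counterclockwise_about_0 p" and x0: "x0 \<in> {0<..<len}"
    and R: "0 < R" "R \<le> x0" "R \<le> len - x0"
    and e: "cmod e = 1" and cone: "\<And>x. \<bar>x - x0\<bar> \<le> R \<Longrightarrow> cmod ((nat_par x - nat_par x0) / e - of_real (x - x0)) \<le> \<bar>x - x0\<bar> / 2"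
  defines "O_R \<equiv> {0..x0-R} \<union> {x0+R..len}"
  shows "integral O_R (\<lambda>x. 1 / (nat_par x - nat_par x0) * dpar x) =
    \<i> * of_real pi + Ln ((nat_par (x0 - R) - nat_par x0) / (- e)) - Ln ((nat_par (x0 + R) - nat_par x0) / e)"
proof -
  define w0 where "w0 = nat_par x0"
  define u where "u x = (nat_par x - w0) / e" for x
  have e0: "e \<noteq> 0" using e by auto
  have cone': "cmod (u x - of_real (x - x0)) \<le> \<bar>x - x0\<bar> / 2" if "\<bar>x - x0\<bar> \<le> R" for x
    using cone[OF that] by (simp add: u_def w0_def)
  have Reu: "\<bar>Re (u x) - (x - x0)\<bar> \<le> \<bar>x - x0\<bar> / 2" if "\<bar>x - x0\<bar> \<le> R" for x
    using cone'[OF that] abs_Re_le_cmod[of "u x - of_real (x - x0)"] by simp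
  have O: "compact O_R" "O_R \<subseteq> {0..len}" "O_R \<in> lmeasurable" using R x0 by (auto simp: O_R_def intro!: lmeasurable_compact)
  have Oc: "continuous_on O_R nat_par" by (rule continuous_on_subset[OF nat_par_cont O(2)])
  have One: "O_R \<noteq> {}" using R x0 by (auto simp: O_R_def)
  have Onz: "nat_par x \<noteq> w0" if "x \<in> O_R" for x
    using nat_par_inj[of x0 x] that x0 R unfolding w0_def O_R_def by auto
  obtain \<kappa> where kap: "\<kappa> > 0" "\<And>x. x \<in> O_R \<Longrightarrow> \<kappa> \<le> cmod (nat_par x - w0)"
  proof -
    have "continuous_on O_R (\<lambda>x. cmod (nat_par x - w0))" by (intro continuous_intros Oc)
    from continuous_attains_inf[OF O(1) One this] obtain x where x: "x \<in> O_R" "\<And>y. y \<in> O_R \<Longrightarrow> cmod (nat_par x - w0) \<le> cmod (nat_par y - w0)" by auto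
    then show thesis using that[of "cmod (nat_par x - w0)"] Onz[of x] by auto
  qed
  obtain N where N: "negligible N" "\<And>s. s \<in> {0<..<len} - N \<Longrightarrow> (nat_par has_vector_derivative dpar s) (at s) \<and> cmod (dpar s) = 1"
    using dpar_unit by metis
  define J where "J z = integral O_R (\<lambda>x. 1 / (nat_par x - z) * dpar x)" for z
  have Ji: "(\<lambda>x. 1 / (nat_par x - z) * dpar x) absolutely_integrable_on O_R" if "\<And>x. x \<in> O_R \<Longrightarrow> nat_par x \<noteq> z" for z
    by (rule continuous_mult_dpar_integrable[OF _ O(1,2)]) (use that in \<open>auto intro!: continuous_intros Oc\<close>)
  \<comment> \<open>The values \<open>\<i>\<close> and \<open>- \<i>\<close> of
    \<open>\<sigma>\<close> treat the two sides of the curve. The point \<open>z \<epsilon>\<close>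
    lies on the normal at distance \<open>\<epsilon>\<close> from \<open>w0\<close>, and the
    logarithm of \<open>\<sigma> * ((w - z \<epsilon>) / e)\<close> is cut along the normal ray from
    \<open>z \<epsilon>\<close> away from \<open>w0\<close>, which the nearby part of the curve does
    not meet.\<close>
  have main: "J w0 + Ln (\<sigma> * u (x0 + R)) - Ln (\<sigma> * u (x0 - R)) \<in> {0, 2 * of_real pi * \<i>}"
    if \<sigma>: "\<sigma> = \<i> \<or> \<sigma> = - \<i>" for \<sigma>
  proof -
    have s2: "\<sigma> * \<sigma> = -1" "\<sigma> \<noteq> 0" "cmod \<sigma> = 1" using \<sigma> by auto
    define z where "z \<epsilon> = w0 + \<sigma> * e * of_real \<epsilon>" for \<epsilon> :: real
    have uz: "\<sigma> * ((nat_par x - z \<epsilon>) / e) = \<sigma> * u x + of_real \<epsilon>" for x \<epsilon>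
    proof -
      have "(nat_par x - z \<epsilon>) / e = u x - \<sigma> * of_real \<epsilon>" using e0 by (simp add: z_def u_def field_simps)
      then have "\<sigma> * ((nat_par x - z \<epsilon>) / e) = \<sigma> * (u x - \<sigma> * of_real \<epsilon>)" by (rule arg_cong)
      also have "\<dots> = \<sigma> * u x - (\<sigma> * \<sigma>) * of_real \<epsilon>" by (simp only: right_diff_distrib mult.assoc)
      finally have "\<sigma> * ((nat_par x - z \<epsilon>) / e) = \<sigma> * u x - (\<sigma> * \<sigma>) * of_real \<epsilon>" .
      then show ?thesis by (simp add: s2(1))
    qed
    \<comment> \<open>The cone condition gives \<open>Re (u x) \<noteq> 0\<close> for
      \<open>x \<noteq> x0\<close>; multiplication by \<open>\<sigma>\<close> turns this into a
      nonzero imaginary part.\<close>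
    have nonpos: "\<sigma> * u x + of_real \<epsilon> \<notin> \<real>\<^sub>\<le>\<^sub>0" if x: "\<bar>x - x0\<bar> \<le> R" and eps: "\<epsilon> > 0 \<or> \<epsilon> = 0 \<and> x \<noteq> x0" for x \<epsilon>
    proof (cases "x = x0")
      case True
      then have "u x = 0" by (simp add: u_def w0_def)
      then show ?thesis using eps True by (auto simp: complex_nonpos_Reals_iff)
    next
      case False
      then have "Re (u x) \<noteq> 0" using Reu[OF x] by (auto simp: abs_minus_commute)
      then have "Im (\<sigma> * u x + of_real \<epsilon>) \<noteq> 0" using \<sigma> by auto
      then show ?thesis by (auto simp: complex_nonpos_Reals_iff)
    qed
    have eq: "J (z \<epsilon>) + (Ln (\<sigma> * u (x0 + R) + of_real \<epsilon>) - Ln (\<sigma> * u (x0 - R) + of_real \<epsilon>)) \<in> {0, 2 * of_real pi * \<i>}"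
      if eps: "0 < \<epsilon>" "\<epsilon> < \<kappa>" for \<epsilon>
    proof -
      have zO: "nat_par x \<noteq> z \<epsilon>" if "x \<in> O_R" for x
      proof
        assume "nat_par x = z \<epsilon>"
        then have "cmod (nat_par x - w0) = \<epsilon>" using eps e s2 by (simp add: z_def norm_mult)
        then show False using kap(2)[OF that] eps by simp
      qed
      have zI: "nat_par x \<noteq> z \<epsilon>" if "\<bar>x - x0\<bar> \<le> R" for x
        using uz[of x \<epsilon>] nonpos[OF that, of \<epsilon>] eps by auto
      have zG: "z \<epsilon> \<notin> path_image p"
      proof
        assume "z \<epsilon> \<in> path_image p"
        then obtain x where x: "x \<in> {0..len}" "nat_par x = z \<epsilon>" unfolding nat_par_image[symmetric] by auto
        show False
        proof (cases "x \<in> O_R")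
          case False
          then have "\<bar>x - x0\<bar> \<le> R" using x(1) unfolding O_R_def by (auto simp: abs_le_iff)
          then show ?thesis using zI x(2) by blast
        qed (use zO x in blast)
      qed
      define f where "f x = 1 / (nat_par x - z \<epsilon>) * dpar x" for x
      have W: "(f has_integral (2 * of_real pi * \<i> * winding_number p (z \<epsilon>))) {0..len}" "f absolutely_integrable_on {0..len}"
        using winding_number_integral[OF zG] by (simp_all add: f_def[abs_def])
      define S where "S = {w. \<sigma> * ((w - z \<epsilon>) / e) \<notin> \<real>\<^sub>\<le>\<^sub>0}"
      have "open S"
      proof -
        have "S = (\<lambda>w. \<sigma> * ((w - z \<epsilon>) / e)) -` (- \<real>\<^sub>\<le>\<^sub>0)" by (auto simp: S_def)
        then show ?thesis by (auto intro!: open_vimage continuous_intros simp: e0 open_Compl)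
      qed
      have I: "(f has_integral (Ln (\<sigma> * ((nat_par (x0+R) - z \<epsilon>) / e)) - Ln (\<sigma> * ((nat_par (x0-R) - z \<epsilon>) / e)))) {x0-R..x0+R}"
        unfolding f_def
      proof (rule lipschitz_path_primitive(2)[where q = "\<lambda>w. 1 / (w - z \<epsilon>)" and Q = "\<lambda>w. Ln (\<sigma> * ((w - z \<epsilon>) / e))" and D = dpar and c = nat_par, OF _ _ N(1) _ \<open>open S\<close>])
        show "1-lipschitz_on {x0-R..x0+R} nat_par" by (rule lipschitz_on_subset[OF nat_par_lipschitz]) (use R x0 in auto)
        show "(nat_par has_vector_derivative dpar x) (at x)" if "x \<in> {x0 - R<..<x0 + R} - N" for x using N(2)[of x] that R by auto
        show "nat_par ` {x0 - R..x0 + R} \<subseteq> S"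
        proof
          fix y assume "y \<in> nat_par ` {x0 - R..x0 + R}"
          then obtain x where x: "x \<in> {x0-R..x0+R}" "y = nat_par x" by auto
          then have "\<bar>x - x0\<bar> \<le> R" by auto
          then show "y \<in> S" using nonpos[of x \<epsilon>] eps x uz[of x \<epsilon>] by (simp add: S_def)
        qed
        show "((\<lambda>w. Ln (\<sigma> * ((w - z \<epsilon>) / e))) has_field_derivative 1 / (w - z \<epsilon>)) (at w)" if "w \<in> S" for w
        proof -
          have "\<sigma> * ((w - z \<epsilon>) / e) \<notin> \<real>\<^sub>\<le>\<^sub>0" using that by (simp add: S_def)
          then have "w \<noteq> z \<epsilon>" by auto
          then show ?thesis using that e0 s2 by (auto simp: S_def field_simps intro!: derivative_eq_intros)
        qed
      qed (use R in auto)
      have fO: "f absolutely_integrable_on O_R" unfolding f_def by (rule Ji[OF zO])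
      have "(f has_integral J (z \<epsilon>)) O_R" unfolding J_def f_def[symmetric] using fO set_lebesgue_integral_eq_integral(1) by blast
      moreover have "O_R \<union> {x0-R..x0+R} = {0..len}" using R x0 by (auto simp: O_R_def)
      moreover have "negligible (O_R \<inter> {x0-R..x0+R})"
        by (rule negligible_subset[of "{x0-R, x0+R}"]) (auto simp: O_R_def)
      ultimately have "(f has_integral (J (z \<epsilon>) + (Ln (\<sigma> * ((nat_par (x0+R) - z \<epsilon>) / e)) - Ln (\<sigma> * ((nat_par (x0-R) - z \<epsilon>) / e))))) {0..len}"
        using has_integral_Un[OF _ I] by metis
      then have "J (z \<epsilon>) + (Ln (\<sigma> * ((nat_par (x0+R) - z \<epsilon>) / e)) - Ln (\<sigma> * ((nat_par (x0-R) - z \<epsilon>) / e))) = 2 * of_real pi * \<i> * winding_number p (z \<epsilon>)"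
        using W(1) has_integral_unique by blast
      then show ?thesis unfolding uz using winding_number_0_1[OF ccw zG] by auto
    qed
    \<comment> \<open>On \<open>O_R\<close> the curve stays at distance at least
      \<open>\<kappa>\<close> from \<open>w0\<close>, so the far part of the integral depends
      continuously on the pole, with an error linear in \<open>\<epsilon>\<close>.\<close>
    have Jlim: "((\<lambda>\<epsilon>. J (z \<epsilon>)) \<longlongrightarrow> J w0) (at_right 0)"
    proof -
      have bnd: "cmod (J (z \<epsilon>) - J w0) \<le> \<epsilon> * (2 / (\<kappa> * \<kappa>) * measure lebesgue O_R)" if eps: "0 < \<epsilon>" "\<epsilon> < \<kappa> / 2" for \<epsilon>
      proof -
        have low: "\<kappa> / 2 \<le> cmod (nat_par x - z \<epsilon>)" if "x \<in> O_R" for x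
        proof -
          have "cmod (nat_par x - w0) \<le> cmod (nat_par x - z \<epsilon>) + cmod (z \<epsilon> - w0)"
            using norm_triangle_ineq[of "nat_par x - z \<epsilon>" "z \<epsilon> - w0"] by simp
          also have "cmod (z \<epsilon> - w0) = \<epsilon>" using eps e s2 by (simp add: z_def norm_mult)
          finally show ?thesis using kap(2)[OF that] eps by simp
        qed
        have zO: "nat_par x \<noteq> z \<epsilon>" if "x \<in> O_R" for x using low[OF that] kap(1) by auto
        have d: "1 / (nat_par x - z \<epsilon>) * dpar x - 1 / (nat_par x - w0) * dpar x = ((z \<epsilon> - w0) / ((nat_par x - z \<epsilon>) * (nat_par x - w0))) * dpar x"
          if "x \<in> O_R" for x using zO[OF that] Onz[OF that] by (simp add: field_simps)
        have ai: "(\<lambda>x. 1 / (nat_par x - z \<epsilon>) * dpar x - 1 / (nat_par x - w0) * dpar x) absolutely_integrable_on O_R"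
          by (intro set_integral_diff(1) Ji zO Onz)
        have "J (z \<epsilon>) - J w0 = integral O_R (\<lambda>x. 1 / (nat_par x - z \<epsilon>) * dpar x - 1 / (nat_par x - w0) * dpar x)"
          unfolding J_def using Ji[of "z \<epsilon>"] Ji[of w0] zO Onz set_lebesgue_integral_eq_integral(1)
          by (subst Henstock_Kurzweil_Integration.integral_diff) blast+
        also have "\<dots> = integral O_R (\<lambda>x. ((z \<epsilon> - w0) / ((nat_par x - z \<epsilon>) * (nat_par x - w0))) * dpar x)"
          by (rule integral_cong[OF d])
        also have "cmod \<dots> \<le> (\<epsilon> * (2 / (\<kappa> * \<kappa>))) * measure lebesgue O_R"
        proof (rule mult_dpar_integral_bound[OF _ O(2,3)])
          show "(\<lambda>x. ((z \<epsilon> - w0) / ((nat_par x - z \<epsilon>) * (nat_par x - w0))) * dpar x) absolutely_integrable_on O_R"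
            by (rule absolutely_integrable_spike[OF ai, of "{}"]) (use d in auto)
          fix x assume x: "x \<in> O_R"
          have "cmod ((z \<epsilon> - w0) / ((nat_par x - z \<epsilon>) * (nat_par x - w0))) = \<epsilon> / (cmod (nat_par x - z \<epsilon>) * cmod (nat_par x - w0))"
            using eps e s2 by (simp add: z_def norm_mult norm_divide)
          also have "\<dots> \<le> \<epsilon> / (\<kappa> / 2 * \<kappa>)"
            using low[OF x] kap(2)[OF x] kap(1) eps by (intro divide_left_mono mult_mono) (auto intro!: mult_pos_pos)
          finally show "cmod ((z \<epsilon> - w0) / ((nat_par x - z \<epsilon>) * (nat_par x - w0))) \<le> \<epsilon> * (2 / (\<kappa> * \<kappa>))" by (simp add: field_simps)
        qed
        finally show ?thesis by (simp add: mult.assoc)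
      qed
      have "((\<lambda>\<epsilon>. J (z \<epsilon>) - J w0) \<longlongrightarrow> 0) (at_right 0)"
      proof (rule Lim_null_comparison)
        show "\<forall>\<^sub>F \<epsilon> in at_right 0. cmod (J (z \<epsilon>) - J w0) \<le> \<epsilon> * (2 / (\<kappa> * \<kappa>) * measure lebesgue O_R)"
          unfolding eventually_at_right_field using kap(1) bnd by (intro exI[of _ "\<kappa>/2"]) auto
        show "((\<lambda>\<epsilon>. \<epsilon> * (2 / (\<kappa> * \<kappa>) * measure lebesgue O_R)) \<longlongrightarrow> 0) (at_right 0)"
          by (rule tendsto_mult_left_zero) (rule tendsto_ident_at)
      qed
      then show ?thesis by (simp add: LIM_zero_iff)
    qed
    have Lnlim: "((\<lambda>\<epsilon>. Ln (\<sigma> * u x + of_real \<epsilon>)) \<longlongrightarrow> Ln (\<sigma> * u x)) (at_right 0)" if "\<bar>x - x0\<bar> \<le> R" "x \<noteq> x0" for x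
    proof (rule tendsto_Ln)
      show "((\<lambda>\<epsilon>. \<sigma> * u x + of_real \<epsilon>) \<longlongrightarrow> \<sigma> * u x) (at_right 0)" by (auto intro!: tendsto_eq_intros)
      show "\<sigma> * u x \<notin> \<real>\<^sub>\<le>\<^sub>0" using nonpos[of x 0] that by simp
    qed
    have "((\<lambda>\<epsilon>. J (z \<epsilon>) + (Ln (\<sigma> * u (x0 + R) + of_real \<epsilon>) - Ln (\<sigma> * u (x0 - R) + of_real \<epsilon>))) \<longlongrightarrow>
       J w0 + (Ln (\<sigma> * u (x0 + R)) - Ln (\<sigma> * u (x0 - R)))) (at_right 0)"
      by (intro tendsto_add tendsto_diff Jlim Lnlim) (use R in auto)
    \<comment> \<open>The winding numbers involved are \<open>0\<close> or \<open>1\<close>, so the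
      expression stays in a closed set of two values and so does its limit.\<close>
    then have "J w0 + (Ln (\<sigma> * u (x0 + R)) - Ln (\<sigma> * u (x0 - R))) \<in> {0, 2 * of_real pi * \<i>}"
    proof (rule Lim_in_closed_set[rotated 3])
      show "\<forall>\<^sub>F \<epsilon> in at_right 0. J (z \<epsilon>) + (Ln (\<sigma> * u (x0 + R) + of_real \<epsilon>) - Ln (\<sigma> * u (x0 - R) + of_real \<epsilon>)) \<in> {0, 2 * of_real pi * \<i>}"
        unfolding eventually_at_right_field using kap(1) eq by (intro exI[of _ "\<kappa>"]) auto
    qed (auto simp: trivial_limit_at_right_real)
    then show ?thesis by (simp add: algebra_simps)
  qed
  define a where "a = u (x0 + R)"
  define b where "b = - u (x0 - R)"
  have ab: "Re a > 0" "Re b > 0" using Reu[of "x0+R"] Reu[of "x0-R"] R by (auto simp: a_def b_def abs_if split: if_splits)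
  have m1: "J w0 + Ln (\<i> * a) - Ln (\<i> * (- b)) \<in> {0, 2 * of_real pi * \<i>}" using main[of \<i>] by (simp add: a_def b_def)
  have m2: "J w0 + Ln (- \<i> * a) - Ln (- \<i> * (- b)) \<in> {0, 2 * of_real pi * \<i>}" using main[of "-\<i>"] by (simp add: a_def b_def)
  \<comment> \<open>The two sides put \<open>X + i pi\<close> and \<open>X - i pi\<close> both into
    \<open>{0, 2 pi i}\<close>, and \<open>X = i pi\<close> is the only solution. It never has to be
    decided which side is inside.\<close>
  define h where "h = \<i> * of_real (pi / 2)"
  define X where "X = J w0 + Ln a - Ln b"
  have hh: "h + h = \<i> * of_real pi" by (simp add: h_def)
  have b: "Ln (\<i> * (- b)) = Ln b - h" "Ln (- \<i> * (- b)) = Ln b + h"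
    using Ln_imaginary_rotations[OF ab(2)] by (simp_all add: h_def)
  have a: "Ln (\<i> * a) = Ln a + h" "Ln (- \<i> * a) = Ln a - h"
    using Ln_imaginary_rotations[OF ab(1)] by (simp_all add: h_def)
  have "J w0 + Ln (\<i> * a) - Ln (\<i> * (- b)) = X + (h + h)" "J w0 + Ln (- \<i> * a) - Ln (- \<i> * (- b)) = X - (h + h)"
    unfolding a b X_def by simp_all
  then have m: "X + \<i> * of_real pi \<in> {0, 2 * of_real pi * \<i>}" "X - \<i> * of_real pi \<in> {0, 2 * of_real pi * \<i>}"
    using m1 m2 unfolding hh by auto
  have "Im X + pi = 0 \<or> Im X + pi = 2 * pi" "Re X = 0" "Im X - pi = 0 \<or> Im X - pi = 2 * pi"
    using m by (auto simp: complex_eq_iff)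
  then have "X = \<i> * of_real pi" using pi_gt_zero by (auto simp: complex_eq_iff)
  then have "J w0 = \<i> * of_real pi + Ln b - Ln a" by (simp add: X_def algebra_simps)
  moreover have "b = (nat_par (x0 - R) - w0) / (- e)" "a = (nat_par (x0 + R) - w0) / e" by (simp_all add: a_def b_def u_def)
  ultimately show ?thesis by (simp add: J_def w0_def)
qed


lemma compact_truncation: "compact {x\<in>{0..len}. R \<le> cmod (nat_par x - w)}"
proof -
  have "closed ({0..len} \<inter> (\<lambda>x. cmod (nat_par x - w)) -` {R..})"
    by (intro continuous_closed_preimage continuous_intros nat_par_cont)
  moreover have "{0..len} \<inter> (\<lambda>x. cmod (nat_par x - w)) -` {R..} = {x\<in>{0..len}. R \<le> cmod (nat_par x - w)}" by auto
  moreover have "bounded {x\<in>{0..len}. R \<le> cmod (nat_par x - w)}" by (rule bounded_subset[of "{0..len}"]) auto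
  ultimately show ?thesis by (simp add: compact_eq_bounded_closed)
qed

text \<open>Truncation by distance in the plane and symmetric truncation in the parameter differ by
  a set \<open>E\<close> whose measure is small compared with \<open>R\<close>, while the kernel is
  of order \<open>1/R\<close> on it; so both have the same limit. For the symmetric truncation the
  two logarithms tend to \<open>0\<close>, because the normalized chords tend to
  \<open>1\<close>.\<close>

lemma pv_integral_1:
  assumes ccw: "counterclockwise_about_0 p"
  obtains N where "negligible N"
    "\<And>x0. x0 \<in> {0<..<len} - N \<Longrightarrow>
      ((\<lambda>R. integral {x\<in>{0..len}. R \<le> cmod (nat_par x - nat_par x0)} (\<lambda>x. 1 / (nat_par x - nat_par x0) * dpar x)) \<longlongrightarrow> \<i> * of_real pi) (at_right 0)"
proof -
  obtain N where N: "negligible N" "\<And>s. s \<in> {0<..<len} - N \<Longrightarrow> (nat_par has_vector_derivative dpar s) (at s) \<and> cmod (dpar s) = 1"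
    using dpar_unit by metis
  show thesis
  proof (rule that[OF N(1)])
    fix x0 assume x0: "x0 \<in> {0<..<len} - N"
    define e where "e = dpar x0"
    define w0 where "w0 = nat_par x0"
    have e: "cmod e = 1" "e \<noteq> 0" using N(2)[OF x0] by (auto simp: e_def)
    have x00: "x0 \<in> {0<..<len}" using x0 by auto
    have der: "\<exists>d>0. \<forall>y. \<bar>y - x0\<bar> < d \<longrightarrow> cmod ((nat_par y - w0) / e - of_real (y - x0)) \<le> \<epsilon> * \<bar>y - x0\<bar>" if eps: "\<epsilon> > 0" for \<epsilon>
    proof -
      have "(nat_par has_derivative (\<lambda>h. h *\<^sub>R e)) (at x0)" using N(2)[OF x0] by (simp add: has_vector_derivative_def e_def)
      then obtain d where d: "d > 0" "\<And>y. norm (y - x0) < d \<Longrightarrow> norm (nat_par y - nat_par x0 - (y - x0) *\<^sub>R e) \<le> \<epsilon> * norm (y - x0)"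
        unfolding has_derivative_at_alt using eps by blast
      show ?thesis
      proof (intro exI[of _ d] conjI allI impI d(1))
        fix y assume "\<bar>y - x0\<bar> < d"
        then have "norm (nat_par y - nat_par x0 - (y - x0) *\<^sub>R e) \<le> \<epsilon> * \<bar>y - x0\<bar>" using d(2)[of y] by simp
        moreover have "(nat_par y - w0) / e - of_real (y - x0) = (nat_par y - nat_par x0 - (y - x0) *\<^sub>R e) / e"
          using e(2) by (simp add: w0_def field_simps scaleR_conv_of_real)
        ultimately show "cmod ((nat_par y - w0) / e - of_real (y - x0)) \<le> \<epsilon> * \<bar>y - x0\<bar>" using e(1) by (simp add: norm_divide)
      qed
    qed
    define f where "f x = 1 / (nat_par x - w0) * dpar x" for x
    define O_R where "O_R R = {0..x0-R} \<union> {x0+R..len}" for R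
    define S_R where "S_R R = {x\<in>{0..len}. R \<le> cmod (nat_par x - w0)}" for R
    \<comment> \<open>Chords divided by \<open>e\<close> and by \<open>R\<close>, with opposite
      signs on the two sides. The common factor \<open>R\<close> drops out of the difference of the
      logarithms.\<close>
    define A where "A R = (nat_par (x0 + R) - w0) / e / of_real R" for R
    define B where "B R = (nat_par (x0 - R) - w0) / (- e) / of_real R" for R
    have ABlim: "(A \<longlongrightarrow> 1) (at_right 0)" "(B \<longlongrightarrow> 1) (at_right 0)"
    proof -
      have *: "\<forall>\<^sub>F R in at_right 0. dist (A R) 1 < \<epsilon> \<and> dist (B R) 1 < \<epsilon>" if eps: "\<epsilon> > 0" for \<epsilon>
      proof -
        obtain d where d: "d > 0" "\<And>y. \<bar>y - x0\<bar> < d \<Longrightarrow> cmod ((nat_par y - w0) / e - of_real (y - x0)) \<le> \<epsilon>/2 * \<bar>y - x0\<bar>"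
          using der[of "\<epsilon>/2"] eps by (meson half_gt_zero)
        have "dist (A R) 1 < \<epsilon> \<and> dist (B R) 1 < \<epsilon>" if R: "0 < R" "R < d" for R
        proof
          have "A R - 1 = ((nat_par (x0 + R) - w0) / e - of_real (x0 + R - x0)) / of_real R" using R by (simp add: A_def diff_divide_distrib)
          then have "dist (A R) 1 = cmod ((nat_par (x0 + R) - w0) / e - of_real (x0 + R - x0)) / R" using R unfolding dist_norm by (simp only: norm_divide) simp
          also have "\<dots> \<le> \<epsilon>/2" using d(2)[of "x0 + R"] R by (simp add: field_simps)
          finally show "dist (A R) 1 < \<epsilon>" using \<open>\<epsilon> > 0\<close> by simp
          have "B R - 1 = - ((nat_par (x0 - R) - w0) / e - of_real (x0 - R - x0)) / of_real R" using R by (simp add: B_def diff_divide_distrib add_divide_distrib)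
          then have "dist (B R) 1 = cmod ((nat_par (x0 - R) - w0) / e - of_real (x0 - R - x0)) / R" using R unfolding dist_norm by (simp only: norm_divide norm_minus_cancel) simp
          also have "\<dots> \<le> \<epsilon>/2" using d(2)[of "x0 - R"] R by (simp add: field_simps)
          finally show "dist (B R) 1 < \<epsilon>" using \<open>\<epsilon> > 0\<close> by simp
        qed
        then show ?thesis unfolding eventually_at_right_field using d(1) by (intro exI[of _ d]) auto
      qed
      show "(A \<longlongrightarrow> 1) (at_right 0)" by (rule tendstoI, rule eventually_mono[OF *]) auto
      show "(B \<longlongrightarrow> 1) (at_right 0)" by (rule tendstoI, rule eventually_mono[OF *]) auto
    qed
    obtain d0 where d0: "d0 > 0" "\<And>y. \<bar>y - x0\<bar> < d0 \<Longrightarrow> cmod ((nat_par y - w0) / e - of_real (y - x0)) \<le> 1/2 * \<bar>y - x0\<bar>"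
      using der[of "1/2"] by auto
    define d1 where "d1 = min d0 (min x0 (len - x0))"
    have d1: "d1 > 0" using d0 x00 by (simp add: d1_def)
    have Jeq: "integral (O_R R) f = \<i> * of_real pi + Ln (B R) - Ln (A R)" if R: "0 < R" "R < d1" for R
    proof -
      have "integral (O_R R) f = \<i> * of_real pi + Ln ((nat_par (x0 - R) - w0) / (- e)) - Ln ((nat_par (x0 + R) - w0) / e)"
        unfolding O_R_def f_def w0_def
      proof (rule symmetric_pv_integral[OF ccw x00 R(1) _ _ e(1)])
        fix x assume "\<bar>x - x0\<bar> \<le> R"
        then show "cmod ((nat_par x - nat_par x0) / e - of_real (x - x0)) \<le> \<bar>x - x0\<bar> / 2"
          using d0(2)[of x] R by (simp add: d1_def w0_def)
      qed (use R in \<open>auto simp: d1_def\<close>)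
      moreover have nz: "A R \<noteq> 0" "B R \<noteq> 0"
        using R nat_par_inj[of x0 "x0+R"] nat_par_inj[of x0 "x0-R"] x00 e by (auto simp: A_def B_def w0_def d1_def)
      have "(nat_par (x0 + R) - w0) / e = of_real R * A R" "(nat_par (x0 - R) - w0) / (- e) = of_real R * B R"
        using R by (simp_all add: A_def B_def)
      ultimately show ?thesis using Ln_times_of_real[OF R(1) nz(1)] Ln_times_of_real[OF R(1) nz(2)] by simp
    qed
    have Jlim: "((\<lambda>R. integral (O_R R) f) \<longlongrightarrow> \<i> * of_real pi) (at_right 0)"
    proof (rule Lim_transform_eventually)
      show "((\<lambda>R. \<i> * of_real pi + Ln (B R) - Ln (A R)) \<longlongrightarrow> \<i> * of_real pi) (at_right 0)"
        using tendsto_diff[OF tendsto_add[OF tendsto_const tendsto_Ln[OF ABlim(2)]] tendsto_Ln[OF ABlim(1)], of "\<i> * of_real pi"] by simp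
      show "\<forall>\<^sub>F R in at_right 0. \<i> * of_real pi + Ln (B R) - Ln (A R) = integral (O_R R) f"
        unfolding eventually_at_right_field using d1 Jeq by (intro exI[of _ d1]) auto
    qed
    have dlim: "((\<lambda>R. integral (O_R R) f - integral (S_R R) f) \<longlongrightarrow> 0) (at_right 0)"
    proof (rule tendstoI)
      fix \<epsilon>0 :: real assume eps0: "\<epsilon>0 > 0"
      \<comment> \<open>\<open>\<epsilon> \<le> 1/2\<close> gives
        \<open>1 / (1 - \<epsilon>) \<le> 2\<close>, so the final estimate
        \<open>4 * \<epsilon> / (1 - \<epsilon>)\<close> is at most \<open>8 * \<epsilon>\<close>,
        which is at most half of \<open>\<epsilon>0\<close>.\<close>
      define \<epsilon> where "\<epsilon> = min (1/2) (\<epsilon>0 / 16)"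
      have eps: "\<epsilon> > 0" "\<epsilon> \<le> 1/2" "\<epsilon> \<le> \<epsilon>0 / 16" using eps0 by (auto simp: \<epsilon>_def)
      obtain d where d: "d > 0" "\<And>y. \<bar>y - x0\<bar> < d \<Longrightarrow> cmod ((nat_par y - w0) / e - of_real (y - x0)) \<le> \<epsilon> * \<bar>y - x0\<bar>"
        using der[of \<epsilon>] eps by auto
      obtain \<kappa> where kap: "\<kappa> > 0" "\<And>x. x \<in> {0..len} \<Longrightarrow> d \<le> \<bar>x - x0\<bar> \<Longrightarrow> \<kappa> \<le> cmod (nat_par x - w0)"
      proof -
        define F where "F = {0..len} \<inter> {x. d \<le> \<bar>x - x0\<bar>}"
        show thesis
        proof (cases "F = {}")
          case True
          show ?thesis
          proof (rule that[of 1])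
            fix x assume "x \<in> {0..len}" "d \<le> \<bar>x - x0\<bar>"
            then have "x \<in> F" by (simp add: F_def)
            then show "1 \<le> cmod (nat_par x - w0)" using True by simp
          qed simp
        next
          case False
          have "compact F" unfolding F_def by (intro compact_Int_closed closed_Collect_le continuous_intros) auto
          moreover have "continuous_on F (\<lambda>x. cmod (nat_par x - w0))" unfolding F_def by (intro continuous_intros continuous_on_subset[OF nat_par_cont]) auto
          ultimately have "\<exists>x\<in>F. \<forall>y\<in>F. cmod (nat_par x - w0) \<le> cmod (nat_par y - w0)"
            using continuous_attains_inf[of F "\<lambda>x. cmod (nat_par x - w0)"] False by simp
          then obtain x where x: "x \<in> F" "\<And>y. y \<in> F \<Longrightarrow> cmod (nat_par x - w0) \<le> cmod (nat_par y - w0)" by blast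
          have "nat_par x \<noteq> w0" using nat_par_inj[of x0 x] x(1) x00 d(1) by (auto simp: F_def w0_def)
          then show ?thesis
          proof (intro that[of "cmod (nat_par x - w0)"])
            fix y assume "y \<in> {0..len}" "d \<le> \<bar>y - x0\<bar>"
            then have "y \<in> F" by (simp add: F_def)
            then show "cmod (nat_par x - w0) \<le> cmod (nat_par y - w0)" by (rule x(2))
          qed (use \<open>nat_par x \<noteq> w0\<close> in simp)
        qed
      qed
      have bnd: "cmod (integral (O_R R) f - integral (S_R R) f) < \<epsilon>0" if R: "0 < R" "R < min \<kappa> d1" for R
      proof -
        have O: "compact (O_R R)" "O_R R \<subseteq> {0..len}" using R x00 by (auto simp: O_R_def d1_def)
        have Sc: "compact (S_R R)" unfolding S_R_def by (rule compact_truncation)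
        \<comment> \<open>A chord is no longer than its parameter interval, so truncation by
          distance removes at least what the symmetric truncation removes.\<close>
        have SO: "S_R R \<subseteq> O_R R"
        proof
          fix x assume x: "x \<in> S_R R"
          then have "R \<le> dist (nat_par x) (nat_par x0)" by (auto simp: S_R_def w0_def dist_norm)
          also have "\<dots> \<le> 1 * dist x x0" using x x00 by (intro lipschitz_onD[OF nat_par_lipschitz]) (auto simp: S_R_def)
          finally have "R \<le> \<bar>x - x0\<bar>" by (simp add: dist_real_def)
          then show "x \<in> O_R R" using x by (auto simp: O_R_def S_R_def abs_if split: if_splits)
        qed
        define E where "E = O_R R - S_R R"
        have Em: "O_R R \<in> lmeasurable" "S_R R \<in> lmeasurable" "E \<in> lmeasurable"
          unfolding E_def by (rule lmeasurable_compact[OF O(1)], rule lmeasurable_compact[OF Sc],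
            rule fmeasurable.Diff[OF lmeasurable_compact[OF O(1)] lmeasurable_compact[OF Sc]])
        have Onz: "nat_par x \<noteq> w0" if "x \<in> O_R R" for x
          using nat_par_inj[of x0 x] that x00 R unfolding w0_def O_R_def d1_def by auto
        have fO: "f absolutely_integrable_on (O_R R)" unfolding f_def
          by (rule continuous_mult_dpar_integrable[OF _ O]) (use Onz in \<open>auto intro!: continuous_intros continuous_on_subset[OF nat_par_cont O(2)]\<close>)
        have fS: "f absolutely_integrable_on (S_R R)" by (rule set_integrable_subset[OF fO]) (use SO Em in auto)
        have fE: "f absolutely_integrable_on E" by (rule set_integrable_subset[OF fO]) (use Em in \<open>auto simp: E_def\<close>)
        have "(f has_integral (integral (S_R R) f + integral E f)) (S_R R \<union> E)"
          using fS fE by (intro has_integral_Un integrable_integral) (auto simp: E_def dest: set_lebesgue_integral_eq_integral(1))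
        moreover have "S_R R \<union> E = O_R R" using SO by (auto simp: E_def)
        ultimately have eqE: "integral (O_R R) f - integral (S_R R) f = integral E f" by (simp add: integral_unique)
        have Ex: "R \<le> \<bar>x - x0\<bar> \<and> (1 - \<epsilon>) * \<bar>x - x0\<bar> \<le> cmod (nat_par x - w0) \<and> cmod (nat_par x - w0) < R" if xE: "x \<in> E" for x
        proof -
          have x: "x \<in> {0..len}" "R \<le> \<bar>x - x0\<bar>" "cmod (nat_par x - w0) < R" using xE O(2) R(1) by (auto simp: E_def O_R_def S_R_def)
          then have "\<bar>x - x0\<bar> < d" using kap(2)[OF x(1)] R by force
          then have "cmod ((nat_par x - w0) / e - of_real (x - x0)) \<le> \<epsilon> * \<bar>x - x0\<bar>" by (rule d(2))
          moreover have "cmod (of_real (x - x0) :: complex) \<le> cmod ((nat_par x - w0) / e) + cmod ((nat_par x - w0) / e - of_real (x - x0))"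
            using norm_triangle_ineq4[of "(nat_par x - w0) / e" "(nat_par x - w0) / e - of_real (x - x0)"] by simp
          moreover have "cmod ((nat_par x - w0) / e) = cmod (nat_par x - w0)" using e by (simp add: norm_divide)
          moreover have "cmod (of_real (x - x0) :: complex) = \<bar>x - x0\<bar>" by (simp only: norm_of_real)
          ultimately show ?thesis using x by (simp add: algebra_simps)
        qed
        have E1: "cmod (integral E f) \<le> 1 / ((1 - \<epsilon>) * R) * measure lebesgue E"
          unfolding f_def
        proof (rule mult_dpar_integral_bound)
          show "(\<lambda>x. 1 / (nat_par x - w0) * dpar x) absolutely_integrable_on E" using fE by (simp add: f_def[abs_def])
          show "E \<subseteq> {0..len}" using O(2) by (auto simp: E_def)
          fix x assume x: "x \<in> E"
          have "(1 - \<epsilon>) * R \<le> (1 - \<epsilon>) * \<bar>x - x0\<bar>" using Ex[OF x] eps by (intro mult_left_mono) auto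
          then have "(1 - \<epsilon>) * R \<le> cmod (nat_par x - w0)" using Ex[OF x] by linarith
          moreover have "0 < (1 - \<epsilon>) * R" using eps R by (intro mult_pos_pos) auto
          ultimately show "cmod (1 / (nat_par x - w0)) \<le> 1 / ((1 - \<epsilon>) * R)" by (simp add: norm_divide frac_le)
        qed (rule Em)
        \<comment> \<open>On either side of \<open>x0\<close> the parameter distance of a point of
          \<open>E\<close> lies between \<open>R\<close> and
          \<open>R / (1 - \<epsilon>)\<close>.\<close>
        have "measure lebesgue E \<le> 4 * \<epsilon> * R"
        proof -
          have "E \<subseteq> {x0 - R / (1 - \<epsilon>)..x0 - R} \<union> {x0 + R..x0 + R / (1 - \<epsilon>)}"
          proof
            fix x assume x: "x \<in> E"
            then have "(1 - \<epsilon>) * \<bar>x - x0\<bar> < R" "R \<le> \<bar>x - x0\<bar>" using Ex[OF x] by auto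
            then have "\<bar>x - x0\<bar> < R / (1 - \<epsilon>)" using eps by (simp add: field_simps)
            then show "x \<in> {x0 - R / (1 - \<epsilon>)..x0 - R} \<union> {x0 + R..x0 + R / (1 - \<epsilon>)}"
              using \<open>R \<le> \<bar>x - x0\<bar>\<close> by (auto simp: abs_if split: if_splits)
          qed
          then have "measure lebesgue E \<le> measure lebesgue ({x0 - R / (1 - \<epsilon>)..x0 - R} \<union> {x0 + R..x0 + R / (1 - \<epsilon>)})"
            using Em(3) by (intro measure_mono_fmeasurable fmeasurable.Un) (auto intro: fmeasurableD)
          also have "\<dots> \<le> measure lebesgue {x0 - R / (1 - \<epsilon>)..x0 - R} + measure lebesgue {x0 + R..x0 + R / (1 - \<epsilon>)}"
            by (rule measure_Un_le) auto
          also have "\<dots> = 2 * (R / (1 - \<epsilon>) - R)"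
          proof -
            have "R \<le> R / (1 - \<epsilon>)" using R eps by (simp add: field_simps)
            then show ?thesis by simp
          qed
          also have "R / (1 - \<epsilon>) - R = \<epsilon> / (1 - \<epsilon>) * R" using eps by (simp add: field_simps)
          also have "\<dots> \<le> (2 * \<epsilon>) * R" using eps R by (intro mult_right_mono) (auto simp: field_simps)
          finally show ?thesis by (simp add: mult.assoc)
        qed
        then have "1 / ((1 - \<epsilon>) * R) * measure lebesgue E \<le> 1 / ((1 - \<epsilon>) * R) * (4 * \<epsilon> * R)"
          using eps R by (intro mult_left_mono) auto
        also have "1 / ((1 - \<epsilon>) * R) * (4 * \<epsilon> * R) = 4 * \<epsilon> / (1 - \<epsilon>)" using R by simp
        also have "\<dots> \<le> 8 * \<epsilon>" using eps by (simp add: field_simps)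
        also have "\<dots> < \<epsilon>0" using eps eps0 by simp
        finally show ?thesis unfolding eqE using E1 by simp
      qed
      have "min \<kappa> d1 > 0" using kap(1) d1 by simp
      then show "\<forall>\<^sub>F R in at_right 0. dist (integral (O_R R) f - integral (S_R R) f) 0 < \<epsilon>0"
        unfolding eventually_at_right_field using bnd by (intro exI[of _ "min \<kappa> d1"]) auto
    qed
    have "((\<lambda>R. integral (S_R R) f) \<longlongrightarrow> \<i> * of_real pi) (at_right 0)"
      using tendsto_diff[OF Jlim dlim] by simp
    then show "((\<lambda>R. integral {x\<in>{0..len}. R \<le> cmod (nat_par x - nat_par x0)} (\<lambda>x. 1 / (nat_par x - nat_par x0) * dpar x)) \<longlongrightarrow> \<i> * of_real pi) (at_right 0)"
      by (simp add: S_R_def f_def[abs_def] w0_def)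
  qed
qed

end

section \<open>The length measure\<close>

lemma measurable_completion_AE:
  fixes f g :: "'a \<Rightarrow> 'b::topological_space"
  assumes g: "g \<in> borel_measurable M" and ae: "AE x in M. f x = g x"
  shows "f \<in> borel_measurable (completion M)"
proof (rule measurableI)
  fix A :: "'b set" assume A: "A \<in> sets borel"
  obtain N where N: "N \<in> null_sets M" "{x \<in> space M. f x \<noteq> g x} \<subseteq> N" using ae unfolding eventually_ae_filter by auto
  have Ns: "N \<in> null_sets (completion M)" using N(1) by (rule null_sets_completionI)
  have "f -` A \<inter> N \<inter> space M \<in> null_sets (completion M)"
    by (rule null_sets_completion_subset[OF _ Ns]) auto
  moreover have "g -` A \<inter> space M - N \<in> sets (completion M)" using measurable_sets[OF g A] N(1) by (auto intro!: sets_completionI_sets sets.Diff)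
  ultimately have "(f -` A \<inter> N \<inter> space M) \<union> (g -` A \<inter> space M - N) \<in> sets (completion M)" by auto
  moreover have "f -` A \<inter> space (completion M) = (f -` A \<inter> N \<inter> space M) \<union> (g -` A \<inter> space M - N)" using N(2) by auto
  ultimately show "f -` A \<inter> space (completion M) \<in> sets (completion M)" by simp
qed auto

lemma completion_ex_borel_measurable_complex:
  fixes f :: "'a \<Rightarrow> complex"
  assumes f: "f \<in> borel_measurable (completion M)"
  shows "\<exists>g\<in>borel_measurable M. AE x in M. f x = g x"
proof -
  obtain a where a: "a \<in> borel_measurable M" "AE x in M. Re (f x) = a x"
    using completion_ex_borel_measurable_real[of "\<lambda>x. Re (f x)" M] f by auto
  obtain b where b: "b \<in> borel_measurable M" "AE x in M. Im (f x) = b x"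
    using completion_ex_borel_measurable_real[of "\<lambda>x. Im (f x)" M] f by auto
  show ?thesis
  proof (intro bexI[of _ "\<lambda>x. Complex (a x) (b x)"])
    show "AE x in M. f x = Complex (a x) (b x)" using a(2) b(2) by eventually_elim (simp add: complex_eq_iff)
    have "(\<lambda>x. of_real (a x) + \<i> * of_real (b x)) \<in> borel_measurable M" using a b by measurable
    then show "(\<lambda>x. Complex (a x) (b x)) \<in> borel_measurable M" by (simp add: Complex_eq)
  qed
qed

context rectifiable_loop begin

text \<open>The length measure before completion. Push-forward arguments are carried out for it and
  then transferred to \<open>LM\<close>.\<close>

definition base_measure :: "complex measure" where
  "base_measure = distr (restrict_space lborel {0..len}) (restrict_space borel (path_image p)) nat_par"

abbreviation "LM \<equiv> length_measure p"

lemma LM_eq: "LM = completion base_measure"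
  by (simp add: length_measure_def base_measure_def len_def nat_par_def)

lemma space_base [simp]: "space base_measure = path_image p"
  and sets_base: "sets base_measure = sets (restrict_space borel (path_image p))"
  by (simp_all add: base_measure_def space_restrict_space)

lemma space_LM [simp]: "space LM = path_image p"
  by (simp add: LM_eq)

lemma AE_LM_iff: "(AE \<tau> in LM. P \<tau>) \<longleftrightarrow> (AE \<tau> in base_measure. P \<tau>)"
  unfolding LM_eq by (rule AE_completion_iff)

lemma nat_par_measurable: "nat_par \<in> measurable (restrict_space lborel {0..len}) (restrict_space borel (path_image p))"
proof (rule measurable_restrict_space2)
  show "nat_par \<in> space (restrict_space lborel {0..len}) \<rightarrow> path_image p"
    using nat_par_image by (auto simp: space_restrict_space)
  have "nat_par \<in> borel_measurable (restrict_space borel {0..len})"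
    by (rule borel_measurable_continuous_on_restrict[OF nat_par_cont])
  then show "nat_par \<in> borel_measurable (restrict_space lborel {0..len})"
    by (simp cong: measurable_cong_sets sets_restrict_space_cong)
qed

section \<open>Null sets, measurability and integrals through the parametrization\<close>

definition inv_par :: "complex \<Rightarrow> real" where "inv_par = the_inv_into {0..<len} nat_par"

lemma inv_par: "s \<in> {0..<len} \<Longrightarrow> inv_par (nat_par s) = s"
  "\<tau> \<in> path_image p \<Longrightarrow> inv_par \<tau> \<in> {0..<len}" "\<tau> \<in> path_image p \<Longrightarrow> nat_par (inv_par \<tau>) = \<tau>"
  unfolding inv_par_def nat_par_image'[symmetric]
  by (rule the_inv_into_f_f[OF nat_par_inj_on] the_inv_into_into[OF nat_par_inj_on _ order_refl] f_the_inv_into_f[OF nat_par_inj_on]; assumption)+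

text \<open>For \<open>0 \<le> a < len\<close> the sublevel set is the image of the compact interval
  \<open>[0, a]\<close>. Continuity cannot be invoked, since \<open>inv_par\<close> jumps at the
  base point of the curve.\<close>

lemma inv_par_measurable: "inv_par \<in> borel_measurable base_measure"
proof (rule borel_measurableI_le)
  fix a :: real
  have "{\<tau> \<in> path_image p. inv_par \<tau> \<le> a} \<in> sets borel"
  proof (cases "a < 0")
    case True
    then have "{\<tau> \<in> path_image p. inv_par \<tau> \<le> a} = {}" using inv_par(2) by force
    then show ?thesis by (simp only: sets.empty_sets)
  next
    case a0: False
    show ?thesis
    proof (cases "a < len")
      case True
      have "{\<tau> \<in> path_image p. inv_par \<tau> \<le> a} = nat_par ` {0..a}"
      proof (intro equalityI subsetI)
        fix \<tau> assume "\<tau> \<in> {\<tau> \<in> path_image p. inv_par \<tau> \<le> a}"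
        then show "\<tau> \<in> nat_par ` {0..a}" using inv_par(2,3)[of \<tau>] by (metis (mono_tags, lifting) atLeastAtMost_iff atLeastLessThan_iff image_eqI mem_Collect_eq)
      next
        fix \<tau> assume "\<tau> \<in> nat_par ` {0..a}"
        then obtain s where "s \<in> {0..a}" "\<tau> = nat_par s" by auto
        then show "\<tau> \<in> {\<tau> \<in> path_image p. inv_par \<tau> \<le> a}" using True inv_par(1)[of s] nat_par_image' by auto
      qed
      moreover have "compact (nat_par ` {0..a})"
        by (intro compact_continuous_image continuous_on_subset[OF nat_par_cont]) (use True in auto)
      ultimately show ?thesis by (simp add: borel_compact)
    next
      case False
      then have "{\<tau> \<in> path_image p. inv_par \<tau> \<le> a} = path_image p" using inv_par(2) by force
      moreover have "compact (path_image p)" using simple by (simp add: compact_path_image simple_path_imp_path)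
      ultimately show ?thesis by (simp add: borel_compact)
    qed
  qed
  then have "{\<tau> \<in> path_image p. inv_par \<tau> \<le> a} \<in> sets (restrict_space borel (path_image p))"
    by (subst sets_restrict_space) (auto simp: image_iff intro!: exI[of _ "{\<tau> \<in> path_image p. inv_par \<tau> \<le> a}"] bexI[of _ "{\<tau> \<in> path_image p. inv_par \<tau> \<le> a}"])
  then show "{\<tau> \<in> space base_measure. inv_par \<tau> \<le> a} \<in> sets base_measure" by (simp add: sets_base)
qed

lemma AE_LM_D:
  assumes "AE \<tau> in LM. P \<tau>"
  obtains N where "negligible N" "\<And>s. s \<in> {0..len} - N \<Longrightarrow> P (nat_par s)"
proof -
  have "AE \<tau> in base_measure. P \<tau>" using assms by (simp only: AE_LM_iff)
  then have "AE s in restrict_space lborel {0..len}. P (nat_par s)"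
    unfolding base_measure_def by (rule AE_distrD[OF nat_par_measurable])
  then have "AE s in lborel. s \<in> {0..len} \<longrightarrow> P (nat_par s)" by (simp add: AE_restrict_space_iff)
  then obtain N where N: "N \<in> null_sets lborel" "{s \<in> space lborel. \<not> (s \<in> {0..len} \<longrightarrow> P (nat_par s))} \<subseteq> N"
    unfolding eventually_ae_filter by auto
  show thesis
    by (rule that[of N]) (use N null_sets_completionI[OF N(1)] in \<open>auto simp: negligible_iff_null_sets\<close>)
qed

text \<open>The exceptional parameters are enlarged to a Borel null set that contains
  \<open>0\<close> and \<open>len\<close>; its preimage under \<open>inv_par\<close> is a measurable
  null set of the curve. Because of the enlargement \<open>P\<close> has to be tested only at
  interior parameters.\<close>

lemma AE_LM_I:
  assumes N: "negligible N" and P: "\<And>s. s \<in> {0<..<len} - N \<Longrightarrow> P (nat_par s)"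
  shows "AE \<tau> in LM. P \<tau>"
proof -
  obtain N' where N': "N' \<in> null_sets lborel" "N \<subseteq> N'"
    using N unfolding negligible_iff_null_sets null_sets_completion_iff2 by blast
  define M where "M = N' \<union> {0, len}"
  have "finite {0, len}" by simp
  have M: "M \<in> null_sets lborel" unfolding M_def by (rule null_sets.Un[OF N'(1) finite_imp_null_set_lborel[OF \<open>finite {0, len}\<close>]])
  define B where "B = {\<tau> \<in> path_image p. inv_par \<tau> \<in> M}"
  have Ms: "M \<in> sets borel" using M by auto
  have Bs: "B \<in> sets base_measure"
    using measurable_sets[OF inv_par_measurable Ms] unfolding B_def by (simp add: vimage_def Int_def conj_commute)
  have "emeasure base_measure B = emeasure (restrict_space lborel {0..len}) (nat_par -` B \<inter> {0..len})"
    unfolding base_measure_def using Bs by (subst emeasure_distr[OF nat_par_measurable]) (auto simp: sets_base space_restrict_space)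
  also have "\<dots> = emeasure lborel (nat_par -` B \<inter> {0..len})"
    by (rule emeasure_restrict_space) auto
  also have "\<dots> \<le> emeasure lborel M"
  proof (rule emeasure_mono)
    show "nat_par -` B \<inter> {0..len} \<subseteq> M"
    proof
      fix s assume s: "s \<in> nat_par -` B \<inter> {0..len}"
      show "s \<in> M"
      proof (cases "s = len")
        case False
        then show ?thesis using s inv_par(1)[of s] by (auto simp: B_def)
      qed (simp add: M_def)
    qed
  qed (use M in auto)
  also have "\<dots> = 0" using M by auto
  finally have "B \<in> null_sets base_measure" using Bs by (auto simp: null_sets_def)
  moreover have "{\<tau> \<in> space base_measure. \<not> P \<tau>} \<subseteq> B"
  proof
    fix \<tau> assume t: "\<tau> \<in> {\<tau> \<in> space base_measure. \<not> P \<tau>}"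
    then have "\<tau> \<in> path_image p" by simp
    note i = inv_par(2)[OF this] inv_par(3)[OF this]
    have "inv_par \<tau> \<in> M"
    proof (rule ccontr)
      assume "inv_par \<tau> \<notin> M"
      then have "inv_par \<tau> \<in> {0<..<len} - N" using i(1) N'(2) by (auto simp: M_def order_le_less)
      then have "P \<tau>" using P[of "inv_par \<tau>"] i(2) by simp
      then show False using t by simp
    qed
    then show "\<tau> \<in> B" using \<open>\<tau> \<in> path_image p\<close> by (simp add: B_def)
  qed
  ultimately have "AE \<tau> in base_measure. P \<tau>" unfolding eventually_ae_filter by blast
  then show ?thesis by (simp only: AE_LM_iff)
qed

text \<open>\<open>f\<close> is measurable for the completed measure only, so a version
  \<open>g\<close> measurable for \<open>base_measure\<close> is taken through the push-forward. The
  two differ on a negligible set of parameters.\<close>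

lemma integral_LM:
  fixes f :: "complex \<Rightarrow> complex"
  assumes f: "f \<in> borel_measurable LM"
  shows "integrable LM f \<longleftrightarrow> (\<lambda>s. f (nat_par s)) absolutely_integrable_on {0..len}"
    and "integrable LM f \<Longrightarrow> integral\<^sup>L LM f = integral {0..len} (\<lambda>s. f (nat_par s))"
proof -
  obtain g where g: "g \<in> borel_measurable base_measure" "AE x in base_measure. f x = g x"
    using completion_ex_borel_measurable_complex f unfolding LM_eq by blast
  have fg: "AE x in LM. f x = g x" using g(2) by (simp only: AE_LM_iff)
  have gLM: "g \<in> borel_measurable LM" using g(1) unfolding LM_eq by (rule measurable_completion)
  obtain N where N: "negligible N" "\<And>s. s \<in> {0..len} - N \<Longrightarrow> f (nat_par s) = g (nat_par s)" using AE_LM_D[OF fg] by blast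
  have "integrable LM f \<longleftrightarrow> integrable LM g" by (rule integrable_cong_AE[OF f gLM fg])
  also have "\<dots> \<longleftrightarrow> integrable base_measure g" unfolding LM_eq by (rule integrable_completion[OF g(1)])
  also have "\<dots> \<longleftrightarrow> integrable (restrict_space lborel {0..len}) (\<lambda>s. g (nat_par s))"
    unfolding base_measure_def
    by (rule integrable_distr_eq[OF nat_par_measurable]) (use g(1) in \<open>simp add: base_measure_def\<close>)
  also have "\<dots> \<longleftrightarrow> set_integrable lborel {0..len} (\<lambda>s. g (nat_par s))"
    by (subst integrable_restrict_space) (auto simp: set_integrable_def)
  also have "\<dots> \<longleftrightarrow> (\<lambda>s. g (nat_par s)) absolutely_integrable_on {0..len}"
  proof -
    have "(\<lambda>s. g (nat_par s)) \<in> borel_measurable (restrict_space lborel {0..len})"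
      using measurable_comp[OF nat_par_measurable, of g borel] g(1) by (simp add: base_measure_def o_def)
    then have "(\<lambda>s. indicator {0..len} s *\<^sub>R g (nat_par s)) \<in> borel_measurable lborel"
      by (subst (asm) borel_measurable_restrict_space_iff) auto
    then show ?thesis unfolding set_integrable_def using integrable_completion by blast
  qed
  also have eq1: "\<dots> \<longleftrightarrow> (\<lambda>s. f (nat_par s)) absolutely_integrable_on {0..len}"
    by (rule absolutely_integrable_spike_eq[OF N(1)]) (use N(2) in auto)
  finally show iff: "integrable LM f \<longleftrightarrow> (\<lambda>s. f (nat_par s)) absolutely_integrable_on {0..len}" .
  assume "integrable LM f"
  then have gi: "(\<lambda>s. g (nat_par s)) absolutely_integrable_on {0..len}" using iff eq1 by simp
  have "integral\<^sup>L LM f = integral\<^sup>L LM g" by (rule integral_cong_AE[OF f gLM fg])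
  also have "\<dots> = integral\<^sup>L base_measure g" unfolding LM_eq by (rule integral_completion[OF g(1)])
  also have "\<dots> = integral\<^sup>L (restrict_space lborel {0..len}) (\<lambda>s. g (nat_par s))"
    unfolding base_measure_def by (rule integral_distr[OF nat_par_measurable]) (use g(1) in \<open>simp add: base_measure_def\<close>)
  also have "\<dots> = (LINT s:{0..len}|lborel. g (nat_par s))"
    by (subst integral_restrict_space) (auto simp: set_lebesgue_integral_def)
  also have "\<dots> = (LINT s:{0..len}|lebesgue. g (nat_par s))"
  proof -
    have "(\<lambda>s. g (nat_par s)) \<in> borel_measurable (restrict_space lborel {0..len})"
      using measurable_comp[OF nat_par_measurable, of g borel] g(1) by (simp add: base_measure_def o_def)
    then have "(\<lambda>s. indicator {0..len} s *\<^sub>R g (nat_par s)) \<in> borel_measurable lborel"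
      by (subst (asm) borel_measurable_restrict_space_iff) auto
    then show ?thesis unfolding set_lebesgue_integral_def by (rule integral_completion[symmetric])
  qed
  also have "\<dots> = integral {0..len} (\<lambda>s. g (nat_par s))" by (rule set_lebesgue_integral_eq_integral(2)[OF gi])
  also have "\<dots> = integral {0..len} (\<lambda>s. f (nat_par s))" by (rule integral_spike[OF N(1)]) (use N(2) in auto)
  finally show "integral\<^sup>L LM f = integral {0..len} (\<lambda>s. f (nat_par s))" .
qed

lemma unit_tangent_nat_par: "s \<in> {0..<len} \<Longrightarrow> unit_tangent p (nat_par s) = dpar s"
  using nat_par_inj_on by (simp add: unit_tangent_def dpar_def nat_par_def len_def)

lemma unit_tangent_norm: "AE \<tau> in LM. cmod (unit_tangent p \<tau>) = 1"
proof -
  obtain N where N: "negligible N" "\<And>s. s \<in> {0<..<len} - N \<Longrightarrow> (nat_par has_vector_derivative dpar s) (at s) \<and> cmod (dpar s) = 1"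
    using dpar_unit by metis
  show ?thesis by (rule AE_LM_I[OF N(1)]) (use N(2) unit_tangent_nat_par in auto)
qed

text \<open>\<open>dpar\<close> is Lebesgue measurable and agrees almost everywhere with a Borel
  function \<open>G\<close>; the composite of \<open>G\<close> with \<open>inv_par\<close> is then a
  measurable version of the tangent.\<close>

lemma unit_tangent_measurable: "unit_tangent p \<in> borel_measurable LM"
proof -
  have "(\<lambda>x. 1 * dpar x) absolutely_integrable_on {0..len}"
    by (rule continuous_mult_dpar_integrable) auto
  then have "(\<lambda>s. indicator {0..len} s *\<^sub>R dpar s) \<in> borel_measurable lebesgue"
    by (simp add: set_integrable_def borel_measurable_integrable)
  then obtain G where G: "G \<in> borel_measurable lborel" "AE s in lborel. indicator {0..len} s *\<^sub>R dpar s = G s"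
    using completion_ex_borel_measurable_complex[of "\<lambda>s. indicator {0..len} s *\<^sub>R dpar s" lborel] by auto
  then obtain N where N: "N \<in> null_sets lborel" "{s \<in> space lborel. indicator {0..len} s *\<^sub>R dpar s \<noteq> G s} \<subseteq> N"
    unfolding eventually_ae_filter by auto
  have "negligible N" using null_sets_completionI[OF N(1)] by (simp add: negligible_iff_null_sets)
  then have "AE \<tau> in LM. unit_tangent p \<tau> = G (inv_par \<tau>)"
  proof (rule AE_LM_I)
    fix s assume s: "s \<in> {0<..<len} - N"
    have "s \<notin> {s \<in> space lborel. indicator {0..len} s *\<^sub>R dpar s \<noteq> G s}" using N(2) s by blast
    then have "indicator {0..len} s *\<^sub>R dpar s = G s" by simp
    then show "unit_tangent p (nat_par s) = G (inv_par (nat_par s))"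
      using s by (simp add: unit_tangent_nat_par inv_par)
  qed
  then have "AE \<tau> in base_measure. unit_tangent p \<tau> = G (inv_par \<tau>)" by (simp only: AE_LM_iff)
  moreover have "(\<lambda>\<tau>. G (inv_par \<tau>)) \<in> borel_measurable base_measure"
    using measurable_compose[OF inv_par_measurable] G(1) by simp
  ultimately show ?thesis unfolding LM_eq by (rule measurable_completion_AE[rotated])
qed

lemma AE_LM_not_point: "AE \<tau> in LM. \<tau> \<noteq> t"
proof -
  have "finite {s \<in> {0..<len}. nat_par s = t}"
  proof (cases "\<exists>s\<in>{0..<len}. nat_par s = t")
    case True
    then obtain s where "s \<in> {0..<len}" "nat_par s = t" by auto
    then have "{s \<in> {0..<len}. nat_par s = t} \<subseteq> {s}" using nat_par_inj_on by (auto simp: inj_on_def)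
    then show ?thesis by (rule finite_subset) simp
  next
    case False
    then have "{s \<in> {0..<len}. nat_par s = t} = {}" by auto
    then show ?thesis by (simp only: finite.emptyI)
  qed
  then have "negligible {s \<in> {0..<len}. nat_par s = t}" by (rule negligible_finite)
  then show ?thesis by (rule AE_LM_I) auto
qed

lemma emeasure_LM: "emeasure LM (path_image p) = ennreal len"
proof -
  have "emeasure LM (path_image p) = emeasure base_measure (path_image p)"
    unfolding LM_eq using sets.top[of base_measure] by (simp add: emeasure_completion)
  also have "\<dots> = emeasure (restrict_space lborel {0..len}) (nat_par -` path_image p \<inter> {0..len})"
    unfolding base_measure_def by (subst emeasure_distr[OF nat_par_measurable]) (auto simp: space_restrict_space sets_restrict_space)
  also have "nat_par -` path_image p \<inter> {0..len} = {0..len}" using nat_par_image by auto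
  also have "emeasure (restrict_space lborel {0..len}) {0..len} = ennreal len"
    using len_pos by (subst emeasure_restrict_space) auto
  finally show ?thesis .
qed

lemma finite_measure_LM: "finite_measure LM"
  by (rule finite_measureI) (simp add: emeasure_LM)

lemma borel_Int_LM: "A \<in> sets borel \<Longrightarrow> path_image p \<inter> A \<in> sets LM"
  unfolding LM_eq by (rule sets_completionI_sets) (auto simp: sets_base sets_restrict_space)

text \<open>\<open>nat_par\<close> does not increase distances, so a whole parameter interval of
  positive length starting at the parameter of \<open>s\<close> is mapped into the ball.\<close>

lemma not_AE_outside_ball:
  assumes s: "s \<in> path_image p" and r: "r > 0"
  shows "\<not> (AE \<tau> in LM. \<tau> \<notin> ball s r)"
proof
  assume "AE \<tau> in LM. \<tau> \<notin> ball s r"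
  then obtain N where N: "negligible N" "\<And>x. x \<in> {0..len} - N \<Longrightarrow> nat_par x \<notin> ball s r" using AE_LM_D by blast
  obtain x where x: "x \<in> {0..<len}" "nat_par x = s" using inv_par(2,3)[OF s] by blast
  define b where "b = min len (x + r)"
  have b: "x < b" "b \<le> len" using x r by (auto simp: b_def)
  have "{x<..<b} \<subseteq> N"
  proof
    fix y assume y: "y \<in> {x<..<b}"
    have "dist (nat_par x) (nat_par y) \<le> 1 * dist x y" using y x b by (intro lipschitz_onD[OF nat_par_lipschitz]) auto
    then have "nat_par y \<in> ball s r" using y x b by (auto simp: b_def dist_real_def)
    then show "y \<in> N" using N(2)[of y] y x b by force
  qed
  then have "negligible {x<..<b}" using N(1) negligible_subset by blast
  then show False using b(1) open_not_negligible[of "{x<..<b}"] by auto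
qed

section \<open>Truncated Cauchy integrals in the arc length parameter\<close>

lemma cauchy_integrand_measurable:
  assumes "h \<in> borel_measurable LM"
  shows "cauchy_integrand p h s \<in> borel_measurable LM"
proof -
  have "(\<lambda>\<tau>. \<tau>) \<in> borel_measurable LM"
    unfolding LM_eq by (rule measurable_completion) (auto intro!: measurable_restrict_space1 simp: measurable_def sets_base space_restrict_space sets_restrict_space)
  then show ?thesis unfolding cauchy_integrand_def[abs_def] using assms unit_tangent_measurable by measurable
qed

lemma cauchy_truncation_nat_par:
  fixes h :: "complex \<Rightarrow> complex" and s :: complex and R :: real
  assumes h: "h \<in> borel_measurable LM"
  defines "S \<equiv> \<lambda>R. {x\<in>{0..len}. R \<le> cmod (nat_par x - s)}"
  assumes i: "(\<lambda>x. h (nat_par x) / (nat_par x - s) * dpar x) absolutely_integrable_on S R"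
  shows "set_integrable LM (path_image p - {\<tau> \<in> path_image p. cmod (\<tau> - s) < R}) (cauchy_integrand p h s)"
    "cauchy_truncated p h s R = 1 / (of_real pi * \<i>) * integral (S R) (\<lambda>x. h (nat_par x) / (nat_par x - s) * dpar x)"
proof -
  define A where "A = path_image p - {\<tau> \<in> path_image p. cmod (\<tau> - s) < R}"
  have "A = path_image p \<inter> (- ball s R)" by (auto simp: A_def dist_norm norm_minus_commute)
  then have As: "A \<in> sets LM" by (simp add: borel_Int_LM)
  define f where "f \<tau> = indicator A \<tau> *\<^sub>R cauchy_integrand p h s \<tau>" for \<tau>
  have fm: "f \<in> borel_measurable LM" unfolding f_def using As cauchy_integrand_measurable[OF h] by measurable
  define g where "g x = h (nat_par x) / (nat_par x - s) * dpar x" for x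
  have SR: "S R \<subseteq> {0..len}" by (auto simp: S_def)
  have fx: "f (nat_par x) = (if x \<in> S R then g x else 0)" if "x \<in> {0..len} - {len}" for x
  proof -
    have "nat_par x \<in> path_image p" using that nat_par_image by auto
    then show ?thesis using that unit_tangent_nat_par[of x]
      by (auto simp: f_def g_def A_def S_def cauchy_integrand_def indicator_def)
  qed
  have "(\<lambda>x. if x \<in> S R then g x else 0) absolutely_integrable_on {0..len}"
    by (rule set_integrable_subset[of _ UNIV]) (use i in \<open>auto simp: absolutely_integrable_restrict_UNIV g_def[abs_def]\<close>)
  then have "(\<lambda>x. f (nat_par x)) absolutely_integrable_on {0..len}"
    by (rule absolutely_integrable_spike[of _ _ "{len}"]) (use fx in auto)
  then have fi: "integrable LM f" using integral_LM(1)[OF fm] by simp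
  then show "set_integrable LM (path_image p - {\<tau> \<in> path_image p. cmod (\<tau> - s) < R}) (cauchy_integrand p h s)"
    by (simp add: set_integrable_def f_def[abs_def] A_def)
  have "set_lebesgue_integral LM A (cauchy_integrand p h s) = integral {0..len} (\<lambda>x. f (nat_par x))"
    using integral_LM(2)[OF fm fi] by (simp add: set_lebesgue_integral_def f_def[abs_def])
  also have "\<dots> = integral {0..len} (\<lambda>x. if x \<in> S R then g x else 0)"
    by (rule integral_spike[of "{len}"]) (use fx in auto)
  also have "\<dots> = integral (S R) g" using integral_restrict_Int[of "{0..len}" "S R" g] SR by (simp add: Int_absorb1 Int_absorb2)
  finally show "cauchy_truncated p h s R = 1 / (of_real pi * \<i>) * integral (S R) (\<lambda>x. h (nat_par x) / (nat_par x - s) * dpar x)"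
    by (simp add: cauchy_truncated_def A_def g_def[abs_def])
qed

lemma cauchy_principal_value:
  fixes h q :: "complex \<Rightarrow> complex"
  assumes h: "h \<in> borel_measurable LM"
    and x0: "x0 \<in> {0<..<len}"
    and pv: "((\<lambda>R. integral {x\<in>{0..len}. R \<le> cmod (nat_par x - nat_par x0)} (\<lambda>x. 1 / (nat_par x - nat_par x0) * dpar x)) \<longlongrightarrow> \<i> * of_real pi) (at_right 0)"
    and q: "\<And>x. x \<in> {0..len} \<Longrightarrow> x \<noteq> x0 \<Longrightarrow> h (nat_par x) = h (nat_par x0) + (nat_par x - nat_par x0) * q (nat_par x)"
    and qi: "(\<lambda>x. q (nat_par x) * dpar x) absolutely_integrable_on {0..len}"
  shows "\<forall>R>0. set_integrable LM (path_image p - {\<tau> \<in> path_image p. cmod (\<tau> - nat_par x0) < R}) (cauchy_integrand p h (nat_par x0))"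
    "(cauchy_truncated p h (nat_par x0) \<longlongrightarrow> h (nat_par x0) + 1 / (of_real pi * \<i>) * integral {0..len} (\<lambda>x. q (nat_par x) * dpar x)) (at_right 0)"
proof -
  define s where "s = nat_par x0"
  define S where "S R = {x\<in>{0..len}. R \<le> cmod (nat_par x - s)}" for R
  have cS: "compact (S R)" for R unfolding S_def by (rule compact_truncation)
  have SR: "S R \<subseteq> {0..len}" for R by (auto simp: S_def)
  define g where "g x = q (nat_par x) * dpar x" for x
  have gS: "g absolutely_integrable_on S R" for R
    unfolding g_def by (rule set_integrable_subset[OF qi]) (use SR cS lmeasurable_compact fmeasurableD in blast)+
  have ncS: "continuous_on (S R) nat_par" for R by (rule continuous_on_subset[OF nat_par_cont SR])
  have oS: "(\<lambda>x. 1 / (nat_par x - s) * dpar x) absolutely_integrable_on S R" if "R > 0" for R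
    by (rule continuous_mult_dpar_integrable[OF _ cS SR])
      (use that in \<open>intro continuous_intros ncS; auto simp: S_def\<close>)
  have eq: "h (nat_par x) / (nat_par x - s) * dpar x = h s * (1 / (nat_par x - s) * dpar x) + g x" if "x \<in> S R" "R > 0" for x R
  proof -
    have ne: "nat_par x \<noteq> s" using that by (auto simp: S_def)
    then have "x \<noteq> x0" by (auto simp: s_def)
    then have "h (nat_par x) = h s + (nat_par x - s) * q (nat_par x)" using q[of x] that SR unfolding s_def by blast
    moreover have "(h s + (nat_par x - s) * q (nat_par x)) / (nat_par x - s) = h s * (1 / (nat_par x - s)) + q (nat_par x)"
      using ne by (simp add: add_divide_distrib)
    ultimately have "h (nat_par x) / (nat_par x - s) = h s * (1 / (nat_par x - s)) + q (nat_par x)" by (simp only:)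
    then show ?thesis by (simp only: g_def distrib_right mult.assoc)
  qed
  have ai: "(\<lambda>x. h s * (1 / (nat_par x - s) * dpar x) + g x) absolutely_integrable_on S R" if "R > 0" for R
    by (intro set_integral_add(1) set_integrable_mult_right oS[OF that] gS)
  have hi: "(\<lambda>x. h (nat_par x) / (nat_par x - s) * dpar x) absolutely_integrable_on S R" if "R > 0" for R
    by (rule absolutely_integrable_spike[OF ai[OF that], of "{}"]) (use eq that in auto)
  note ct = cauchy_truncation_nat_par[OF h, where s = s, folded S_def]
  show "\<forall>R>0. set_integrable LM (path_image p - {\<tau> \<in> path_image p. cmod (\<tau> - nat_par x0) < R}) (cauchy_integrand p h (nat_par x0))"
    using ct(1)[OF hi] by (simp add: s_def)
  have val: "cauchy_truncated p h s R = 1 / (of_real pi * \<i>) * (h s * integral (S R) (\<lambda>x. 1 / (nat_par x - s) * dpar x) + integral (S R) g)" if R: "R > 0" for R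
  proof -
    have "integral (S R) (\<lambda>x. h (nat_par x) / (nat_par x - s) * dpar x) = integral (S R) (\<lambda>x. h s * (1 / (nat_par x - s) * dpar x) + g x)"
      by (rule integral_cong) (use eq R in auto)
    also have "\<dots> = integral (S R) (\<lambda>x. h s * (1 / (nat_par x - s) * dpar x)) + integral (S R) g"
      using set_integrable_mult_right[OF oS[OF R], of "h s"] gS[of R] set_lebesgue_integral_eq_integral(1)
      by (intro Henstock_Kurzweil_Integration.integral_add) blast+
    also have "integral (S R) (\<lambda>x. h s * (1 / (nat_par x - s) * dpar x)) = h s * integral (S R) (\<lambda>x. 1 / (nat_par x - s) * dpar x)"
      by (rule integral_mult_right)
    finally show ?thesis using ct(2)[OF hi[OF R]] by simp
  qed
  \<comment> \<open>The truncated sets exhaust the parameter interval up to the point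
    \<open>x0\<close>, so dominated convergence applies along every sequence of radii.\<close>
  have glim: "((\<lambda>R. integral (S R) g) \<longlongrightarrow> integral {0..len} g) (at_right 0)"
  proof (rule tendsto_at_right_sequentially[of 0 1])
    fix r :: "nat \<Rightarrow> real" assume r: "\<And>n. 0 < r n" "\<And>n. r n < 1" "decseq r" "r \<longlonglongrightarrow> 0"
    define gn where "gn n x = (if x \<in> S (r n) then g x else 0)" for n x
    have gg: "g integrable_on {0..len}" "g absolutely_integrable_on {0..len}" using qi set_lebesgue_integral_eq_integral(1) unfolding g_def by blast+
    have "(\<lambda>n. integral {0..len} (gn n)) \<longlonglongrightarrow> integral {0..len} (\<lambda>x. if x = x0 then 0 else g x)"
    proof (rule dominated_convergence(2)[where h = "\<lambda>x. norm (g x)"])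
      show "gn n integrable_on {0..len}" for n
        unfolding gn_def using integrable_restrict_Int[of "S (r n)" g "{0..len}"] SR[of "r n"] gS[of "r n"] set_lebesgue_integral_eq_integral(1)[OF gS]
        by (simp add: Int_absorb1 Int_absorb2)
      show "(\<lambda>x. norm (g x)) integrable_on {0..len}" using absolutely_integrable_norm[OF gg(2)] set_lebesgue_integral_eq_integral(1) by (auto simp: o_def)
      show "norm (gn n x) \<le> norm (g x)" for n x by (simp add: gn_def)
      fix x assume x: "x \<in> {0..len}"
      show "(\<lambda>n. gn n x) \<longlonglongrightarrow> (if x = x0 then 0 else g x)"
      proof (cases "x = x0")
        case True
        then have "gn n x = 0" for n using r(1)[of n] by (auto simp: gn_def S_def s_def)
        then show ?thesis using True by simp
      next
        case False
        then have "cmod (nat_par x - s) > 0" using nat_par_inj[of x0 x] x0 x by (auto simp: s_def)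
        then have "\<forall>\<^sub>F n in sequentially. r n < cmod (nat_par x - s)" using order_tendstoD(2)[OF r(4)] by blast
        then have "\<forall>\<^sub>F n in sequentially. gn n x = g x" by eventually_elim (use x in \<open>auto simp: gn_def S_def\<close>)
        then show ?thesis using False by (simp add: tendsto_eventually)
      qed
    qed
    moreover have "integral {0..len} (gn n) = integral (S (r n)) g" for n
      unfolding gn_def using integral_restrict_Int[of "{0..len}" "S (r n)" g] SR[of "r n"] by (simp add: Int_absorb1 Int_absorb2)
    moreover have "integral {0..len} (\<lambda>x. if x = x0 then 0 else g x) = integral {0..len} g"
      by (rule integral_spike[of "{x0}"]) auto
    ultimately show "(\<lambda>n. integral (S (r n)) g) \<longlonglongrightarrow> integral {0..len} g" by simp
  qed simp
  have "((\<lambda>R. 1 / (of_real pi * \<i>) * (h s * integral (S R) (\<lambda>x. 1 / (nat_par x - s) * dpar x) + integral (S R) g)) \<longlongrightarrow>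
     1 / (of_real pi * \<i>) * (h s * (\<i> * of_real pi) + integral {0..len} g)) (at_right 0)"
    by (intro tendsto_mult tendsto_add tendsto_const glim) (use pv in \<open>simp add: S_def s_def\<close>)
  moreover have "1 / (of_real pi * \<i>) * (h s * (\<i> * of_real pi) + integral {0..len} g) = h s + 1 / (of_real pi * \<i>) * integral {0..len} g"
    by (simp add: field_simps)
  ultimately have "((\<lambda>R. 1 / (of_real pi * \<i>) * (h s * integral (S R) (\<lambda>x. 1 / (nat_par x - s) * dpar x) + integral (S R) g)) \<longlongrightarrow>
     h s + 1 / (of_real pi * \<i>) * integral {0..len} g) (at_right 0)" by simp
  then have "(cauchy_truncated p h s \<longlongrightarrow> h s + 1 / (of_real pi * \<i>) * integral {0..len} g) (at_right 0)"
    by (rule Lim_transform_eventually) (auto simp: eventually_at_right_field val intro!: exI[of _ 1])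
  then show "(cauchy_truncated p h (nat_par x0) \<longlongrightarrow> h (nat_par x0) + 1 / (of_real pi * \<i>) * integral {0..len} (\<lambda>x. q (nat_par x) * dpar x)) (at_right 0)"
    by (simp add: s_def g_def[abs_def])
qed

end

section \<open>Bounded operators \<open>u S v I\<close>\<close>

lemma banach_function_normD:
  assumes "banach_function_norm M \<rho>"
  shows "\<And>f a. f \<in> borel_measurable M \<Longrightarrow> a \<ge> 0 \<Longrightarrow> \<rho> (\<lambda>x. ennreal a * f x) = ennreal a * \<rho> f"
    "\<And>f g. f \<in> borel_measurable M \<Longrightarrow> g \<in> borel_measurable M \<Longrightarrow> \<rho> (\<lambda>x. f x + g x) \<le> \<rho> f + \<rho> g"
    "\<And>f g. f \<in> borel_measurable M \<Longrightarrow> g \<in> borel_measurable M \<Longrightarrow> (AE x in M. g x \<le> f x) \<Longrightarrow> \<rho> g \<le> \<rho> f"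
    "\<And>F f. (\<And>n. F n \<in> borel_measurable M) \<Longrightarrow> f \<in> borel_measurable M \<Longrightarrow>
        (AE x in M. incseq (\<lambda>n. F n x) \<and> (\<lambda>n. F n x) \<longlonglongrightarrow> f x) \<Longrightarrow> (\<lambda>n. \<rho> (F n)) \<longlonglongrightarrow> \<rho> f"
    "\<And>E. E \<in> sets M \<Longrightarrow> \<rho> (indicator E) < \<infinity>"
    "\<And>E. E \<in> sets M \<Longrightarrow> \<exists>C. 0 < C \<and> C < \<infinity> \<and> (\<forall>f\<in>borel_measurable M. (\<integral>\<^sup>+x\<in>E. f x \<partial>M) \<le> C * \<rho> f)"
  using assms unfolding banach_function_norm_def by blast+

lemma banach_function_norm_zero:
  assumes "banach_function_norm M \<rho>"
  shows "\<rho> (\<lambda>x. 0) = 0"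
  using assms unfolding banach_function_norm_def by auto

lemma banach_function_norm_cong_AE:
  assumes "banach_function_norm M \<rho>" "f \<in> borel_measurable M" "g \<in> borel_measurable M" "AE x in M. f x = g x"
  shows "\<rho> f = \<rho> g"
proof (rule antisym)
  show "\<rho> f \<le> \<rho> g" by (rule banach_function_normD(3)[OF assms(1,3,2)]) (use assms(4) in eventually_elim, simp)
  show "\<rho> g \<le> \<rho> f" by (rule banach_function_normD(3)[OF assms(1,2,3)]) (use assms(4) in eventually_elim, simp)
qed

lemma banach_function_norm_AE_finite:
  assumes \<rho>: "banach_function_norm M \<rho>" and g: "g \<in> borel_measurable M" "\<rho> g < \<infinity>"
  shows "AE x in M. g x < \<infinity>"
proof -
  obtain C where C: "0 < C" "C < \<infinity>" "\<forall>f\<in>borel_measurable M. (\<integral>\<^sup>+x\<in>space M. f x \<partial>M) \<le> C * \<rho> f"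
    using banach_function_normD(6)[OF \<rho> sets.top] by blast
  have "(\<integral>\<^sup>+x. g x \<partial>M) = (\<integral>\<^sup>+x\<in>space M. g x \<partial>M)" by (rule nn_integral_cong) simp
  also have "\<dots> \<le> C * \<rho> g" using C(3) g(1) by blast
  also have "\<dots> < \<infinity>" using C(2) g(2) by (simp add: ennreal_mult_less_top)
  finally have "(\<integral>\<^sup>+x. g x \<partial>M) \<noteq> \<infinity>" by simp
  then have "AE x in M. g x \<noteq> \<infinity>" by (rule nn_integral_PInf_AE[OF g(1)])
  then show ?thesis by eventually_elim (simp add: less_top)
qed

text \<open>A gliding hump: if the supremum were infinite, a series of test functions would have infinite integral.\<close>

lemma associate_norm_finite:
  assumes \<rho>: "banach_function_norm M \<rho>" and b: "b \<in> borel_measurable M"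
    and fin: "\<And>g. g \<in> borel_measurable M \<Longrightarrow> \<rho> g \<le> 1 \<Longrightarrow> (\<integral>\<^sup>+x. g x * b x \<partial>M) < \<infinity>"
  shows "associate_norm M \<rho> b < \<infinity>"
proof (rule ccontr)
  assume nt: "\<not> ?thesis"
  have top: "(SUP f\<in>{f \<in> borel_measurable M. \<rho> f \<le> 1}. \<integral>\<^sup>+x. f x * b x \<partial>M) = \<infinity>"
  proof -
    from nt have "associate_norm M \<rho> b = \<infinity>" by (simp add: less_top[symmetric])
    then show ?thesis by (simp only: associate_norm_def)
  qed
  \<comment> \<open>The threshold is matched to the weights \<open>2^-(n+1)\<close> chosen below:
    each weighted test function contributes at least \<open>n\<close> to the integral, while the
    weights sum to at most \<open>1\<close>.\<close>
  have "\<exists>g. g \<in> borel_measurable M \<and> \<rho> g \<le> 1 \<and> ennreal (real n * 2 ^ Suc n) < (\<integral>\<^sup>+x. g x * b x \<partial>M)" for n :: nat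
  proof -
    have "ennreal (real n * 2 ^ Suc n) < (SUP f\<in>{f \<in> borel_measurable M. \<rho> f \<le> 1}. \<integral>\<^sup>+x. f x * b x \<partial>M)"
      unfolding top by simp
    then show ?thesis unfolding less_SUP_iff by blast
  qed
  then obtain G where G: "\<And>n. G n \<in> borel_measurable M" "\<And>n. \<rho> (G n) \<le> 1"
    "\<And>n. ennreal (real n * 2 ^ Suc n) < (\<integral>\<^sup>+x. G n x * b x \<partial>M)" by metis
  define a where "a n = (1/2 :: real) ^ Suc n" for n
  have a0: "a n \<ge> 0" for n by (simp add: a_def)
  define F where "F N x = (\<Sum>n<N. ennreal (a n) * G n x)" for N x
  define f where "f x = (SUP N. F N x)" for x
  have Fm: "F N \<in> borel_measurable M" for N unfolding F_def using G(1) by measurable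
  have fm: "f \<in> borel_measurable M" unfolding f_def using Fm by measurable
  have Finc: "incseq (\<lambda>N. F N x)" for x
    unfolding F_def by (intro incseq_SucI) auto
  have suma: "(\<Sum>n<N. a n) \<le> 1" for N
  proof -
    have "(\<Sum>n<N. a n) = 1 - (1/2)^N" by (induction N) (auto simp: a_def field_simps)
    then show ?thesis by simp
  qed
  have \<rho>F: "\<rho> (F N) \<le> ennreal (\<Sum>n<N. a n)" for N
  proof (induction N)
    case 0
    have "F 0 = (\<lambda>x. 0)" by (auto simp: F_def)
    then show ?case using banach_function_norm_zero[OF \<rho>] by simp
  next
    case (Suc N)
    have "F (Suc N) = (\<lambda>x. F N x + ennreal (a N) * G N x)" by (auto simp: F_def)
    then have "\<rho> (F (Suc N)) \<le> \<rho> (F N) + \<rho> (\<lambda>x. ennreal (a N) * G N x)"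
      using banach_function_normD(2)[OF \<rho> Fm] G(1) by simp
    also have "\<rho> (\<lambda>x. ennreal (a N) * G N x) = ennreal (a N) * \<rho> (G N)" by (rule banach_function_normD(1)[OF \<rho> G(1) a0])
    also have "\<dots> \<le> ennreal (a N) * 1" by (rule mult_left_mono[OF G(2)]) simp
    also have "\<rho> (F N) + ennreal (a N) * 1 \<le> ennreal (\<Sum>n<N. a n) + ennreal (a N)" using Suc by (simp add: add_right_mono)
    also have "\<dots> = ennreal (\<Sum>n<Suc N. a n)" using a0 by (simp add: ennreal_plus[symmetric] sum_nonneg del: ennreal_plus)
    finally show ?case by (simp add: add_left_mono)
  qed
  have "(\<lambda>N. \<rho> (F N)) \<longlonglongrightarrow> \<rho> f"
    by (rule banach_function_normD(4)[OF \<rho> Fm fm]) (use Finc LIMSEQ_SUP in \<open>auto simp: f_def\<close>)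
  then have "\<rho> f \<le> 1"
    by (rule LIMSEQ_le_const2) (use \<rho>F suma order_trans ennreal_leI in \<open>metis ennreal_1\<close>)
  then have "(\<integral>\<^sup>+x. f x * b x \<partial>M) < \<infinity>" by (rule fin[OF fm])
  moreover have "of_nat n \<le> (\<integral>\<^sup>+x. f x * b x \<partial>M)" for n :: nat
  proof -
    have "(of_nat n :: ennreal) = ennreal (a n) * ennreal (real n * 2 ^ Suc n)"
      using a0 by (simp add: ennreal_mult[symmetric] a_def power_one_over ennreal_of_nat_eq_real_of_nat)
    also have "\<dots> \<le> ennreal (a n) * (\<integral>\<^sup>+x. G n x * b x \<partial>M)" using G(3)[of n] by (intro mult_left_mono) auto
    also have "\<dots> = (\<integral>\<^sup>+x. ennreal (a n) * G n x * b x \<partial>M)"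
      using G(1)[of n] b by (simp add: nn_integral_cmult[symmetric] mult.assoc)
    also have "\<dots> \<le> (\<integral>\<^sup>+x. f x * b x \<partial>M)"
    proof (intro nn_integral_mono mult_right_mono)
      fix x
      have "ennreal (a n) * G n x \<le> F (Suc n) x" unfolding F_def by (simp add: add_increasing)
      also have "\<dots> \<le> f x" unfolding f_def by (rule SUP_upper) simp
      finally show "ennreal (a n) * G n x \<le> f x" .
    qed simp
    finally show ?thesis .
  qed
  moreover obtain x where x: "(\<integral>\<^sup>+x. f x * b x \<partial>M) = ennreal x" "x \<ge> 0"
    using calculation(1) by (cases "\<integral>\<^sup>+x. f x * b x \<partial>M") auto
  moreover obtain n :: nat where "x < real n" using reals_Archimedean2 by blast
  ultimately show False by (metis ennreal_le_iff ennreal_of_nat_eq_real_of_nat not_le)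
qed

lemma ennreal_weight_cancel:
  fixes g w :: ennreal
  assumes "0 < w" "w < \<infinity>" "g < \<infinity>"
  shows "ennreal (enn2real (g / w)) * w = g" "ennreal (enn2real (g / w)) = g * (1 / w)"
proof -
  obtain r where r: "w = ennreal r" "r \<ge> 0" using assms(2) by (cases w) auto
  obtain a where a: "g = ennreal a" "a \<ge> 0" using assms(3) by (cases g) auto
  have r0: "r > 0" using assms(1) r by (simp add: ennreal_less_zero_iff order_le_less)
  have *: "g / w = ennreal (a / r)" using r r0 a by (simp add: divide_ennreal)
  show "ennreal (enn2real (g / w)) * w = g" unfolding * using r r0 a by (simp add: ennreal_mult[symmetric])
  have "1 / w = ennreal (1 / r)" using r r0 divide_ennreal[of 1 r] by simp
  then show "ennreal (enn2real (g / w)) = g * (1 / w)" unfolding * using r r0 a by (simp add: ennreal_mult[symmetric])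
qed

context rectifiable_loop begin

section \<open>Testing the operator \<open>u S v I\<close>\<close>

lemma AE_LM_ex: "AE \<tau> in LM. P \<tau> \<Longrightarrow> \<exists>\<tau>\<in>path_image p. P \<tau>"
proof (rule ccontr)
  assume ae: "AE \<tau> in LM. P \<tau>" and "\<not> (\<exists>\<tau>\<in>path_image p. P \<tau>)"
  then have False: "AE \<tau> in LM. False"
  proof -
    have "AE \<tau> in LM. \<tau> \<in> path_image p" by (rule AE_I2) simp
    then show ?thesis using ae by eventually_elim (use \<open>\<not> (\<exists>\<tau>\<in>path_image p. P \<tau>)\<close> in blast)
  qed
  have "AE \<tau> in LM. \<tau> \<notin> ball (p 0) 1" by (rule eventually_mono[OF False]) simp
  moreover have "p 0 \<in> path_image p" by (auto simp: path_image_def)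
  ultimately show False using not_AE_outside_ball[of "p 0" 1] by auto
qed

lemma path_image_diameter: obtains B where "B > 0" "\<And>s t. s \<in> path_image p \<Longrightarrow> t \<in> path_image p \<Longrightarrow> cmod (s - t) \<le> B"
proof -
  have "bounded (path_image p)" using simple by (simp add: bounded_path_image simple_path_imp_path)
  then obtain b where b: "b > 0" "\<And>s. s \<in> path_image p \<Longrightarrow> cmod s \<le> b" unfolding bounded_pos by auto
  show thesis
  proof (rule that[of "2*b"])
    fix s t assume "s \<in> path_image p" "t \<in> path_image p"
    then show "cmod (s - t) \<le> 2*b" using b(2)[of s] b(2)[of t] norm_triangle_ineq4[of s t] by linarith
  qed (use b in auto)
qed

text \<open>Truncated integrals at two distinct points suffice. Every point of the curve has
  distance at least \<open>R\<close> from one of them, and there \<open>cmod (g \<tau>)\<close> is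
  at most the diameter bound \<open>B\<close> times the truncated integrand.\<close>

lemma cauchy_S_exists_integrable:
  assumes "cauchy_S_exists p g"
  shows "(\<integral>\<^sup>+\<tau>. ennreal (cmod (g \<tau>)) \<partial>LM) < \<infinity>"
proof -
  let ?A = "\<lambda>t R. path_image p - {\<tau> \<in> path_image p. cmod (\<tau> - t) < R}"
  define P where "P t \<longleftrightarrow> (\<forall>R>0. set_integrable LM (?A t R) (cauchy_integrand p g t))" for t
  have AP: "AE t in LM. P t" using assms unfolding cauchy_S_exists_def P_def by eventually_elim auto
  obtain t1 where t1: "t1 \<in> path_image p" "P t1" using AE_LM_ex[OF AP] by blast
  have "AE t in LM. P t \<and> t \<noteq> t1" using AP AE_LM_not_point[of t1] by eventually_elim auto
  then obtain t2 where t2: "t2 \<in> path_image p" "P t2" "t2 \<noteq> t1" using AE_LM_ex by blast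
  obtain B where B: "B > 0" "\<And>s t. s \<in> path_image p \<Longrightarrow> t \<in> path_image p \<Longrightarrow> cmod (s - t) \<le> B" using path_image_diameter by blast
  define R where "R = cmod (t1 - t2) / 2"
  have R: "R > 0" using t2 by (simp add: R_def)
  define I where "I t \<tau> = indicator (?A t R) \<tau> *\<^sub>R cauchy_integrand p g t \<tau>" for t \<tau>
  have Ii: "integrable LM (I t1)" "integrable LM (I t2)"
    using t1 t2 R by (auto simp: P_def set_integrable_def I_def[abs_def])
  have pt: "ennreal (cmod (g \<tau>)) \<le> ennreal B * ennreal (norm (I t \<tau>))"
    if \<tau>: "\<tau> \<in> path_image p" "cmod (unit_tangent p \<tau>) = 1" "R \<le> cmod (\<tau> - t)" "t \<in> path_image p" for \<tau> t
  proof -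
    have "cmod (\<tau> - t) > 0" using R \<tau> by linarith
    then have "cmod (g \<tau>) = cmod (\<tau> - t) * norm (I t \<tau>)"
      using \<tau> by (simp add: I_def cauchy_integrand_def norm_mult norm_divide)
    also have "\<dots> \<le> B * norm (I t \<tau>)" using B(2)[of \<tau> t] \<tau> by (intro mult_right_mono) auto
    finally show ?thesis using B(1) by (simp add: ennreal_mult[symmetric] ennreal_leI)
  qed
  have "(\<integral>\<^sup>+\<tau>. ennreal (cmod (g \<tau>)) \<partial>LM) \<le> (\<integral>\<^sup>+\<tau>. ennreal B * ennreal (norm (I t1 \<tau>)) + ennreal B * ennreal (norm (I t2 \<tau>)) \<partial>LM)"
  proof (rule nn_integral_mono_AE)
    have "AE \<tau> in LM. \<tau> \<in> path_image p" by (rule AE_I2) simp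
    then show "AE \<tau> in LM. ennreal (cmod (g \<tau>)) \<le> ennreal B * ennreal (norm (I t1 \<tau>)) + ennreal B * ennreal (norm (I t2 \<tau>))"
      using unit_tangent_norm
    proof eventually_elim
      case (elim \<tau>)
      have "cmod (t1 - t2) \<le> cmod (\<tau> - t1) + cmod (\<tau> - t2)"
        using norm_triangle_ineq4[of "\<tau> - t2" "\<tau> - t1"] by simp
      then have "R \<le> cmod (\<tau> - t1) \<or> R \<le> cmod (\<tau> - t2)" unfolding R_def by linarith
      then show ?case
      proof
        assume "R \<le> cmod (\<tau> - t1)"
        then show ?thesis using pt[of \<tau> t1] elim t1 by (simp add: add_increasing2)
      next
        assume "R \<le> cmod (\<tau> - t2)"
        then show ?thesis using pt[of \<tau> t2] elim t2 by (simp add: add_increasing)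
      qed
    qed
  qed
  also have "\<dots> = ennreal B * (\<integral>\<^sup>+\<tau>. ennreal (norm (I t1 \<tau>)) \<partial>LM) + ennreal B * (\<integral>\<^sup>+\<tau>. ennreal (norm (I t2 \<tau>)) \<partial>LM)"
    using Ii by (subst nn_integral_add) (auto simp: nn_integral_cmult borel_measurable_integrable)
  also have "\<dots> < \<infinity>" using Ii by (auto simp: integrable_iff_bounded ennreal_mult_less_top)
  finally show ?thesis .
qed

text \<open>A nonnegative \<open>g\<close> with \<open>\<rho> g \<le> 1\<close> is turned into the
  element \<open>F = g / w\<close> of the weighted space, and existence of \<open>S (v F)\<close>
  already makes \<open>v F\<close> integrable. Finiteness for each single \<open>g\<close> is what
  the gliding hump needs.\<close>

lemma mult_S_mult_associate:
  assumes \<rho>: "banach_function_norm LM \<rho>" and w: "is_weight LM w"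
    and b: "mult_S_mult_bounded p \<rho> w u v" and v: "v \<in> borel_measurable LM"
  shows "v \<in> weighted_space LM (associate_norm LM \<rho>) (\<lambda>\<tau>. 1 / w \<tau>)"
proof -
  have wm: "w \<in> borel_measurable LM" and wae: "AE x in LM. 0 < w x \<and> w x < \<infinity>" using w by (auto simp: is_weight_def)
  have "associate_norm LM \<rho> (\<lambda>x. ennreal (cmod (v x)) * (1 / w x)) < \<infinity>"
  proof (rule associate_norm_finite[OF \<rho>])
    show "(\<lambda>x. ennreal (cmod (v x)) * (1 / w x)) \<in> borel_measurable LM" using v wm by measurable
    fix g assume g: "g \<in> borel_measurable LM" "\<rho> g \<le> 1"
    have "\<rho> g < \<infinity>" using g(2) by (metis ennreal_one_less_top infinity_ennreal_def order_le_less_trans)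
    then have gfin: "AE x in LM. g x < \<infinity>" by (rule banach_function_norm_AE_finite[OF \<rho> g(1)])
    define F where "F x = complex_of_real (enn2real (g x / w x))" for x
    have Fm: "F \<in> borel_measurable LM" unfolding F_def using g(1) wm by measurable
    have ae: "AE x in LM. ennreal (cmod (F x)) * w x = g x \<and> ennreal (cmod (F x)) = g x * (1 / w x)"
      using wae gfin by eventually_elim (use ennreal_weight_cancel in \<open>simp add: F_def\<close>)
    have "weighted_norm \<rho> w F = \<rho> g" unfolding weighted_norm_def
      by (rule banach_function_norm_cong_AE[OF \<rho> _ g(1)]) (use Fm wm ae in \<open>auto elim: eventually_mono\<close>)
    then have "F \<in> weighted_space LM \<rho> w" using Fm \<open>\<rho> g < \<infinity>\<close> by (simp add: weighted_space_def)
    then have "cauchy_S_exists p (\<lambda>\<tau>. v \<tau> * F \<tau>)" using b by (auto simp: mult_S_mult_bounded_def)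
    then have "(\<integral>\<^sup>+\<tau>. ennreal (cmod (v \<tau> * F \<tau>)) \<partial>LM) < \<infinity>" by (rule cauchy_S_exists_integrable)
    also have "(\<integral>\<^sup>+\<tau>. ennreal (cmod (v \<tau> * F \<tau>)) \<partial>LM) = (\<integral>\<^sup>+x. g x * (ennreal (cmod (v x)) * (1 / w x)) \<partial>LM)"
      by (rule nn_integral_cong_AE) (use ae in eventually_elim, simp add: norm_mult ennreal_mult mult_ac)
    finally show "(\<integral>\<^sup>+x. g x * (ennreal (cmod (v x)) * (1 / w x)) \<partial>LM) < \<infinity>" .
  qed
  then show ?thesis using v by (simp add: weighted_space_def weighted_norm_def)
qed

text \<open>The test function \<open>f\<close> is the indicator of a set \<open>A\<close> near
  \<open>s\<close>, divided by \<open>v\<close> and by the tangent. Then \<open>S (v f)\<close> at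
  \<open>t\<close> is, up to the factor \<open>1 / (pi i)\<close>, the integral of
  \<open>1 / (\<tau> - t)\<close> over \<open>A\<close> in arc length; for \<open>t\<close> away
  from \<open>s\<close> no cancellation occurs in it. So \<open>cmod (u t)\<close> is dominated
  there by a multiple of \<open>u S (v f)\<close>, which belongs to the space.\<close>

lemma mult_S_mult_far_part:
  assumes \<rho>: "banach_function_norm LM \<rho>" and w: "is_weight LM w"
    and b: "mult_S_mult_bounded p \<rho> w u v" and v: "v \<in> borel_measurable LM" "AE \<tau> in LM. v \<tau> \<noteq> 0"
    and s: "s \<in> path_image p" and d: "d > 0"
  obtains K g where "K > 0" "g \<in> weighted_space LM \<rho> w"
    "\<And>t. t \<in> path_image p \<Longrightarrow> d / 2 \<le> cmod (t - s) \<Longrightarrow> cmod (u t) \<le> K * cmod (g t)"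
proof -
  have wm[measurable]: "w \<in> borel_measurable LM" and wae: "AE x in LM. 0 < w x \<and> w x < \<infinity>" using w by (auto simp: is_weight_def)
  note v(1)[measurable] unit_tangent_measurable[measurable]
  \<comment> \<open>On \<open>E n\<close> both the weight and \<open>1 / cmod v\<close> are bounded,
    which puts \<open>f\<close> into the weighted space. These sets exhaust the part of the curve in
    the ball up to a null set, so one of them has positive measure.\<close>
  define E where "E n = {\<tau> \<in> path_image p. \<tau> \<in> ball s (d/8) \<and> w \<tau> \<le> of_nat (Suc n) \<and> 1 \<le> real (Suc n) * cmod (v \<tau>)}" for n
  have Es: "E n \<in> sets LM" for n
  proof -
    have "{\<tau> \<in> space LM. w \<tau> \<le> of_nat (Suc n) \<and> 1 \<le> real (Suc n) * cmod (v \<tau>)} \<in> sets LM" by measurable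
    moreover have "path_image p \<inter> ball s (d/8) \<in> sets LM" by (rule borel_Int_LM) simp
    moreover have "E n = {\<tau> \<in> space LM. w \<tau> \<le> of_nat (Suc n) \<and> 1 \<le> real (Suc n) * cmod (v \<tau>)} \<inter> (path_image p \<inter> ball s (d/8))"
      by (auto simp: E_def)
    ultimately show ?thesis by (simp only: sets.Int)
  qed
  obtain n where n: "emeasure LM (E n) \<noteq> 0"
  proof (rule ccontr)
    assume "\<not> thesis"
    then have "emeasure LM (E n) = 0" for n using that by blast
    then have "E n \<in> null_sets LM" for n using Es by (auto simp: null_sets_def)
    then have "AE \<tau> in LM. \<tau> \<notin> E n" for n by (rule AE_not_in)
    then have "AE \<tau> in LM. \<forall>n. \<tau> \<notin> E n" by (subst AE_all_countable) blast
    moreover have "AE \<tau> in LM. \<tau> \<in> path_image p" by (rule AE_I2) simp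
    ultimately have "AE \<tau> in LM. \<tau> \<notin> ball s (d/8)" using wae v(2)
    proof eventually_elim
      case (elim \<tau>)
      obtain k1 :: nat where k1: "w \<tau> \<le> of_nat k1"
      proof -
        obtain x where x: "w \<tau> = ennreal x" "x \<ge> 0" using elim by (cases "w \<tau>") auto
        obtain k :: nat where "x \<le> real k" using real_arch_simple by blast
        then show ?thesis using that[of k] x by (simp add: ennreal_of_nat_eq_real_of_nat ennreal_leI)
      qed
      obtain k2 :: nat where k2: "1 / cmod (v \<tau>) \<le> real k2" using real_arch_simple by blast
      define k where "k = max k1 k2"
      have "w \<tau> \<le> of_nat (Suc k)" using k1 by (rule order_trans) (simp add: k_def del: of_nat_Suc)
      moreover have "1 / cmod (v \<tau>) \<le> real (Suc k)" using k2 by (rule order_trans) (simp add: k_def)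
      then have "1 \<le> real (Suc k) * cmod (v \<tau>)" using elim by (simp add: divide_le_eq)
      moreover have "\<tau> \<notin> E k" using elim by auto
      ultimately show ?case using elim by (auto simp: E_def)
    qed
    then show False using not_AE_outside_ball[OF s, of "d/8"] d by auto
  qed
  define A where "A = E n"
  have As[measurable]: "A \<in> sets LM" using Es by (simp add: A_def)
  interpret finite_measure LM by (rule finite_measure_LM)
  have mA: "measure LM A > 0" using n by (simp add: A_def emeasure_eq_measure zero_less_measure_iff)
  have Av: "1 \<le> real (Suc n) * cmod (v \<tau>)" "w \<tau> \<le> of_nat (Suc n)" "\<tau> \<in> path_image p" "cmod (\<tau> - s) < d/8" if "\<tau> \<in> A" for \<tau>
    using that by (auto simp: A_def E_def dist_norm norm_minus_commute)
  have v0: "v \<tau> \<noteq> 0" if "\<tau> \<in> A" for \<tau> using Av(1)[OF that] by auto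
  define f where "f \<tau> = indicator A \<tau> *\<^sub>R (1 / (v \<tau> * unit_tangent p \<tau>))" for \<tau>
  have fm[measurable]: "f \<in> borel_measurable LM" unfolding f_def by measurable
  have "weighted_norm \<rho> w f \<le> \<rho> (\<lambda>x. ennreal (real (Suc n) * real (Suc n)) * indicator A x)"
    unfolding weighted_norm_def
  proof (rule banach_function_normD(3)[OF \<rho>])
    show "AE x in LM. ennreal (cmod (f x)) * w x \<le> ennreal (real (Suc n) * real (Suc n)) * indicator A x"
      using unit_tangent_norm
    proof eventually_elim
      case (elim x)
      show ?case
      proof (cases "x \<in> A")
        case True
        have "cmod (f x) = 1 / cmod (v x)" using True elim by (simp add: f_def norm_divide norm_mult)
        also have "\<dots> \<le> real (Suc n)" using Av(1)[OF True] v0[OF True] by (simp add: divide_le_eq)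
        finally have "ennreal (cmod (f x)) * w x \<le> ennreal (real (Suc n)) * of_nat (Suc n)"
          using Av(2)[OF True] by (intro mult_mono ennreal_leI) auto
        also have "\<dots> = ennreal (real (Suc n) * real (Suc n))"
          by (simp only: ennreal_of_nat_eq_real_of_nat ennreal_mult'' of_nat_0_le_iff)
        finally show ?thesis using True by simp
      qed (simp add: f_def)
    qed
  qed measurable
  also have "\<dots> = ennreal (real (Suc n) * real (Suc n)) * \<rho> (indicator A)"
    by (rule banach_function_normD(1)[OF \<rho>]) auto
  also have "\<dots> < \<infinity>" using banach_function_normD(5)[OF \<rho> As] by (simp only: ennreal_mult_less_top infinity_ennreal_def) auto
  finally have fX: "f \<in> weighted_space LM \<rho> w" using fm by (simp add: weighted_space_def)
  define g where "g t = u t * cauchy_S p (\<lambda>\<tau>. v \<tau> * f \<tau>) t" for t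
  have gX: "g \<in> weighted_space LM \<rho> w" using b fX unfolding mult_S_mult_bounded_def g_def by blast
  obtain B where B: "B > 0" "\<And>s t. s \<in> path_image p \<Longrightarrow> t \<in> path_image p \<Longrightarrow> cmod (s - t) \<le> B" using path_image_diameter by blast
  \<comment> \<open>The radius \<open>d/8\<close> and the separation \<open>d/2\<close> leave at
    least \<open>3/8 * d\<close> between \<open>\<tau>\<close> and \<open>t\<close>, so
    \<open>(s - t) / (\<tau> - t)\<close> differs from \<open>1\<close> by at most
    \<open>1/3\<close>. This is the origin of \<open>2/3\<close>; \<open>B\<close> bounds
    \<open>cmod (s - t)\<close>.\<close>
  define c0 where "c0 = 2 / 3 * measure LM A / (pi * B)"
  have c0: "c0 > 0" using mA B by (simp add: c0_def)
  have low: "c0 \<le> cmod (cauchy_S p (\<lambda>\<tau>. v \<tau> * f \<tau>) t)" if t: "t \<in> path_image p" "d / 2 \<le> cmod (t - s)" for t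
  proof -
    have far: "3 / 8 * d \<le> cmod (\<tau> - t)" if "\<tau> \<in> A" for \<tau>
      using Av(4)[OF that] t(2) norm_triangle_ineq4[of "\<tau> - s" "\<tau> - t"] by (simp add: norm_minus_commute)
    define k where "k \<tau> = indicator A \<tau> *\<^sub>R (1 / (\<tau> - t))" for \<tau>
    have idm: "(\<lambda>\<tau>. \<tau>) \<in> borel_measurable LM"
      unfolding LM_eq by (rule measurable_completion) (auto intro!: measurable_restrict_space1 simp: measurable_def sets_base space_restrict_space sets_restrict_space)
    have km: "k \<in> borel_measurable LM" unfolding k_def using idm by measurable
    have kb: "cmod (k \<tau>) \<le> 8 / (3 * d)" for \<tau>
    proof (cases "\<tau> \<in> A")
      case True
      have "cmod (k \<tau>) = 1 / cmod (\<tau> - t)" using True by (simp add: k_def norm_divide)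
      also have "\<dots> \<le> 1 / (3 / 8 * d)" using far[OF True] d by (intro divide_left_mono) (auto intro!: mult_pos_pos)
      finally show ?thesis by simp
    qed (use d in \<open>simp add: k_def\<close>)
    have ki: "integrable LM k" by (rule integrable_const_bound[of _ "8 / (3*d)"]) (use kb km in auto)
    have trunc: "cauchy_truncated p (\<lambda>\<tau>. v \<tau> * f \<tau>) t R = 1 / (of_real pi * \<i>) * integral\<^sup>L LM k" if R: "0 < R" "R < d / 4" for R
    proof -
      let ?A = "path_image p - {\<tau> \<in> path_image p. cmod (\<tau> - t) < R}"
      have "?A = path_image p \<inter> (- ball t R)" by (auto simp: dist_norm norm_minus_commute)
      then have As': "?A \<in> sets LM" by (simp add: borel_Int_LM)
      have "(\<lambda>\<tau>. v \<tau> * f \<tau>) \<in> borel_measurable LM" by measurable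
      then have cm: "cauchy_integrand p (\<lambda>\<tau>. v \<tau> * f \<tau>) t \<in> borel_measurable LM" by (rule cauchy_integrand_measurable)
      have "set_lebesgue_integral LM ?A (cauchy_integrand p (\<lambda>\<tau>. v \<tau> * f \<tau>) t) = integral\<^sup>L LM k"
        unfolding set_lebesgue_integral_def
      proof (rule integral_cong_AE[OF _ km])
        show "(\<lambda>x. indicator ?A x *\<^sub>R cauchy_integrand p (\<lambda>\<tau>. v \<tau> * f \<tau>) t x) \<in> borel_measurable LM"
          using As' cm by measurable
        show "AE x in LM. indicator ?A x *\<^sub>R cauchy_integrand p (\<lambda>\<tau>. v \<tau> * f \<tau>) t x = k x"
          using unit_tangent_norm
        proof eventually_elim
          case (elim x)
          show ?case
          proof (cases "x \<in> A")
            case True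
            have "R \<le> cmod (x - t)" using far[OF True] R d by linarith
            moreover have "unit_tangent p x \<noteq> 0" using elim by auto
            ultimately show ?thesis using True v0[OF True] Av(3)[OF True]
              by (simp add: cauchy_integrand_def f_def k_def indicator_def)
          qed (simp add: cauchy_integrand_def f_def k_def)
        qed
      qed
      then show ?thesis by (simp add: cauchy_truncated_def)
    qed
    have "(cauchy_truncated p (\<lambda>\<tau>. v \<tau> * f \<tau>) t \<longlongrightarrow> 1 / (of_real pi * \<i>) * integral\<^sup>L LM k) (at_right 0)"
    proof (rule tendsto_eventually)
      show "\<forall>\<^sub>F R in at_right 0. cauchy_truncated p (\<lambda>\<tau>. v \<tau> * f \<tau>) t R = 1 / (of_real pi * \<i>) * integral\<^sup>L LM k"
        unfolding eventually_at_right_field using d trunc by (intro exI[of _ "d/4"]) auto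
    qed
    then have S: "cauchy_S p (\<lambda>\<tau>. v \<tau> * f \<tau>) t = 1 / (of_real pi * \<i>) * integral\<^sup>L LM k"
      unfolding cauchy_S_def by (intro tendsto_Lim) (auto simp: trivial_limit_at_right_real)
    have kk: "Re ((s - t) * k \<tau>) \<ge> 2 / 3 * indicator A \<tau>" for \<tau>
    proof (cases "\<tau> \<in> A")
      case True
      have ne: "\<tau> \<noteq> t" using far[OF True] d by auto
      have "(s - t) * k \<tau> = 1 + (s - \<tau>) / (\<tau> - t)" using True ne by (simp add: k_def field_simps)
      moreover have "cmod ((s - \<tau>) / (\<tau> - t)) \<le> (d / 8) / (3 / 8 * d)"
        unfolding norm_divide using Av(4)[OF True] far[OF True] d by (intro frac_le) (auto simp: norm_minus_commute)
      then have "\<bar>Re ((s - \<tau>) / (\<tau> - t))\<bar> \<le> 1 / 3" using abs_Re_le_cmod[of "(s - \<tau>) / (\<tau> - t)"] d by simp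
      ultimately show ?thesis using True by simp
    qed (simp add: k_def)
    have "2 / 3 * measure LM A = (\<integral>\<tau>. 2 / 3 * indicator A \<tau> \<partial>LM)"
      using As Av(3) by (simp add: Int_absorb2 subset_iff)
    also have "\<dots> \<le> (\<integral>\<tau>. Re ((s - t) * k \<tau>) \<partial>LM)"
      using ki As kk by (intro integral_mono integrable_mult_right integrable_Re) (auto simp: emeasure_eq_measure)
    also have "\<dots> = Re ((s - t) * integral\<^sup>L LM k)" using ki by (simp add: integral_Re[symmetric] del: times_complex.simps)
    also have "\<dots> \<le> cmod ((s - t) * integral\<^sup>L LM k)" by (rule complex_Re_le_cmod)
    also have "\<dots> \<le> B * cmod (integral\<^sup>L LM k)" unfolding norm_mult using B(2)[OF s t(1)] by (intro mult_right_mono) auto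
    finally have "2 / 3 * measure LM A / B \<le> cmod (integral\<^sup>L LM k)" using B(1) by (simp add: field_simps)
    then have "c0 \<le> cmod (integral\<^sup>L LM k) / pi" unfolding c0_def using B(1) by (simp add: field_simps)
    then show ?thesis unfolding S by (simp add: norm_mult norm_divide)
  qed
  show thesis
  proof (rule that[of "1 / c0" g])
    fix t assume t: "t \<in> path_image p" "d / 2 \<le> cmod (t - s)"
    have "c0 * cmod (u t) \<le> cmod (g t)" unfolding g_def norm_mult using low[OF t] by (metis mult.commute mult_left_mono norm_ge_zero)
    then show "cmod (u t) \<le> 1 / c0 * cmod (g t)" using c0 by (simp add: field_simps)
  qed (use c0 gX in auto)
qed

text \<open>The estimate away from a point is used for two points of the curve at distance
  \<open>d\<close>: every point of the curve is at distance at least \<open>d/2\<close> from one of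
  them.\<close>

lemma mult_S_mult_weighted:
  assumes \<rho>: "banach_function_norm LM \<rho>" and w: "is_weight LM w"
    and b: "mult_S_mult_bounded p \<rho> w u v" and v: "v \<in> borel_measurable LM" "AE \<tau> in LM. v \<tau> \<noteq> 0"
    and u: "u \<in> borel_measurable LM"
  shows "u \<in> weighted_space LM \<rho> w"
proof -
  have wm[measurable]: "w \<in> borel_measurable LM" using w by (auto simp: is_weight_def)
  define s1 where "s1 = p 0"
  define s2 where "s2 = p (1/2)"
  have s: "s1 \<in> path_image p" "s2 \<in> path_image p" by (auto simp: s1_def s2_def path_image_def)
  have "s1 \<noteq> s2" using simple_path_eq_interior[OF simple, of "1/2" 0] by (auto simp: s1_def s2_def)
  define d where "d = cmod (s1 - s2)"
  have d: "d > 0" using \<open>s1 \<noteq> s2\<close> by (simp add: d_def)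
  obtain K1 g1 where 1: "K1 > 0" "g1 \<in> weighted_space LM \<rho> w" "\<And>t. t \<in> path_image p \<Longrightarrow> d / 2 \<le> cmod (t - s1) \<Longrightarrow> cmod (u t) \<le> K1 * cmod (g1 t)"
    using mult_S_mult_far_part[OF \<rho> w b v s(1) d] by metis
  obtain K2 g2 where 2: "K2 > 0" "g2 \<in> weighted_space LM \<rho> w" "\<And>t. t \<in> path_image p \<Longrightarrow> d / 2 \<le> cmod (t - s2) \<Longrightarrow> cmod (u t) \<le> K2 * cmod (g2 t)"
    using mult_S_mult_far_part[OF \<rho> w b v s(2) d] by metis
  have gm[measurable]: "g1 \<in> borel_measurable LM" "g2 \<in> borel_measurable LM" using 1 2 by (auto simp: weighted_space_def)
  note u[measurable]
  define G1 where "G1 x = ennreal (cmod (g1 x)) * w x" for x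
  define G2 where "G2 x = ennreal (cmod (g2 x)) * w x" for x
  have Gm[measurable]: "G1 \<in> borel_measurable LM" "G2 \<in> borel_measurable LM" unfolding G1_def G2_def by measurable
  have "weighted_norm \<rho> w u \<le> \<rho> (\<lambda>x. ennreal K1 * G1 x + ennreal K2 * G2 x)"
    unfolding weighted_norm_def
  proof (rule banach_function_normD(3)[OF \<rho>])
    show "AE x in LM. ennreal (cmod (u x)) * w x \<le> ennreal K1 * G1 x + ennreal K2 * G2 x"
    proof (rule AE_I2)
      fix x assume "x \<in> space LM"
      then have x: "x \<in> path_image p" by simp
      have "cmod (s1 - s2) \<le> cmod (x - s1) + cmod (x - s2)" using norm_triangle_ineq4[of "x - s2" "x - s1"] by simp
      then have "d / 2 \<le> cmod (x - s1) \<or> d / 2 \<le> cmod (x - s2)" unfolding d_def by linarith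
      then show "ennreal (cmod (u x)) * w x \<le> ennreal K1 * G1 x + ennreal K2 * G2 x"
      proof
        assume "d / 2 \<le> cmod (x - s1)"
        then have "ennreal (cmod (u x)) \<le> ennreal K1 * ennreal (cmod (g1 x))"
          using 1(3)[OF x] 1(1) by (simp add: ennreal_mult[symmetric] ennreal_leI)
        then have "ennreal (cmod (u x)) * w x \<le> ennreal K1 * G1 x"
          unfolding G1_def mult.assoc[symmetric] by (rule mult_right_mono) simp
        then show ?thesis by (simp add: add_increasing2)
      next
        assume "d / 2 \<le> cmod (x - s2)"
        then have "ennreal (cmod (u x)) \<le> ennreal K2 * ennreal (cmod (g2 x))"
          using 2(3)[OF x] 2(1) by (simp add: ennreal_mult[symmetric] ennreal_leI)
        then have "ennreal (cmod (u x)) * w x \<le> ennreal K2 * G2 x"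
          unfolding G2_def mult.assoc[symmetric] by (rule mult_right_mono) simp
        then show ?thesis by (simp add: add_increasing)
      qed
    qed
  qed measurable
  also have "\<dots> \<le> \<rho> (\<lambda>x. ennreal K1 * G1 x) + \<rho> (\<lambda>x. ennreal K2 * G2 x)"
    by (rule banach_function_normD(2)[OF \<rho>]) measurable
  also have "\<dots> = ennreal K1 * \<rho> G1 + ennreal K2 * \<rho> G2"
    using banach_function_normD(1)[OF \<rho> Gm(1), of K1] banach_function_normD(1)[OF \<rho> Gm(2), of K2] 1(1) 2(1) by simp
  also have "\<dots> < \<infinity>"
    using 1(2) 2(2) by (simp add: weighted_space_def weighted_norm_def G1_def[abs_def] G2_def[abs_def] ennreal_mult_less_top)
  finally show ?thesis using u by (simp add: weighted_space_def)
qed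

end

section \<open>Cuts and inversion\<close>

lemma closed_if_closed_Int_cball:
  fixes S :: "complex set"
  assumes "\<And>B. closed (S \<inter> cball 0 B)"
  shows "closed S"
  unfolding closed_sequential_limits
proof (intro allI impI)
  fix x l assume x: "(\<forall>n. x n \<in> S) \<and> x \<longlonglongrightarrow> l"
  then have "bounded (range x)" using convergent_imp_bounded by blast
  then obtain B where B: "\<And>n. norm (x n) \<le> B" unfolding bounded_iff by auto
  have "l \<in> S \<inter> cball 0 B"
    by (rule closed_sequentially[OF assms[of B], of x]) (use x B in auto)
  then show "l \<in> S" by simp
qed

text \<open>In polar coordinates both sets are images of convex rectangles, with the angle ranging
  over the open interval from \<open>0\<close> to \<open>2 pi\<close>.\<close>

lemma connected_slit_annulus:
  "connected {\<xi>. 1 < cmod \<xi> \<and> \<xi> \<notin> of_real ` {1..}}"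
  "connected {\<xi>. cmod \<xi> < 1 \<and> \<xi> \<notin> of_real ` {0..1}}"
proof -
  let ?f = "\<lambda>(r, \<theta>). of_real r * cis \<theta>"
  have c: "connected (?f ` A)" if "convex A" for A :: "(real \<times> real) set"
    unfolding split_beta by (intro connected_continuous_image continuous_intros convex_connected that)
  have polar: "\<exists>\<theta>\<in>{0<..<2*pi}. \<xi> = of_real (cmod \<xi>) * cis \<theta>" if "\<xi> \<notin> of_real ` {0..}" for \<xi>
  proof -
    have A: "\<xi> = of_real (cmod \<xi>) * cis (Arg \<xi>)" using rcis_cmod_Arg[of \<xi>] by (simp add: rcis_def)
    have "Arg \<xi> \<noteq> 0"
    proof
      assume "Arg \<xi> = 0"
      then have "\<xi> = of_real (cmod \<xi>)" using A by simp
      then show False using that by (metis atLeast_iff image_eqI norm_ge_zero)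
    qed
    moreover have "- pi < Arg \<xi>" "Arg \<xi> \<le> pi" using Arg_bounded by auto
    moreover have "cis (Arg \<xi> + 2 * pi) = cis (Arg \<xi>)" by (simp add: cis_mult[symmetric])
    ultimately show ?thesis
      using A pi_gt_zero by (cases "Arg \<xi> > 0") (force intro: bexI[of _ "Arg \<xi>"], intro bexI[of _ "Arg \<xi> + 2*pi"], auto)
  qed
  have nonreal: "of_real r * cis \<theta> \<notin> of_real ` {0..}" if "r > 0" "\<theta> \<in> {0<..<2*pi}" for r \<theta>
  proof
    assume "complex_of_real r * cis \<theta> \<in> of_real ` {0..}"
    then obtain y where y: "y \<ge> 0" "complex_of_real r * cis \<theta> = of_real y" by auto
    then have "y = r" using that by (metis abs_of_nonneg abs_of_pos mult.right_neutral norm_cis norm_mult norm_of_real)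
    then have "cis \<theta> = 1" using y that by simp
    then have "cos \<theta> = 1" by (simp add: complex_eq_iff)
    then obtain n :: int where "\<theta> = of_int n * 2 * pi" using cos_one_2pi_int by blast
    then have "0 < of_int n * (2 * pi)" "of_int n * (2 * pi) < 1 * (2*pi)" using that by auto
    then have "0 < n" "n < 1" using pi_gt_zero by (auto simp: zero_less_mult_iff mult_less_cancel_right)
    then show False by simp
  qed
  have "{\<xi>. 1 < cmod \<xi> \<and> \<xi> \<notin> of_real ` {1..}} = ?f ` ({1<..} \<times> {0<..<2*pi})"
  proof (intro equalityI subsetI)
    fix \<xi> assume "\<xi> \<in> {\<xi>. 1 < cmod \<xi> \<and> \<xi> \<notin> of_real ` {1..}}"
    then have x: "1 < cmod \<xi>" "\<xi> \<notin> of_real ` {1..}" by auto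
    have "\<xi> \<notin> of_real ` {0..}"
    proof
      assume "\<xi> \<in> of_real ` {0..}"
      then obtain y where "y \<ge> 0" "\<xi> = of_real y" by auto
      then show False using x by auto
    qed
    then obtain \<theta> where "\<theta> \<in> {0<..<2*pi}" "\<xi> = of_real (cmod \<xi>) * cis \<theta>" using polar by blast
    then show "\<xi> \<in> ?f ` ({1<..} \<times> {0<..<2*pi})" using x by (intro image_eqI[of _ _ "(cmod \<xi>, \<theta>)"]) auto
  next
    fix \<xi> assume "\<xi> \<in> ?f ` ({1<..} \<times> {0<..<2*pi})"
    then obtain r \<theta> where r: "1 < r" "\<theta> \<in> {0<..<2*pi}" "\<xi> = of_real r * cis \<theta>" by auto
    then have "\<xi> \<notin> of_real ` {0..}" using nonreal[of r \<theta>] by auto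
    then show "\<xi> \<in> {\<xi>. 1 < cmod \<xi> \<and> \<xi> \<notin> of_real ` {1..}}" using r by (auto simp: norm_mult)
  qed
  then show "connected {\<xi>. 1 < cmod \<xi> \<and> \<xi> \<notin> of_real ` {1..}}" using c[of "{1<..} \<times> {0<..<2*pi}"] by (simp add: convex_Times)
  have "{\<xi>. cmod \<xi> < 1 \<and> \<xi> \<notin> of_real ` {0..1}} = ?f ` ({0<..<1} \<times> {0<..<2*pi})"
  proof (intro equalityI subsetI)
    fix \<xi> assume "\<xi> \<in> {\<xi>. cmod \<xi> < 1 \<and> \<xi> \<notin> of_real ` {0..1}}"
    then have x: "cmod \<xi> < 1" "\<xi> \<notin> of_real ` {0..1}" by auto
    have n0: "\<xi> \<notin> of_real ` {0..}"
    proof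
      assume "\<xi> \<in> of_real ` {0..}"
      then obtain y where "y \<ge> 0" "\<xi> = of_real y" by auto
      then show False using x by auto
    qed
    then obtain \<theta> where "\<theta> \<in> {0<..<2*pi}" "\<xi> = of_real (cmod \<xi>) * cis \<theta>" using polar by blast
    moreover have "\<xi> \<noteq> 0" using n0 by force
    ultimately show "\<xi> \<in> ?f ` ({0<..<1} \<times> {0<..<2*pi})" using x by (intro image_eqI[of _ _ "(cmod \<xi>, \<theta>)"]) auto
  next
    fix \<xi> assume "\<xi> \<in> ?f ` ({0<..<1} \<times> {0<..<2*pi})"
    then obtain r \<theta> where r: "0 < r" "r < 1" "\<theta> \<in> {0<..<2*pi}" "\<xi> = of_real r * cis \<theta>" by auto
    then have "\<xi> \<notin> of_real ` {0..}" using nonreal[of r \<theta>] by auto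
    then show "\<xi> \<in> {\<xi>. cmod \<xi> < 1 \<and> \<xi> \<notin> of_real ` {0..1}}" using r by (auto simp: norm_mult)
  qed
  then show "connected {\<xi>. cmod \<xi> < 1 \<and> \<xi> \<notin> of_real ` {0..1}}" using c[of "{0<..<1} \<times> {0<..<2*pi}"] by (simp add: convex_Times)
qed

text \<open>The inside and the slit outside, each enlarged by the curve without \<open>t\<close>,
  are connected and overlap in that punctured curve, so the complement of the cut is connected. As
  the cut is itself connected and unbounded, the complement has no holes.\<close>

lemma simply_connected_cut_plane:
  fixes c :: "real \<Rightarrow> complex" and \<Lambda> :: "complex set"
  assumes c: "simple_path c" "pathfinish c = pathstart c"
    and \<Lambda>: "closed \<Lambda>" "connected \<Lambda>" "\<not> bounded \<Lambda>" "\<Lambda> \<inter> path_image c = {t}" "\<Lambda> \<inter> inside (path_image c) = {}"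
    and out: "connected (outside (path_image c) - \<Lambda>)"
  shows "open (- \<Lambda>)" "simply_connected (- \<Lambda>)" "inside (path_image c) \<subseteq> - \<Lambda>" "path_image c - {t} \<subseteq> - \<Lambda>"
proof -
  define G where "G = path_image c - {t}"
  show o: "open (- \<Lambda>)" and i: "inside (path_image c) \<subseteq> - \<Lambda>" and g: "path_image c - {t} \<subseteq> - \<Lambda>" using \<Lambda> by auto
  have j: "connected (inside (path_image c))" "frontier (inside (path_image c)) = path_image c" "frontier (outside (path_image c)) = path_image c"
    using Jordan_inside_outside[OF c] by auto
  have c1: "connected (inside (path_image c) \<union> G)"
  proof (rule connected_intermediate_closure[OF j(1)])
    show "inside (path_image c) \<union> G \<subseteq> closure (inside (path_image c))"
      using closure_subset[of "inside (path_image c)"] j(2) unfolding G_def frontier_def by blast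
  qed simp
  have c2: "connected ((outside (path_image c) - \<Lambda>) \<union> G)"
  proof (rule connected_intermediate_closure[OF out])
    have "G \<subseteq> closure (outside (path_image c) - \<Lambda>)"
    proof
      fix \<tau> assume t: "\<tau> \<in> G"
      then have "\<tau> \<in> closure (outside (path_image c))" using j(3) by (auto simp: G_def frontier_def)
      moreover have "\<tau> \<in> - \<Lambda>" using t g by (auto simp: G_def)
      ultimately have "\<tau> \<in> closure ((- \<Lambda>) \<inter> outside (path_image c))" using open_Int_closure_subset[OF o] by blast
      moreover have "(- \<Lambda>) \<inter> outside (path_image c) = outside (path_image c) - \<Lambda>" by auto
      ultimately show "\<tau> \<in> closure (outside (path_image c) - \<Lambda>)" by simp
    qed
    then show "outside (path_image c) - \<Lambda> \<union> G \<subseteq> closure (outside (path_image c) - \<Lambda>)" using closure_subset by blast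
  qed auto
  have c3: "G \<noteq> {}"
  proof
    assume "G = {}"
    then have "path_image c \<subseteq> {t}" by (auto simp: G_def)
    then have "c 0 = c (1/2)" by (simp add: path_image_def image_subset_iff)
    then show False using simple_path_eq_interior[OF c(1), of "1/2" 0] by simp
  qed
  have "connected ((inside (path_image c) \<union> G) \<union> ((outside (path_image c) - \<Lambda>) \<union> G))"
    by (rule connected_Un[OF c1 c2]) (use c3 in blast)
  moreover have "(inside (path_image c) \<union> G) \<union> ((outside (path_image c) - \<Lambda>) \<union> G) = - \<Lambda>"
    using i g \<Lambda>(4) inside_Un_outside[of "path_image c"] unfolding G_def by blast
  ultimately have "connected (- \<Lambda>)" by simp
  moreover have "components \<Lambda> = {\<Lambda>}" using \<Lambda>(2,3) by (metis components_eq_sing_iff bounded_empty)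
  ultimately show "simply_connected (- \<Lambda>)"
    unfolding simply_connected_eq_unbounded_complement_components[OF o] using \<Lambda>(3) by simp
qed

text \<open>The complement of the inverted curve is the disjoint union of the open sets
  \<open>A\<close> and \<open>B\<close>, where \<open>A\<close> is bounded and \<open>B\<close> is
  connected and unbounded. Components that meet \<open>A\<close> stay in it and are bounded, while
  \<open>B\<close> lies in an unbounded one.\<close>

lemma inside_inverse_curve:
  fixes c :: "real \<Rightarrow> complex"
  assumes c: "simple_path c" "pathfinish c = pathstart c" and z0: "0 \<in> inside (path_image c)"
  shows "inside (inverse ` path_image c) = insert 0 (inverse ` outside (path_image c))"
    "outside (inverse ` path_image c) = inverse ` (inside (path_image c) - {0})"
proof -
  let ?G = "path_image c"
  have j: "connected (inside ?G)" "connected (outside ?G)" "open (inside ?G)" "open (outside ?G)" "\<not> bounded (outside ?G)"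
    using Jordan_inside_outside[OF c] by auto
  have G0: "0 \<notin> ?G" "0 \<notin> outside ?G" using z0 inside_no_overlap[of ?G] inside_Int_outside[of ?G] by blast+
  define A where "A = insert 0 (inverse ` outside ?G)"
  define B where "B = inverse ` (inside ?G - {0})"
  have inv_cont: "continuous_on X inverse" if "0 \<notin> X" for X :: "complex set" using that by (intro continuous_intros) auto
  obtain r where r: "r > 0" "ball 0 r \<subseteq> inside ?G" using j(3) z0 open_contains_ball by blast
  have bA: "bounded A"
  proof -
    have "norm (inverse z) \<le> inverse r" if z: "z \<in> outside ?G" for z
    proof -
      have "z \<notin> ball 0 r" using r z inside_Int_outside[of ?G] by blast
      then show ?thesis using r by (auto simp: norm_inverse dist_norm intro!: le_imp_inverse_le)
    qed
    then show ?thesis unfolding A_def bounded_iff using r by (auto intro!: exI[of _ "inverse r"])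
  qed
  have img: "\<zeta> \<in> inverse ` X \<longleftrightarrow> inverse \<zeta> \<in> X" for \<zeta> and X :: "complex set"
  proof
    assume "inverse \<zeta> \<in> X"
    then show "\<zeta> \<in> inverse ` X" by (rule image_eqI[rotated]) simp
  qed auto
  have memA: "\<zeta> \<in> A \<longleftrightarrow> \<zeta> = 0 \<or> inverse \<zeta> \<in> outside ?G" for \<zeta>
    unfolding A_def insert_iff img by simp
  have memB: "\<zeta> \<in> B \<longleftrightarrow> \<zeta> \<noteq> 0 \<and> inverse \<zeta> \<in> inside ?G" for \<zeta>
    unfolding B_def img by auto
  have memG: "\<zeta> \<in> inverse ` ?G \<longleftrightarrow> \<zeta> \<noteq> 0 \<and> inverse \<zeta> \<in> ?G" for \<zeta>
    unfolding img using G0 by auto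
  have nI: "z \<notin> ?G" if "z \<in> inside ?G" for z using that inside_no_overlap[of ?G] by blast
  have nO: "z \<notin> inside ?G" if "z \<in> outside ?G" for z using that inside_Int_outside[of ?G] by blast
  have AB: "A \<inter> B = {}" using memA memB nO by auto
  have comp: "- (inverse ` ?G) = A \<union> B"
  proof -
    have "inverse \<zeta> \<in> outside ?G \<longleftrightarrow> inverse \<zeta> \<notin> ?G \<and> inverse \<zeta> \<notin> inside ?G" for \<zeta>
      using inside_Un_outside[of ?G] inside_Int_outside[of ?G] by blast
    then show ?thesis using memA memB memG G0 nI by blast
  qed
  have oB: "open B"
  proof -
    have "B = - {0} \<inter> inverse -` inside ?G" using memB by auto
    moreover have "open (- {0} \<inter> inverse -` inside ?G)"
      by (rule continuous_open_preimage[OF inv_cont]) (use j in auto)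
    ultimately show ?thesis by simp
  qed
  \<comment> \<open>At \<open>0\<close> openness says that a neighbourhood of infinity belongs to
    the outside, that is, that the curve and its inside are bounded.\<close>
  have oA: "open A"
  proof -
    have "\<exists>e>0. ball \<zeta> e \<subseteq> A" if \<zeta>: "\<zeta> \<in> A" for \<zeta>
    proof (cases "\<zeta> = 0")
      case True
      have "bounded (?G \<union> inside ?G)" using Jordan_inside_outside[OF c] c(1) by (simp add: bounded_path_image simple_path_imp_path)
      then obtain b where b: "b > 0" "\<And>z. z \<in> ?G \<union> inside ?G \<Longrightarrow> cmod z \<le> b" unfolding bounded_pos by blast
      have "ball 0 (inverse (2*b)) \<subseteq> A"
      proof
        fix x :: complex assume x: "x \<in> ball 0 (inverse (2*b))"
        show "x \<in> A"
        proof (rule ccontr)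
          assume nA: "x \<notin> A"
          then have "x \<noteq> 0" "inverse x \<notin> outside ?G" using memA by auto
          then have "cmod (inverse x) \<le> b" using b(2)[of "inverse x"] inside_Un_outside[of ?G] by blast
          then have "inverse (cmod x) \<le> b" by (simp add: norm_inverse)
          moreover have "inverse (inverse (2*b)) < inverse (cmod x)" using x \<open>x \<noteq> 0\<close> by (intro less_imp_inverse_less) auto
          moreover have "inverse (inverse (2*b)) = 2*b" by (rule inverse_inverse_eq)
ultimately show False using b(1) by linarith
        qed
      qed
      then show ?thesis using True b(1) by (intro exI[of _ "inverse (2*b)"]) auto
    next
      case False
      have "open (- {0} \<inter> inverse -` outside ?G)"
        by (rule continuous_open_preimage[OF inv_cont]) (use j in auto)
      moreover have "\<zeta> \<in> - {0} \<inter> inverse -` outside ?G" using False \<zeta> memA by auto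
      ultimately obtain e where "e > 0" "ball \<zeta> e \<subseteq> - {0} \<inter> inverse -` outside ?G" using open_contains_ball by blast
      then show ?thesis using memA by (intro exI[of _ e]) auto
    qed
    then show ?thesis by (simp add: open_contains_ball)
  qed
  have cB: "connected B" unfolding B_def
    by (rule connected_continuous_image[OF inv_cont]) (use connected_open_delete[OF j(3,1)] in auto)
  have ubB: "\<not> bounded B"
  proof
    assume "bounded B"
    then obtain b where b: "b > 0" "\<And>z. z \<in> B \<Longrightarrow> cmod z \<le> b" unfolding bounded_pos by blast
    define x where "x = min (r/2) (inverse (2*b))"
    have x: "0 < x" "x < r" "x \<le> inverse (2*b)" using r b by (auto simp: x_def)
    have "inverse (complex_of_real x) \<in> B" using r(2) x memB[of "inverse (complex_of_real x)"] by (auto simp: subset_iff)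
    then have "inverse x \<le> b" using b(2) x by (force simp: norm_inverse)
    moreover have "inverse (inverse (2*b)) \<le> inverse x" using x by (intro le_imp_inverse_le) auto
    moreover have "inverse (inverse (2*b)) = 2*b" by (rule inverse_inverse_eq)
ultimately show False using b(1) by linarith
  qed
  have sepA: "connected_component_set (- (inverse ` ?G)) \<zeta> \<subseteq> A" if "\<zeta> \<in> A" for \<zeta>
  proof -
    let ?C = "connected_component_set (- (inverse ` ?G)) \<zeta>"
    have cC: "connected ?C" by simp
    have CAB: "?C \<subseteq> A \<union> B" unfolding comp[symmetric] by (rule connected_component_subset)
    have "\<zeta> \<in> ?C" using that comp by (simp add: connected_component_refl)
    then have "A \<inter> ?C \<noteq> {}" using that by blast
    then have "B \<inter> ?C = {}" using connectedD[OF cC oA oB] AB CAB by blast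
    then show ?thesis using CAB by blast
  qed
  have "\<zeta> \<in> inside (inverse ` ?G) \<longleftrightarrow> \<zeta> \<in> A" for \<zeta>
  proof
    assume z: "\<zeta> \<in> inside (inverse ` ?G)"
    show "\<zeta> \<in> A"
    proof (rule ccontr)
      assume "\<zeta> \<notin> A"
      then have zB: "\<zeta> \<in> B" using z comp by (auto simp: inside_def)
      have "B \<subseteq> connected_component_set (- (inverse ` ?G)) \<zeta>"
        by (rule connected_component_maximal[OF zB cB]) (use comp in auto)
      then show False using z ubB bounded_subset by (auto simp: inside_def)
    qed
  next
    assume z: "\<zeta> \<in> A"
    then show "\<zeta> \<in> inside (inverse ` ?G)" using sepA[OF z] bA bounded_subset comp by (auto simp: inside_def)
  qed
  then have I: "inside (inverse ` ?G) = A" by blast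
  then show "inside (inverse ` ?G) = insert 0 (inverse ` outside ?G)" by (simp add: A_def)
  have "outside (inverse ` ?G) = - (inverse ` ?G) - A"
    using inside_Un_outside[of "inverse ` ?G"] inside_Int_outside[of "inverse ` ?G"] I by auto
  then show "outside (inverse ` ?G) = inverse ` (inside ?G - {0})" using comp AB by (auto simp: B_def)
qed

text \<open>Two of the connectedness statements prepare the inversion: the cut without
  \<open>0\<close> becomes a connected cut reaching infinity, and the inside minus the cut, an image
  of the slit disc, becomes the slit outside.\<close>

lemma interior_cut_props:
  assumes "interior_conformal_map \<Gamma> t \<Phi>" "inside \<Gamma> \<inter> \<Gamma> = {}" "t \<in> \<Gamma>"
  shows "compact (interior_cut \<Phi>)" "0 \<in> interior_cut \<Phi>" "t \<in> interior_cut \<Phi>" "connected (interior_cut \<Phi>)" "interior_cut \<Phi> \<subseteq> insert t (inside \<Gamma>)"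
    "connected (interior_cut \<Phi> - {0})" "connected (inside \<Gamma> - interior_cut \<Phi>)"
    "continuous_on {0..1} (\<lambda>x. \<Phi> (of_real x))" "\<Phi> (of_real 0) = 0" "\<Phi> (of_real 1) = t" "(\<lambda>x. \<Phi> (of_real x)) ` {0..<1} \<subseteq> inside \<Gamma>"
proof -
  have h: "\<Phi> holomorphic_on ball 0 1" "bij_betw \<Phi> (ball 0 1) (inside \<Gamma>)" "continuous_on (cball 0 1) \<Phi>" "\<Phi> 0 = 0" "\<Phi> 1 = t"
    using assms(1) by (auto simp: interior_conformal_map_def)
  have inj: "inj_on \<Phi> (ball 0 1)" and im: "\<Phi> ` ball 0 1 = inside \<Gamma>" using h(2) by (auto simp: bij_betw_def)
  show c: "continuous_on {0..1} (\<lambda>x. \<Phi> (of_real x))"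
    by (rule continuous_on_compose2[OF h(3)]) (auto intro!: continuous_intros)
  show "\<Phi> (of_real 0) = 0" "\<Phi> (of_real 1) = t" using h by auto
  show i: "(\<lambda>x. \<Phi> (of_real x)) ` {0..<1} \<subseteq> inside \<Gamma>" using im by auto
  show "compact (interior_cut \<Phi>)" "connected (interior_cut \<Phi>)" unfolding interior_cut_def
    by (intro compact_continuous_image connected_continuous_image c; simp)+
  show "0 \<in> interior_cut \<Phi>" unfolding interior_cut_def by (rule image_eqI[of _ _ 0]) (use h in auto)
  show "t \<in> interior_cut \<Phi>" unfolding interior_cut_def by (rule image_eqI[of _ _ 1]) (use h in auto)
  show "interior_cut \<Phi> \<subseteq> insert t (inside \<Gamma>)"
  proof
    fix z assume "z \<in> interior_cut \<Phi>"
    then obtain x where x: "0 \<le> x" "x \<le> 1" "z = \<Phi> (of_real x)" by (auto simp: interior_cut_def)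
    then show "z \<in> insert t (inside \<Gamma>)" using subsetD[OF i imageI[of x "{0..<1}"]] h(5) by (cases "x = 1") auto
  qed
  have n0: "\<Phi> (of_real x) \<noteq> 0" if x: "0 < x" "x \<le> 1" for x
  proof (cases "x = 1")
    case True
    have "0 \<in> inside \<Gamma>" using i h(4) by force
    then have "0 \<notin> \<Gamma>" using assms(2) by blast
    then show ?thesis using True h(5) assms(3) by auto
  next
    case False
    then show ?thesis using inj_onD[OF inj, of "of_real x" 0] h(4) x by auto
  qed
  have "interior_cut \<Phi> - {0} = (\<lambda>x. \<Phi> (of_real x)) ` {0<..1}"
    unfolding interior_cut_def using n0 h(4) by (auto simp: image_iff) (metis greaterThanAtMost_iff of_real_0 order_le_less)
  moreover have "continuous_on {0<..1} (\<lambda>x. \<Phi> (of_real x))" by (rule continuous_on_subset[OF c]) auto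
  moreover have "connected {0<..1::real}" unfolding connected_iff_interval by auto
  ultimately show "connected (interior_cut \<Phi> - {0})" using connected_continuous_image by metis
  have "inside \<Gamma> - interior_cut \<Phi> = \<Phi> ` {\<xi>. cmod \<xi> < 1 \<and> \<xi> \<notin> of_real ` {0..1}}"
  proof (intro equalityI subsetI)
    fix z assume z: "z \<in> inside \<Gamma> - interior_cut \<Phi>"
    then have "z \<in> \<Phi> ` ball 0 1" using im by auto
    then obtain \<xi> where x: "\<xi> \<in> ball 0 1" "z = \<Phi> \<xi>" by blast
    then have "\<xi> \<notin> of_real ` {0..1}" using z by (auto simp: interior_cut_def)
    then show "z \<in> \<Phi> ` {\<xi>. cmod \<xi> < 1 \<and> \<xi> \<notin> of_real ` {0..1}}" using x by auto
  next
    fix z assume "z \<in> \<Phi> ` {\<xi>. cmod \<xi> < 1 \<and> \<xi> \<notin> of_real ` {0..1}}"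
    then obtain \<xi> where x: "cmod \<xi> < 1" "\<xi> \<notin> of_real ` {0..1}" "z = \<Phi> \<xi>" by auto
    have zi: "z \<in> inside \<Gamma>" using x im by auto
    have "z \<notin> interior_cut \<Phi>"
    proof
      assume "z \<in> interior_cut \<Phi>"
      then obtain y where y: "0 \<le> y" "y \<le> 1" "z = \<Phi> (of_real y)" by (auto simp: interior_cut_def)
      show False
      proof (cases "y = 1")
        case True
        then show ?thesis using y h(5) zi disjoint_iff[THEN iffD1, OF assms(2)] assms(3) by auto
      next
        case False
        then have "\<xi> = of_real y" using inj_onD[OF inj, of \<xi> "of_real y"] x y by auto
        then show ?thesis using x y by auto
      qed
    qed
    then show "z \<in> inside \<Gamma> - interior_cut \<Phi>" using zi by simp
  qed
  then show "connected (inside \<Gamma> - interior_cut \<Phi>)"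
    using connected_continuous_image[OF continuous_on_subset[OF h(3)] connected_slit_annulus(2)] by (auto simp: subset_iff)
qed

lemma exterior_cut_props:
  assumes "exterior_conformal_map \<Gamma> t \<Psi>" "outside \<Gamma> \<inter> \<Gamma> = {}" "t \<in> \<Gamma>"
  shows "closed (exterior_cut \<Psi>)" "connected (exterior_cut \<Psi>)" "\<not> bounded (exterior_cut \<Psi>)" "t \<in> exterior_cut \<Psi>"
    "exterior_cut \<Psi> \<subseteq> insert t (outside \<Gamma>)" "connected (outside \<Gamma> - exterior_cut \<Psi>)"
    "continuous_on {1..} (\<lambda>x. \<Psi> (of_real x))" "filterlim (\<lambda>x. \<Psi> (of_real x)) at_infinity at_top" "(\<lambda>x. \<Psi> (of_real x)) ` {1<..} \<subseteq> outside \<Gamma>" "\<Psi> (of_real 1) = t"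
proof -
  have h: "bij_betw \<Psi> {z. 1 < cmod z} (outside \<Gamma>)" "continuous_on {z. 1 \<le> cmod z} \<Psi>" "filterlim \<Psi> at_infinity at_infinity" "\<Psi> 1 = t"
    using assms(1) by (auto simp: exterior_conformal_map_def)
  have inj: "inj_on \<Psi> {z. 1 < cmod z}" and im: "\<Psi> ` {z. 1 < cmod z} = outside \<Gamma>" using h(1) by (auto simp: bij_betw_def)
  show c: "continuous_on {1..} (\<lambda>x. \<Psi> (of_real x))"
    by (rule continuous_on_compose2[OF h(2)]) (auto intro!: continuous_intros)
  show "\<Psi> (of_real 1) = t" using h by simp
  show i: "(\<lambda>x. \<Psi> (of_real x)) ` {1<..} \<subseteq> outside \<Gamma>" using im by auto
  show f: "filterlim (\<lambda>x. \<Psi> (of_real x)) at_infinity at_top"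
    by (rule filterlim_compose[OF h(3)]) (rule filterlim_of_real_at_infinity)
  show "connected (exterior_cut \<Psi>)" unfolding exterior_cut_def by (intro connected_continuous_image c) simp
  show "t \<in> exterior_cut \<Psi>" unfolding exterior_cut_def by (rule image_eqI[of _ _ 1]) (use h in auto)
  show "exterior_cut \<Psi> \<subseteq> insert t (outside \<Gamma>)"
  proof
    fix z assume "z \<in> exterior_cut \<Psi>"
    then obtain x where x: "1 \<le> x" "z = \<Psi> (of_real x)" by (auto simp: exterior_cut_def)
    then show "z \<in> insert t (outside \<Gamma>)" using subsetD[OF i imageI[of x "{1<..}"]] h(4) by (cases "x = 1") auto
  qed
  have big: "\<exists>X\<ge>1. \<forall>x\<ge>X. B < cmod (\<Psi> (of_real x))" for B
  proof -
    have "\<forall>\<^sub>F x in at_top. B + 1 \<le> cmod (\<Psi> (of_real x))"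
      using f unfolding filterlim_at_infinity_conv_norm_at_top filterlim_at_top by blast
    then obtain X where "\<forall>x\<ge>X. B + 1 \<le> cmod (\<Psi> (of_real x))" unfolding eventually_at_top_linorder by auto
    then show ?thesis by (intro exI[of _ "max X 1"]) force
  qed
  show "closed (exterior_cut \<Psi>)"
  proof (rule closed_if_closed_Int_cball)
    fix B
    obtain X where X: "X \<ge> 1" "\<forall>x\<ge>X. B < cmod (\<Psi> (of_real x))" using big by blast
    have "exterior_cut \<Psi> \<inter> cball 0 B = (\<lambda>x. \<Psi> (of_real x)) ` {1..X} \<inter> cball 0 B"
      unfolding exterior_cut_def using X by (auto simp: image_iff) (metis atLeastAtMost_iff linorder_not_le order_le_less)
    moreover have "compact ((\<lambda>x. \<Psi> (of_real x)) ` {1..X})"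
      by (intro compact_continuous_image continuous_on_subset[OF c]) auto
    ultimately show "closed (exterior_cut \<Psi> \<inter> cball 0 B)" by (simp add: compact_imp_closed closed_Int)
  qed
  show "\<not> bounded (exterior_cut \<Psi>)"
  proof
    assume "bounded (exterior_cut \<Psi>)"
    then obtain B where B: "\<And>z. z \<in> exterior_cut \<Psi> \<Longrightarrow> cmod z \<le> B" unfolding bounded_iff by auto
    obtain X where X: "X \<ge> 1" "\<forall>x\<ge>X. B < cmod (\<Psi> (of_real x))" using big by blast
    then have "\<Psi> (of_real X) \<in> exterior_cut \<Psi>" unfolding exterior_cut_def by (intro image_eqI[of _ _ X]) auto
    then show False using B[of "\<Psi> (of_real X)"] X by force
  qed
  have "outside \<Gamma> - exterior_cut \<Psi> = \<Psi> ` {\<xi>. 1 < cmod \<xi> \<and> \<xi> \<notin> of_real ` {1..}}"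
  proof (intro equalityI subsetI)
    fix z assume z: "z \<in> outside \<Gamma> - exterior_cut \<Psi>"
    then have "z \<in> \<Psi> ` {z. 1 < cmod z}" using im by auto
    then obtain \<xi> where x: "1 < cmod \<xi>" "z = \<Psi> \<xi>" by blast
    then have "\<xi> \<notin> of_real ` {1..}" using z by (auto simp: exterior_cut_def)
    then show "z \<in> \<Psi> ` {\<xi>. 1 < cmod \<xi> \<and> \<xi> \<notin> of_real ` {1..}}" using x by auto
  next
    fix z assume "z \<in> \<Psi> ` {\<xi>. 1 < cmod \<xi> \<and> \<xi> \<notin> of_real ` {1..}}"
    then obtain \<xi> where x: "1 < cmod \<xi>" "\<xi> \<notin> of_real ` {1..}" "z = \<Psi> \<xi>" by auto
    have zi: "z \<in> outside \<Gamma>" using x im by auto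
    have "z \<notin> exterior_cut \<Psi>"
    proof
      assume "z \<in> exterior_cut \<Psi>"
      then obtain y where y: "1 \<le> y" "z = \<Psi> (of_real y)" by (auto simp: exterior_cut_def)
      show False
      proof (cases "y = 1")
        case True
        then show ?thesis using y h(4) zi disjoint_iff[THEN iffD1, OF assms(2)] assms(3) by auto
      next
        case False
        then have "\<xi> = of_real y" using inj_onD[OF inj, of \<xi> "of_real y"] x y by auto
        then show ?thesis using x y by auto
      qed
    qed
    then show "z \<in> outside \<Gamma> - exterior_cut \<Psi>" using zi by simp
  qed
  then show "connected (outside \<Gamma> - exterior_cut \<Psi>)"
    using connected_continuous_image[OF continuous_on_subset[OF h(2)] connected_slit_annulus(1)] by (auto simp: subset_iff less_imp_le)
qed

lemma inverse_curve:
  fixes c :: "real \<Rightarrow> complex"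
  assumes "simple_path c" "pathfinish c = pathstart c" "0 \<notin> path_image c"
  shows "simple_path (\<lambda>x. inverse (c x))" "pathfinish (\<lambda>x. inverse (c x)) = pathstart (\<lambda>x. inverse (c x))"
    "path_image (\<lambda>x. inverse (c x)) = inverse ` path_image c"
proof -
  have n: "c x \<noteq> 0" if "x \<in> {0..1}" for x using assms(3) that by (auto simp: path_image_def)
  have "path (\<lambda>x. inverse (c x))" unfolding path_def
    by (intro continuous_intros) (use assms(1) n in \<open>auto simp: simple_path_def path_def\<close>)
  then show "simple_path (\<lambda>x. inverse (c x))" using assms(1) by (simp add: simple_path_def loop_free_def)
  show "pathfinish (\<lambda>x. inverse (c x)) = pathstart (\<lambda>x. inverse (c x))" using assms(2) by (simp add: pathfinish_def pathstart_def)
  show "path_image (\<lambda>x. inverse (c x)) = inverse ` path_image c" by (auto simp: path_image_def)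
qed

text \<open>Inversion turns the interior cut without \<open>0\<close> into a cut from
  \<open>1/t\<close> to infinity that lies outside the inverted curve, so the criterion used for the
  exterior cut applies. The new cut is closed because inside a ball only a compact part of the old
  cut is visible, and unbounded because \<open>0\<close> is a limit point of the old one.\<close>

lemma inverted_interior_cut:
  fixes c :: "real \<Rightarrow> complex"
  assumes c: "simple_path c" "pathfinish c = pathstart c" and z0: "0 \<in> inside (path_image c)"
    and m: "interior_conformal_map (path_image c) t \<Phi>" and t: "t \<in> path_image c"
  defines "\<Lambda> \<equiv> inverse ` (interior_cut \<Phi> - {0})"
  shows "open (- \<Lambda>)" "simply_connected (- \<Lambda>)" "inside (inverse ` path_image c) \<subseteq> - \<Lambda>"
    "inverse ` path_image c - {inverse t} \<subseteq> - \<Lambda>" "inverse t \<in> \<Lambda>" "0 \<notin> \<Lambda>" "\<And>z. inverse z \<in> \<Lambda> \<Longrightarrow> z \<in> interior_cut \<Phi>"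
proof -
  let ?I = "interior_cut \<Phi>" let ?G = "path_image c"
  have d: "inside ?G \<inter> ?G = {}" by (rule inside_no_overlap)
  note I = interior_cut_props[OF m d t]
  have G0: "0 \<notin> ?G" using z0 d by blast
  have t0: "t \<noteq> 0" using t G0 by auto
  have mem: "\<zeta> \<in> \<Lambda> \<longleftrightarrow> \<zeta> \<noteq> 0 \<and> inverse \<zeta> \<in> ?I" for \<zeta>
  proof
    assume "\<zeta> \<noteq> 0 \<and> inverse \<zeta> \<in> ?I"
    then show "\<zeta> \<in> \<Lambda>" unfolding \<Lambda>_def by (intro image_eqI[of _ _ "inverse \<zeta>"]) auto
  qed (auto simp: \<Lambda>_def)
  show tL: "inverse t \<in> \<Lambda>" using mem t0 I(3) by auto
  show "0 \<notin> \<Lambda>" using mem by simp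
  show "\<And>z. inverse z \<in> \<Lambda> \<Longrightarrow> z \<in> interior_cut \<Phi>" by (simp add: mem)
  have cl: "closed \<Lambda>"
  proof (rule closed_if_closed_Int_cball)
    fix B :: real
    show "closed (\<Lambda> \<inter> cball 0 B)"
    proof (cases "B > 0")
      case False
      have "\<zeta> \<notin> \<Lambda>" if "cmod \<zeta> \<le> B" for \<zeta>
      proof -
        have "cmod \<zeta> \<le> 0" using that False by linarith
        then show ?thesis using \<open>0 \<notin> \<Lambda>\<close> by simp
      qed
      then have "\<Lambda> \<inter> cball 0 B = {}" by auto
      then show ?thesis by simp
    next
      case True
      have sub: "cmod \<zeta> \<le> B \<longleftrightarrow> inverse B \<le> cmod (inverse \<zeta>)" if "\<zeta> \<noteq> 0" for \<zeta>
        using True that by (simp add: norm_inverse)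
      have eq: "\<Lambda> \<inter> cball 0 B = inverse ` (?I - ball 0 (inverse B))"
      proof (intro equalityI subsetI)
        fix \<zeta> assume "\<zeta> \<in> \<Lambda> \<inter> cball 0 B"
        then have z: "\<zeta> \<noteq> 0" "inverse \<zeta> \<in> ?I" "cmod \<zeta> \<le> B" by (simp_all add: mem)
        have "inverse B \<le> cmod (inverse \<zeta>)" using sub[OF z(1)] z(3) by blast
        then have "inverse \<zeta> \<in> ?I - ball 0 (inverse B)" using z(2) by (simp add: dist_norm)
        then show "\<zeta> \<in> inverse ` (?I - ball 0 (inverse B))" by (rule image_eqI[rotated]) simp
      next
        fix \<zeta> assume "\<zeta> \<in> inverse ` (?I - ball 0 (inverse B))"
        then obtain z where z: "z \<in> ?I" "\<not> cmod z < inverse B" "\<zeta> = inverse z" by auto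
        have "0 < inverse B" using True by simp
        then have z0: "z \<noteq> 0" using z(2) by force
        have zz: "\<zeta> \<noteq> 0" "inverse \<zeta> = z" using z0 z(3) by simp_all
        then have "cmod \<zeta> \<le> B" using sub[OF zz(1)] z(2) by (simp only: zz not_less)
        then show "\<zeta> \<in> \<Lambda> \<inter> cball 0 B" using zz z(1) by (simp add: mem)
      qed
      have "compact (inverse ` (?I - ball 0 (inverse B)))"
        using True by (intro compact_continuous_image continuous_intros compact_diff I(1)) auto
      then show ?thesis unfolding eq by (rule compact_imp_closed)
    qed
  qed
  have co: "connected \<Lambda>" unfolding \<Lambda>_def
    by (rule connected_continuous_image[OF _ I(6)]) (intro continuous_intros, auto)
  have ub: "\<not> bounded \<Lambda>"
  proof
    assume "bounded \<Lambda>"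
    then obtain b where b: "b > 0" "\<And>\<zeta>. \<zeta> \<in> \<Lambda> \<Longrightarrow> cmod \<zeta> \<le> b" unfolding bounded_pos by blast
    have "?I \<noteq> {0}" using I(3) t0 by auto
    then have "0 islimpt ?I"
      by (intro connected_imp_perfect I(2,4)) (use I(2) in auto)
    then obtain z where z: "z \<in> ?I" "z \<noteq> 0" "dist z 0 < inverse (2*b)" unfolding islimpt_approachable using b(1)
      by (metis inverse_positive_iff_positive mult_pos_pos zero_less_numeral)
    have "inverse z \<in> \<Lambda>" using mem z by auto
    then have "inverse (cmod z) \<le> b" using b(2) by (force simp: norm_inverse)
    moreover have "inverse (inverse (2*b)) < inverse (cmod z)" using z by (intro less_imp_inverse_less) auto
    moreover have "inverse (inverse (2*b)) = 2*b" by (rule inverse_inverse_eq)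
    ultimately show False using b(1) by linarith
  qed
  have int: "\<Lambda> \<inter> inverse ` ?G = {inverse t}"
  proof (intro equalityI subsetI)
    fix \<zeta> assume "\<zeta> \<in> \<Lambda> \<inter> inverse ` ?G"
    then obtain z where z: "z \<in> ?G" "\<zeta> = inverse z" "inverse z \<in> \<Lambda>" by blast
    then have "z \<in> ?I" by (simp add: mem)
    then have "z = t" using z(1) I(5) d by blast
    then show "\<zeta> \<in> {inverse t}" using z(2) by simp
  next
    fix \<zeta> assume "\<zeta> \<in> {inverse t}"
    then show "\<zeta> \<in> \<Lambda> \<inter> inverse ` ?G" using tL t by simp
  qed
  note ic = inside_inverse_curve[OF c z0]
  have io: "inside ?G \<inter> outside ?G = {}" by (rule inside_Int_outside)
  have og: "outside ?G \<inter> ?G = {}" by (rule outside_no_overlap)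
  have dis: "\<Lambda> \<inter> inside (inverse ` ?G) = {}"
  proof (rule ccontr)
    assume "\<Lambda> \<inter> inside (inverse ` ?G) \<noteq> {}"
    then obtain \<zeta> where z: "\<zeta> \<in> \<Lambda>" "\<zeta> \<in> inside (inverse ` ?G)" by blast
    then have \<zeta>: "\<zeta> \<noteq> 0" "inverse \<zeta> \<in> ?I" by (simp_all add: mem)
    then obtain y where "y \<in> outside ?G" "\<zeta> = inverse y" using z(2) unfolding ic(1) by blast
    then have "inverse \<zeta> \<in> outside ?G" by simp
    then show False using \<zeta>(2) I(5) io og t by blast
  qed
  have oL: "outside (inverse ` ?G) - \<Lambda> = inverse ` (inside ?G - ?I)"
  proof -
    have "inverse ` (inside ?G - {0}) - \<Lambda> = inverse ` ((inside ?G - {0}) - (?I - {0}))"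
      unfolding \<Lambda>_def by (rule image_set_diff[symmetric]) (simp add: inj_on_def)
    moreover have "(inside ?G - {0}) - (?I - {0}) = inside ?G - ?I" using I(2) by blast
    ultimately show ?thesis using ic(2) by simp
  qed
  have cout: "connected (outside (inverse ` ?G) - \<Lambda>)" unfolding oL
    by (rule connected_continuous_image[OF _ I(7)]) (use I(2) in \<open>auto intro!: continuous_intros\<close>)
  note iv = inverse_curve[OF c G0]
  note S = simply_connected_cut_plane[OF iv(1,2), unfolded iv(3), OF cl co ub int dis cout]
  show "open (- \<Lambda>)" "simply_connected (- \<Lambda>)" "inside (inverse ` path_image c) \<subseteq> - \<Lambda>"
    "inverse ` path_image c - {inverse t} \<subseteq> - \<Lambda>" using S by auto
qed

lemma exterior_cut_complement:
  fixes c :: "real \<Rightarrow> complex"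
  assumes c: "simple_path c" "pathfinish c = pathstart c"
    and m: "exterior_conformal_map (path_image c) t \<Psi>" and t: "t \<in> path_image c"
  shows "open (- exterior_cut \<Psi>)" "simply_connected (- exterior_cut \<Psi>)" "inside (path_image c) \<subseteq> - exterior_cut \<Psi>"
    "path_image c - {t} \<subseteq> - exterior_cut \<Psi>"
proof -
  have d: "outside (path_image c) \<inter> path_image c = {}" by (rule outside_no_overlap)
  note E = exterior_cut_props[OF m d t]
  have e1: "exterior_cut \<Psi> \<inter> path_image c = {t}" using E(4,5) d t by blast
  have e2: "exterior_cut \<Psi> \<inter> inside (path_image c) = {}"
    using E(5) inside_Int_outside[of "path_image c"] inside_no_overlap[of "path_image c"] t by blast
  note S = simply_connected_cut_plane[OF c E(1,2,3) e1 e2 E(6)]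
  show "open (- exterior_cut \<Psi>)" "simply_connected (- exterior_cut \<Psi>)" "inside (path_image c) \<subseteq> - exterior_cut \<Psi>"
    "path_image c - {t} \<subseteq> - exterior_cut \<Psi>" using S by auto
qed

text \<open>The access path from \<open>0\<close> to \<open>1/t\<close> that the closed curve
  theorem demands for the inverted domain: the exterior cut traversed from infinity to
  \<open>t\<close> and then inverted, with infinity replaced by the value \<open>0\<close> at
  parameter \<open>0\<close>.\<close>

lemma exterior_path_inverted:
  assumes m: "exterior_conformal_map \<Gamma> t \<Psi>" and t: "t \<in> \<Gamma>" and z0: "0 \<in> inside \<Gamma>"
  defines "\<eta> \<equiv> \<lambda>x::real. if x = 0 then 0 else inverse (\<Psi> (of_real (inverse x)))"
  shows "continuous_on {0..1} \<eta>" "\<eta> 0 = 0" "\<eta> 1 = inverse t" "\<eta> ` {0..<1} \<subseteq> insert 0 (inverse ` outside \<Gamma>)"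
proof -
  have d: "outside \<Gamma> \<inter> \<Gamma> = {}" by (rule outside_no_overlap)
  note E = exterior_cut_props[OF m d t]
  show "\<eta> 0 = 0" "\<eta> 1 = inverse t" using E(10) by (auto simp: \<eta>_def)
  show "\<eta> ` {0..<1} \<subseteq> insert 0 (inverse ` outside \<Gamma>)"
  proof
    fix z assume "z \<in> \<eta> ` {0..<1}"
    then obtain x where x: "0 \<le> x" "x < 1" "z = \<eta> x" by auto
    show "z \<in> insert 0 (inverse ` outside \<Gamma>)"
    proof (cases "x = 0")
      case False
      then have "inverse x \<in> {1<..}" using x by (simp add: one_less_inverse_iff)
      then have "\<Psi> (of_real (inverse x)) \<in> outside \<Gamma>" using E(9) by blast
      then show ?thesis using x(3) False by (auto simp: \<eta>_def)
    qed (use x in \<open>simp add: \<eta>_def\<close>)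
  qed
  have lim0: "((\<lambda>x::real. inverse (\<Psi> (of_real (inverse x)))) \<longlongrightarrow> 0) (at_right 0)"
  proof -
    have "filterlim (\<lambda>x::real. \<Psi> (of_real (inverse x))) at_infinity (at_right 0)"
      by (rule filterlim_compose[OF E(8) filterlim_inverse_at_top_right])
    then show ?thesis by (rule filterlim_compose[OF tendsto_inverse_0])
  qed
  have nz: "\<Psi> (of_real y) \<noteq> 0" if "y \<ge> 1" for y
  proof -
    have "\<Psi> (of_real y) \<in> exterior_cut \<Psi>" unfolding exterior_cut_def using that by auto
    then have "\<Psi> (of_real y) \<notin> inside \<Gamma>"
      using E(5) t inside_Int_outside[of \<Gamma>] inside_no_overlap[of \<Gamma>] by blast
    then show ?thesis using z0 by metis
  qed
  have co: "continuous_on {0<..1} (\<lambda>x. inverse (\<Psi> (of_real (inverse x))))"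
  proof (rule continuous_on_inverse)
    show "continuous_on {0<..1} (\<lambda>x. \<Psi> (of_real (inverse x)))"
      by (rule continuous_on_compose2[OF E(7)]) (auto intro!: continuous_intros simp: one_le_inverse_iff)
    show "\<forall>x\<in>{0<..1}. \<Psi> (of_real (inverse x)) \<noteq> 0"
    proof
      fix x :: real assume "x \<in> {0<..1}"
      then show "\<Psi> (of_real (inverse x)) \<noteq> 0" by (intro nz) (simp add: one_le_inverse_iff)
    qed
  qed
  show "continuous_on {0..1} \<eta>"
    unfolding continuous_on_def
  proof
    fix x :: real assume x: "x \<in> {0..1}"
    show "(\<eta> \<longlongrightarrow> \<eta> x) (at x within {0..1})"
    proof (cases "x = 0")
      case True
      have "(\<eta> \<longlongrightarrow> 0) (at_right 0)"
        by (rule Lim_transform_eventually[OF lim0]) (rule eventually_mono[OF eventually_at_right_less[of 0]], simp add: \<eta>_def)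
      moreover have "at (0::real) within {0..1} = at_right 0" by (rule at_within_Icc_at_right) simp
      ultimately show ?thesis using True by (simp add: \<eta>_def)
    next
      case False
      then have x0: "x \<in> {0<..1}" using x by auto
      have "at x within {0..1} = at x within {0<..1}" by (rule at_within_nhd[of x "{0<..}"]) (use x0 in auto)
      moreover have "((\<lambda>x. inverse (\<Psi> (of_real (inverse x)))) \<longlongrightarrow> inverse (\<Psi> (of_real (inverse x)))) (at x within {0<..1})"
        using co x0 unfolding continuous_on_def by blast
      then have "(\<eta> \<longlongrightarrow> inverse (\<Psi> (of_real (inverse x)))) (at x within {0<..1})"
        by (rule Lim_transform_eventually) (auto simp: \<eta>_def eventually_at_filter)
      ultimately show ?thesis using False by (simp add: \<eta>_def)
    qed
  qed
qed

context rectifiable_loop begin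

section \<open>Difference quotients on the curve and the values of \<open>S h\<close>\<close>

lemma finite_fibre: "finite {x \<in> {0..len}. nat_par x = z}"
proof -
  have "{x \<in> {0..len}. nat_par x = z} \<subseteq> insert len {x \<in> {0..<len}. nat_par x = z}" by auto
  moreover have "finite {x \<in> {0..<len}. nat_par x = z}"
    by (rule finite_subset[OF _ finite_vimage_IntI[of "{z}" nat_par "{0..<len}"]]) (use nat_par_inj_on in auto)
  ultimately show ?thesis by (metis finite_insert finite_subset)
qed

lemma continuous_off_point_measurable:
  fixes h :: "complex \<Rightarrow> complex"
  assumes h: "continuous_on (path_image p - {t}) h"
  shows "h \<in> borel_measurable LM"
proof -
  have "(\<lambda>z. indicator (path_image p - {t}) z *\<^sub>R h z) \<in> borel_measurable borel"
  proof (rule borel_measurable_continuous_on_indicator[OF _ h])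
    have "closed (path_image p)" using simple by (simp add: closed_path_image simple_path_imp_path)
    then show "path_image p - {t} \<in> sets borel" by auto
  qed
  then have "(\<lambda>z. indicator (path_image p - {t}) z *\<^sub>R h z) \<in> borel_measurable base_measure"
    using measurable_restrict_space1[of _ borel borel "path_image p"] measurable_cong_sets[OF sets_base refl] by blast
  moreover have "AE z in base_measure. h z = indicator (path_image p - {t}) z *\<^sub>R h z"
    using AE_LM_not_point[of t, unfolded AE_LM_iff] AE_space by eventually_elim (simp add: indicator_def)
  ultimately show ?thesis unfolding LM_eq by (rule measurable_completion_AE)
qed

definition quot :: "(complex \<Rightarrow> complex) \<Rightarrow> complex \<Rightarrow> complex \<Rightarrow> complex" where
  "quot h s z = (if z = s then deriv h s else (h z - h s) / (z - s))"

lemma quot_holomorphic: "h holomorphic_on S \<Longrightarrow> open S \<Longrightarrow> s \<in> S \<Longrightarrow> quot h s holomorphic_on S"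
  unfolding quot_def[abs_def] by (rule pole_lemma) (simp_all add: interior_open)

lemma quot_eq: "h z = h s + (z - s) * quot h s z"
  by (simp add: quot_def)

text \<open>The bound is a multiple of \<open>1 + cmod (h z)\<close>, the shape in which both the
  closed curve theorem and the integrability argument take it. It also survives iteration of the
  quotient.\<close>

lemma quot_bound:
  assumes "r > 0" "r \<le> cmod (z - s)"
  shows "cmod (quot h s z) \<le> (1 + cmod (h s)) / r * (1 + cmod (h z))"
proof -
  have n: "z \<noteq> s" "0 < cmod (z - s)" using assms by auto
  have "cmod (quot h s z) = cmod (h z - h s) / cmod (z - s)" using n by (simp add: quot_def norm_divide)
  also have "\<dots> \<le> cmod (h z - h s) / r" using assms n by (intro divide_left_mono mult_pos_pos) auto
  also have "\<dots> \<le> ((1 + cmod (h s)) * (1 + cmod (h z))) / r"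
  proof (rule divide_right_mono)
    have "cmod (h z - h s) \<le> cmod (h z) + cmod (h s)" by (rule norm_triangle_ineq4)
    also have "\<dots> \<le> (1 + cmod (h s)) * (1 + cmod (h z))" by (simp add: algebra_simps)
    finally show "cmod (h z - h s) \<le> (1 + cmod (h s)) * (1 + cmod (h z))" .
  qed (use assms in simp)
  finally show ?thesis by simp
qed

text \<open>Near \<open>s\<close> the quotient is continuous on a compact disc and therefore
  bounded; elsewhere it is dominated by a multiple of \<open>1 + cmod h\<close>. The finitely many
  parameters over \<open>t\<close> are removed, since nothing is known about continuity of
  \<open>h\<close> there.\<close>

lemma quot_integrable:
  assumes S: "open S" "path_image p - {t} \<subseteq> S" and h: "h holomorphic_on S" and s: "s \<in> path_image p - {t}"
    and hi: "(\<lambda>x. h (nat_par x)) absolutely_integrable_on {0..len}"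
  shows "(\<lambda>x. quot h s (nat_par x) * dpar x) absolutely_integrable_on {0..len}"
proof (rule mult_dpar_integrable)
  define N where "N = {x \<in> {0..len}. nat_par x = t}"
  have N: "finite N" unfolding N_def by (rule finite_fibre)
  have sS: "s \<in> S" using S s by auto
  then obtain r where r: "r > 0" "cball s r \<subseteq> S" using S(1) open_contains_cball by blast
  have qh: "continuous_on S (quot h s)" using quot_holomorphic[OF h S(1) sS] by (rule holomorphic_on_imp_continuous_on)
  have "bounded (quot h s ` cball s r)"
    by (intro compact_imp_bounded compact_continuous_image continuous_on_subset[OF qh] r(2)) simp
  then obtain B0 where B0: "\<And>z. z \<in> cball s r \<Longrightarrow> cmod (quot h s z) \<le> B0" unfolding bounded_iff by blast
  define B where "B = max B0 ((1 + cmod (h s)) / r)"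
  have Bn: "B \<ge> 0" using r(1) by (auto simp: B_def le_max_iff_disj)
  have bd: "cmod (quot h s z) \<le> B * (1 + cmod (h z))" for z
  proof (cases "z \<in> cball s r")
    case True
    then have "cmod (quot h s z) \<le> B * 1" using B0 by (auto simp: B_def le_max_iff_disj)
    also have "\<dots> \<le> B * (1 + cmod (h z))" using Bn by (intro mult_left_mono) auto
    finally show ?thesis .
  next
    case False
    then have "r \<le> cmod (z - s)" by (simp add: dist_norm norm_minus_commute)
    from quot_bound[OF r(1) this] have "cmod (quot h s z) \<le> (1 + cmod (h s)) / r * (1 + cmod (h z))" .
    also have "\<dots> \<le> B * (1 + cmod (h z))" by (intro mult_right_mono) (auto simp: B_def)
    finally show ?thesis .
  qed
  have "(\<lambda>x. quot h s (nat_par x)) absolutely_integrable_on ({0..len} - N)"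
  proof (rule measurable_bounded_by_integrable_imp_absolutely_integrable)
    have "continuous_on ({0..len} - N) (\<lambda>x. quot h s (nat_par x))"
      by (rule continuous_on_compose2[OF qh continuous_on_subset[OF nat_par_cont]])
        (use S(2) nat_par_image in \<open>auto simp: N_def\<close>)
    moreover have "N \<in> null_sets lebesgue" using negligible_finite[OF N] by (simp add: negligible_iff_null_sets)
    then have "N \<in> sets lebesgue" by (rule null_setsD2)
    then show "{0..len} - N \<in> sets lebesgue" by (rule sets.Diff[rotated]) simp
    ultimately show "(\<lambda>x. quot h s (nat_par x)) \<in> borel_measurable (lebesgue_on ({0..len} - N))"
      by (rule continuous_imp_measurable_on_sets_lebesgue)
    have "(\<lambda>x. B * (1 + cmod (h (nat_par x)))) integrable_on {0..len}"
      using absolutely_integrable_norm[OF hi] set_lebesgue_integral_eq_integral(1)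
      by (intro integrable_on_mult_right integrable_add) (auto simp: absolutely_integrable_on_def)
    then show "(\<lambda>x. B * (1 + cmod (h (nat_par x)))) integrable_on ({0..len} - N)"
      by (rule integrable_spike_set) (use N in \<open>auto intro!: negligible_finite intro: finite_subset[OF _ N]\<close>)
    show "\<And>x. x \<in> {0..len} - N \<Longrightarrow> norm (quot h s (nat_par x)) \<le> B * (1 + cmod (h (nat_par x)))" using bd by simp
  qed
  then show "(\<lambda>x. quot h s (nat_par x)) absolutely_integrable_on {0..len}"
    by (rule absolutely_integrable_spike_set) (auto intro!: negligible_finite intro: finite_subset[OF _ N])
qed auto

text \<open>The part common to both evaluations of \<open>S h\<close>: for each \<open>s\<close>
  there remains the integral of \<open>quot h s\<close> along the curve.\<close>

lemma cauchy_S_of_quotients: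
  assumes ccw: "counterclockwise_about_0 p" and hm: "h \<in> borel_measurable LM"
    and qi: "\<And>s. s \<in> path_image p - {t} \<Longrightarrow> (\<lambda>x. quot h s (nat_par x) * dpar x) absolutely_integrable_on {0..len}"
  shows "cauchy_S_exists p h"
    "AE s in LM. cauchy_S p h s = h s + 1 / (of_real pi * \<i>) * integral {0..len} (\<lambda>x. quot h s (nat_par x) * dpar x)"
proof -
  obtain N where N: "negligible N"
    "\<And>x0. x0 \<in> {0<..<len} - N \<Longrightarrow>
      ((\<lambda>R. integral {x\<in>{0..len}. R \<le> cmod (nat_par x - nat_par x0)} (\<lambda>x. 1 / (nat_par x - nat_par x0) * dpar x)) \<longlongrightarrow> \<i> * of_real pi) (at_right 0)"
    using pv_integral_1[OF ccw] by blast
  define Nt where "Nt = N \<union> {x \<in> {0..len}. nat_par x = t}"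
  have Nt: "negligible Nt" unfolding Nt_def using N(1) negligible_finite[OF finite_fibre] by (rule negligible_Un)
  have pv: "(\<forall>R>0. set_integrable LM (path_image p - {\<tau> \<in> path_image p. cmod (\<tau> - nat_par x0) < R}) (cauchy_integrand p h (nat_par x0)))
    \<and> (cauchy_truncated p h (nat_par x0) \<longlongrightarrow> h (nat_par x0) + 1 / (of_real pi * \<i>) * integral {0..len} (\<lambda>x. quot h (nat_par x0) (nat_par x) * dpar x)) (at_right 0)"
    if x: "x0 \<in> {0<..<len} - Nt" for x0
  proof -
    have "nat_par x0 \<in> path_image p - {t}" using x nat_par_image by (auto simp: Nt_def)
    note q = qi[OF this]
    have xx: "x0 \<in> {0<..<len}" "x0 \<in> {0<..<len} - N" using x by (auto simp: Nt_def)
    show ?thesis by (intro conjI cauchy_principal_value[OF hm xx(1) N(2)[OF xx(2)] quot_eq q])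
  qed
  show "cauchy_S_exists p h" unfolding cauchy_S_exists_def
    by (rule AE_LM_I[OF Nt]) (use pv in blast)
  show "AE s in LM. cauchy_S p h s = h s + 1 / (of_real pi * \<i>) * integral {0..len} (\<lambda>x. quot h s (nat_par x) * dpar x)"
    by (rule AE_LM_I[OF Nt]) (use pv in \<open>simp add: cauchy_S_def tendsto_Lim\<close>)
qed

text \<open>The integral of \<open>quot h s\<close> vanishes by the closed curve theorem for the
  loop based at \<open>t\<close>. That \<open>h\<close> is a power of \<open>z - t\<close> enters
  through the size estimate: near \<open>t\<close> the quotient is bounded by a multiple of
  \<open>1 + cmod (exp (\<delta> * L z))\<close>.\<close>

lemma cauchy_S_plus:
  fixes \<eta> :: "real \<Rightarrow> complex" and L h :: "complex \<Rightarrow> complex"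
  assumes ccw: "counterclockwise_about_0 p" and t: "t \<in> path_image p"
    and eta: "continuous_on {0..1} \<eta>" "\<eta> 0 = 0" "\<eta> 1 = t" "\<eta> ` {0..<1} \<subseteq> inside (path_image p)"
    and S: "open S" "simply_connected S" "inside (path_image p) \<subseteq> S" "path_image p - {t} \<subseteq> S"
    and L: "L holomorphic_on S" "\<And>z. z \<in> S \<Longrightarrow> exp (L z) = z - t"
    and h: "\<And>z. z \<in> S \<Longrightarrow> h z = exp (\<delta> * L z)" and hi: "integrable LM h"
  shows "cauchy_S_exists p h" "AE s in LM. cauchy_S p h s = h s"
proof -
  have hh: "h holomorphic_on S"
    by (rule holomorphic_transform[of "\<lambda>z. exp (\<delta> * L z)"]) (use h L(1) in \<open>auto intro!: holomorphic_intros\<close>)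
  have hm: "h \<in> borel_measurable LM" using hi by simp
  then have hai: "(\<lambda>x. h (nat_par x)) absolutely_integrable_on {0..len}" using integral_LM(1) hi by blast
  obtain s0 where s0: "s0 \<in> {0..<len}" "nat_par s0 = t" using t nat_par_image' by (metis imageE)
  obtain N where N: "negligible N"
    "\<And>x. x \<in> {0<..<1} - N \<Longrightarrow> (shifted s0 has_vector_derivative (of_real len * dpar (shift_par s0 x))) (at x)"
    using shifted_derivative[OF s0(1)] by blast
  have z0: "0 \<in> inside (path_image p)" using ccw by (simp add: counterclockwise_about_0_def)
  have ps: "pathstart (shifted s0) = t" "pathfinish (shifted s0) = t"
    using shifted_ends[OF s0(1)] s0(2) by (auto simp: pathstart_def pathfinish_def)
  note im = shifted_image[OF s0(1)]
  note qi = quot_integrable[OF S(1,4) hh _ hai]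
  have i0: "integral {0..len} (\<lambda>x. quot h s (nat_par x) * dpar x) = 0" if s: "s \<in> path_image p - {t}" for s
  proof -
    have sS: "s \<in> S" using S s by auto
    define D where "D x = of_real len * dpar (shift_par s0 x)" for x
    note si = shifted_integral[OF s0(1) qi[OF s]]
    have eq: "(\<lambda>x. of_real len * (quot h s (nat_par (shift_par s0 x)) * dpar (shift_par s0 x))) = (\<lambda>x. quot h s (shifted s0 x) * D x)"
      by (simp add: fun_eq_iff shifted_def D_def algebra_simps)
    have hi': "(\<lambda>x. h (shifted s0 x)) absolutely_integrable_on {0..1}"
    proof -
      have "(\<lambda>x. of_real (inverse len) * (of_real len * h (nat_par (shift_par s0 x)))) absolutely_integrable_on {0..1}"
        using shifted_integral(1)[OF s0(1) hai] by (rule set_integrable_mult_right)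
      then show ?thesis using len_pos by (simp add: shifted_def mult.assoc[symmetric] del: of_real_inverse flip: of_real_mult)
    qed
    \<comment> \<open>Points within \<open>r\<close> of \<open>t\<close> have distance at least
      \<open>r\<close> from \<open>s\<close>, where \<open>quot_bound\<close> applies.\<close>
    define r where "r = cmod (t - s) / 2"
    have r: "r > 0" using s by (auto simp: r_def)
    have "integral {0..1} (\<lambda>x. quot h s (shifted s0 x) * D x) = 0"
    proof (rule integral_closed_curve_eq_0[where c = "shifted s0" and t = t and \<eta> = \<eta> and S = S and L = L and \<delta> = \<delta> and N = N and ?r0.0 = r and B = "(1 + cmod (h s)) / r"])
      show "simple_path (shifted s0)" by (rule shifted_simple[OF s0(1)])
      show "negligible N" by (rule N(1))
      show "(shifted s0 has_vector_derivative D x) (at x)" if "x \<in> {0<..<1} - N" for x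
        unfolding D_def by (rule N(2)) (use that in auto)
      show "len-lipschitz_on {0..1} (shifted s0)" by (rule shifted_lipschitz[OF s0(1)])
      show "continuous_on S L" using L(1) by (rule holomorphic_on_imp_continuous_on)
      show "quot h s holomorphic_on S" by (rule quot_holomorphic[OF hh S(1) sS])
      show "0 < r" by (rule r)
      show "cmod (quot h s z) \<le> (1 + cmod (h s)) / r * (1 + cmod (exp (\<delta> * L z)))" if z: "z \<in> S" "cmod (z - t) < r" for z
      proof -
        have "cmod (t - s) \<le> cmod (z - t) + cmod (z - s)" using norm_triangle_ineq[of "t - z" "z - s"] by (simp add: norm_minus_commute)
        then have "r \<le> cmod (z - s)" using z(2) unfolding r_def by linarith
        from quot_bound[OF r this] h[OF z(1)] show ?thesis by metis
      qed
      show "(\<lambda>x. exp (\<delta> * L (shifted s0 x))) absolutely_integrable_on {0..1}"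
      proof -
        have fin: "finite {0, 1::real}" by simp
        have "exp (\<delta> * L (shifted s0 x)) = h (shifted s0 x)" if "x \<in> {0..1} - {0,1}" for x
        proof -
          have "x \<in> {0<..<1}" using that by auto
          then have "shifted s0 x \<noteq> shifted s0 0" using simple_path_eq_interior[OF shifted_simple[OF s0(1)], of x 0] by auto
          then have "shifted s0 x \<in> path_image p - {t}" using ps that im by (auto simp: pathstart_def path_image_def)
          then show ?thesis using h[of "shifted s0 x"] S(4) by auto
        qed
        then show ?thesis using hi' by (intro absolutely_integrable_spike[OF hi' negligible_finite[OF fin]]) auto
      qed
      show "(\<lambda>x. quot h s (shifted s0 x) * D x) absolutely_integrable_on {0..1}" using si(1) unfolding eq .
    qed (use ps im z0 eta S L in auto)
    then show ?thesis using si(2) unfolding eq by simp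
  qed
  show "cauchy_S_exists p h" by (rule cauchy_S_of_quotients(1)[OF ccw hm, of t]) (rule qi)
  have r: "AE s in LM. cauchy_S p h s = h s + 1 / (of_real pi * \<i>) * integral {0..len} (\<lambda>x. quot h s (nat_par x) * dpar x)"
    by (rule cauchy_S_of_quotients(2)[OF ccw hm, of t]) (rule qi)
  show "AE s in LM. cauchy_S p h s = h s"
    using r AE_space AE_LM_not_point[of t] by eventually_elim (use i0 in simp)
qed


lemma shifted_finite_fibre:
  assumes s0: "s0 \<in> {0..<len}"
  shows "finite {x \<in> {0..1}. shifted s0 x = z}"
proof -
  have inj: "inj_on (shifted s0) {0<..<1}"
    by (rule inj_onI) (use simple_path_eq_interior[OF shifted_simple[OF s0]] shifted_ends[OF s0] in auto)
  have "{x \<in> {0..1}. shifted s0 x = z} \<subseteq> insert 0 (insert 1 (shifted s0 -` {z} \<inter> {0<..<1}))" by auto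
  moreover have "finite (shifted s0 -` {z} \<inter> {0<..<1})" by (rule finite_vimage_IntI[OF _ inj]) simp
  ultimately show ?thesis by (metis finite_insert finite_subset)
qed

text \<open>With \<open>\<zeta> = 1/z\<close>, \<open>\<sigma> = 1/s\<close> and
  \<open>T = quot H \<sigma>\<close> one finds
  \<open>quot h s z dz = \<sigma> T(\<zeta>) d\<zeta> / \<zeta>\<close>, which may have a pole at
  \<open>\<zeta> = 0\<close>, that is, at infinity. Subtracting the value \<open>T 0\<close> leaves
  the holomorphic function \<open>U\<close>, whose integral vanishes; the subtracted term is a
  multiple of \<open>dz / z\<close>, with integral \<open>2 pi i\<close>. Since
  \<open>H 0 = 1\<close>, the integral of the quotient is \<open>2 pi i (1 - h s)\<close>, hence
  \<open>S h = 2 - h\<close>.\<close>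

lemma cauchy_S_minus:
  fixes \<eta> :: "real \<Rightarrow> complex" and L h :: "complex \<Rightarrow> complex"
  assumes ccw: "counterclockwise_about_0 p" and t: "t \<in> path_image p"
    and eta: "continuous_on {0..1} \<eta>" "\<eta> 0 = 0" "\<eta> 1 = inverse t" "\<eta> ` {0..<1} \<subseteq> inside (inverse ` path_image p)"
    and S: "open S" "simply_connected S" "inside (inverse ` path_image p) \<subseteq> S" "inverse ` path_image p - {inverse t} \<subseteq> S"
    and L: "L holomorphic_on S" "\<And>\<zeta>. \<zeta> \<in> S \<Longrightarrow> exp (L \<zeta>) = 1 - t * \<zeta>" "L 0 = 0"
    and h: "\<And>z. z \<noteq> 0 \<Longrightarrow> inverse z \<in> S \<Longrightarrow> h z = exp (\<delta> * L (inverse z))" and hi: "integrable LM h"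
  shows "cauchy_S_exists p h" "AE s in LM. cauchy_S p h s = 2 - h s"
proof -
  define S' where "S' = - {0} \<inter> inverse -` S"
  have oS': "open S'" unfolding S'_def
    by (rule continuous_open_preimage) (use S(1) in \<open>auto intro!: continuous_intros\<close>)
  have S'h: "h z = exp (\<delta> * L (inverse z))" if "z \<in> S'" for z using h that by (auto simp: S'_def)
  have z0: "0 \<in> inside (path_image p)" using ccw by (simp add: counterclockwise_about_0_def)
  then have G0: "0 \<notin> path_image p" using inside_no_overlap[of "path_image p"] by blast
  have t0: "t \<noteq> 0" using t G0 by auto
  have S'G: "path_image p - {t} \<subseteq> S'"
  proof
    fix z assume z: "z \<in> path_image p - {t}"
    then have "inverse z \<in> inverse ` path_image p - {inverse t}" by simp
    then have "inverse z \<in> S" using S(4) by blast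
    moreover have "z \<noteq> 0" using z G0 by auto
    ultimately show "z \<in> S'" by (simp add: S'_def)
  qed
  have "(\<lambda>z. exp (\<delta> * L (inverse z))) holomorphic_on S'"
  proof -
    have "(L \<circ> inverse) holomorphic_on S'"
      by (rule holomorphic_on_compose_gen[OF _ L(1)]) (auto intro!: holomorphic_intros simp: S'_def)
    then show ?thesis unfolding comp_def by (intro holomorphic_intros)
  qed
  then have hh: "h holomorphic_on S'" by (rule holomorphic_transform) (use S'h in simp)
  have hm: "h \<in> borel_measurable LM" using hi by simp
  then have hai: "(\<lambda>x. h (nat_par x)) absolutely_integrable_on {0..len}" using integral_LM(1) hi by blast
  obtain s0 where s0: "s0 \<in> {0..<len}" "nat_par s0 = t" using t nat_par_image' by (metis imageE)
  obtain N where N: "negligible N"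
    "\<And>x. x \<in> {0<..<1} - N \<Longrightarrow> (shifted s0 has_vector_derivative (of_real len * dpar (shift_par s0 x))) (at x)"
    using shifted_derivative[OF s0(1)] by blast
  define c where "c = shifted s0"
  define c' where "c' x = inverse (c x)" for x
  define D where "D x = of_real len * dpar (shift_par s0 x)" for x
  define D' where "D' x = - D x / (c x)\<^sup>2" for x
  have c01: "c 0 = t" "c 1 = t" using shifted_ends[OF s0(1)] s0(2) by (auto simp: c_def)
  have im: "path_image c = path_image p" unfolding c_def by (rule shifted_image[OF s0(1)])
  have csi: "simple_path c" unfolding c_def by (rule shifted_simple[OF s0(1)])
  have cc: "pathfinish c = pathstart c" using c01 by (simp add: pathstart_def pathfinish_def)
  note ic = inverse_curve[OF csi cc G0[folded im], folded c'_def[abs_def], unfolded im]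
  have z0': "0 \<in> inside (inverse ` path_image p)"
    using inside_inverse_curve(1)[OF csi cc z0[folded im], unfolded im] by blast
  have cG: "c x \<in> path_image p" if "x \<in> {0..1}" for x using that im by (auto simp: path_image_def)
  have c0: "c x \<noteq> 0" if "x \<in> {0..1}" for x using cG[OF that] G0 by auto
  \<comment> \<open>The curve keeps a positive distance from \<open>0\<close>, which makes the
    inverted loop Lipschitz.\<close>
  obtain m where m: "m > 0" "\<And>x. x \<in> {0..1} \<Longrightarrow> m \<le> cmod (c x)"
  proof -
    have "closed (path_image p)" using simple by (simp add: closed_path_image simple_path_imp_path)
    then obtain d where "d > 0" "\<And>z. z \<in> path_image p \<Longrightarrow> d \<le> dist 0 z"
      using separate_point_closed[OF _ G0] by blast
    then show ?thesis using cG by (intro that[of d]) auto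
  qed
  have lip: "(len / (m * m))-lipschitz_on {0..1} c'"
  proof (rule lipschitz_onI)
    fix x y :: real assume xy: "x \<in> {0..1}" "y \<in> {0..1}"
    have "dist (c' x) (c' y) = cmod (c y - c x) / (cmod (c x) * cmod (c y))"
      using c0[OF xy(1)] c0[OF xy(2)] by (simp add: c'_def dist_norm norm_divide[symmetric] norm_mult[symmetric] field_simps)
    also have "\<dots> \<le> (len * dist x y) / (m * m)"
    proof (rule frac_le)
      show "cmod (c y - c x) \<le> len * dist x y"
        using lipschitz_onD[OF shifted_lipschitz[OF s0(1)] xy] by (simp add: c_def dist_norm norm_minus_commute)
      show "m * m \<le> cmod (c x) * cmod (c y)" using m xy by (intro mult_mono) auto
    qed (use m len_pos in auto)
    finally show "dist (c' x) (c' y) \<le> len / (m * m) * dist x y" by simp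
  qed (use m len_pos in simp)
  have der: "(c' has_vector_derivative D' x) (at x)" if x: "x \<in> {0<..<1} - N" for x
  proof -
    have "(c has_vector_derivative D x) (at x)" unfolding c_def D_def by (rule N(2)[OF x])
    moreover have "(inverse has_field_derivative - (inverse (c x) ^ Suc (Suc 0))) (at (c x))"
      by (rule DERIV_inverse) (use c0 x in auto)
    ultimately have "((inverse \<circ> c) has_vector_derivative D x * - (inverse (c x) ^ Suc (Suc 0))) (at x)"
      by (rule field_vector_diff_chain_at)
    then show ?thesis using c0[of x] x by (simp add: c'_def[abs_def] comp_def D'_def power2_eq_square field_simps)
  qed
  have Sz: "0 \<in> S" using S(3) z0' by blast
  define H where "H \<zeta> = exp (\<delta> * L \<zeta>)" for \<zeta>
  have H: "H holomorphic_on S" unfolding H_def[abs_def] using L(1) by (intro holomorphic_intros)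
  have hH: "h z = H (inverse z)" if "z \<in> S'" for z using S'h[OF that] by (simp add: H_def)
  \<comment> \<open>Since \<open>1 - t * \<zeta> = - t * (\<zeta> - 1/t)\<close>, subtracting
    \<open>Ln (- t)\<close> yields a logarithm of \<open>\<zeta> - 1/t\<close>, the form required by
    the closed curve theorem. The constant \<open>M\<close> records the effect on the power.\<close>
  define L' where "L' \<zeta> = L \<zeta> - Ln (- t)" for \<zeta>
  have expL': "exp (L' \<zeta>) = \<zeta> - inverse t" if "\<zeta> \<in> S" for \<zeta>
    unfolding L'_def exp_diff using L(2)[OF that] t0 by (simp add: field_simps)
  define M where "M = exp (\<delta> * Ln (- t))"
  have HL: "H \<zeta> = M * exp (\<delta> * L' \<zeta>)" for \<zeta>
    by (simp add: H_def M_def L'_def exp_add[symmetric] algebra_simps)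
  have M0: "M \<noteq> 0" by (simp add: M_def)
  note qi = quot_integrable[OF oS' S'G hh _ hai]
  have wn: "((\<lambda>x. dpar x / nat_par x) has_integral 2 * of_real pi * \<i>) {0..len}"
    "(\<lambda>x. dpar x / nat_par x) absolutely_integrable_on {0..len}"
    using winding_number_integral[OF G0] ccw by (simp_all add: counterclockwise_about_0_def)
  have i0: "integral {0..len} (\<lambda>x. quot h s (nat_par x) * dpar x) = 2 * of_real pi * \<i> * (1 - h s)" if s: "s \<in> path_image p - {t}" for s
  proof -
    define \<sigma> where "\<sigma> = inverse s"
    have sn: "s \<noteq> 0" using s G0 by auto
    then have \<sigma>0: "\<sigma> \<noteq> 0" by (simp add: \<sigma>_def)
    have sS: "\<sigma> \<in> S" using S'G s unfolding S'_def \<sigma>_def by blast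
    define T where "T = quot H \<sigma>"
    have T: "T holomorphic_on S" unfolding T_def by (rule quot_holomorphic[OF H S(1) sS])
    define U where "U = quot T 0"
    have U: "U holomorphic_on S" unfolding U_def by (rule quot_holomorphic[OF T S(1) Sz])
    have hs: "h s = H \<sigma>" unfolding \<sigma>_def by (rule hH) (use S'G s in blast)
    have "T 0 = (H 0 - H \<sigma>) / (0 - \<sigma>)" using \<sigma>0 by (simp add: T_def quot_def)
    moreover have "H 0 = 1" by (simp add: H_def L(3))
    ultimately have sT: "\<sigma> * T 0 = h s - 1" using \<sigma>0 unfolding hs by (simp add: field_simps)
    define F where "F x = quot h s (nat_par x) * dpar x + \<sigma> * T 0 * (dpar x / nat_par x)" for x
    have Fi: "F absolutely_integrable_on {0..len}" unfolding F_def
      by (intro set_integral_add(1) qi[OF s] set_integrable_mult_right wn(2))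
    have FI: "integral {0..len} F = integral {0..len} (\<lambda>x. quot h s (nat_par x) * dpar x) + \<sigma> * T 0 * (2 * of_real pi * \<i>)"
    proof -
      have "(F has_integral (integral {0..len} (\<lambda>x. quot h s (nat_par x) * dpar x) + \<sigma> * T 0 * (2 * of_real pi * \<i>))) {0..len}"
        unfolding F_def
        by (intro has_integral_add has_integral_mult_right wn(1) integrable_integral set_lebesgue_integral_eq_integral(1) qi[OF s])
      then show ?thesis by (rule integral_unique)
    qed
    note si = shifted_integral[OF s0(1) Fi]
    \<comment> \<open>At these finitely many parameters a quotient takes its filled-in value or
      \<open>1 / c x\<close> lies outside \<open>S\<close>; the pointwise identity of integrands is
      claimed elsewhere only.\<close>
    define E where "E = {x \<in> {0..1}. shifted s0 x = s} \<union> {x \<in> {0..1}. shifted s0 x = t}"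
    have E: "negligible E" unfolding E_def by (intro negligible_finite finite_UnI shifted_finite_fibre s0(1))
    have offE: "c x \<in> S'" "c x \<noteq> s" "c x \<noteq> 0" "inverse (c x) \<in> S" if "x \<in> {0..1} - E" for x
    proof -
      show "c x \<in> S'" "c x \<noteq> s" "c x \<noteq> 0" using that cG[of x] S'G c0[of x] by (auto simp: E_def c_def)
      then show "inverse (c x) \<in> S" by (simp add: S'_def)
    qed
    have pw: "of_real len * F (shift_par s0 x) = \<sigma> * (U (c' x) * D' x)" if x: "x \<in> {0..1} - E" for x
    proof -
      define z where "z = c x"
      have z: "z \<in> S'" "z \<noteq> s" "z \<noteq> 0" using offE[OF x] by (auto simp: z_def)
      have "inverse z \<noteq> \<sigma>" using z(2) by (simp add: \<sigma>_def)
      then have Tz: "T (inverse z) = (h z - h s) / (inverse z - \<sigma>)"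
        using hH[OF z(1)] hH[of s] S'G s by (simp add: T_def quot_def \<sigma>_def subset_iff)
      have inv: "inverse z - \<sigma> = (s - z) / (z * s)" using z(3) sn by (simp add: \<sigma>_def field_simps)
      have q: "quot h s z = (h z - h s) / (z - s)" using z(2) by (simp add: quot_def)
      have Tq: "T (inverse z) = - (quot h s z * (z * s))"
        unfolding Tz inv q using z sn by (simp add: field_simps)
      have "U (inverse z) = (T (inverse z) - T 0) * z" using z(3) by (simp add: U_def quot_def field_simps)
      then have "\<sigma> * (U (c' x) * D' x) = \<sigma> * ((- (quot h s z * (z * s)) - T 0) * z * (- D x / z\<^sup>2))"
        unfolding Tq by (simp add: c'_def D'_def z_def)
      also have "\<dots> = (quot h s z + \<sigma> * T 0 / z) * D x"
        using z(3) sn by (simp add: \<sigma>_def power2_eq_square field_simps)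
      also have "\<dots> = of_real len * F (shift_par s0 x)"
        by (simp add: F_def D_def z_def c_def shifted_def algebra_simps)
      finally show ?thesis by simp
    qed
    have Ui: "(\<lambda>x. U (c' x) * D' x) absolutely_integrable_on {0..1}"
    proof (rule absolutely_integrable_spike[OF _ E])
      show "(\<lambda>x. inverse \<sigma> * (of_real len * F (shift_par s0 x))) absolutely_integrable_on {0..1}"
        by (rule set_integrable_mult_right[OF si(1)])
      show "U (c' x) * D' x = inverse \<sigma> * (of_real len * F (shift_par s0 x))" if "x \<in> {0..1} - E" for x
        unfolding pw[OF that] using \<sigma>0 by simp
    qed
    \<comment> \<open>\<open>U\<close> is an iterated quotient with centres \<open>\<sigma>\<close>
      and \<open>0\<close>; points within this radius of \<open>1/t\<close> stay away from
      both.\<close>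
    define r where "r = min (cmod (inverse t) / 2) (cmod (inverse t - \<sigma>) / 2)"
    have ts: "inverse t \<noteq> \<sigma>" using s by (auto simp: \<sigma>_def)
    have r: "r > 0" using ts t0 by (auto simp: r_def)
    define K1 where "K1 = (1 + cmod (T 0)) / r"
    define K2 where "K2 = (1 + cmod (H \<sigma>)) / r"
    have K: "K1 \<ge> 0" "K2 \<ge> 0" using r by (auto simp: K1_def K2_def)
    have "integral {0..1} (\<lambda>x. U (c' x) * D' x) = 0"
    proof (rule integral_closed_curve_eq_0[where c = c' and t = "inverse t" and \<eta> = \<eta> and S = S and L = L' and \<delta> = \<delta> and N = N and ?r0.0 = r and B = "K1 * (1 + K2) * (1 + cmod M)"])
      show "simple_path c'" by (rule ic(1))
      show "pathstart c' = inverse t" "pathfinish c' = inverse t" using c01 by (auto simp: pathstart_def pathfinish_def c'_def)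
      show "0 \<in> inside (path_image c')" "\<eta> ` {0..<1} \<subseteq> inside (path_image c')" "inside (path_image c') \<subseteq> S"
        "path_image c' - {inverse t} \<subseteq> S" unfolding ic(3) using z0' eta S by auto
      show "(len / (m * m))-lipschitz_on {0..1} c'" by (rule lip)
      show "negligible N" by (rule N(1))
      show "\<And>x. x \<in> {0<..<1} - N \<Longrightarrow> (c' has_vector_derivative D' x) (at x)" by (rule der)
      show "continuous_on S L'" unfolding L'_def[abs_def] by (intro continuous_intros holomorphic_on_imp_continuous_on L(1))
      show "\<And>z. z \<in> S \<Longrightarrow> exp (L' z) = z - inverse t" by (rule expL')
      show "U holomorphic_on S" by (rule U)
      show "0 < r" by (rule r)
      show "cmod (U z) \<le> K1 * (1 + K2) * (1 + cmod M) * (1 + cmod (exp (\<delta> * L' z)))" if z: "z \<in> S" "cmod (z - inverse t) < r" for z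
      proof -
        have "cmod (inverse t - \<sigma>) \<le> cmod (z - inverse t) + cmod (z - \<sigma>)"
          using norm_triangle_ineq[of "inverse t - z" "z - \<sigma>"] by (simp add: norm_minus_commute)
        then have r1: "r \<le> cmod (z - \<sigma>)" using z(2) unfolding r_def by linarith
        have "cmod (inverse t) \<le> cmod (z - inverse t) + cmod z"
          using norm_triangle_ineq[of "inverse t - z" z] by (simp add: norm_minus_commute)
        then have r2: "r \<le> cmod (z - 0)" using z(2) unfolding r_def diff_zero by linarith
        let ?e = "cmod (exp (\<delta> * L' z))"
        have "1 + cmod (H z) \<le> (1 + cmod M) * (1 + ?e)" unfolding HL norm_mult by (simp add: algebra_simps)
        then have T1: "cmod (T z) \<le> K2 * ((1 + cmod M) * (1 + ?e))"
          using quot_bound[OF r r1, of H] K(2) unfolding T_def K2_def by (meson mult_left_mono order_trans)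
        have one: "1 \<le> (1 + cmod M) * (1 + ?e)" by (simp add: algebra_simps)
        have "cmod (U z) \<le> K1 * (1 + cmod (T z))" using quot_bound[OF r r2, of T] unfolding U_def K1_def .
        also have "\<dots> \<le> K1 * ((1 + cmod M) * (1 + ?e) + K2 * ((1 + cmod M) * (1 + ?e)))"
          using T1 one K(1) by (intro mult_left_mono add_mono)
        also have "\<dots> = K1 * (1 + K2) * (1 + cmod M) * (1 + ?e)" by (simp add: algebra_simps)
        finally show ?thesis .
      qed
      show "(\<lambda>x. exp (\<delta> * L' (c' x))) absolutely_integrable_on {0..1}"
      proof (rule absolutely_integrable_spike[OF _ E])
        have "(\<lambda>x. inverse (M * of_real len) * (of_real len * h (nat_par (shift_par s0 x)))) absolutely_integrable_on {0..1}"
          by (rule set_integrable_mult_right[OF shifted_integral(1)[OF s0(1) hai]])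
        then show "(\<lambda>x. inverse M * h (c x)) absolutely_integrable_on {0..1}"
          using len_pos M0 by (simp add: c_def shifted_def field_simps)
        show "exp (\<delta> * L' (c' x)) = inverse M * h (c x)" if "x \<in> {0..1} - E" for x
          using hH[OF offE(1)[OF that]] M0 by (simp add: HL c'_def)
      qed
      show "(\<lambda>x. U (c' x) * D' x) absolutely_integrable_on {0..1}" by (rule Ui)
    qed (use eta S in auto)
    moreover have "integral {0..1} (\<lambda>x. of_real len * F (shift_par s0 x)) = integral {0..1} (\<lambda>x. \<sigma> * (U (c' x) * D' x))"
      by (rule integral_spike[OF E]) (use pw in simp)
    ultimately have "integral {0..len} F = 0" unfolding si(2) by simp
    then show ?thesis unfolding FI sT by (simp add: algebra_simps add_eq_0_iff)
  qed
  show "cauchy_S_exists p h" by (rule cauchy_S_of_quotients(1)[OF ccw hm, of t]) (rule qi)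
  have r: "AE s in LM. cauchy_S p h s = h s + 1 / (of_real pi * \<i>) * integral {0..len} (\<lambda>x. quot h s (nat_par x) * dpar x)"
    by (rule cauchy_S_of_quotients(2)[OF ccw hm, of t]) (rule qi)
  show "AE s in LM. cauchy_S p h s = 2 - h s"
    using r AE_space AE_LM_not_point[of t]
  proof eventually_elim
    case (elim s)
    then have "integral {0..len} (\<lambda>x. quot h s (nat_par x) * dpar x) = 2 * of_real pi * \<i> * (1 - h s)" by (intro i0) simp
    moreover have "1 / (of_real pi * \<i>) * (2 * of_real pi * \<i> * (1 - h s)) = 2 * (1 - h s)"
      by (simp add: nonzero_eq_divide_eq mult.commute mult.left_commute)
    ultimately show ?case using elim(1) by (simp only:) simp
  qed
qed

end

section \<open>Comparison of weights\<close>

lemma associate_norm_mono: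
  assumes fm: "f \<in> borel_measurable M" and C: "C \<ge> 0" and le: "AE x in M. g x \<le> ennreal C * f x"
  shows "associate_norm M \<rho> g \<le> ennreal C * associate_norm M \<rho> f"
  unfolding associate_norm_def
proof (rule SUP_least)
  fix F assume F: "F \<in> {f \<in> borel_measurable M. \<rho> f \<le> 1}"
  then have Fm: "F \<in> borel_measurable M" by simp
  have "(\<integral>\<^sup>+x. F x * g x \<partial>M) \<le> (\<integral>\<^sup>+x. ennreal C * (F x * f x) \<partial>M)"
  proof (rule nn_integral_mono_AE)
    show "AE x in M. F x * g x \<le> ennreal C * (F x * f x)"
      using le
    proof eventually_elim
      case (elim x)
      then have "F x * g x \<le> F x * (ennreal C * f x)" by (rule mult_left_mono) simp
      then show ?case by (simp only: mult.left_commute)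
    qed
  qed
  also have "\<dots> = ennreal C * (\<integral>\<^sup>+x. F x * f x \<partial>M)" using Fm fm by (intro nn_integral_cmult) measurable
  also have "\<dots> \<le> ennreal C * (SUP f'\<in>{f \<in> borel_measurable M. \<rho> f \<le> 1}. \<integral>\<^sup>+x. f' x * f x \<partial>M)"
    by (intro mult_left_mono SUP_upper F) simp
  finally show "(\<integral>\<^sup>+x. F x * g x \<partial>M) \<le> ennreal C * (SUP f'\<in>{f \<in> borel_measurable M. \<rho> f \<le> 1}. \<integral>\<^sup>+x. f' x * f x \<partial>M)" .
qed

lemma weighted_associate_space_mono:
  assumes w: "w \<in> borel_measurable M" and f: "f \<in> weighted_space M (associate_norm M \<rho>) (\<lambda>x. 1 / w x)"
    and g: "g \<in> borel_measurable M" and C: "C \<ge> 0" and le: "AE x in M. cmod (g x) \<le> C * cmod (f x)"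
  shows "g \<in> weighted_space M (associate_norm M \<rho>) (\<lambda>x. 1 / w x)"
proof -
  have fm[measurable]: "f \<in> borel_measurable M" and fin: "associate_norm M \<rho> (\<lambda>x. ennreal (cmod (f x)) * (1 / w x)) < \<infinity>"
    using f by (auto simp: weighted_space_def weighted_norm_def)
  note w[measurable]
  have "associate_norm M \<rho> (\<lambda>x. ennreal (cmod (g x)) * (1 / w x)) \<le> ennreal C * associate_norm M \<rho> (\<lambda>x. ennreal (cmod (f x)) * (1 / w x))"
  proof (rule associate_norm_mono[OF _ C])
    show "AE x in M. ennreal (cmod (g x)) * (1 / w x) \<le> ennreal C * (ennreal (cmod (f x)) * (1 / w x))"
      using le by eventually_elim (use C in \<open>simp add: mult.assoc[symmetric] ennreal_mult[symmetric] mult_right_mono ennreal_leI\<close>)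
  qed measurable
  also have "\<dots> < \<infinity>" using fin by (simp add: ennreal_mult_less_top)
  finally show ?thesis using g by (simp add: weighted_space_def weighted_norm_def)
qed

lemma weighted_norm_mono:
  assumes \<rho>: "banach_function_norm M \<rho>" and w: "w \<in> borel_measurable M" and f: "f \<in> borel_measurable M"
    and g: "g \<in> borel_measurable M" and C: "C \<ge> 0" and le: "AE x in M. cmod (g x) \<le> C * cmod (f x)"
  shows "weighted_norm \<rho> w g \<le> ennreal C * weighted_norm \<rho> w f"
proof -
  note w[measurable] f[measurable] g[measurable]
  have "\<rho> (\<lambda>x. ennreal (cmod (g x)) * w x) \<le> \<rho> (\<lambda>x. ennreal C * (ennreal (cmod (f x)) * w x))"
  proof (rule banach_function_normD(3)[OF \<rho>])
    show "AE x in M. ennreal (cmod (g x)) * w x \<le> ennreal C * (ennreal (cmod (f x)) * w x)"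
      using le by eventually_elim (use C in \<open>simp add: mult.assoc[symmetric] ennreal_mult[symmetric] mult_right_mono ennreal_leI\<close>)
  qed measurable
  also have "\<dots> = ennreal C * \<rho> (\<lambda>x. ennreal (cmod (f x)) * w x)"
    by (rule banach_function_normD(1)[OF \<rho> _ C]) measurable
  finally show ?thesis by (simp add: weighted_norm_def)
qed

lemma weighted_space_mono:
  assumes \<rho>: "banach_function_norm M \<rho>" and w: "w \<in> borel_measurable M" and f: "f \<in> weighted_space M \<rho> w"
    and g: "g \<in> borel_measurable M" and C: "C \<ge> 0" and le: "AE x in M. cmod (g x) \<le> C * cmod (f x)"
  shows "g \<in> weighted_space M \<rho> w"
proof -
  have fm: "f \<in> borel_measurable M" and fin: "weighted_norm \<rho> w f < \<infinity>" using f by (auto simp: weighted_space_def)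
  have "weighted_norm \<rho> w g \<le> ennreal C * weighted_norm \<rho> w f" by (rule weighted_norm_mono[OF \<rho> w fm g C le])
  also have "\<dots> < \<infinity>" using fin by (simp add: ennreal_mult_less_top)
  finally show ?thesis using g by (simp add: weighted_space_def)
qed

text \<open>With \<open>F = v' f / v\<close> one has \<open>v' f = v F\<close>, and \<open>F\<close>
  is dominated by \<open>f\<close>, so the given bound applies to \<open>F\<close>. The conditions
  on zeros make this identity, and the corresponding one for \<open>u'\<close>, hold at every point,
  as division by zero gives \<open>0\<close>; \<open>cauchy_S\<close> is thus applied to literally
  the same function on both sides.\<close>

lemma mult_S_mult_bounded_comparable:
  assumes \<rho>: "banach_function_norm (length_measure p) \<rho>" and w: "w \<in> borel_measurable (length_measure p)"
    and b: "mult_S_mult_bounded p \<rho> w u v"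
    and m: "u \<in> borel_measurable (length_measure p)" "v \<in> borel_measurable (length_measure p)"
      "u' \<in> borel_measurable (length_measure p)" "v' \<in> borel_measurable (length_measure p)"
    and z: "\<And>\<tau>. v \<tau> = 0 \<Longrightarrow> v' \<tau> = 0" "\<And>\<tau>. u \<tau> = 0 \<Longrightarrow> u' \<tau> = 0"
    and A: "A \<ge> 0" "AE \<tau> in length_measure p. cmod (u' \<tau>) \<le> A * cmod (u \<tau>)"
    and B: "B \<ge> 0" "AE \<tau> in length_measure p. cmod (v' \<tau>) \<le> B * cmod (v \<tau>)"
  shows "mult_S_mult_bounded p \<rho> w u' v'"
proof -
  let ?M = "length_measure p"
  obtain C where C: "\<And>f. f \<in> weighted_space ?M \<rho> w \<Longrightarrow> cauchy_S_exists p (\<lambda>\<tau>. v \<tau> * f \<tau>) \<and>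
        (\<lambda>t. u t * cauchy_S p (\<lambda>\<tau>. v \<tau> * f \<tau>) t) \<in> weighted_space ?M \<rho> w \<and>
        weighted_norm \<rho> w (\<lambda>t. u t * cauchy_S p (\<lambda>\<tau>. v \<tau> * f \<tau>) t) \<le> ennreal C * weighted_norm \<rho> w f"
    using b unfolding mult_S_mult_bounded_def by blast
  note m[measurable]
  have "cauchy_S_exists p (\<lambda>\<tau>. v' \<tau> * f \<tau>) \<and>
        (\<lambda>t. u' t * cauchy_S p (\<lambda>\<tau>. v' \<tau> * f \<tau>) t) \<in> weighted_space ?M \<rho> w \<and>
        weighted_norm \<rho> w (\<lambda>t. u' t * cauchy_S p (\<lambda>\<tau>. v' \<tau> * f \<tau>) t) \<le> ennreal (A * max 0 C * B) * weighted_norm \<rho> w f"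
    if f: "f \<in> weighted_space ?M \<rho> w" for f
  proof -
    have fm[measurable]: "f \<in> borel_measurable ?M" using f by (simp add: weighted_space_def)
    define F where "F \<tau> = v' \<tau> * f \<tau> / v \<tau>" for \<tau>
    have Fm: "F \<in> borel_measurable ?M" unfolding F_def by measurable
    have vF: "(\<lambda>\<tau>. v' \<tau> * f \<tau>) = (\<lambda>\<tau>. v \<tau> * F \<tau>)"
    proof
      fix \<tau> show "v' \<tau> * f \<tau> = v \<tau> * F \<tau>" using z(1)[of \<tau>] by (cases "v \<tau> = 0") (auto simp: F_def)
    qed
    have Fle: "AE \<tau> in ?M. cmod (F \<tau>) \<le> B * cmod (f \<tau>)"
      using B(2)
    proof eventually_elim
      case (elim \<tau>)
      show ?case
      proof (cases "v \<tau> = 0")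
        case False
        have "cmod (F \<tau>) = cmod (v' \<tau>) / cmod (v \<tau>) * cmod (f \<tau>)" by (simp add: F_def norm_mult norm_divide)
        also have "\<dots> \<le> B * cmod (f \<tau>)"
          using elim False by (intro mult_right_mono) (simp_all add: pos_divide_le_eq)
        finally show ?thesis .
      qed (use B(1) in \<open>simp add: F_def\<close>)
    qed
    have FX: "F \<in> weighted_space ?M \<rho> w" by (rule weighted_space_mono[OF \<rho> w f Fm B(1) Fle])
    have Fn: "weighted_norm \<rho> w F \<le> ennreal B * weighted_norm \<rho> w f" by (rule weighted_norm_mono[OF \<rho> w fm Fm B(1) Fle])
    define X where "X = cauchy_S p (\<lambda>\<tau>. v \<tau> * F \<tau>)"
    have CF: "cauchy_S_exists p (\<lambda>\<tau>. v \<tau> * F \<tau>)" "(\<lambda>t. u t * X t) \<in> weighted_space ?M \<rho> w"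
      "weighted_norm \<rho> w (\<lambda>t. u t * X t) \<le> ennreal C * weighted_norm \<rho> w F" using C[OF FX] by (auto simp: X_def)
    have uXm[measurable]: "(\<lambda>t. u t * X t) \<in> borel_measurable ?M" using CF(2) by (simp add: weighted_space_def)
    have "(\<lambda>t. u' t * X t) = (\<lambda>t. u' t / u t * (u t * X t))"
    proof
      fix t show "u' t * X t = u' t / u t * (u t * X t)" using z(2)[of t] by (cases "u t = 0") auto
    qed
    moreover have "(\<lambda>t. u' t / u t * (u t * X t)) \<in> borel_measurable ?M" by measurable
    ultimately have u'm: "(\<lambda>t. u' t * X t) \<in> borel_measurable ?M" by (simp only:)
    have le: "AE t in ?M. cmod (u' t * X t) \<le> A * cmod (u t * X t)"
      using A(2) by eventually_elim (simp add: norm_mult mult.assoc[symmetric] mult_right_mono)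
    have "weighted_norm \<rho> w (\<lambda>t. u' t * X t) \<le> ennreal A * weighted_norm \<rho> w (\<lambda>t. u t * X t)"
      by (rule weighted_norm_mono[OF \<rho> w uXm u'm A(1) le])
    also have "\<dots> \<le> ennreal A * (ennreal (max 0 C) * (ennreal B * weighted_norm \<rho> w f))"
    proof (intro mult_left_mono order_trans[OF CF(3)])
      show "ennreal C * weighted_norm \<rho> w F \<le> ennreal (max 0 C) * (ennreal B * weighted_norm \<rho> w f)"
        by (intro mult_mono Fn ennreal_leI) auto
    qed simp
    also have "\<dots> = ennreal (A * max 0 C * B) * weighted_norm \<rho> w f"
      using A(1) B(1) by (simp add: ennreal_mult mult.assoc)
    finally have "weighted_norm \<rho> w (\<lambda>t. u' t * X t) \<le> ennreal (A * max 0 C * B) * weighted_norm \<rho> w f" .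
    moreover have "(\<lambda>t. u' t * X t) \<in> weighted_space ?M \<rho> w"
      by (rule weighted_space_mono[OF \<rho> w CF(2) u'm A(1) le])
    ultimately show ?thesis using CF(1) unfolding vF X_def by blast
  qed
  then show ?thesis unfolding mult_S_mult_bounded_def by blast
qed

context rectifiable_loop begin

section \<open>Integrability in both spaces and logarithms on the punctured curve\<close>

lemma weighted_space_integrable:
  assumes "S_bounded p \<rho> w" "f \<in> weighted_space LM \<rho> w"
  shows "integrable LM f"
proof (rule integrableI_bounded)
  show "f \<in> borel_measurable LM" using assms(2) by (simp add: weighted_space_def)
  have "cauchy_S_exists p (\<lambda>\<tau>. 1 * f \<tau>)" using assms unfolding mult_S_mult_bounded_def by blast
  then show "(\<integral>\<^sup>+x. ennreal (norm (f x)) \<partial>LM) < \<infinity>" using cauchy_S_exists_integrable by simp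
qed

text \<open>Boundedness of \<open>S\<close> puts the constant \<open>1\<close> into the weighted
  space, which means \<open>\<rho> w < \<infinity>\<close>. A multiple of \<open>w\<close> is then
  an admissible test function, and pairing it with \<open>f / w\<close> gives the integral of
  \<open>cmod f\<close> up to a constant.\<close>

lemma weighted_associate_space_integrable:
  assumes \<rho>: "banach_function_norm LM \<rho>" and w: "is_weight LM w" and b: "S_bounded p \<rho> w"
    and f: "f \<in> weighted_space LM (associate_norm LM \<rho>) (\<lambda>\<tau>. 1 / w \<tau>)"
  shows "integrable LM f"
proof (rule integrableI_bounded)
  have wm[measurable]: "w \<in> borel_measurable LM" and wae: "AE x in LM. 0 < w x \<and> w x < \<infinity>" using w by (auto simp: is_weight_def)
  show fm[measurable]: "f \<in> borel_measurable LM" using f by (simp add: weighted_space_def)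
  have "(\<lambda>_. 1) \<in> weighted_space LM \<rho> w" by (rule mult_S_mult_weighted[OF \<rho> w b]) auto
  then have "\<rho> w < \<infinity>" by (simp add: weighted_space_def weighted_norm_def)
  then obtain R where R: "\<rho> w = ennreal R" "R \<ge> 0" by (cases "\<rho> w") auto
  \<comment> \<open>Division by \<open>1 + R\<close> normalizes to norm at most \<open>1\<close>
    without a case distinction for \<open>R = 0\<close>.\<close>
  define c where "c = 1 / (1 + R)"
  have c: "c > 0" "c * R \<le> 1" using R(2) by (auto simp: c_def)
  have F: "(\<lambda>x. ennreal c * w x) \<in> {f \<in> borel_measurable LM. \<rho> f \<le> 1}"
    using banach_function_normD(1)[OF \<rho> wm, of c] c R by (simp add: ennreal_mult[symmetric] ennreal_le_1)
  have "ennreal c * (\<integral>\<^sup>+x. ennreal (norm (f x)) \<partial>LM) = (\<integral>\<^sup>+x. ennreal c * ennreal (norm (f x)) \<partial>LM)"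
    by (intro nn_integral_cmult[symmetric]) measurable
  also have "\<dots> = (\<integral>\<^sup>+x. (ennreal c * w x) * (ennreal (cmod (f x)) * (1 / w x)) \<partial>LM)"
  proof (rule nn_integral_cong_AE)
    show "AE x in LM. ennreal c * ennreal (norm (f x)) = (ennreal c * w x) * (ennreal (cmod (f x)) * (1 / w x))"
      using wae
    proof eventually_elim
      case (elim x)
      then obtain r where r: "w x = ennreal r" "r \<ge> 0" by (cases "w x") auto
      then have r0: "r > 0" using elim by (simp add: ennreal_less_zero_iff order_le_less)
      then have "1 / w x = ennreal (1 / r)" using r by (simp add: divide_ennreal[symmetric])
      then show ?case using r r0 c by (simp add: ennreal_mult[symmetric])
    qed
  qed
  also have "\<dots> \<le> associate_norm LM \<rho> (\<lambda>x. ennreal (cmod (f x)) * (1 / w x))"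
    unfolding associate_norm_def by (rule SUP_upper[OF F])
  also have "\<dots> < \<infinity>" using f by (simp add: weighted_space_def weighted_norm_def)
  finally show "(\<integral>\<^sup>+x. ennreal (norm (f x)) \<partial>LM) < \<infinity>" using c(1) by (auto simp: ennreal_mult_less_top)
qed

lemma punctured_curve_image:
  assumes s0: "s0 \<in> {0..<len}"
  shows "shifted s0 ` {0<..<1} = path_image p - {nat_par s0}" "continuous_on {0<..<1} (shifted s0)"
proof -
  have sp: "simple_path (shifted s0)" by (rule shifted_simple[OF s0])
  have e: "shifted s0 0 = nat_par s0" "shifted s0 1 = nat_par s0" using shifted_ends[OF s0] by auto
  have "continuous_on {0..1} (shifted s0)" using simple_path_imp_path[OF sp] by (simp add: path_def)
  then show "continuous_on {0<..<1} (shifted s0)" by (rule continuous_on_subset) auto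
  show "shifted s0 ` {0<..<1} = path_image p - {nat_par s0}"
  proof (intro equalityI subsetI)
    fix z assume "z \<in> shifted s0 ` {0<..<1}"
    then obtain x where x: "0 < x" "x < 1" "z = shifted s0 x" by auto
    then have "z \<in> path_image (shifted s0)" by (auto simp: path_image_def)
    moreover have "z \<noteq> nat_par s0" using simple_path_eq_interior[OF sp, of x 0] x e by auto
    ultimately show "z \<in> path_image p - {nat_par s0}" using shifted_image[OF s0] by simp
  next
    fix z assume z: "z \<in> path_image p - {nat_par s0}"
    then have "z \<in> path_image (shifted s0)" using shifted_image[OF s0] by simp
    then obtain x where x: "0 \<le> x" "x \<le> 1" "z = shifted s0 x" by (auto simp: path_image_def)
    then have "x \<noteq> 0" "x \<noteq> 1" using z e by auto
    then show "z \<in> shifted s0 ` {0<..<1}" using x by auto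
  qed
qed

lemma connected_punctured_curve: "t \<in> path_image p \<Longrightarrow> connected (path_image p - {t})"
proof -
  assume "t \<in> path_image p"
  then obtain s0 where s0: "s0 \<in> {0..<len}" "nat_par s0 = t" using nat_par_image' by (metis imageE)
  note pc = punctured_curve_image[OF s0(1), unfolded s0(2)]
  show ?thesis unfolding pc(1)[symmetric] by (rule connected_continuous_image[OF pc(2) connected_Ioo])
qed

text \<open>Along the closed parameter interval the loop, which avoids \<open>0\<close>, has a
  continuous logarithm \<open>q\<close>, bounded by compactness. On the open interval
  \<open>A\<close> differs from it by a constant, so \<open>A\<close> cannot blow up at
  \<open>t\<close>.\<close>

lemma log_bounded_on_punctured_curve:
  assumes t: "t \<in> path_image p" and z0: "0 \<notin> path_image p"
    and A: "continuous_on (path_image p - {t}) A" "\<And>\<tau>. \<tau> \<in> path_image p - {t} \<Longrightarrow> exp (A \<tau>) = \<tau>"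
  obtains K where "\<And>\<tau>. \<tau> \<in> path_image p - {t} \<Longrightarrow> cmod (A \<tau>) \<le> K"
proof -
  obtain s0 where s0: "s0 \<in> {0..<len}" "nat_par s0 = t" using t nat_par_image' by (metis imageE)
  note pc = punctured_curve_image[OF s0(1), unfolded s0(2)]
  have sp: "path (shifted s0)" "0 \<notin> path_image (shifted s0)"
    using shifted_simple[OF s0(1)] shifted_image[OF s0(1)] z0 by (auto simp: simple_path_imp_path)
  obtain q where q: "path q" "\<And>x. x \<in> {0..1} \<Longrightarrow> shifted s0 x = 0 + exp (q x)"
    using winding_number_as_continuous_log[OF sp] by blast
  have c1: "continuous_on {0<..<1} (\<lambda>x. A (shifted s0 x))"
    by (rule continuous_on_compose2[OF A(1) pc(2)]) (use pc(1) in auto)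
  have c2: "continuous_on {0<..<1} q" using q(1) unfolding path_def by (rule continuous_on_subset) auto
  have c3: "exp (A (shifted s0 x)) = exp (q x)" if "x \<in> {0<..<1}" for x
  proof -
    have "shifted s0 x \<in> path_image p - {t}" using that pc(1) by blast
    then have "exp (A (shifted s0 x)) = shifted s0 x" by (rule A(2))
    then show ?thesis using q(2)[of x] that by simp
  qed
  obtain n :: int where n: "\<And>x. x \<in> {0<..<1} \<Longrightarrow> A (shifted s0 x) = q x + 2 * of_int n * of_real pi * \<i>"
    using continuous_logs_differ_by_const[OF connected_Ioo c1 c2 c3] by blast
  have "bounded (path_image q)" using q(1) by (rule bounded_path_image)
  then obtain K where K: "\<And>z. z \<in> path_image q \<Longrightarrow> cmod z \<le> K" unfolding bounded_iff by blast
  have "cmod (A \<tau>) \<le> K + cmod (2 * of_int n * of_real pi * \<i>)" if tau: "\<tau> \<in> path_image p - {t}" for \<tau>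
  proof -
    obtain x where x: "x \<in> {0<..<1}" "\<tau> = shifted s0 x" using tau pc(1) by blast
    have "q x \<in> path_image q" using x by (auto simp: path_image_def)
    then have "cmod (q x) \<le> K" by (rule K)
    then show ?thesis using norm_triangle_ineq[of "q x" "2 * of_int n * of_real pi * \<i>"] unfolding x(2) n[OF x(1)] by linarith
  qed
  then show ?thesis by (rule that)
qed

end

section \<open>The factorization\<close>

lemma phi_fun_eq:
  "\<tau> \<noteq> t \<Longrightarrow> phi_fun \<theta> t \<delta> \<tau> = cmod (exp (\<delta> * (of_real (ln (cmod (\<tau> - t))) + \<i> * of_real (\<theta> \<tau>))))"
  by (simp add: phi_fun_def powr_def norm_exp_eq_Re exp_add[symmetric] algebra_simps)

lemma g_fun_eq:
  "\<tau> \<noteq> 0 \<Longrightarrow> g_fun \<alpha> \<gamma> \<tau> = exp (\<gamma> * (of_real (ln (cmod \<tau>)) + \<i> * of_real (\<alpha> \<tau>)))"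
  by (simp add: g_fun_def powr_def Ln_of_real exp_add[symmetric] algebra_simps)

lemma arg_branch_log:
  assumes "arg_branch D f \<theta>" "continuous_on D f" "\<And>z. z \<in> D \<Longrightarrow> f z \<noteq> 0"
  shows "continuous_on D (\<lambda>z. of_real (ln (cmod (f z))) + \<i> * of_real (\<theta> z))"
    "\<And>z. z \<in> D \<Longrightarrow> exp (of_real (ln (cmod (f z))) + \<i> * of_real (\<theta> z)) = f z"
proof -
  have \<theta>: "continuous_on D \<theta>" "\<And>z. z \<in> D \<Longrightarrow> f z = of_real (cmod (f z)) * exp (\<i> * of_real (\<theta> z))"
    using assms(1) by (auto simp: arg_branch_def)
  show "continuous_on D (\<lambda>z. of_real (ln (cmod (f z))) + \<i> * of_real (\<theta> z))"
    by (intro continuous_intros \<theta>(1) assms(2)) (use assms(3) in auto)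
  fix z assume z: "z \<in> D"
  have "exp (of_real (ln (cmod (f z)))) = complex_of_real (cmod (f z))"
    using assms(3)[OF z] by (simp add: exp_of_real)
  then show "exp (of_real (ln (cmod (f z))) + \<i> * of_real (\<theta> z)) = f z"
    using \<theta>(2)[OF z] by (simp add: exp_add)
qed

lemma holomorphic_log_exists:
  assumes "open S" "simply_connected S" "f holomorphic_on S" "\<And>z. z \<in> S \<Longrightarrow> f z \<noteq> 0"
  obtains L where "L holomorphic_on S" "\<And>z. z \<in> S \<Longrightarrow> exp (L z) = f z"
proof -
  have "\<exists>g. g holomorphic_on S \<and> (\<forall>z\<in>S. f z = exp (g z))"
    using assms simply_connected_eq_holomorphic_log[OF assms(1)] by blast
  then obtain g where g: "g holomorphic_on S" "\<forall>z\<in>S. f z = exp (g z)" by blast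
  show ?thesis by (rule that[OF g(1)]) (use g(2) in auto)
qed

theorem lemma7p1:
  fixes p :: "real \<Rightarrow> complex"
    and \<rho> :: "(complex \<Rightarrow> ennreal) \<Rightarrow> ennreal"
    and w :: "complex \<Rightarrow> ennreal"
    and \<Gamma> :: "complex set"
    and t \<gamma> :: complex and k :: int
    and \<Phi> \<Psi> :: "complex \<Rightarrow> complex"
    and \<alpha> \<theta> :: "complex \<Rightarrow> real"
  assumes curve: "rectifiable_Jordan_curve p" "counterclockwise_about_0 p" "\<Gamma> = path_image p"
    and norm: "banach_function_norm (length_measure p) \<rho>"
    and weight: "is_weight (length_measure p) w"
    and S_bdd: "S_bounded p \<rho> w"
    and refl: "reflexive_space (weighted_space (length_measure p) \<rho> w) (weighted_norm \<rho> w)"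
    and t: "t \<in> \<Gamma>"
    and maps: "interior_conformal_map \<Gamma> t \<Phi>" "exterior_conformal_map \<Gamma> t \<Psi>"
    and arg: "arg_branch (- (interior_cut \<Phi> \<union> exterior_cut \<Psi>)) (\<lambda>z. z) \<alpha>"
    and arg_t: "arg_branch (\<Gamma> - {t}) (\<lambda>\<tau>. \<tau> - t) \<theta>"
    and phi_S_phi: "mult_S_mult_bounded p \<rho> w
          (\<lambda>\<tau>. of_real (phi_fun \<theta> t (of_int k - \<gamma>) \<tau>))
          (\<lambda>\<tau>. of_real (phi_fun \<theta> t (\<gamma> - of_int k) \<tau>))"
  shows "\<exists>a_minus a_plus.
           power_branch (- interior_cut \<Phi>) (\<lambda>z. 1 - t / z) (of_int k - \<gamma>) a_minus \<and>
           (a_minus \<longlongrightarrow> 1) at_infinity \<and>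
           power_branch (- exterior_cut \<Psi>) (\<lambda>z. z - t) (\<gamma> - of_int k) a_plus \<and>
           (\<forall>\<tau>\<in>\<Gamma> - {t}. g_fun \<alpha> \<gamma> \<tau> = a_minus \<tau> * \<tau> powi k * a_plus \<tau>) \<and>
           wiener_hopf_factorization p \<rho> w (g_fun \<alpha> \<gamma>) a_minus k a_plus"
proof -
  have curve': "counterclockwise_about_0 p" "rectifiable_loop p" using curve by (auto simp: rectifiable_loop_def)
  interpret rectifiable_loop p by (rule curve'(2))
  define \<delta> where "\<delta> = \<gamma> - of_int k"
  define G where "G = path_image p - {t}"
  have \<delta>': "of_int k - \<gamma> = - \<delta>" by (simp add: \<delta>_def)
  note ccw = curve'(1) and \<Gamma> = curve(3)
  have tp: "t \<in> path_image p" using t \<Gamma> by simp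
  have m1: "interior_conformal_map (path_image p) t \<Phi>" and m2: "exterior_conformal_map (path_image p) t \<Psi>" using maps \<Gamma> by auto
  have z0: "0 \<in> inside (path_image p)" using ccw by (simp add: counterclockwise_about_0_def)
  then have G0: "0 \<notin> path_image p" using inside_no_overlap[of "path_image p"] by blast
  have t0: "t \<noteq> 0" using tp G0 by auto
  have wm: "w \<in> borel_measurable LM" using weight by (simp add: is_weight_def)
  define \<Lambda> where "\<Lambda> = inverse ` (interior_cut \<Phi> - {0})"
  note I = interior_cut_props[OF m1 inside_no_overlap tp] and E = exterior_cut_props[OF m2 outside_no_overlap tp]
  note EC = exterior_cut_complement[OF simple closed_p m2 tp]
  note IC = inverted_interior_cut[OF simple closed_p z0 m1 tp, folded \<Lambda>_def]
  note \<eta>' = exterior_path_inverted[OF m2 tp z0]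
  note ic = inside_inverse_curve[OF simple closed_p z0]

  obtain L0 where L0: "L0 holomorphic_on (- exterior_cut \<Psi>)" "\<And>z. z \<in> - exterior_cut \<Psi> \<Longrightarrow> exp (L0 z) = z - t"
  proof (rule holomorphic_log_exists[OF EC(1,2), of "\<lambda>z. z - t"])
    show "z - t \<noteq> 0" if "z \<in> - exterior_cut \<Psi>" for z using that E(4) by auto
  qed (auto intro!: holomorphic_intros)
  \<comment> \<open>The logarithm of \<open>1 - t/z\<close> is constructed in the variable
    \<open>1/z\<close>, in which the complement of the interior cut, with infinity included, is a
    simply connected domain of the plane.\<close>
  obtain M0 where M0: "M0 holomorphic_on (- \<Lambda>)" "\<And>\<zeta>. \<zeta> \<in> - \<Lambda> \<Longrightarrow> exp (M0 \<zeta>) = 1 - t * \<zeta>"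
  proof (rule holomorphic_log_exists[OF IC(1,2), of "\<lambda>\<zeta>. 1 - t * \<zeta>"])
    show "1 - t * \<zeta> \<noteq> 0" if z: "\<zeta> \<in> - \<Lambda>" for \<zeta>
    proof
      assume "1 - t * \<zeta> = 0"
      then have "\<zeta> = inverse t" using t0 by (simp add: field_simps)
      then show False using z IC(5) by simp
    qed
  qed (auto intro!: holomorphic_intros)
  \<comment> \<open>Normalized to vanish at \<open>0\<close>, which stands for infinity; this gives
    \<open>a_minus\<close> the limit \<open>1\<close>.\<close>
  define M where "M \<zeta> = M0 \<zeta> - M0 0" for \<zeta>
  have z\<Lambda>: "0 \<in> - \<Lambda>" using IC(6) by simp
  have M: "M holomorphic_on (- \<Lambda>)" "M 0 = 0" unfolding M_def[abs_def] by (intro holomorphic_intros M0(1), simp)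
  have eM: "exp (M \<zeta>) = 1 - t * \<zeta>" if "\<zeta> \<in> - \<Lambda>" for \<zeta>
    using M0(2)[OF that] M0(2)[OF z\<Lambda>] by (simp add: M_def exp_diff)
  have inv\<Lambda>: "inverse z \<in> - \<Lambda>" if "z \<in> - interior_cut \<Phi>" for z using IC(7) that by blast
  have GI: "G \<subseteq> - interior_cut \<Phi>" using I(5) inside_no_overlap[of "path_image p"] unfolding G_def by blast
  have GE: "G \<subseteq> - exterior_cut \<Psi>" using EC(4) by (simp add: G_def)
  have Gn: "\<tau> \<noteq> 0" if "\<tau> \<in> G" for \<tau> using that G0 by (auto simp: G_def)
  have Lm: "(\<lambda>z. M (inverse z)) holomorphic_on (- interior_cut \<Phi>)"
  proof -
    have "(M \<circ> inverse) holomorphic_on (- interior_cut \<Phi>)"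
    proof (rule holomorphic_on_compose_gen[OF _ M(1)])
      show "inverse holomorphic_on - interior_cut \<Phi>" using I(2) by (intro holomorphic_intros) auto
      show "inverse ` (- interior_cut \<Phi>) \<subseteq> - \<Lambda>" using inv\<Lambda> by blast
    qed
    then show ?thesis by (simp add: comp_def)
  qed
  have cG: "connected G" unfolding G_def by (rule connected_punctured_curve[OF tp])
  have Gc: "continuous_on G (\<lambda>\<tau>. L0 \<tau>)" "continuous_on G (\<lambda>\<tau>. M (inverse \<tau>))"
    using holomorphic_on_imp_continuous_on[OF L0(1)] holomorphic_on_imp_continuous_on[OF Lm] GE GI continuous_on_subset by blast+

  define A where "A \<tau> = of_real (ln (cmod \<tau>)) + \<i> * of_real (\<alpha> \<tau>)" for \<tau>
  have Ga: "arg_branch G (\<lambda>z. z) \<alpha>"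
    unfolding arg_branch_def
  proof (intro conjI ballI)
    have sub: "G \<subseteq> - (interior_cut \<Phi> \<union> exterior_cut \<Psi>)" using GI GE by blast
    show "continuous_on G \<alpha>" using arg sub by (auto simp: arg_branch_def intro: continuous_on_subset)
    show "z = of_real (cmod z) * exp (\<i> * of_real (\<alpha> z))" if "z \<in> G" for z
      using arg sub that unfolding arg_branch_def by blast
  qed
  have A: "continuous_on G A" "\<And>\<tau>. \<tau> \<in> G \<Longrightarrow> exp (A \<tau>) = \<tau>"
    using arg_branch_log[OF Ga continuous_on_id Gn] unfolding A_def[abs_def] by blast+
  define B where "B \<tau> = of_real (ln (cmod (\<tau> - t))) + \<i> * of_real (\<theta> \<tau>)" for \<tau>
  have B: "continuous_on G B" "\<And>\<tau>. \<tau> \<in> G \<Longrightarrow> exp (B \<tau>) = \<tau> - t"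
  proof -
    have a: "arg_branch G (\<lambda>\<tau>. \<tau> - t) \<theta>" using arg_t \<Gamma> by (simp add: G_def)
    have c: "continuous_on G (\<lambda>\<tau>. \<tau> - t)" by (intro continuous_intros)
    have n: "\<tau> - t \<noteq> 0" if "\<tau> \<in> G" for \<tau> using that by (simp add: G_def)
    show "continuous_on G B" "\<And>\<tau>. \<tau> \<in> G \<Longrightarrow> exp (B \<tau>) = \<tau> - t"
      using arg_branch_log[OF a c n] unfolding B_def[abs_def] by blast+
  qed
  have c1: "continuous_on G (\<lambda>\<tau>. L0 \<tau> - M (inverse \<tau>))" by (intro continuous_intros Gc)
  have e1: "exp (L0 \<tau> - M (inverse \<tau>)) = exp (A \<tau>)" if g: "\<tau> \<in> G" for \<tau>
  proof -
    have n: "\<tau> \<noteq> 0" "\<tau> \<noteq> t" using Gn[OF g] g by (auto simp: G_def)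
    have "exp (L0 \<tau>) = \<tau> - t" "exp (M (inverse \<tau>)) = 1 - t * inverse \<tau>"
      using L0(2)[of \<tau>] eM[OF inv\<Lambda>[of \<tau>]] g GE GI by auto
    moreover have "1 - t * inverse \<tau> = (\<tau> - t) / \<tau>" using n by (simp add: field_simps)
    ultimately have "exp (L0 \<tau> - M (inverse \<tau>)) = \<tau>" using n by (simp add: exp_diff)
    then show ?thesis using A(2)[OF g] by simp
  qed
  \<comment> \<open>Both sides are logarithms of \<open>\<tau>\<close> on the connected set
    \<open>G\<close>. As \<open>M\<close> is already fixed at infinity, the integer is absorbed into
    \<open>L\<close>.\<close>
  obtain n :: int where n: "\<And>\<tau>. \<tau> \<in> G \<Longrightarrow> L0 \<tau> - M (inverse \<tau>) = A \<tau> + 2 * of_int n * of_real pi * \<i>"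
    using continuous_logs_differ_by_const[OF cG c1 A(1) e1] by blast
  define L where "L z = L0 z - 2 * of_int n * of_real pi * \<i>" for z
  have Lh: "L holomorphic_on (- exterior_cut \<Psi>)" unfolding L_def[abs_def] by (intro holomorphic_intros L0(1))
  have eL: "exp (L z) = z - t" if "z \<in> - exterior_cut \<Psi>" for z
  proof -
    have "exp (2 * of_int n * of_real pi * \<i>) = (1::complex)"
      using exp_integer_2pi[of "of_int n"] by (simp add: mult_ac)
    then show ?thesis using L0(2)[OF that] by (simp add: L_def exp_diff)
  qed
  have LA: "L \<tau> = A \<tau> + M (inverse \<tau>)" if "\<tau> \<in> G" for \<tau>
    using n[OF that] by (simp add: L_def algebra_simps)
  have Lc: "continuous_on G L" unfolding L_def[abs_def] by (intro continuous_intros Gc)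
  have e2: "exp (L \<tau>) = exp (B \<tau>)" if "\<tau> \<in> G" for \<tau> using B(2)[OF that] eL[of \<tau>] that GE by auto
  \<comment> \<open>The given branch \<open>\<theta>\<close> may differ from \<open>Im L\<close> by
    a multiple of \<open>2 pi\<close>. For complex \<open>\<delta>\<close> this changes the modulus
    of the power, but only by the constant factor \<open>E1\<close>.\<close>
  obtain m :: int where m: "\<And>\<tau>. \<tau> \<in> G \<Longrightarrow> L \<tau> = B \<tau> + 2 * of_int m * of_real pi * \<i>"
    using continuous_logs_differ_by_const[OF cG Lc B(1) e2] by blast
  obtain K where K: "\<And>\<tau>. \<tau> \<in> G \<Longrightarrow> cmod (A \<tau>) \<le> K"
    using log_bounded_on_punctured_curve[OF tp G0 A(1)[unfolded G_def] A(2)[unfolded G_def]] unfolding G_def by blast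
  have bA: "cmod (exp (c * A \<tau>)) \<le> exp (cmod c * K)" if "\<tau> \<in> G" for c \<tau>
  proof -
    have "cmod (exp (c * A \<tau>)) \<le> exp (cmod (c * A \<tau>))" by (rule norm_exp)
    also have "\<dots> \<le> exp (cmod c * K)" unfolding norm_mult using K[OF that] by (simp add: mult_left_mono)
    finally show ?thesis .
  qed
  have AEG: "AE \<tau> in LM. \<tau> \<in> G" using AE_LM_not_point[of t] AE_space by eventually_elim (simp add: G_def)
  have meas: "f \<in> borel_measurable LM" if "continuous_on G f" for f :: "complex \<Rightarrow> complex"
    using continuous_off_point_measurable that by (simp add: G_def)

  define am where "am z = exp (- \<delta> * M (inverse z))" for z
  \<comment> \<open>No logarithm exists at \<open>t\<close>, and the value there is set to
    \<open>0\<close>. Since \<open>\<phi>\<close> vanishes at \<open>t\<close> too, and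
    \<open>1 / 0 = 0\<close>, the pointwise conditions on zeros in the comparison of operators are
    met.\<close>
  define ap where "ap z = (if z = t then 0 else exp (\<delta> * L z))" for z
  define \<phi> where "\<phi> d \<tau> = complex_of_real (phi_fun \<theta> t d \<tau>)" for d \<tau>
  define E1 where "E1 = cmod (exp (\<delta> * (2 * of_int m * of_real pi * \<i>)))"
  have E1: "E1 > 0" by (simp add: E1_def)
  have apG: "ap \<tau> = exp (\<delta> * L \<tau>)" if "\<tau> \<in> G" for \<tau> using that by (simp add: ap_def G_def)
  have tE: "t \<notin> - exterior_cut \<Psi>" using E(4) by simp
  have apE: "ap z = exp (\<delta> * L z)" "1 / ap z = exp (- \<delta> * L z)" if "z \<in> - exterior_cut \<Psi>" for z
    using that tE by (auto simp: ap_def exp_minus field_simps)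
  have am1: "1 / am z = exp (\<delta> * M (inverse z))" for z by (simp add: am_def exp_minus field_simps)
  have \<phi>G: "\<phi> d \<tau> = of_real (cmod (exp (d * B \<tau>)))" if "\<tau> \<in> G" for d \<tau>
    using that by (simp add: \<phi>_def G_def B_def phi_fun_eq)
  have \<phi>0: "\<phi> d \<tau> = 0 \<longleftrightarrow> \<tau> = t" for d \<tau>
    by (auto simp: \<phi>_def phi_fun_def)
  have cap: "cmod (ap \<tau>) = E1 * cmod (\<phi> \<delta> \<tau>)" "cmod (1 / ap \<tau>) = inverse E1 * cmod (\<phi> (- \<delta>) \<tau>)" if g: "\<tau> \<in> G" for \<tau>
  proof -
    have "exp (\<delta> * L \<tau>) = exp (\<delta> * B \<tau>) * exp (\<delta> * (2 * of_int m * of_real pi * \<i>))"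
      unfolding m[OF g] by (simp add: distrib_left exp_add)
    then show c: "cmod (ap \<tau>) = E1 * cmod (\<phi> \<delta> \<tau>)"
      by (simp add: apG[OF g] \<phi>G[OF g] E1_def norm_mult)
    show "cmod (1 / ap \<tau>) = inverse E1 * cmod (\<phi> (- \<delta>) \<tau>)"
      unfolding norm_divide c by (simp add: \<phi>G[OF g] exp_minus norm_inverse divide_inverse)
  qed
  have cam: "am \<tau> = 1 / ap \<tau> * exp (\<delta> * A \<tau>)" "1 / am \<tau> = ap \<tau> * exp (- \<delta> * A \<tau>)" if g: "\<tau> \<in> G" for \<tau>
    unfolding am1 apG[OF g] LA[OF g] am_def by (simp_all add: exp_minus exp_add distrib_left field_simps)
  have conts: "continuous_on G am" "continuous_on G (\<lambda>\<tau>. 1 / am \<tau>)" "continuous_on G ap" "continuous_on G (\<lambda>\<tau>. 1 / ap \<tau>)" "continuous_on G (\<phi> d)" for d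
  proof -
    show "continuous_on G am" "continuous_on G (\<lambda>\<tau>. 1 / am \<tau>)" unfolding am1 unfolding am_def[abs_def]
      by (intro continuous_intros Gc)+
    have "continuous_on G (\<lambda>\<tau>. exp (\<delta> * L \<tau>))" by (intro continuous_intros Lc)
    then show c: "continuous_on G ap" by (rule continuous_on_eq) (simp add: apG)
    show "continuous_on G (\<lambda>\<tau>. 1 / ap \<tau>)" by (intro continuous_intros c) (simp add: apG)
    have "continuous_on G (\<lambda>\<tau>. complex_of_real (cmod (exp (d * B \<tau>))))" by (intro continuous_intros B(1))
    then show "continuous_on G (\<phi> d)" by (rule continuous_on_eq) (simp add: \<phi>G)
  qed
  note ms = conts[THEN meas]
  have b0: "mult_S_mult_bounded p \<rho> w (\<phi> (- \<delta>)) (\<phi> \<delta>)"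
    using phi_S_phi unfolding \<delta>' \<delta>_def[symmetric] \<phi>_def[abs_def] .
  have bnd: "mult_S_mult_bounded p \<rho> w (\<lambda>\<tau>. 1 / ap \<tau>) ap"
  proof (rule mult_S_mult_bounded_comparable[OF norm wm b0 ms(5) ms(5) ms(4) ms(3), of "inverse E1" E1])
    show "ap \<tau> = 0" if "\<phi> \<delta> \<tau> = 0" for \<tau> using that unfolding \<phi>0 by (simp add: ap_def)
    show "1 / ap \<tau> = 0" if "\<phi> (- \<delta>) \<tau> = 0" for \<tau> using that unfolding \<phi>0 by (simp add: ap_def)
    show "AE \<tau> in LM. cmod (1 / ap \<tau>) \<le> inverse E1 * cmod (\<phi> (- \<delta>) \<tau>)"
      using AEG by eventually_elim (simp only: cap order_refl)
    show "AE \<tau> in LM. cmod (ap \<tau>) \<le> E1 * cmod (\<phi> \<delta> \<tau>)"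
      using AEG by eventually_elim (simp only: cap order_refl)
  qed (use E1 in simp_all)
  let ?X = "weighted_space LM \<rho> w" and ?X' = "weighted_space LM (associate_norm LM \<rho>) (\<lambda>\<tau>. 1 / w \<tau>)"
  have apn: "AE \<tau> in LM. ap \<tau> \<noteq> 0" using AEG by eventually_elim (simp add: apG)
  have X1: "ap \<in> ?X'" by (rule mult_S_mult_associate[OF norm weight bnd ms(3)])
  have X2: "(\<lambda>\<tau>. 1 / ap \<tau>) \<in> ?X" by (rule mult_S_mult_weighted[OF norm weight bnd ms(3) apn ms(4)])
  have X3: "am \<in> ?X"
  proof (rule weighted_space_mono[OF norm wm X2 ms(1)])
    show "AE \<tau> in LM. cmod (am \<tau>) \<le> exp (cmod \<delta> * K) * cmod (1 / ap \<tau>)"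
      using AEG
    proof eventually_elim
      case (elim \<tau>)
      show ?case unfolding cam(1)[OF elim] norm_mult using mult_left_mono[OF bA[OF elim, of \<delta>], of "cmod (1 / ap \<tau>)"] by (simp only: mult.commute norm_ge_zero)
    qed
  qed simp
  have X4: "(\<lambda>\<tau>. 1 / am \<tau>) \<in> ?X'"
  proof (rule weighted_associate_space_mono[OF wm X1 ms(2)])
    show "AE \<tau> in LM. cmod (1 / am \<tau>) \<le> exp (cmod (- \<delta>) * K) * cmod (ap \<tau>)"
      using AEG
    proof eventually_elim
      case (elim \<tau>)
      show ?case unfolding cam(2)[OF elim] norm_mult using mult_left_mono[OF bA[OF elim, of "- \<delta>"], of "cmod (ap \<tau>)"] by (simp only: mult.commute norm_ge_zero)
    qed
  qed simp
  note i1 = weighted_associate_space_integrable[OF norm weight S_bdd X1]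
    and i2 = weighted_space_integrable[OF S_bdd X2] and i3 = weighted_space_integrable[OF S_bdd X3]
    and i4 = weighted_associate_space_integrable[OF norm weight S_bdd X4]

  note plus = cauchy_S_plus[where \<eta> = "\<lambda>x. \<Phi> (of_real x)", OF ccw tp I(8,9,10,11) EC Lh eL]
  have P1: "ap \<in> plus_space p ?X'" unfolding plus_space_def
  \<comment> \<open>The function serves as its own preimage under the projection, because
    \<open>S\<close> reproduces it.\<close>
  proof (intro CollectI conjI ms(3) bexI[OF _ X1])
    show "cauchy_S_exists p ap" by (rule plus(1)[where \<delta> = \<delta>, OF _ _ i1]) (auto simp: apE)
    have "AE s in LM. cauchy_S p ap s = ap s" by (rule plus(2)[where \<delta> = \<delta>, OF _ _ i1]) (auto simp: apE)
    then show "AE \<tau> in LM. ap \<tau> = (ap \<tau> + cauchy_S p ap \<tau>) / 2" by eventually_elim simp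
  qed
  have P2: "(\<lambda>\<tau>. 1 / ap \<tau>) \<in> plus_space p ?X" unfolding plus_space_def
  proof (intro CollectI conjI ms(4) bexI[OF _ X2])
    show "cauchy_S_exists p (\<lambda>\<tau>. 1 / ap \<tau>)" by (rule plus(1)[where \<delta> = "- \<delta>", OF _ _ i2]) (auto simp: apE exp_minus divide_inverse)
    have "AE s in LM. cauchy_S p (\<lambda>\<tau>. 1 / ap \<tau>) s = 1 / ap s" by (rule plus(2)[where \<delta> = "- \<delta>", OF _ _ i2]) (auto simp: apE exp_minus divide_inverse)
    then show "AE \<tau> in LM. 1 / ap \<tau> = (1 / ap \<tau> + cauchy_S p (\<lambda>\<tau>. 1 / ap \<tau>) \<tau>) / 2" by eventually_elim simp
  qed
  note minus = cauchy_S_minus[where \<eta> = "\<lambda>x. if x = 0 then 0 else inverse (\<Psi> (of_real (inverse x)))", OF ccw tp \<eta>'(1,2,3) \<eta>'(4)[folded ic(1)] IC(1,2,3,4) M(1) eM M(2)]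
  have N1: "am \<in> minus_space p ?X" unfolding minus_space_def
  \<comment> \<open>The function is again its own preimage: \<open>S h = 2 - h\<close> gives
    \<open>(h - S h) / 2 = h - 1\<close>, so the additive constant is \<open>1\<close>.\<close>
  proof (intro CollectI conjI ms(1) bexI[OF _ X3] exI[of _ 1])
    show "cauchy_S_exists p am" by (rule minus(1)[where \<delta> = "- \<delta>", OF _ _ i3]) (auto simp: am_def)
    have "AE s in LM. cauchy_S p am s = 2 - am s" by (rule minus(2)[where \<delta> = "- \<delta>", OF _ _ i3]) (auto simp: am_def)
    then show "AE \<tau> in LM. am \<tau> = (am \<tau> - cauchy_S p am \<tau>) / 2 + 1" by eventually_elim (simp add: field_simps)
  qed
  have N2: "(\<lambda>\<tau>. 1 / am \<tau>) \<in> minus_space p ?X'" unfolding minus_space_def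
  proof (intro CollectI conjI ms(2) bexI[OF _ X4] exI[of _ 1])
    show "cauchy_S_exists p (\<lambda>\<tau>. 1 / am \<tau>)" by (rule minus(1)[where \<delta> = \<delta>, OF _ _ i4]) (auto simp: am1)
    have "AE s in LM. cauchy_S p (\<lambda>\<tau>. 1 / am \<tau>) s = 2 - 1 / am s" by (rule minus(2)[where \<delta> = \<delta>, OF _ _ i4]) (auto simp: am1)
    then show "AE \<tau> in LM. 1 / am \<tau> = (1 / am \<tau> - cauchy_S p (\<lambda>\<tau>. 1 / am \<tau>) \<tau>) / 2 + 1"
      by eventually_elim (simp only:, simp add: diff_divide_distrib)
  qed
  have gG: "g_fun \<alpha> \<gamma> \<tau> = exp (\<gamma> * A \<tau>)" if "\<tau> \<in> G" for \<tau>
    using Gn[OF that] by (simp add: g_fun_eq A_def)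
  have id: "g_fun \<alpha> \<gamma> \<tau> = am \<tau> * \<tau> powi k * ap \<tau>" if g: "\<tau> \<in> G" for \<tau>
  proof -
    \<comment> \<open>An integer power can be computed from any logarithm of \<open>\<tau>\<close>,
      here from \<open>A\<close>. With \<open>L = A + M\<close> the exponents add up to
      \<open>\<gamma> * A\<close>, the \<open>M\<close> terms cancelling.\<close>
    have "\<tau> powi k = exp (of_int k * A \<tau>)" using A(2)[OF g] exp_power_int[of "A \<tau>" k] by simp
    then show ?thesis unfolding gG[OF g] am_def apG[OF g] LA[OF g]
      by (simp add: exp_add[symmetric] \<delta>_def algebra_simps)
  qed
  have Linf: "g_fun \<alpha> \<gamma> \<in> L_infinity LM" "(\<lambda>\<tau>. 1 / g_fun \<alpha> \<gamma> \<tau>) \<in> L_infinity LM"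
  proof -
    have "continuous_on G (\<lambda>\<tau>. exp (\<gamma> * A \<tau>))" by (intro continuous_intros A(1))
    then have c: "continuous_on G (g_fun \<alpha> \<gamma>)" by (rule continuous_on_eq) (simp add: gG)
    have c': "continuous_on G (\<lambda>\<tau>. 1 / g_fun \<alpha> \<gamma> \<tau>)" by (intro continuous_intros c) (simp add: gG)
    have "AE \<tau> in LM. cmod (g_fun \<alpha> \<gamma> \<tau>) \<le> exp (cmod \<gamma> * K)"
      using AEG by eventually_elim (simp only: gG bA)
    moreover have "AE \<tau> in LM. cmod (1 / g_fun \<alpha> \<gamma> \<tau>) \<le> exp (cmod (- \<gamma>) * K)"
      using AEG
    proof eventually_elim
      case (elim \<tau>)
      then have "1 / g_fun \<alpha> \<gamma> \<tau> = exp (- \<gamma> * A \<tau>)" by (simp add: gG exp_minus divide_inverse)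
      then show ?case using bA[OF elim, of "- \<gamma>"] by (simp only:)
    qed
    ultimately show "g_fun \<alpha> \<gamma> \<in> L_infinity LM" "(\<lambda>\<tau>. 1 / g_fun \<alpha> \<gamma> \<tau>) \<in> L_infinity LM"
      unfolding L_infinity_def using meas[OF c] meas[OF c'] by blast+
  qed
  have "power_branch (- interior_cut \<Phi>) (\<lambda>z. 1 - t / z) (of_int k - \<gamma>) am"
    unfolding power_branch_def
  proof (intro exI[of _ "\<lambda>z. M (inverse z)"] conjI ballI Lm)
    show "exp (M (inverse z)) = 1 - t / z" if "z \<in> - interior_cut \<Phi>" for z
      using eM[OF inv\<Lambda>[OF that]] by (simp add: divide_inverse)
    show "am z = exp ((of_int k - \<gamma>) * M (inverse z))" for z by (simp only: am_def \<delta>')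
  qed
  moreover have "(am \<longlongrightarrow> 1) at_infinity"
  proof -
    have "continuous (at 0) M"
      using holomorphic_on_imp_continuous_on[OF M(1)] IC(1) z\<Lambda> by (simp add: continuous_on_eq_continuous_at)
    then have "((\<lambda>z. M (inverse z)) \<longlongrightarrow> M 0) at_infinity"
      by (rule continuous_within_tendsto_compose'[of 0 UNIV, simplified]) (rule tendsto_inverse_0)
    then have "(am \<longlongrightarrow> exp (- \<delta> * M 0)) at_infinity" unfolding am_def[abs_def] by (intro tendsto_intros)
    then show ?thesis by (simp add: M(2))
  qed
  moreover have "power_branch (- exterior_cut \<Psi>) (\<lambda>z. z - t) (\<gamma> - of_int k) ap"
    unfolding power_branch_def \<delta>_def[symmetric]
    by (intro exI[of _ L] conjI ballI Lh) (simp_all add: eL apE)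
  moreover have "\<forall>\<tau>\<in>\<Gamma> - {t}. g_fun \<alpha> \<gamma> \<tau> = am \<tau> * \<tau> powi k * ap \<tau>" using id \<Gamma> by (simp add: G_def)
  moreover have "wiener_hopf_factorization p \<rho> w (g_fun \<alpha> \<gamma>) am k ap"
    unfolding wiener_hopf_factorization_def Let_def
  proof (intro conjI Linf P1 P2 N1 N2 bnd)
    show "AE \<tau> in LM. g_fun \<alpha> \<gamma> \<tau> = am \<tau> * \<tau> powi k * ap \<tau>" using AEG by eventually_elim (rule id)
  qed
  ultimately show ?thesis by blast
qed

end
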